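(* There exist absolute constants $\rho,\gamma,\lambda>0$ such that for every integer $d\ge2$ and all distinct $j,k\in\{1,\ldots,d\}$, $$4c_d\le\|R_{\mathrm{dis}}^{(jj-kk)}\|_{\ell^1(\mathbb Z^d)\to\ell^{1,\infty}(\mathbb Z^d)}\le4c_d\left(1+\frac{\lambda d}{2^{d/2}}\right),$$ and, for every $1<p<\infty$, with $p^*=\max\left\{p,\frac{p}{p-1}\right\}$, $$4c_d\left(1+\frac{d-2}{2^{d/2}}-\frac{\rho}{4^{d/2}}\right)\le\|R_{\mathrm{dis}}^{(jj-kk)}\|_{\ell^p(\mathbb Z^d)\to\ell^p(\mathbb Z^d)}\le(p^*-1)+4c_d\left(1+\frac{\gamma d}{2^{d/2}}\right).$$ In particular, as $d\to\infty$, $$4c_d\le\|R_{\mathrm{dis}}^{(jj-kk)}\|_{\ell^1(\mathbb Z^d)\to\ell^{1,\infty}(\mathbb Z^d)}\le4c_d\left[1+(1+o(1))\frac{d}{2^{d/2}}\right],$$ and for every fixed $1<p<\infty$, $$\|R_{\mathrm{dis}}^{(jj-kk)}\|_{\ell^p(\mathbb Z^d)\to\ell^p(\mathbb Z^d)}=4c_d\left[1+(1+o(1))\frac{d}{2^{d/2}}\right].$$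
   Context: For an integer $d\ge2$ put $c_d=\Gamma\left(\frac{d+2}{2}\right)/\pi^{d/2}$, and let $|\cdot|$ be the Euclidean norm. For $j,k\in\{1,\ldots,d\}$ and $f:\mathbb Z^d\to\mathbb C$, $$R_{\mathrm{dis}}^{(jk)}f(n)=c_d\sum_{m\in\mathbb Z^d\setminus\{0\}}\frac{m_jm_k}{|m|^{d+2}}f(n-m),\qquad n\in\mathbb Z^d,$$ so that $R_{\mathrm{dis}}^{(jj-kk)}:=R_{\mathrm{dis}}^{(jj)}-R_{\mathrm{dis}}^{(kk)}$ is convolution on $\mathbb Z^d$ with the kernel $c_d\frac{m_j^2-m_k^2}{|m|^{d+2}}$ for $m\neq0$ (and $0$ at $m=0$). $\|T\|_{\ell^p(\mathbb Z^d)\to\ell^p(\mathbb Z^d)}$ denotes the operator norm. The weak quasi-norm is $\|g\|_{\ell^{1,\infty}(\mathbb Z^d)}=\sup_{\tau>0}\tau\,\#\{n\in\mathbb Z^d:|g(n)|>\tau\}$, and $\|T\|_{\ell^1\to\ell^{1,\infty}}=\sup\{\|Tf\|_{\ell^{1,\infty}}:\|f\|_{\ell^1}\le1\}$. "Absolute constant" means a constant independent of $d$, $j$, $k$, $p$. $o(1)$ denotes a quantity tending to $0$ as $d\to\infty$ (for fixed $p$ in the last formula). *)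

theory Defs
  imports "HOL-Analysis.Analysis"
begin

text \<open>The dimension \<open>d\<close> is quantified inside the theorem, so the lattice of integer points in
  dimension \<open>d\<close> is a set of functions with coordinates indexed by \<open>{1..d}\<close>. Coordinates outside
  \<open>{1..d}\<close> are \<open>0\<close>, so that pointwise subtraction stays in the lattice.\<close>

definition Zd :: "nat \<Rightarrow> (nat \<Rightarrow> int) set" where
  "Zd d = {n. \<forall>i. i \<notin> {1..d} \<longrightarrow> n i = 0}"

definition eucl_norm :: "nat \<Rightarrow> (nat \<Rightarrow> int) \<Rightarrow> real" where
  "eucl_norm d m = L2_set (\<lambda>i. real_of_int (m i)) {1..d}"

definition riesz_const :: "nat \<Rightarrow> real" where
  "riesz_const d = Gamma ((real d + 2) / 2) / pi powr (real d / 2)"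

text \<open>For \<open>f\<close> in \<open>\<ell>\<^sup>p\<close> with \<open>1 \<le> p < \<infinity>\<close> the series below converges absolutely, since the kernel
  is of size at most \<open>|m|\<close> to the power \<open>-d\<close>; hence the unordered sum is the intended one.\<close>

definition R_dis ::
    "nat \<Rightarrow> nat \<Rightarrow> nat \<Rightarrow> ((nat \<Rightarrow> int) \<Rightarrow> complex) \<Rightarrow> (nat \<Rightarrow> int) \<Rightarrow> complex" where
  "R_dis d j k f n =
     of_real (riesz_const d) *
     (\<Sum>\<^sub>\<infinity>m\<in>Zd d - {\<lambda>_. 0}.
        of_real (real_of_int (m j * m k) / eucl_norm d m ^ (d + 2)) * f (n - m))"

definition R_dis_diff ::
    "nat \<Rightarrow> nat \<Rightarrow> nat \<Rightarrow> ((nat \<Rightarrow> int) \<Rightarrow> complex) \<Rightarrow> (nat \<Rightarrow> int) \<Rightarrow> complex" where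
  "R_dis_diff d j k f n = R_dis d j j f n - R_dis d k k f n"

text \<open>All norms are extended-real valued: \<open>\<infinity>\<close> outside the respective space, and \<open>\<infinity>\<close> for an
  unbounded operator. They only depend on the values of a function on \<^term>\<open>Zd d\<close>.\<close>

definition lp_norm :: "nat \<Rightarrow> real \<Rightarrow> ((nat \<Rightarrow> int) \<Rightarrow> complex) \<Rightarrow> ereal" where
  "lp_norm d p f =
     (if (\<lambda>n. norm (f n) powr p) summable_on Zd d
      then ereal ((\<Sum>\<^sub>\<infinity>n\<in>Zd d. norm (f n) powr p) powr (1 / p))
      else \<infinity>)"

definition weak_l1_norm :: "nat \<Rightarrow> ((nat \<Rightarrow> int) \<Rightarrow> complex) \<Rightarrow> ereal" where
  "weak_l1_norm d g =
     (SUP \<tau>\<in>{0<..}.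
        if finite {n \<in> Zd d. norm (g n) > \<tau>}
        then ereal (\<tau> * real (card {n \<in> Zd d. norm (g n) > \<tau>}))
        else \<infinity>)"

definition lp_opnorm ::
    "nat \<Rightarrow> real \<Rightarrow> (((nat \<Rightarrow> int) \<Rightarrow> complex) \<Rightarrow> (nat \<Rightarrow> int) \<Rightarrow> complex) \<Rightarrow> ereal" where
  "lp_opnorm d p T = (SUP f\<in>{f. lp_norm d p f \<le> 1}. lp_norm d p (T f))"

definition weak_opnorm ::
    "nat \<Rightarrow> (((nat \<Rightarrow> int) \<Rightarrow> complex) \<Rightarrow> (nat \<Rightarrow> int) \<Rightarrow> complex) \<Rightarrow> ereal" where
  "weak_opnorm d T = (SUP f\<in>{f. lp_norm d 1 f \<le> 1}. weak_l1_norm d (T f))"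

end

theory Submission
  imports Defs "HOL-Library.Function_Algebras"
begin

text \<open>
  The kernel of the operator is, for \<open>m \<noteq> 0\<close>, a superposition of Gaussians: by Euler's integral,
  \[ c_d \frac{m_j^2-m_k^2}{|m|^{d+2}}
     = \int_0^\infty (m_j^2-m_k^2) \Bigl(\frac{s}{\pi}\Bigr)^{d/2} e^{-s|m|^2} \, ds , \]
  where \<open>1/s\<close> plays the role of a heat time. It is split at \<open>s = 1\<close> into a part \<open>near\<close> (\<open>s > 1\<close>)
  and a part \<open>far\<close> (\<open>s \<le> 1\<close>). Since \<open>c\<^sub>d\<close> grows faster than every exponential in \<open>d\<close>
  (\<open>power_le_riesz_const\<close>), a bound \<open>B\<^sup>d\<close> on any quantity, with whatever base, is negligible against
  \<open>c\<^sub>d\<close> times any exponential rate. This is what makes crude constants sufficient everywhere below.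

  The near part is small-scale and absolutely summable, so it is treated by its \<open>\<ell>\<^sup>1\<close> norm. The points with
  \<open>|m|\<^sup>2\<close> equal to \<open>1\<close> or \<open>2\<close> contribute \<open>4 c\<^sub>d (1 + (d-2)/2^(d/2))\<close>, up to an exponential in \<open>d\<close>
  (\<open>shell_kern_sum\<close>, \<open>shell_near_kern\<close>); all others contribute
  \<open>O(c\<^sub>d r\<^sup>d 2^(-d/2))\<close> with an \<open>r < 1\<close> (\<open>sum_near_le\<close>).

  The far part is bounded on \<open>\<ell>\<^sup>p\<close> with the sharp constant \<open>p* - 1\<close>, up to an additive exponential in \<open>d\<close>.
  It is compared in \<open>\<ell>\<^sup>1\<close> with the same expression formed with a lazy random walk on the lattice
  in place of the heat flow (\<open>far_walk_riesz\<close>, through a local limit theorem with Gaussian tails). For the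
  walk, the bilinear form is a martingale-transform form: every averaging step in a coordinate direction
  loses some energy, which is counted with sign \<open>-1\<close>, \<open>1\<close> or \<open>0\<close>. Burkholder's function gives the
  sharp bound by induction over the steps (\<open>tform_le\<close>): its concavity along both diagonals
  (\<open>burk_zigzag\<close>) pays for each step, and it majorizes \<open>|y|\<^sup>p - (p-1)\<^sup>p |x|\<^sup>p\<close> (\<open>burk_majorant\<close>).
  Complex functions are reduced to real ones by averaging over rotations of the complex plane.

  For the weak-type bound, the far part satisfies a Calderon-Zygmund estimate with an exponential
  constant (\<open>cz_weak_type_far\<close>). Splitting the level \<open>\<tau>\<close> into \<open>(1-\<eta>)\<tau>\<close> for the near part and \<open>\<eta>\<tau>\<close> for the far
  part, with an exponentially small \<open>\<eta>\<close>, leaves the \<open>\<ell>\<^sup>1\<close> norm of the near part as the main term.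

  The weak-type lower bound tests the operator on the indicator of one point. For the lower bound on
  \<open>\<ell>\<^sup>p\<close> the test function is the sign \<open>(-1)^(x\<^sub>k)\<close> on a large cube. The far part then cancels to an exponential
  in \<open>d\<close> (\<open>far_alternating\<close>). In the near part, antisymmetry under exchanging \<open>j\<close> and \<open>k\<close> makes all terms with
  \<open>|m|\<^sup>2 \<le> 4\<close> nonnegative, so that the two innermost shells enter with their full absolute value (\<open>near_alternating\<close>).

  Finally, a permutation of coordinates shows that the norm on \<open>\<ell>\<^sup>p\<close> does not depend on \<open>j\<close> and \<open>k\<close>
  (\<open>lp_opnorm_indep\<close>); this is what allows one error sequence to serve all pairs in the last formula.
\<close>

section \<open>Burkholder's function\<close>

text \<open>Burkholder's function for differentially subordinate martingales; the normalization is
  the one for which \<open>burk_majorant\<close> holds.\<close>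
definition burk :: "real \<Rightarrow> real \<Rightarrow> real \<Rightarrow> real" where
  "burk p x y = p * (1 - 1/p) powr (p - 1) *
     ((\<bar>y\<bar> - (p - 1) * \<bar>x\<bar>) * (\<bar>x\<bar> + \<bar>y\<bar>) powr (p - 1))"

text \<open>A convex increasing function composed with the convex map \<open>t \<mapsto> max t
  0\<close> is convex. The concavity of Burkholder's function along a diagonal is reduced to this,
  one hinge for each point where the formula changes.\<close>
lemma hinge_midpoint:
  fixes f f' f'' :: "real \<Rightarrow> real"
  assumes 1: "\<And>s. s \<ge> 0 \<Longrightarrow> (f has_real_derivative f' s) (at s)"
    and 2: "\<And>s. s \<ge> 0 \<Longrightarrow> (f' has_real_derivative f'' s) (at s)"
    and 3: "\<And>s. s \<ge> 0 \<Longrightarrow> f'' s \<ge> 0" and 4: "f' 0 \<ge> 0"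
  shows "f (max ((a + b) / 2) 0) \<le> (f (max a 0) + f (max b 0)) / 2"
proof -
  have cv: "convex_on {0..} f"
    by (rule f''_ge0_imp_convex[of _ f f' f'']) (use assms in auto)
  have f'0: "f' s \<ge> 0" if "s \<ge> 0" for s
    using DERIV_nonneg_imp_nondecreasing[of 0 s f'] that 2 3 4 by (meson order_trans)
  have mono: "f s \<le> f t" if "0 \<le> s" "s \<le> t" for s t
    using DERIV_nonneg_imp_nondecreasing[of s t f] that 1 f'0 by (meson order_trans)
  have "f (max ((a + b) / 2) 0) \<le> f ((1/2) * max a 0 + (1/2) * max b 0)"
    by (rule mono) auto
  also have "\<dots> \<le> (1/2) * f (max a 0) + (1/2) * f (max b 0)"
    using convex_onD[OF cv, of "1/2" "max a 0" "max b 0"] by simp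
  finally show ?thesis by simp
qed

lemma powr_Suc_pm: "(w::real) > 0 \<Longrightarrow> w powr (q - 1) = w powr (q - 2) * w"
  "(w::real) > 0 \<Longrightarrow> w powr (q - 2) = w powr (q - 3) * w"
  using powr_add[of w "q - 2" 1] powr_add[of w "q - 3" 1] by (simp_all add: algebra_simps)

lemma powr_midpoint:
  assumes "p \<ge> (1::real)" "u \<ge> 0" "v \<ge> 0"
  shows "((u + v) / 2) powr p \<le> (u powr p + v powr p) / 2"
proof -
  have half: "(t/2) powr p \<le> t powr p / 2" if "t \<ge> 0" for t
  proof -
    have "(t/2) powr p = t powr p * (1/2) powr p" using that by (simp add: powr_divide)
    also have "(1/2::real) powr p \<le> (1/2) powr 1" by (rule powr_mono') (use assms in auto)
    finally show ?thesis by (simp add: mult_left_mono)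
  qed
  show ?thesis
  proof (cases "u = 0 \<or> v = 0")
    case True thus ?thesis using half[of u] half[of v] assms by auto
  next
    case False
    hence "u > 0" "v > 0" using assms by auto
    thus ?thesis using convex_onD[OF powr_convex[OF assms(1)], of "1/2" u v] by (simp add: add_divide_distrib)
  qed
qed

lemma DERIV_affine_powr:
  assumes "2 * s + c > (0::real)"
  shows "((\<lambda>s. (A * s + B) * (2 * s + c) powr r) has_real_derivative
     A * (2 * s + c) powr r + 2 * r * (A * s + B) * (2 * s + c) powr (r - 1)) (at s)"
proof -
  have "((\<lambda>s. A * s + B) has_real_derivative A) (at s)"
    "((\<lambda>s. 2 * s + c) has_real_derivative 2) (at s)"
    by (auto intro!: derivative_eq_intros)
  from DERIV_mult[OF this(1) DERIV_chain2[OF has_real_derivative_powr[OF assms, of r] this(2)]]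
  show ?thesis by (rule DERIV_cong) simp
qed

text \<open>Along the diagonal \<open>a \<mapsto> (a, a + c)\<close> the function is linear where
  \<open>a\<close> and \<open>a + c\<close> have opposite signs, because \<open>|x| + |y|\<close> is
  constant there. On each of the two outer rays it equals the continuation of that linear function
  minus a convex increasing function of the distance to the ray's end.\<close>
lemma burk_diag_nonneg:
  assumes p: "p \<ge> 2" and c: "c \<ge> 0"
  shows "(burk p a (a + c) + burk p b (b + c)) / 2 \<le> burk p ((a + b) / 2) ((a + b) / 2 + c)"
proof -
  define al where "al = p * (1 - 1/p) powr (p - 1)"
  have al: "al \<ge> 0" unfolding al_def using p by simp
  define F where "F a = (\<bar>a + c\<bar> - (p - 1) * \<bar>a\<bar>) * (\<bar>a\<bar> + \<bar>a + c\<bar>) powr (p - 1)" for a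
  have bF: "burk p a (a + c) = al * F a" for a unfolding burk_def al_def F_def by simp
  have "(F a + F b) / 2 \<le> F ((a + b) / 2)"
  proof (cases "c = 0")
    case True
    have F: "F a = - (p - 2) / 2 * (2 * \<bar>a\<bar>) powr p" for a
    proof (cases "a = 0")
      case False
      have "(2 * \<bar>a\<bar>) powr p = (2 * \<bar>a\<bar>) powr (p - 1) * (2 * \<bar>a\<bar>)"
        using False by (simp add: powr_diff)
      thus ?thesis unfolding F_def True by (simp add: algebra_simps)
    qed (simp add: F_def True)
    have "(2 * \<bar>(a + b)/2\<bar>) powr p \<le> ((2 * \<bar>a\<bar> + 2 * \<bar>b\<bar>)/2) powr p"
      by (rule powr_mono2) (use p abs_triangle_ineq[of a b] in auto)
    also have "\<dots> \<le> ((2 * \<bar>a\<bar>) powr p + (2 * \<bar>b\<bar>) powr p) / 2"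
      by (rule powr_midpoint) (use p in auto)
    finally have "(p - 2) / 2 * (2 * \<bar>(a + b)/2\<bar>) powr p \<le> (p - 2) / 2 * (((2 * \<bar>a\<bar>) powr p + (2 * \<bar>b\<bar>) powr p) / 2)"
      by (rule mult_left_mono) (use p in auto)
    thus ?thesis unfolding F by (simp add: field_simps)
  next
    case False
    with c have c: "c > 0" by simp
    \<comment> \<open>the two hinge functions: the gap to the linear part beyond \<open>a = 0\<close> and beyond \<open>a = - c\<close>\<close>
    define n1 where "n1 s = (p * s + c) * c powr (p - 1) - ((2 - p) * s + c) * (2 * s + c) powr (p - 1)" for s
    define n1' where "n1' s = p * c powr (p - 1) - ((2 - p) * (2 * s+c) powr (p - 1)
        + 2 * (p - 1) * ((2 - p) * s + c) * (2 * s+c) powr (p - 2))" for s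
    define n1'' where "n1'' s = 4 * (p - 1) * (p - 2) * p * s * (2 * s+c) powr (p - 3)" for s
    define n2 where "n2 s = ((p - 2) * s + (p - 1) * c) * (2 * s + c) powr (p - 1) - ((p - 1) * c + p * s) * c powr (p - 1)" for s
    define n2' where "n2' s = (p - 2) * (2 * s+c) powr (p - 1) + 2 * (p - 1) * ((p - 2) * s + (p - 1) * c) * (2 * s+c) powr (p - 2) - p * c powr (p - 1)" for s
    define n2'' where "n2'' s = 4 * (p - 1) * (p - 2) * (2 * s+c) powr (p - 2) + 4 * (p - 1) * (p - 2) * ((p - 2) * s + (p - 1) * c) * (2 * s+c) powr (p - 3)" for s
    define L where "L a = (p * a + c) * c powr (p - 1)" for a
    have dec: "F a = L a - n1 (max a 0) - n2 (max (- c - a) 0)" for a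
    proof -
      consider "a \<ge> 0" | "- c \<le> a" "a < 0" | "a < - c" by linarith
      thus ?thesis
      proof cases
        case 1
        thus ?thesis using c by (simp add: F_def L_def n1_def n2_def max_def algebra_simps)
      next
        case 2
        have "\<bar>a\<bar> + \<bar>a + c\<bar> = c" using 2 by auto
        moreover have "\<bar>a + c\<bar> - (p - 1) * \<bar>a\<bar> = p * a + c" using 2 by (simp add: algebra_simps)
        ultimately show ?thesis using 2 c by (simp add: F_def L_def n1_def n2_def max_def algebra_simps)
      next
        case 3
        have e: "\<bar>a\<bar> + \<bar>a + c\<bar> = 2 * (- c - a) + c" using 3 c by auto
        have "\<bar>a + c\<bar> - (p - 1) * \<bar>a\<bar> = - ((p - 2) * (- c - a) + (p - 1) * c)" using 3 c by (simp add: algebra_simps)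
        thus ?thesis unfolding F_def e using 3 c by (simp add: L_def n1_def n2_def max_def algebra_simps)
      qed
    qed
    have w: "2 * s + c > 0" if "s \<ge> 0" for s using that c by simp
    have h1: "n1 (max ((a + b) / 2) 0) \<le> (n1 (max a 0) + n1 (max b 0)) / 2" for a b
    proof (rule hinge_midpoint[of n1 n1' n1''])
      fix s :: real assume s: "s \<ge> 0"
      note w = w[OF s]
      define X where "X = (2 * s + c) powr (p - 3)"
      have P: "(2 * s + c) powr (p - 1 - 1) = X * (2 * s + c)" "(2 * s + c) powr (p - 2) = X * (2 * s + c)"
        "(2 * s + c) powr (p - 2 - 1) = X" "(2 * s + c) powr (p - 3) = X"
        unfolding powr_Suc_pm(2)[OF w, of p, symmetric] X_def by (simp_all add: diff_diff_eq)
      have "((\<lambda>s. p * c powr (p - 1) * s + c * c powr (p - 1)) has_real_derivative p * c powr (p - 1)) (at s)"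
        by (auto intro!: derivative_eq_intros)
      from DERIV_diff[OF this DERIV_affine_powr[OF w, of "2 - p" c "p - 1"]]
      have "((\<lambda>s. p * c powr (p - 1) * s + c * c powr (p - 1) - ((2 - p) * s + c) * (2 * s + c) powr (p - 1))
         has_real_derivative n1' s) (at s)"
        by (rule DERIV_cong) (simp add: n1'_def diff_diff_eq)
      moreover have "n1 = (\<lambda>s. p * c powr (p - 1) * s + c * c powr (p - 1) - ((2 - p) * s + c) * (2 * s + c) powr (p - 1))"
        unfolding n1_def by (auto simp: ring_distribs)
      ultimately show "(n1 has_real_derivative n1' s) (at s)" by simp
      have n1': "n1' = (\<lambda>s. p * c powr (p - 1) - ((0 * s + (2 - p)) * (2 * s + c) powr (p - 1)
        + ((2 * (p - 1) * (2 - p)) * s + 2 * (p - 1) * c) * (2 * s + c) powr (p - 2)))"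
        unfolding n1'_def by (auto simp: ring_distribs)
      show "(n1' has_real_derivative n1'' s) (at s)" unfolding n1'
        by (rule DERIV_cong[OF DERIV_diff[OF DERIV_const
              DERIV_add[OF DERIV_affine_powr[OF w] DERIV_affine_powr[OF w]]]])
           (unfold P n1''_def, algebra)
      show "n1'' s \<ge> 0" using s p by (simp add: n1''_def)
    next
      show "n1' 0 \<ge> 0" using c by (simp add: n1'_def powr_Suc_pm(1)[OF c] algebra_simps)
    qed
    have h2: "n2 (max ((a + b) / 2) 0) \<le> (n2 (max a 0) + n2 (max b 0)) / 2" for a b
    proof (rule hinge_midpoint[of n2 n2' n2''])
      fix s :: real assume s: "s \<ge> 0"
      note w = w[OF s]
      define X where "X = (2 * s + c) powr (p - 3)"
      have P: "(2 * s + c) powr (p - 1 - 1) = X * (2 * s + c)" "(2 * s + c) powr (p - 2) = X * (2 * s + c)"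
        "(2 * s + c) powr (p - 2 - 1) = X" "(2 * s + c) powr (p - 3) = X"
        unfolding powr_Suc_pm(2)[OF w, of p, symmetric] X_def by (simp_all add: diff_diff_eq)
      have "((\<lambda>s. p * c powr (p - 1) * s + (p - 1) * c * c powr (p - 1)) has_real_derivative p * c powr (p - 1)) (at s)"
        by (auto intro!: derivative_eq_intros)
      from DERIV_diff[OF DERIV_affine_powr[OF w, of "p - 2" "(p - 1) * c" "p - 1"] this]
      have "((\<lambda>s. ((p - 2) * s + (p - 1) * c) * (2 * s + c) powr (p - 1) - (p * c powr (p - 1) * s + (p - 1) * c * c powr (p - 1)))
         has_real_derivative n2' s) (at s)"
        by (rule DERIV_cong) (simp add: n2'_def diff_diff_eq)
      moreover have "n2 = (\<lambda>s. ((p - 2) * s + (p - 1) * c) * (2 * s + c) powr (p - 1) - (p * c powr (p - 1) * s + (p - 1) * c * c powr (p - 1)))"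
        unfolding n2_def by (auto simp: ring_distribs)
      ultimately show "(n2 has_real_derivative n2' s) (at s)" by simp
      have n2': "n2' = (\<lambda>s. (0 * s + (p - 2)) * (2 * s + c) powr (p - 1)
        + ((2 * (p - 1) * (p - 2)) * s + 2 * (p - 1) * ((p - 1) * c)) * (2 * s + c) powr (p - 2) - p * c powr (p - 1))"
        unfolding n2'_def by (auto simp: ring_distribs)
      show "(n2' has_real_derivative n2'' s) (at s)" unfolding n2'
        by (rule DERIV_cong[OF DERIV_diff[OF
              DERIV_add[OF DERIV_affine_powr[OF w] DERIV_affine_powr[OF w]] DERIV_const]])
           (unfold P n2''_def, algebra)
      show "n2'' s \<ge> 0" using s p c by (simp add: n2''_def)
    next
      have "n2' 0 = c powr (p - 2) * c * (2 * (p - 1) * (p - 1) - 2)"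
        using c by (simp add: n2'_def powr_Suc_pm(1)[OF c] algebra_simps)
      moreover have "(p - 1) * (p - 1) \<ge> 1 * 1" by (rule mult_mono) (use p in auto)
      hence "2 * (p - 1) * (p - 1) - 2 \<ge> 0" by (subst mult.assoc) linarith
      ultimately show "n2' 0 \<ge> 0" using c by (simp only:) (intro mult_nonneg_nonneg, auto)
    qed
    have "n2 (max (- c - (a + b) / 2) 0) \<le> (n2 (max (- c - a) 0) + n2 (max (- c - b) 0)) / 2"
      using h2[of "- c - a" "- c - b"] by (simp add: field_simps)
    moreover have "L ((a + b) / 2) = (L a + L b) / 2" by (simp add: L_def field_simps)
    ultimately show ?thesis using h1[of a b] unfolding dec[of a] dec[of b] dec[of "(a+b)/2"] by simp
  qed
  from mult_left_mono[OF this al] show ?thesis unfolding bF by (simp add: field_simps)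
qed

lemma burk_sym: "burk p (- x) y = burk p x y" "burk p x (- y) = burk p x y"
  by (simp_all add: burk_def)

lemma burk_diag:
  assumes p: "p \<ge> 2"
  shows "(burk p a (a + c) + burk p b (b + c)) / 2 \<le> burk p ((a + b) / 2) ((a + b) / 2 + c)"
proof (cases "c \<ge> 0")
  case True thus ?thesis by (rule burk_diag_nonneg[OF p])
next
  case False
  have e: "burk p a (a + c) = burk p (- a) (- a + (- c))" for a
    using burk_sym(1)[of p a "- a - c"] burk_sym(2)[of p a "a + c"] by simp
  have m: "(- a + - b)/2 = - ((a + b)/2)" by (simp add: field_simps)
  from False have "- c \<ge> 0" by simp
  note * = burk_diag_nonneg[OF p this, of "- a" "- b", unfolded m]
  show ?thesis unfolding e[of a] e[of b] e[of "(a + b)/2"] by (rule *)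
qed

text \<open>The step of the Bellman induction: \<open>x\<close> moves to \<open>a\<close> or
  \<open>b\<close> around its mean and \<open>y\<close> moves by the same or the opposite amount,
  hence along a diagonal. The case \<open>\<epsilon> = -1\<close> is the other one reflected in
  \<open>y\<close>.\<close>
lemma burk_zigzag:
  assumes p: "p \<ge> 2" and eps: "\<bar>\<epsilon>\<bar> = (1::real)"
  shows "(burk p a (y + \<epsilon> * (a - (a + b)/2)) + burk p b (y + \<epsilon> * (b - (a + b)/2))) / 2
      \<le> burk p ((a + b) / 2) y"
proof (cases "\<epsilon> = 1")
  case True
  have 1: "a + (y - (a + b)/2) = y + \<epsilon> * (a - (a + b)/2)" "b + (y - (a + b)/2) = y + \<epsilon> * (b - (a + b)/2)"
    "(a + b)/2 + (y - (a + b)/2) = y"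
    using True by (simp_all add: field_simps)
  show ?thesis using burk_diag[OF p, of a "y - (a + b)/2" b] unfolding 1 .
next
  case False
  hence e: "\<epsilon> = -1" using eps by auto
  have 1: "a + (- y - (a + b)/2) = - (y + \<epsilon> * (a - (a + b)/2))" "b + (- y - (a + b)/2) = - (y + \<epsilon> * (b - (a + b)/2))"
    "(a + b)/2 + (- y - (a + b)/2) = - y"
    using e by (simp_all add: field_simps)
  show ?thesis using burk_diag[OF p, of a "- y - (a + b)/2" b] unfolding 1 burk_sym(2) .
qed

lemma burk_zero: "p \<ge> 2 \<Longrightarrow> burk p x 0 \<le> 0"
  unfolding burk_def by (auto intro!: mult_nonneg_nonpos mult_nonpos_nonneg)

lemma MVT_interior:
  fixes f :: "real \<Rightarrow> real"
  assumes "a < b" "continuous_on {a..b} f" "\<And>x. a < x \<Longrightarrow> x < b \<Longrightarrow> (f has_real_derivative f' x) (at x)"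
  shows "\<exists>z. a < z \<and> z < b \<and> f b - f a = (b - a) * f' z"
proof -
  have "\<exists>l z. a < z \<and> z < b \<and> DERIV f z :> l \<and> f b - f a = (b - a) * l"
    by (rule MVT) (use assms in \<open>auto simp: real_differentiable_def\<close>)
  thus ?thesis using assms(3) DERIV_unique by metis
qed

lemma bernoulli_powr:
  assumes "q \<ge> (1::real)" "x > 0"
  shows "x powr q \<ge> 1 + q * (x - 1)"
proof -
  have "x powr q - 1 powr q \<ge> q * (x - 1)"
    by (rule convex_on_imp_above_tangent[OF powr_convex[OF assms(1)]])
       (use assms in \<open>auto simp: interior_open intro!: derivative_eq_intros\<close>)
  thus ?thesis by simp
qed

text \<open>The majorization on the line \<open>|x| + |y| = const\<close>, after scaling. Both sides
  agree to first order at \<open>e = 0\<close>, so the sign of the second derivative decides. For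
  \<open>e < 0\<close> it is nonnegative. For \<open>e > 0\<close> it decreases, so the difference
  is first convex and then concave, and nonnegativity at \<open>e = 1\<close> suffices.\<close>
lemma burk_scalar:
  fixes p e :: real
  assumes p: "p \<ge> 2" and e: "1 - p \<le> e" "e \<le> 1"
  shows "(1 + e/(p - 1)) powr p \<le> p^2/(p - 1) * e + (1 - e) powr p"
proof (rule ccontr)
  define h where "h e = p^2/(p - 1) * e + (1 - e) powr p - (1 + e/(p - 1)) powr p" for e
  define h' where "h' e = p^2/(p - 1) - p * (1 - e) powr (p - 1) - p/(p - 1) * (1 + e/(p - 1)) powr (p - 1)" for e
  define h'' where "h'' e = p * (p - 1) * (1 - e) powr (p - 2) - p/(p - 1) * (1 + e/(p - 1)) powr (p - 2)" for e
  assume "\<not> ?thesis"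
  hence neg: "h e < 0" by (simp add: h_def)
  have pos: "1 - e > 0" "1 + e/(p - 1) > 0" if "1 - p < e" "e < 1" for e
    using that p by (auto simp: field_simps)
  have D1: "(h has_real_derivative h' e) (at e)" if "1 - p < e" "e < 1" for e
    unfolding h_def h'_def by (rule derivative_eq_intros refl | use pos[OF that] p in simp)+
  have D2: "(h' has_real_derivative h'' e) (at e)" if "1 - p < e" "e < 1" for e
    unfolding h'_def h''_def
    by (rule derivative_eq_intros refl | use pos[OF that] p in simp)+

  have cont: "continuous_on {1 - p .. 1} h" unfolding h_def
    by (intro continuous_on_add continuous_on_diff continuous_on_mult continuous_on_powr' continuous_on_const
      continuous_on_id continuous_on_divide) (use p in \<open>auto simp: field_simps\<close>)
  have cont': "continuous_on {a..b} h'" if "1 - p < a" "b < 1" for a b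
    using D2 that by (intro continuous_at_imp_continuous_on) (meson DERIV_isCont atLeastAtMost_iff less_le_trans le_less_trans)
  have h0: "h 0 = 0" by (simp add: h_def)
  have h'0: "h' 0 = 0" using p by (simp add: h'_def field_simps power2_eq_square)
  have "1/p \<le> (1 - 1/p) powr (p - 1)"
    using bernoulli_powr[of "p - 1" "1 - 1/p"] p by (simp add: field_simps)
  moreover have "(p/(p-1)) powr (p - 1) * (1 - 1/p) powr (p - 1) = 1"
    using p by (subst powr_mult[symmetric]) (simp_all add: field_simps)
  ultimately have "(p/(p-1)) powr (p - 1) * (1/p) \<le> 1"
    using p by (metis mult_left_mono powr_ge_zero)
  hence b: "(p/(p-1)) powr (p - 1) \<le> p"
    using p by (simp add: field_simps)
  have "(1 + 1/(p-1)) powr p = (p/(p-1)) powr ((p - 1) + 1)" using p by (simp add: field_simps)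
  also have "\<dots> = (p/(p-1)) powr (p - 1) * (p/(p-1))" using p by (subst powr_add) simp
  also have "\<dots> \<le> p * (p/(p-1))" by (rule mult_right_mono[OF b]) (use p in simp)
  finally have h1: "h 1 \<ge> 0" using p by (simp add: h_def power2_eq_square)
  show False
  proof (cases "e < 0")
    case True
    obtain \<xi> where xi: "e < \<xi>" "\<xi> < 0" "h 0 - h e = (0 - e) * h' \<xi>"
      using MVT_interior[of e 0 h h'] D1 continuous_on_subset[OF cont] True \<open>1 - p \<le> e\<close> by fastforce
    have "(0 - e) * h' \<xi> > 0" using neg h0 xi(3) by linarith
    hence "h' \<xi> > 0" using True by (simp add: zero_less_mult_iff mult_less_0_iff)
    obtain \<zeta> where ze: "\<xi> < \<zeta>" "\<zeta> < 0" "h' 0 - h' \<xi> = (0 - \<xi>) * h'' \<zeta>"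
      using MVT_interior[of \<xi> 0 h' h''] D2 cont'[of \<xi> 0] xi e by fastforce
    have "(0 - \<xi>) * h'' \<zeta> < 0" using \<open>h' \<xi> > 0\<close> h'0 ze(3) by linarith
    hence "h'' \<zeta> < 0" using xi(2) by (simp add: mult_less_0_iff zero_less_mult_iff)
    moreover have "h'' \<zeta> \<ge> 0"
    proof -
      have z: "1 - p < \<zeta>" "\<zeta> < 1" using ze xi e by auto
      have "1 / (p - 1) * (1 + \<zeta>/(p - 1)) powr (p - 2) \<le> (p - 1) * (1 - \<zeta>) powr (p - 2)"
      proof (rule mult_mono)
        have "1 * 1 \<le> (p - 1) * (p - 1)" by (rule mult_mono) (use p in auto)
        thus "1/(p - 1) \<le> p - 1" using p by (simp add: field_simps)
        have "\<zeta>/(p - 1) \<le> 0" using ze p by (simp add: field_simps)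
        thus "(1 + \<zeta>/(p - 1)) powr (p - 2) \<le> (1 - \<zeta>) powr (p - 2)"
          by (intro powr_mono2) (use p ze pos[OF z] in auto)
      qed (use p in auto)
      hence "p * (1 / (p - 1) * (1 + \<zeta>/(p - 1)) powr (p - 2)) \<le> p * ((p - 1) * (1 - \<zeta>) powr (p - 2))"
        by (rule mult_left_mono) (use p in auto)
      thus ?thesis unfolding h''_def by (simp add: algebra_simps)
    qed
    ultimately show False by simp
  next
    case False
    moreover have "e \<noteq> 0" "e \<noteq> 1" using neg h0 h1 by auto
    ultimately have e01: "0 < e" "e < 1" using e by auto
    obtain \<xi> where xi: "0 < \<xi>" "\<xi> < e" "h e - h 0 = (e - 0) * h' \<xi>"
      using MVT_interior[of 0 e h h'] D1 continuous_on_subset[OF cont] e01 p by fastforce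
    have "(e - 0) * h' \<xi> < 0" using neg h0 xi(3) by linarith
    hence x': "h' \<xi> < 0" using e01 by (simp add: mult_less_0_iff zero_less_mult_iff)
    obtain \<eta> where et: "e < \<eta>" "\<eta> < 1" "h 1 - h e = (1 - e) * h' \<eta>"
      using MVT_interior[of e 1 h h'] D1 continuous_on_subset[OF cont] e01 p by fastforce
    have "(1 - e) * h' \<eta> > 0" using neg h1 et(3) by linarith
    hence e': "h' \<eta> > 0" using e01 by (simp add: mult_less_0_iff zero_less_mult_iff)
    obtain \<zeta> where ze: "0 < \<zeta>" "\<zeta> < \<xi>" "h' \<xi> - h' 0 = (\<xi> - 0) * h'' \<zeta>"
      using MVT_interior[of 0 \<xi> h' h''] D2 cont'[of 0 \<xi>] xi e01 p by fastforce
    have "(\<xi> - 0) * h'' \<zeta> < 0" using x' h'0 ze(3) by linarith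
    hence z: "h'' \<zeta> < 0" using xi by (simp add: mult_less_0_iff zero_less_mult_iff)
    obtain \<theta> where th: "\<xi> < \<theta>" "\<theta> < \<eta>" "h' \<eta> - h' \<xi> = (\<eta> - \<xi>) * h'' \<theta>"
      using MVT_interior[of \<xi> \<eta> h' h''] D2 cont'[of \<xi> \<eta>] xi et e01 p by fastforce
    have "(\<eta> - \<xi>) * h'' \<theta> > 0" using x' e' th(3) by linarith
    hence t: "h'' \<theta> > 0" using xi et by (simp add: mult_less_0_iff zero_less_mult_iff)
    have "h'' \<theta> \<le> h'' \<zeta>"
    proof -
      have zt: "\<zeta> \<le> \<theta>" "\<theta> < 1" "0 < \<zeta>" using ze th et by auto
      have "(1 - \<theta>) powr (p - 2) \<le> (1 - \<zeta>) powr (p - 2)" by (rule powr_mono2) (use p zt in auto)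
      moreover have "(1 + \<zeta>/(p - 1)) powr (p - 2) \<le> (1 + \<theta>/(p - 1)) powr (p - 2)"
        by (rule powr_mono2) (use p zt in \<open>auto simp: divide_right_mono add_nonneg_nonneg\<close>)
      ultimately show ?thesis unfolding h''_def
        by (intro diff_mono mult_left_mono) (use p in auto)
    qed
    with z t show False by simp
  qed
qed

text \<open>By homogeneity everything reduces to one parameter \<open>e\<close>, which vanishes
  where \<open>|y| = (p-1)|x|\<close>.\<close>
lemma burk_majorant:
  assumes p: "p \<ge> 2"
  shows "\<bar>y\<bar> powr p - ((p - 1) * \<bar>x\<bar>) powr p \<le> burk p x y"
proof (cases "x = 0 \<and> y = 0")
  case True thus ?thesis by (simp add: burk_def)
next
  case False
  define s where "s = \<bar>x\<bar> + \<bar>y\<bar>"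
  have s: "s > 0" using False by (auto simp: s_def)
  define e where "e = 1 - p * \<bar>x\<bar> / s"
  have "\<bar>x\<bar> \<le> s" by (simp add: s_def)
  hence "p * \<bar>x\<bar> / s \<le> p" using s p by (simp add: field_simps)
  hence e: "1 - p \<le> e" "e \<le> 1" using s p by (auto simp: e_def)
  define B where "B = (s * (1 - 1/p)) powr p"
  have B: "B \<ge> 0" by (simp add: B_def)
  have y: "\<bar>y\<bar> = s * (1 - 1/p) * (1 + e/(p - 1))"
  proof -
    have "(1 - 1/p) * (1 + e/(p - 1)) = 1 - \<bar>x\<bar>/s" using p s by (simp add: e_def field_simps)
    hence "s * ((1 - 1/p) * (1 + e/(p - 1))) = s - \<bar>x\<bar>" using s by (simp add: field_simps)
    thus ?thesis by (simp add: s_def mult.assoc)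
  qed
  have x: "(p - 1) * \<bar>x\<bar> = s * (1 - 1/p) * (1 - e)" using p s by (simp add: e_def field_simps)
  have pos: "s * (1 - 1/p) \<ge> 0" "1 - e \<ge> 0" "1 + e/(p - 1) \<ge> 0" using s p e by (auto simp: field_simps)
  have "\<bar>y\<bar> powr p - ((p - 1) * \<bar>x\<bar>) powr p = B * ((1 + e/(p - 1)) powr p - (1 - e) powr p)"
    unfolding x y B_def using pos by (simp only: powr_mult) (simp add: algebra_simps)
  also have "\<dots> \<le> B * (p^2/(p - 1) * e)"
    by (rule mult_left_mono) (use burk_scalar[OF p e] B in auto)
  also have "B = (1 - 1/p) powr (p - 1) * (1 - 1/p) * s powr (p - 1) * s"
  proof -
    have "B = s powr p * (1 - 1/p) powr p" unfolding B_def using s p by (simp add: powr_mult)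
    thus ?thesis using powr_add[of s "p - 1" 1] powr_add[of "1 - 1/p" "p - 1" 1] s p by simp
  qed
  also have "(1 - 1/p) powr (p - 1) * (1 - 1/p) * s powr (p - 1) * s * (p^2/(p - 1) * e)
     = p * (1 - 1/p) powr (p - 1) * ((s * e) * s powr (p - 1))"
  proof -
    have "(1 - 1/p) * (p^2/(p - 1)) = p" using p by (simp add: field_simps power2_eq_square)
    moreover have "(1 - 1/p) powr (p - 1) * (1 - 1/p) * s powr (p - 1) * s * (p^2/(p - 1) * e)
      = ((1 - 1/p) * (p^2/(p - 1))) * ((1 - 1/p) powr (p - 1) * ((s * e) * s powr (p - 1)))"
      by (simp only: ac_simps)
    ultimately show ?thesis by (simp only: ac_simps)
  qed
  also have "s * e = \<bar>y\<bar> - (p - 1) * \<bar>x\<bar>" using s by (simp add: e_def field_simps) (simp add: s_def algebra_simps)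
  finally show ?thesis by (simp add: burk_def s_def)
qed

section \<open>The Bellman induction on an abelian group\<close>

definition fsup :: "('g \<Rightarrow> real) \<Rightarrow> bool" where "fsup f \<longleftrightarrow> finite {x. f x \<noteq> 0}"

definition tot :: "('g \<Rightarrow> real) \<Rightarrow> real" where "tot f = (\<Sum>\<^sub>\<infinity>x. f x)"

lemma fsup_summable: "fsup f \<Longrightarrow> f summable_on UNIV"
  unfolding fsup_def by (rule summable_on_cong_neutral[THEN iffD1, of _ "{x. f x \<noteq> 0}"]) (auto intro: summable_on_finite)

lemma fsup_binop:
  assumes "fsup f" "fsup g" "z 0 0 = 0" shows "fsup (\<lambda>x. z (f x) (g x))"
  unfolding fsup_def
  by (rule finite_subset[of _ "{x. f x \<noteq> 0} \<union> {x. g x \<noteq> 0}"]) (use assms in \<open>auto simp: fsup_def\<close>)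

lemma fsup_add: "fsup f \<Longrightarrow> fsup g \<Longrightarrow> fsup (\<lambda>x. f x + g x)"
  by (rule fsup_binop) auto

lemma fsup_unop: "fsup f \<Longrightarrow> z 0 = 0 \<Longrightarrow> fsup (\<lambda>x. z (f x))"
  using fsup_binop[of f f "\<lambda>a b. z a"] by simp

lemma fsup_mult_left: "fsup f \<Longrightarrow> fsup (\<lambda>x. g x * f x)"
  unfolding fsup_def by (rule finite_subset[of _ "{x. f x \<noteq> 0}"]) auto

lemma fsup_shift: fixes f :: "'g::ab_group_add \<Rightarrow> real"
  assumes "fsup f" shows "fsup (\<lambda>x. f (x + e))"
proof -
  have "{x. f (x + e) \<noteq> 0} \<subseteq> (\<lambda>x. x - e) ` {x. f x \<noteq> 0}"
    by (auto simp: image_iff intro!: exI[of _ "_ + e"])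
  thus ?thesis using assms unfolding fsup_def by (meson finite_imageI finite_subset)
qed

lemma fsup_zero [simp]: "fsup (\<lambda>_. 0)" by (simp add: fsup_def)

lemma tot_zero [simp]: "tot (\<lambda>_. 0) = 0" by (simp add: tot_def)

lemma tot_add: "fsup f \<Longrightarrow> fsup g \<Longrightarrow> tot (\<lambda>x. f x + g x) = tot f + tot g"
  unfolding tot_def by (intro infsum_add fsup_summable)

lemma tot_cmult: "tot (\<lambda>x. c * f x) = c * tot f"
  unfolding tot_def by (rule infsum_cmult_right')

lemma tot_diff: "fsup f \<Longrightarrow> fsup g \<Longrightarrow> tot (\<lambda>x. f x - g x) = tot f - tot g"
  using tot_add[of f "\<lambda>x. (-1) * g x"] tot_cmult[of "-1" g] fsup_mult_left[of g "\<lambda>_. -1"] by simp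

lemma tot_mono: "fsup f \<Longrightarrow> fsup g \<Longrightarrow> (\<And>x. f x \<le> g x) \<Longrightarrow> tot f \<le> tot g"
  unfolding tot_def by (intro infsum_mono fsup_summable)

lemma tot_shift: fixes f :: "'g::ab_group_add \<Rightarrow> real" shows "tot (\<lambda>x. f (x + e)) = tot f"
  unfolding tot_def
  by (rule infsum_reindex_bij_witness[of _ "\<lambda>x. x - e" "\<lambda>x. x + e"]) auto

lemma tot_sum: "finite S \<Longrightarrow> (\<And>s. s \<in> S \<Longrightarrow> fsup (f s)) \<Longrightarrow> tot (\<lambda>x. \<Sum>s\<in>S. f s x) = (\<Sum>s\<in>S. tot (f s))"
proof (induction S rule: finite_induct)
  case (insert a S)
  have "fsup (\<lambda>x. \<Sum>s\<in>S. f s x)"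
    unfolding fsup_def
  proof (rule finite_subset[of _ "\<Union>s\<in>S. {x. f s x \<noteq> 0}"])
    show "{x. (\<Sum>s\<in>S. f s x) \<noteq> 0} \<subseteq> (\<Union>s\<in>S. {x. f s x \<noteq> 0})" using sum.not_neutral_contains_not_neutral by fastforce
    show "finite (\<Union>s\<in>S. {x. f s x \<noteq> 0})" using insert by (auto simp: fsup_def)
  qed
  thus ?case using insert tot_add[of "f a" "\<lambda>x. \<Sum>s\<in>S. f s x"] by simp
qed simp

lemma tot_finite: "finite S \<Longrightarrow> (\<And>x. x \<notin> S \<Longrightarrow> f x = 0) \<Longrightarrow> tot f = sum f S"
  unfolding tot_def by (subst infsum_cong_neutral[of S _ f f]) (auto)

definition avg :: "'g::ab_group_add \<Rightarrow> ('g \<Rightarrow> real) \<Rightarrow> 'g \<Rightarrow> real" where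
  "avg e f x = (f x + f (x + e)) / 2"

lemma fsup_avg: "fsup f \<Longrightarrow> fsup (avg e f)"
  unfolding avg_def using fsup_binop[of f "\<lambda>x. f (x + e)" "\<lambda>a b. (a + b)/2"] fsup_shift[of f e] by simp

lemma tot_avg: assumes "fsup f" shows "tot (avg e f) = tot f"
proof -
  have "tot (avg e f) = tot (\<lambda>x. (1/2) * (f x + f (x + e)))" by (simp add: avg_def[abs_def])
  also have "\<dots> = (1/2) * (tot f + tot f)"
    unfolding tot_cmult using tot_add[OF assms fsup_shift[OF assms, of e]] tot_shift[of f e] by simp
  finally show ?thesis by simp
qed

text \<open>Each entry of the list is a direction of averaging with a coefficient. An averaging step
  loses the amount \<open>tot (u v) - tot (avg u avg v)\<close>, a quarter of the sum of the
  products of the increments; the form adds up these losses with the coefficients.\<close>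
fun tform :: "('g::ab_group_add \<times> real) list \<Rightarrow> ('g \<Rightarrow> real) \<Rightarrow> ('g \<Rightarrow> real) \<Rightarrow> real" where
  "tform [] u v = 0"
| "tform ((e, \<phi>) # L) u v =
     \<phi> * (tot (\<lambda>x. u x * v x) - tot (\<lambda>x. avg e u x * avg e v x)) + tform L (avg e u) (avg e v)"

text \<open>The second argument \<open>y\<close> is a free variable standing for the dual
  martingale. Applying the hypothesis at the shifted values \<open>y \<plusminus> (half the
  increment of u)\<close> produces exactly the energy lost in the step, with its sign.\<close>
lemma zigzag_step_unit:
  fixes u v s r :: "'g::ab_group_add \<Rightarrow> real"
  assumes p: "p \<ge> 2" and phi: "\<bar>\<phi>\<bar> = 1"
    and I: "\<And>x y. y * v x + s x \<le> burk p (u x) y / p + r x"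
  shows "y * avg e v x + (avg e s x + \<phi> * (avg e (\<lambda>x. u x * v x) x - avg e u x * avg e v x))
     \<le> burk p (avg e u x) y / p + avg e r x"
proof -
  define m where "m = (u x + u (x + e)) / 2"
  have "y * avg e v x + (avg e s x + \<phi> * (avg e (\<lambda>x. u x * v x) x - avg e u x * avg e v x))
     = (((y + \<phi> * (u x - m)) * v x + s x) + ((y + \<phi> * (u (x + e) - m)) * v (x + e) + s (x + e))) / 2"
    unfolding avg_def m_def by (simp add: field_simps)
  also have "\<dots> \<le> ((burk p (u x) (y + \<phi> * (u x - m)) / p + r x) + (burk p (u (x + e)) (y + \<phi> * (u (x + e) - m)) / p + r (x + e))) / 2"
    by (intro divide_right_mono add_mono I) auto
  also have "\<dots> = ((burk p (u x) (y + \<phi> * (u x - m)) + burk p (u (x + e)) (y + \<phi> * (u (x + e) - m))) / 2) / p + avg e r x"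
    by (simp add: avg_def add_divide_distrib)
  also have "\<dots> \<le> burk p m y / p + avg e r x"
    using burk_zigzag[OF p phi, of "u x" y "u (x + e)"] p unfolding m_def
    by (intro add_right_mono divide_right_mono) auto
  finally show ?thesis unfolding m_def avg_def .
qed

text \<open>The coefficient \<open>0\<close> is the average of the coefficients \<open>1\<close> and
  \<open>-1\<close>.\<close>
lemma zigzag_step:
  fixes u v s r :: "'g::ab_group_add \<Rightarrow> real"
  assumes p: "p \<ge> 2" and phi: "\<phi> \<in> {-1, 0, 1}"
    and I: "\<And>x y. y * v x + s x \<le> burk p (u x) y / p + r x"
  shows "y * avg e v x + (avg e s x + \<phi> * (avg e (\<lambda>x. u x * v x) x - avg e u x * avg e v x))
     \<le> burk p (avg e u x) y / p + avg e r x"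
proof (cases "\<phi> = 0")
  case False
  thus ?thesis using zigzag_step_unit[where u=u and v=v and s=s and r=r and \<phi>=\<phi>, OF p _ I] phi by auto
next
  case True
  show ?thesis using zigzag_step_unit[where u=u and v=v and s=s and r=r and \<phi>=1 and y=y and e=e and x=x, OF p _ I]
    zigzag_step_unit[where u=u and v=v and s=s and r=r and \<phi>="-1" and y=y and e=e and x=x, OF p _ I] True by simp
qed

text \<open>Induction over the steps with the invariant \<open>y v + s \<le> burk p u y / p +
  r\<close>, in which \<open>s\<close> collects the energy spent so far and \<open>r\<close> is only
  averaged. At the end \<open>y = 0\<close> is chosen, where Burkholder's function is
  nonpositive.\<close>
lemma tform_le:
  fixes u v s r :: "'g::ab_group_add \<Rightarrow> real"
  assumes p: "p \<ge> 2" and L: "snd ` set L \<subseteq> {-1, 0, 1}"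
    and I: "\<And>x y. y * v x + s x \<le> burk p (u x) y / p + r x"
    and fs: "fsup u" "fsup v" "fsup s" "fsup r"
  shows "tot s + tform L u v \<le> tot r"
  using L I fs
proof (induction L arbitrary: u v s r)
  case Nil
  have "s x \<le> r x" for x using Nil.prems(2)[of 0 x] burk_zero[OF p, of "u x"] p
    by (smt (verit, best) divide_nonpos_pos mult_zero_left)
  thus ?case using tot_mono[of s r] Nil.prems by simp
next
  case (Cons a L)
  obtain e \<phi> where a: "a = (e, \<phi>)" by force
  let ?s = "\<lambda>x. avg e s x + \<phi> * (avg e (\<lambda>x. u x * v x) x - avg e u x * avg e v x)"
  have uv: "fsup (\<lambda>x. u x * v x)" "fsup (\<lambda>x. avg e u x * avg e v x)"
    using Cons.prems by (auto intro!: fsup_mult_left fsup_avg)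
  have fd: "fsup (\<lambda>x. avg e (\<lambda>x. u x * v x) x - avg e u x * avg e v x)"
    using fsup_binop[OF fsup_avg[OF uv(1), of e] uv(2), of "(-)"] by simp
  have fs: "fsup ?s"
    using fsup_binop[OF fsup_avg[OF Cons.prems(5), of e] fd, of "\<lambda>a b. a + \<phi> * b"] by simp
  have "tot ?s + tform L (avg e u) (avg e v) \<le> tot (avg e r)"
  proof (rule Cons.IH)
    show "y * avg e v x + ?s x \<le> burk p (avg e u x) y / p + avg e r x" for x y
      by (rule zigzag_step[OF p _ Cons.prems(2)]) (use Cons.prems a in auto)
  qed (use Cons.prems fs fsup_avg in auto)
  moreover have "tot ?s = tot s + \<phi> * (tot (\<lambda>x. u x * v x) - tot (\<lambda>x. avg e u x * avg e v x))"
    using tot_add[OF fsup_avg[OF Cons.prems(5), of e] fsup_mult_left[OF fd, of "\<lambda>_. \<phi>"]]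
      tot_cmult[of \<phi> "\<lambda>x. avg e (\<lambda>x. u x * v x) x - avg e u x * avg e v x"]
      tot_diff[OF fsup_avg[OF uv(1), of e] uv(2)] tot_avg[OF uv(1), of e] tot_avg[OF Cons.prems(5), of e]
    by simp
  ultimately show ?case using tot_avg[OF Cons.prems(6), of e] a by simp
qed

lemma young_abs:
  fixes p q a b :: real
  assumes "p > 1" "q = p/(p - 1)"
  shows "a * b \<le> \<bar>a\<bar> powr p / p + \<bar>b\<bar> powr q / q"
proof -
  have "1/q = (p - 1)/p" unfolding assms(2) by simp
  hence "1/p + 1/q = 1" using assms(1) by (simp add: field_simps)
  moreover have "q > 1" unfolding assms(2) using assms(1) by (simp add: field_simps)
  ultimately have pq: "1/p + 1/q = 1" "q > 1" by auto
  have "a * b \<le> \<bar>a\<bar> * \<bar>b\<bar>" by (metis abs_ge_self abs_mult)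
  also have "\<dots> \<le> \<bar>a\<bar> powr p / p + \<bar>b\<bar> powr q / q"
    using Youngs_inequality[of p q "\<bar>a\<bar>" "\<bar>b\<bar>"] assms pq by auto
  finally show ?thesis .
qed

text \<open>The invariant holds initially by Young's inequality in \<open>y\<close> and the
  majorization.\<close>
lemma tform_bound:
  fixes f h :: "'g::ab_group_add \<Rightarrow> real"
  assumes p: "p \<ge> 2" and q: "q = p/(p - 1)" and L: "snd ` set L \<subseteq> {-1, 0, 1}" and fs: "fsup f" "fsup h"
  shows "tform L f h \<le> tot (\<lambda>x. ((p - 1) * \<bar>f x\<bar>) powr p) / p + tot (\<lambda>x. \<bar>h x\<bar> powr q) / q"
proof -
  have fsp: "fsup (\<lambda>x. ((p - 1) * \<bar>f x\<bar>) powr p)" "fsup (\<lambda>x. \<bar>h x\<bar> powr q)"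
    using fsup_unop[OF fs(1), of "\<lambda>t. ((p - 1) * \<bar>t\<bar>) powr p"] fsup_unop[OF fs(2), of "\<lambda>t. \<bar>t\<bar> powr q"] by auto
  have fr: "fsup (\<lambda>x. ((p - 1) * \<bar>f x\<bar>) powr p / p + \<bar>h x\<bar> powr q / q)"
    using fsup_binop[OF fsp, of "\<lambda>a b. a / p + b / q"] by simp
  have "tot (\<lambda>_::'g. 0) + tform L f h \<le> tot (\<lambda>x. ((p - 1) * \<bar>f x\<bar>) powr p / p + \<bar>h x\<bar> powr q / q)"
  proof (rule tform_le[OF p L, where v = h])
    fix x y
    have "y * h x \<le> \<bar>y\<bar> powr p / p + \<bar>h x\<bar> powr q / q" by (rule young_abs) (use p q in auto)
    moreover have "\<bar>y\<bar> powr p / p \<le> (burk p (f x) y + ((p - 1) * \<bar>f x\<bar>) powr p) / p"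
      using burk_majorant[OF p, of y "f x"] p by (intro divide_right_mono) auto
    ultimately show "y * h x + 0 \<le> burk p (f x) y / p + (((p - 1) * \<bar>f x\<bar>) powr p / p + \<bar>h x\<bar> powr q / q)"
      by (simp add: add_divide_distrib)
  qed (use fs fr in auto)
  also have "tot (\<lambda>x. ((p - 1) * \<bar>f x\<bar>) powr p / p + \<bar>h x\<bar> powr q / q)
    = tot (\<lambda>x. ((p - 1) * \<bar>f x\<bar>) powr p) / p + tot (\<lambda>x. \<bar>h x\<bar> powr q) / q"
    using tot_add[OF fsup_mult_left[OF fsp(1), of "\<lambda>_. 1/p"] fsup_mult_left[OF fsp(2), of "\<lambda>_. 1/q"]]
      tot_cmult[of "1/p" "\<lambda>x. ((p - 1) * \<bar>f x\<bar>) powr p"] tot_cmult[of "1/q" "\<lambda>x. \<bar>h x\<bar> powr q"] by simp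
  finally show ?thesis by simp
qed

text \<open>The cross-correlation; it turns bilinear forms of convolution operators into a linear
  functional of the kernel.\<close>
definition corr :: "('g::ab_group_add \<Rightarrow> real) \<Rightarrow> ('g \<Rightarrow> real) \<Rightarrow> 'g \<Rightarrow> real" where
  "corr f h m = tot (\<lambda>x. f x * h (x + m))"

lemma fsup_corr:
  fixes f h :: "'g::ab_group_add \<Rightarrow> real"
  assumes "fsup f" "fsup h" shows "fsup (corr f h)"
proof -
  have "{m. corr f h m \<noteq> 0} \<subseteq> (\<lambda>(x, y). y - x) ` ({x. f x \<noteq> 0} \<times> {y. h y \<noteq> 0})"
  proof
    fix m assume "m \<in> {m. corr f h m \<noteq> 0}"
    hence ne: "corr f h m \<noteq> 0" by simp
    have "\<exists>x. f x * h (x + m) \<noteq> 0"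
    proof (rule ccontr)
      assume "\<not> ?thesis"
      hence "(\<lambda>x. f x * h (x + m)) = (\<lambda>_. 0)" by auto
      thus False using ne unfolding corr_def by simp
    qed
    then obtain x where x: "f x \<noteq> 0" "h (x + m) \<noteq> 0" by auto
    thus "m \<in> (\<lambda>(x, y). y - x) ` ({x. f x \<noteq> 0} \<times> {y. h y \<noteq> 0})"
      by (intro image_eqI[of _ _ "(x, x + m)"]) auto
  qed
  moreover have "finite ((\<lambda>(x, y). y - x) ` ({x. f x \<noteq> 0} \<times> {y. h y \<noteq> 0}))"
    using assms unfolding fsup_def by auto
  ultimately show ?thesis unfolding fsup_def by (rule finite_subset)
qed

lemma corr_avg:
  fixes f h :: "'g::ab_group_add \<Rightarrow> real"
  assumes "fsup f" "fsup h"
  shows "corr (avg e f) (avg e h) m = corr f h m / 2 + corr f h (m + e) / 4 + corr f h (m - e) / 4"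
proof -
  have F: "fsup (\<lambda>x. f (x + a) * h (x + b))" for a b
    by (intro fsup_mult_left fsup_shift assms)
  have S: "tot (\<lambda>x. f (x + e) * h (x + b)) = corr f h (b - e)" for b
    using tot_shift[of "\<lambda>x. f x * h (x + (b - e))" e] by (simp add: corr_def algebra_simps)
  have "corr (avg e f) (avg e h) m = tot (\<lambda>x. (1/4) * ((f (x + 0) * h (x + m) + f (x + 0) * h (x + (m + e)))
     + (f (x + e) * h (x + m) + f (x + e) * h (x + (m + e)))))"
    unfolding corr_def avg_def by (rule arg_cong[of _ _ tot]) (auto simp: algebra_simps add_divide_distrib)
  also have "\<dots> = (1/4) * ((tot (\<lambda>x. f (x + 0) * h (x + m)) + tot (\<lambda>x. f (x + 0) * h (x + (m + e))))
     + (tot (\<lambda>x. f (x + e) * h (x + m)) + tot (\<lambda>x. f (x + e) * h (x + (m + e)))))"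
    by (simp only: tot_cmult tot_add[OF fsup_add[OF F[of 0 m] F[of 0 "m + e"]] fsup_add[OF F[of e m] F[of e "m + e"]]]
         tot_add[OF F[of 0 m] F[of 0 "m + e"]] tot_add[OF F[of e m] F[of e "m + e"]])
  also have "\<dots> = corr f h m / 2 + corr f h (m + e) / 4 + corr f h (m - e) / 4"
    unfolding S by (simp add: corr_def)
  finally show ?thesis .
qed

definition pairing :: "('g::ab_group_add \<Rightarrow> real) \<Rightarrow> ('g \<Rightarrow> real) \<Rightarrow> ('g \<Rightarrow> real) \<Rightarrow> real" where
  "pairing k f h = tot (\<lambda>m. k m * corr f h m)"

definition smear :: "'g::ab_group_add \<Rightarrow> ('g \<Rightarrow> real) \<Rightarrow> 'g \<Rightarrow> real" where
  "smear e k m = k m / 2 + k (m - e) / 4 + k (m + e) / 4"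

text \<open>Averaging both arguments once forward amounts to one lazy step \<open>(1/4, 1/2,
  1/4)\<close> for the kernel. So forward averages, which have the zigzag structure, generate a
  symmetric walk.\<close>
lemma pairing_avg:
  fixes f h :: "'g::ab_group_add \<Rightarrow> real"
  assumes "fsup f" "fsup h"
  shows "pairing k (avg e f) (avg e h) = pairing (smear e k) f h"
proof -
  note fc = fsup_corr[OF assms]
  have F: "fsup (\<lambda>m. k (m + a) * corr f h (m + b))" for a b
    by (intro fsup_mult_left fsup_shift fc)
  have F': "fsup (\<lambda>m. c * (k (m + a) * corr f h (m + b)))" for a b c
    by (intro fsup_mult_left F)
  have "pairing k (avg e f) (avg e h) = tot (\<lambda>m. ((1/2) * (k (m + 0) * corr f h (m + 0)) + (1/4) * (k (m + 0) * corr f h (m + e)))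
       + (1/4) * (k (m + 0) * corr f h (m + - e)))"
    unfolding pairing_def corr_avg[OF assms] by (rule arg_cong[of _ _ tot]) (auto simp: algebra_simps)
  also have "\<dots> = ((1/2) * tot (\<lambda>m. k (m + 0) * corr f h (m + 0)) + (1/4) * tot (\<lambda>m. k (m + 0) * corr f h (m + e)))
       + (1/4) * tot (\<lambda>m. k (m + 0) * corr f h (m + - e))"
    by (simp only: tot_add[OF fsup_add[OF F' F'] F'] tot_add[OF F' F'] tot_cmult)
  also have "tot (\<lambda>m. k (m + 0) * corr f h (m + e)) = tot (\<lambda>m. k (m + - e) * corr f h (m + 0))"
    using tot_shift[of "\<lambda>m. k (m + - e) * corr f h (m + 0)" e] by simp
  also have "tot (\<lambda>m. k (m + 0) * corr f h (m + - e)) = tot (\<lambda>m. k (m + e) * corr f h (m + 0))"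
    using tot_shift[of "\<lambda>m. k (m + e) * corr f h (m + 0)" "- e"] by simp
  also have "((1/2) * tot (\<lambda>m. k (m + 0) * corr f h (m + 0)) + (1/4) * tot (\<lambda>m. k (m + - e) * corr f h (m + 0)))
       + (1/4) * tot (\<lambda>m. k (m + e) * corr f h (m + 0)) =
    tot (\<lambda>m. ((1/2) * (k (m + 0) * corr f h (m + 0)) + (1/4) * (k (m + - e) * corr f h (m + 0)))
       + (1/4) * (k (m + e) * corr f h (m + 0)))"
    by (simp only: tot_add[OF fsup_add[OF F' F'] F'] tot_add[OF F' F'] tot_cmult)
  also have "\<dots> = pairing (smear e k) f h"
    unfolding pairing_def smear_def by (rule arg_cong[of _ _ tot]) (auto simp: algebra_simps)
  finally show ?thesis .
qed

lemma pairing_lin: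
  fixes f h :: "'g::ab_group_add \<Rightarrow> real"
  assumes "fsup f" "fsup h"
  shows "pairing (\<lambda>m. a m + c * b m) f h = pairing a f h + c * pairing b f h"
proof -
  note fc = fsup_corr[OF assms]
  have "pairing (\<lambda>m. a m + c * b m) f h = tot (\<lambda>m. a m * corr f h m + c * (b m * corr f h m))"
    unfolding pairing_def by (rule arg_cong[of _ _ tot]) (auto simp: algebra_simps)
  also have "\<dots> = pairing a f h + c * pairing b f h"
    using tot_add[OF fsup_mult_left[OF fc, of a] fsup_mult_left[OF fsup_mult_left[OF fc, of b], of "\<lambda>_. c"]]
    by (simp add: pairing_def tot_cmult)
  finally show ?thesis .
qed

lemma pairing_finite:
  fixes f h :: "'g::ab_group_add \<Rightarrow> real"
  assumes S: "finite S" "\<And>x. x \<notin> S \<Longrightarrow> f x = 0" "\<And>x. x \<notin> S \<Longrightarrow> h x = 0"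
  shows "pairing k f h = (\<Sum>x\<in>S. \<Sum>y\<in>S. k (y - x) * f x * h y)"
proof -
  have c: "corr f h m = (\<Sum>x\<in>S. f x * h (x + m))" for m
    unfolding corr_def by (rule tot_finite) (use S in auto)
  have fh: "fsup h" unfolding fsup_def by (rule finite_subset[OF _ S(1)]) (use S in auto)
  have e: "(\<lambda>m. k m * corr f h m) = (\<lambda>m. \<Sum>x\<in>S. (k m * f x) * h (m + x))"
    unfolding c by (auto simp: sum_distrib_left algebra_simps)
  have "pairing k f h = (\<Sum>x\<in>S. tot (\<lambda>m. (k m * f x) * h (m + x)))"
    unfolding pairing_def e by (rule tot_sum[OF S(1)]) (intro fsup_mult_left fsup_shift fh)
  also have "\<dots> = (\<Sum>x\<in>S. tot (\<lambda>y. (k (y - x) * f x) * h y))"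
  proof (rule sum.cong[OF refl])
    fix x assume "x \<in> S"
    show "tot (\<lambda>m. k m * f x * h (m + x)) = tot (\<lambda>y. k (y - x) * f x * h y)"
      using tot_shift[of "\<lambda>y. k (y - x) * f x * h y" x] by simp
  qed
  also have "\<dots> = (\<Sum>x\<in>S. \<Sum>y\<in>S. (k (y - x) * f x) * h y)"
    by (rule sum.cong[OF refl], rule tot_finite) (use S in auto)
  finally show ?thesis by simp
qed

section \<open>Second-order Riesz transforms of the lazy lattice walk\<close>

definition unitv :: "nat \<Rightarrow> nat \<Rightarrow> int" where "unitv i = (\<lambda>l. if l = i then 1 else 0)"

text \<open>The law of the lazy walk after \<open>n\<close> steps, \<open>(2n choose n + a) /
  4\<^sup>n\<close>.\<close>
fun cbin :: "nat \<Rightarrow> int \<Rightarrow> real" where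
  "cbin 0 a = (if a = 0 then 1 else 0)"
| "cbin (Suc n) a = cbin n a / 2 + cbin n (a - 1) / 4 + cbin n (a + 1) / 4"

lemma cbin_even: "cbin n (- a) = cbin n a"
proof (induction n arbitrary: a)
  case (Suc n)
  have "cbin n (- a - 1) = cbin n (a + 1)" "cbin n (- a + 1) = cbin n (a - 1)"
    using Suc[of "a + 1"] Suc[of "a - 1"] by simp_all
  thus ?case using Suc[of a] by simp
qed simp

definition walk :: "nat \<Rightarrow> (nat \<Rightarrow> nat) \<Rightarrow> (nat \<Rightarrow> int) \<Rightarrow> real" where
  "walk d a m = (if m \<in> Zd d then \<Prod>i\<in>{1..d}. cbin (a i) (m i) else 0)"

lemma Zd_pm_unitv: "i \<in> {1..d} \<Longrightarrow> m + unitv i \<in> Zd d \<longleftrightarrow> m \<in> Zd d"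
  "i \<in> {1..d} \<Longrightarrow> m - unitv i \<in> Zd d \<longleftrightarrow> m \<in> Zd d"
  by (auto simp: Zd_def unitv_def)

lemma Zd_uminus: "- m \<in> Zd d \<longleftrightarrow> m \<in> Zd d" by (auto simp: Zd_def)

lemma Zd_diff: "m \<in> Zd d \<Longrightarrow> n \<in> Zd d \<Longrightarrow> m - n \<in> Zd d" by (auto simp: Zd_def)

lemma walk_even: "walk d a (- m) = walk d a m"
  by (simp add: walk_def Zd_uminus cbin_even)

lemma walk_cong: "(\<And>i. i \<in> {1..d} \<Longrightarrow> a i = b i) \<Longrightarrow> walk d a = walk d b"
  by (auto simp: walk_def intro!: prod.cong)

lemma smear_walk:
  assumes i: "i \<in> {1..d}"
  shows "smear (unitv i) (walk d a) = walk d (a(i := Suc (a i)))"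
proof
  fix m
  show "smear (unitv i) (walk d a) m = walk d (a(i := Suc (a i))) m"
  proof (cases "m \<in> Zd d")
    case False
    thus ?thesis using i by (simp add: smear_def walk_def Zd_pm_unitv)
  next
    case True
    define R where "R = (\<Prod>l\<in>{1..d} - {i}. cbin (a l) (m l))"
    have pr: "(\<Prod>l\<in>{1..d}. cbin (b l) (x l)) = cbin (b i) (x i) * R"
      if "\<And>l. l \<noteq> i \<Longrightarrow> b l = a l" "\<And>l. l \<noteq> i \<Longrightarrow> x l = m l" for b x
      using i that by (subst prod.remove[of _ i]) (auto simp: R_def)
    have "walk d a m = cbin (a i) (m i) * R"
      using True pr[of a m] by (simp add: walk_def)
    moreover have "walk d a (m - unitv i) = cbin (a i) (m i - 1) * R"
      using True Zd_pm_unitv(2)[OF i, of m] pr[of a "m - unitv i"] by (simp add: walk_def unitv_def)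
    moreover have "walk d a (m + unitv i) = cbin (a i) (m i + 1) * R"
      using True Zd_pm_unitv(1)[OF i, of m] pr[of a "m + unitv i"] by (simp add: walk_def unitv_def)
    moreover have "walk d (a(i := Suc (a i))) m = cbin (Suc (a i)) (m i) * R"
      using True pr[of "a(i := Suc (a i))" m] by (simp add: walk_def del: cbin.simps)
    ultimately show ?thesis by (simp add: smear_def algebra_simps)
  qed
qed

abbreviation smears :: "nat list \<Rightarrow> ((nat \<Rightarrow> int) \<Rightarrow> real) \<Rightarrow> (nat \<Rightarrow> int) \<Rightarrow> real" where
  "smears is P \<equiv> foldr (\<lambda>i. smear (unitv i)) is P"

lemma smears_walk:
  assumes "distinct is" "set is \<subseteq> {1..d}"
  shows "smears is (walk d a) = walk d (\<lambda>i. if i \<in> set is then Suc (a i) else a i)"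
  using assms
proof (induction "is")
  case (Cons i "is")
  have "smears (i # is) (walk d a) = smear (unitv i) (walk d (\<lambda>i. if i \<in> set is then Suc (a i) else a i))"
    using Cons by simp
  also have "\<dots> = walk d ((\<lambda>i. if i \<in> set is then Suc (a i) else a i)(i := Suc (a i)))"
    using Cons.prems by (subst smear_walk) auto
  finally show ?case by (auto simp: fun_upd_def intro!: walk_cong)
qed simp

lemma smears_lin: "smears is (\<lambda>m. P m + c * Q m) = (\<lambda>m. smears is P m + c * smears is Q m)"
  by (induction "is") (auto simp: smear_def algebra_simps add_divide_distrib)

lemma smears_zero: "smears is (\<lambda>m. 0) = (\<lambda>m. 0)"
  by (induction "is") (auto simp: smear_def)

lemma smears_sum: "finite T \<Longrightarrow> smears is (\<lambda>m. \<Sum>t\<in>T. P t m) = (\<lambda>m. \<Sum>t\<in>T. smears is (P t) m)"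
proof (induction T rule: finite_induct)
  case (insert t T)
  thus ?case using smears_lin[of "is" "P t" 1 "\<lambda>m. \<Sum>t\<in>T. P t m"] by simp
qed (simp add: smears_zero)

definition tform_kernel :: "((nat \<Rightarrow> int) \<times> real) list \<Rightarrow> ((nat \<Rightarrow> int) \<Rightarrow> real) \<Rightarrow> bool" where
  "tform_kernel L k \<longleftrightarrow> (\<forall>f h. fsup f \<longrightarrow> fsup h \<longrightarrow> tform L f h = pairing k f h)"

lemma walk_0: "walk d (\<lambda>_. 0) m = (if m = 0 then 1 else 0)"
proof (cases "m = 0")
  case False
  show ?thesis
  proof (cases "m \<in> Zd d")
    case True
    from False obtain i where i: "m i \<noteq> 0" by (auto simp: fun_eq_iff)
    hence "i \<in> {1..d}" using True by (auto simp: Zd_def)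
    thus ?thesis using False i by (auto simp: walk_def)
  qed (use False in \<open>simp add: walk_def\<close>)
qed (simp add: walk_def Zd_def)

lemma pairing_walk_0: "pairing (walk d (\<lambda>_. 0)) f h = tot (\<lambda>x. f x * h x)"
proof -
  have "pairing (walk d (\<lambda>_. 0)) f h = (\<Sum>m\<in>{0}. walk d (\<lambda>_. 0) m * corr f h m)"
    unfolding pairing_def by (rule tot_finite) (auto simp: walk_0)
  thus ?thesis by (simp add: walk_0 corr_def)
qed

lemma tform_kernel_Nil: "tform_kernel [] (\<lambda>_. 0)"
  unfolding tform_kernel_def pairing_def by simp

text \<open>The new kernel is the old one moved by one step, plus the energy of this step as a
  difference of two walk laws.\<close>
lemma tform_kernel_Cons:
  assumes "tform_kernel L k" and i: "i \<in> {1..d}"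
  shows "tform_kernel ((unitv i, \<phi>) # L)
     (\<lambda>m. smear (unitv i) k m + \<phi> * (walk d (\<lambda>_. 0) m - walk d ((\<lambda>_. 0)(i := Suc 0)) m))"
  unfolding tform_kernel_def
proof (intro allI impI)
  fix f h :: "(nat \<Rightarrow> int) \<Rightarrow> real" assume fs: "fsup f" "fsup h"
  let ?e = "unitv i"
  have "tform ((?e, \<phi>) # L) f h = \<phi> * (pairing (walk d (\<lambda>_. 0)) f h - pairing (walk d (\<lambda>_. 0)) (avg ?e f) (avg ?e h))
     + pairing k (avg ?e f) (avg ?e h)"
    using assms fs by (simp add: pairing_walk_0 tform_kernel_def fsup_avg)
  also have "\<dots> = \<phi> * (pairing (walk d (\<lambda>_. 0)) f h + (-1) * pairing (walk d ((\<lambda>_. 0)(i := Suc 0))) f h)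
     + pairing (smear ?e k) f h"
    unfolding pairing_avg[OF fs] smear_walk[OF i] by simp
  also have "\<dots> = pairing (\<lambda>m. smear ?e k m + \<phi> * (walk d (\<lambda>_. 0) m + (-1) * walk d ((\<lambda>_. 0)(i := Suc 0)) m)) f h"
    by (simp only: pairing_lin[OF fs] add.commute)
  finally show "tform ((?e, \<phi>) # L) f h =
     pairing (\<lambda>m. smear ?e k m + \<phi> * (walk d (\<lambda>_. 0) m - walk d ((\<lambda>_. 0)(i := Suc 0)) m)) f h" by simp
qed

lemma tform_kernel_zeros:
  assumes "tform_kernel L k" and "set is \<subseteq> {1..d}"
  shows "tform_kernel (map (\<lambda>i. (unitv i, 0)) is @ L) (smears is k)"
  using assms(2)
proof (induction "is")
  case (Cons i "is")
  thus ?case using tform_kernel_Cons[of "map (\<lambda>i. (unitv i, 0)) is @ L" "smears is k" i d 0] by simp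
qed (simp add: assms)

text \<open>For \<open>P\<close> the law of the walk at time \<open>n\<close> in every coordinate
  and \<open>S\<^sub>j\<close> a step in coordinate \<open>j\<close>, this is \<open>(S\<^sub>j - 1)
  P - (S\<^sub>k - 1) S\<^sub>j P\<close>, the walk's analogue of \<open>(\<partial>\<^sub>j\<^sup>2
  - \<partial>\<^sub>k\<^sup>2)\<close> applied to the heat kernel.\<close>
definition step_kernel :: "nat \<Rightarrow> nat \<Rightarrow> nat \<Rightarrow> nat \<Rightarrow> (nat \<Rightarrow> int) \<Rightarrow> real" where
  "step_kernel d j k n m = 2 * walk d ((\<lambda>_. n)(j := Suc n)) m - walk d (\<lambda>_. n) m
      - walk d ((\<lambda>_. n)(j := Suc n, k := Suc n)) m"

lemma step_kernel_even: "step_kernel d j k n (- m) = step_kernel d j k n m"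
  by (simp add: step_kernel_def walk_even)

lemma smears_step_kernel:
  assumes "distinct is" "set is = {1..d}"
  shows "smears is (step_kernel d j k n) = step_kernel d j k (Suc n)"
proof -
  have w: "smears is (walk d a) = walk d (\<lambda>i. Suc (a i))" for a
    using assms by (subst smears_walk[of _ d]) (auto intro!: walk_cong)
  have "step_kernel d j k n = (\<lambda>m. (0 + 2 * walk d ((\<lambda>_. n)(j := Suc n)) m) + (-1) * walk d (\<lambda>_. n) m
      + (-1) * walk d ((\<lambda>_. n)(j := Suc n, k := Suc n)) m)"
    by (auto simp: step_kernel_def)
  hence "smears is (step_kernel d j k n) = (\<lambda>m. (0 + 2 * walk d (\<lambda>i. Suc (((\<lambda>_. n)(j := Suc n)) i)) m) + (-1) * walk d (\<lambda>_. Suc n) m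
      + (-1) * walk d (\<lambda>i. Suc (((\<lambda>_. n)(j := Suc n, k := Suc n)) i)) m)"
    by (simp only: smears_lin smears_zero w)
  moreover have "(\<lambda>i. Suc (((\<lambda>_. n)(j := Suc n)) i)) = (\<lambda>_. Suc n)(j := Suc (Suc n))"
    "(\<lambda>i. Suc (((\<lambda>_. n)(j := Suc n, k := Suc n)) i)) = (\<lambda>_. Suc n)(j := Suc (Suc n), k := Suc (Suc n))"
    by auto
  ultimately show ?thesis by (auto simp: step_kernel_def)
qed

text \<open>One round moves each coordinate once. The sign is \<open>-1\<close> on \<open>j\<close>
  and \<open>1\<close> on \<open>k\<close>, since the step kernel counts the energy lost in
  direction \<open>k\<close> positively and the energy lost in direction \<open>j\<close>
  negatively.\<close>
fun rounds :: "nat \<Rightarrow> nat \<Rightarrow> nat \<Rightarrow> nat \<Rightarrow> ((nat \<Rightarrow> int) \<times> real) list" where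
  "rounds d j k 0 = []"
| "rounds d j k (Suc N) = (unitv j, -1) # (unitv k, 1) #
     map (\<lambda>i. (unitv i, 0)) (filter (\<lambda>i. i \<noteq> j \<and> i \<noteq> k) [1..<Suc d]) @ rounds d j k N"

text \<open>Going one round back in time shifts all earlier contributions by one step of the whole
  walk, and the first two entries of the round contribute the kernel at time
  \<open>0\<close>.\<close>
lemma tform_kernel_rounds:
  assumes jk: "j \<in> {1..d}" "k \<in> {1..d}" "j \<noteq> k"
  shows "tform_kernel (rounds d j k N) (\<lambda>m. \<Sum>n\<in>{..<N}. step_kernel d j k n m)"
proof (induction N)
  case 0 thus ?case by (simp add: tform_kernel_Nil)
next
  case (Suc N)
  let ?is = "filter (\<lambda>i. i \<noteq> j \<and> i \<noteq> k) [1..<Suc d]"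
  let ?S = "\<lambda>m. \<Sum>n\<in>{..<N}. step_kernel d j k n m"
  have all: "distinct (j # k # ?is)" "set (j # k # ?is) = {1..d}" using jk by auto
  have sub: "set ?is \<subseteq> {1..d}" by auto
  note K1 = tform_kernel_zeros[OF Suc sub]
  note K2 = tform_kernel_Cons[OF K1 jk(2), of 1]
  note K3 = tform_kernel_Cons[OF K2 jk(1), of "-1"]
  have "(\<lambda>m. smear (unitv j) (\<lambda>m. smear (unitv k) (smears ?is ?S) m
           + 1 * (walk d (\<lambda>_. 0) m - walk d ((\<lambda>_. 0)(k := Suc 0)) m)) m
           + (-1) * (walk d (\<lambda>_. 0) m - walk d ((\<lambda>_. 0)(j := Suc 0)) m))
       = (\<lambda>m. smears (j # k # ?is) ?S m + step_kernel d j k 0 m)"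
  proof
    fix m
    have s: "smear (unitv j) (\<lambda>m. A m + 1 * (B m - C m)) m = smear (unitv j) A m + smear (unitv j) B m - smear (unitv j) C m"
      for A B C by (simp add: smear_def field_simps)
    have c: "((\<lambda>_. 0)(k := Suc 0, j := Suc (((\<lambda>_. 0)(k := Suc 0)) j))) = (\<lambda>_. 0)(j := Suc 0, k := Suc 0)"
      using jk by auto
    show "smear (unitv j) (\<lambda>m. smear (unitv k) (smears ?is ?S) m
           + 1 * (walk d (\<lambda>_. 0) m - walk d ((\<lambda>_. 0)(k := Suc 0)) m)) m
           + (-1) * (walk d (\<lambda>_. 0) m - walk d ((\<lambda>_. 0)(j := Suc 0)) m)
       = smears (j # k # ?is) ?S m + step_kernel d j k 0 m"
      unfolding s smear_walk[OF jk(1)] c by (simp add: step_kernel_def)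
  qed
  also have "smears (j # k # ?is) ?S = (\<lambda>m. \<Sum>n\<in>{..<N}. step_kernel d j k (Suc n) m)"
    by (subst smears_sum) (use smears_step_kernel[OF all] in auto)
  also have "(\<lambda>m. (\<Sum>n\<in>{..<N}. step_kernel d j k (Suc n) m) + step_kernel d j k 0 m) = (\<lambda>m. \<Sum>n\<in>{..<Suc N}. step_kernel d j k n m)"
    by (subst sum.lessThan_Suc_shift) auto
  finally show ?case using K3 by (simp only: rounds.simps append.simps)
qed

text \<open>The sum starts at time \<open>1\<close>, the time that corresponds to the heat
  parameters \<open>s \<in> [1/2, 1]\<close>.\<close>
definition walk_riesz :: "nat \<Rightarrow> nat \<Rightarrow> nat \<Rightarrow> nat \<Rightarrow> (nat \<Rightarrow> int) \<Rightarrow> real" where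
  "walk_riesz d j k N m = (\<Sum>n\<in>{1..N}. step_kernel d j k n m)"

text \<open>A preliminary round with coefficients \<open>0\<close> moves the whole sum from
  \<open>0, \<dots>, N-1\<close> to \<open>1, \<dots>, N\<close>.\<close>
lemma tform_kernel_walk_riesz:
  assumes jk: "j \<in> {1..d}" "k \<in> {1..d}" "j \<noteq> k"
  shows "tform_kernel (map (\<lambda>i. (unitv i, 0)) [1..<Suc d] @ rounds d j k N) (walk_riesz d j k N)"
proof -
  have "smears [1..<Suc d] (\<lambda>m. \<Sum>n\<in>{..<N}. step_kernel d j k n m) = walk_riesz d j k N"
  proof (subst smears_sum)
    have "smears [1..<Suc d] (step_kernel d j k n) = step_kernel d j k (Suc n)" for n
      by (rule smears_step_kernel) auto
    moreover have "(\<Sum>n\<in>{..<N}. step_kernel d j k (Suc n) m) = (\<Sum>n\<in>{1..N}. step_kernel d j k n m)" for m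
      using sum.atLeast1_atMost_eq[of "\<lambda>n. step_kernel d j k n m" N] by simp
    ultimately show "(\<lambda>m. \<Sum>n\<in>{..<N}. smears [1..<Suc d] (step_kernel d j k n) m) = walk_riesz d j k N"
      by (auto simp: walk_riesz_def)
  qed auto
  moreover have "set [1..<Suc d] \<subseteq> {1..d}" by auto
  ultimately show ?thesis using tform_kernel_zeros[OF tform_kernel_rounds[OF jk, of N], of "[1..<Suc d]" d] by metis
qed

lemma rounds_signs: "snd ` set (rounds d j k N) \<subseteq> {-1, 0, 1}"
  by (induction N) auto

text \<open>Boundedness on \<open>\<ell>\<^sup>p\<close> with constant \<open>C\<close> in bilinear
  form. The right side is a sum instead of a product of norms, which is what the Bellman induction
  produces; for positive \<open>C\<close> scaling recovers the norm.\<close>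
definition form_bound :: "nat \<Rightarrow> real \<Rightarrow> real \<Rightarrow> ((nat \<Rightarrow> int) \<Rightarrow> real) \<Rightarrow> bool" where
  "form_bound d p C k \<longleftrightarrow> (\<forall>S (f :: (nat \<Rightarrow> int) \<Rightarrow> real) h. finite S \<longrightarrow> S \<subseteq> Zd d \<longrightarrow>
     (\<Sum>x\<in>S. \<Sum>y\<in>S. k (y - x) * f x * h y)
       \<le> C * ((\<Sum>x\<in>S. \<bar>f x\<bar> powr p) / p + (\<Sum>x\<in>S. \<bar>h x\<bar> powr (p/(p - 1))) / (p/(p - 1))))"

text \<open>The Bellman bound has the unbalanced right side \<open>(p-1)\<^sup>p |f|\<^sup>p / p +
  |h|\<^sup>q / q\<close>; replacing \<open>f, h\<close> by \<open>\<mu> f, h / \<mu>\<close>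
  balances it to the factor \<open>p - 1\<close> in both terms.\<close>
lemma form_bound_walk_riesz_ge2:
  assumes jk: "j \<in> {1..d}" "k \<in> {1..d}" "j \<noteq> k" and p: "p \<ge> 2"
  shows "form_bound d p (p - 1) (walk_riesz d j k N)"
  unfolding form_bound_def
proof (intro allI impI)
  fix S and f h :: "(nat \<Rightarrow> int) \<Rightarrow> real"
  assume S: "finite S" "S \<subseteq> Zd d"
  define q where "q = p/(p - 1)"
  \<comment> \<open>chosen such that \<open>((p-1) \<mu>)\<^sup>p = \<mu>\<^sup>-\<^sup>q = p - 1\<close>\<close>
  define \<mu> where "\<mu> = (p - 1) powr (- 1 / q)"
  have mu: "\<mu> > 0" using p by (simp add: \<mu>_def)
  have q: "q > 0" using p by (simp add: q_def)
  define F where "F x = (if x \<in> S then \<mu> * f x else 0)" for x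
  define H where "H x = (if x \<in> S then h x / \<mu> else 0)" for x
  have fs: "fsup F" "fsup H" unfolding fsup_def F_def H_def
    by (rule finite_subset[OF _ S(1)]; auto)+
  let ?L = "map (\<lambda>i. (unitv i, 0)) [1..<Suc d] @ rounds d j k N"
  have "snd ` set ?L \<subseteq> {-1, 0, 1}" using rounds_signs[of d j k N] by auto
  note B = tform_bound[OF p q_def this fs]
  have "tform ?L F H = pairing (walk_riesz d j k N) F H"
    using tform_kernel_walk_riesz[OF jk, of N] fs unfolding tform_kernel_def by blast
  also have "\<dots> = (\<Sum>x\<in>S. \<Sum>y\<in>S. walk_riesz d j k N (y - x) * F x * H y)"
    by (rule pairing_finite[OF S(1)]) (auto simp: F_def H_def)
  also have "\<dots> = (\<Sum>x\<in>S. \<Sum>y\<in>S. walk_riesz d j k N (y - x) * f x * h y)"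
    using mu by (intro sum.cong refl) (auto simp: F_def H_def)
  finally have 1: "tform ?L F H = (\<Sum>x\<in>S. \<Sum>y\<in>S. walk_riesz d j k N (y - x) * f x * h y)" .
  have "(p - 1) * \<mu> = (p - 1) powr (1 + - 1 / q)" using p unfolding \<mu>_def by (subst powr_add) simp
  also have "1 + - 1 / q = 1 / p" using p by (simp add: q_def field_simps)
  finally have mp: "((p - 1) * \<mu>) powr p = p - 1" using p by (simp add: powr_powr)
  have "\<mu> powr (- q) = p - 1" using p q by (simp add: \<mu>_def powr_powr)
  hence mq: "(1 / \<mu>) powr q = p - 1" using mu by (simp add: powr_minus_divide powr_divide)
  have 2: "tot (\<lambda>x. ((p - 1) * \<bar>F x\<bar>) powr p) = (p - 1) * (\<Sum>x\<in>S. \<bar>f x\<bar> powr p)"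
  proof -
    have "tot (\<lambda>x. ((p - 1) * \<bar>F x\<bar>) powr p) = (\<Sum>x\<in>S. ((p - 1) * \<bar>F x\<bar>) powr p)"
      by (rule tot_finite[OF S(1)]) (simp add: F_def)
    also have "\<dots> = (\<Sum>x\<in>S. (p - 1) * \<bar>f x\<bar> powr p)"
    proof (rule sum.cong[OF refl])
      fix x assume "x \<in> S"
      have "(p - 1) * \<bar>F x\<bar> = ((p - 1) * \<mu>) * \<bar>f x\<bar>" using \<open>x \<in> S\<close> mu by (simp add: F_def abs_mult)
      thus "((p - 1) * \<bar>F x\<bar>) powr p = (p - 1) * \<bar>f x\<bar> powr p" using p mu mp by (simp add: powr_mult)
    qed
    finally show ?thesis by (simp add: sum_distrib_left)
  qed
  have 3: "tot (\<lambda>x. \<bar>H x\<bar> powr q) = (p - 1) * (\<Sum>x\<in>S. \<bar>h x\<bar> powr q)"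
  proof -
    have "tot (\<lambda>x. \<bar>H x\<bar> powr q) = (\<Sum>x\<in>S. \<bar>H x\<bar> powr q)"
      by (rule tot_finite[OF S(1)]) (simp add: H_def)
    also have "\<dots> = (\<Sum>x\<in>S. (p - 1) * \<bar>h x\<bar> powr q)"
    proof (rule sum.cong[OF refl])
      fix x assume "x \<in> S"
      have "\<bar>H x\<bar> = (1 / \<mu>) * \<bar>h x\<bar>" using \<open>x \<in> S\<close> mu by (simp add: H_def)
      moreover have "((1 / \<mu>) * \<bar>h x\<bar>) powr q = (1 / \<mu>) powr q * \<bar>h x\<bar> powr q"
        by (rule powr_mult)
      ultimately show "\<bar>H x\<bar> powr q = (p - 1) * \<bar>h x\<bar> powr q" using mq by (simp only:)
    qed
    finally show ?thesis by (simp add: sum_distrib_left)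
  qed
  from B show "(\<Sum>x\<in>S. \<Sum>y\<in>S. walk_riesz d j k N (y - x) * f x * h y)
     \<le> (p - 1) * ((\<Sum>x\<in>S. \<bar>f x\<bar> powr p) / p + (\<Sum>x\<in>S. \<bar>h x\<bar> powr (p/(p - 1))) / (p/(p - 1)))"
    unfolding 1 2 3 q_def[symmetric] by (simp add: distrib_left)
qed

text \<open>For \<open>p < 2\<close> the two functions exchange roles, because the kernel is
  even.\<close>
lemma form_bound_walk_riesz:
  assumes jk: "j \<in> {1..d}" "k \<in> {1..d}" "j \<noteq> k" and p: "p > 1"
  shows "form_bound d p (max p (p/(p - 1)) - 1) (walk_riesz d j k N)"
proof (cases "p \<ge> 2")
  case True
  have "p/(p - 1) \<le> p" using True by (simp add: field_simps)
  hence "max p (p/(p - 1)) = p" by simp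
  thus ?thesis using form_bound_walk_riesz_ge2[OF jk True] by simp
next
  case False
  define q where "q = p/(p - 1)"
  have q: "q \<ge> 2" unfolding q_def using p False by (simp add: field_simps)
  have "p \<le> q" using q False by simp
  hence mx: "max p (p/(p - 1)) = q" by (simp add: q_def max_def)
  have qq: "q/(q - 1) = p" unfolding q_def using p by (simp add: field_simps)
  have ev: "walk_riesz d j k N (y - x) = walk_riesz d j k N (x - y)" for x y
  proof -
    have "step_kernel d j k n (y - x) = step_kernel d j k n (x - y)" for n
      using step_kernel_even[of d j k n "x - y"] by simp
    thus ?thesis by (simp add: walk_riesz_def)
  qed
  show ?thesis unfolding form_bound_def mx
  proof (intro allI impI)
    fix S and f h :: "(nat \<Rightarrow> int) \<Rightarrow> real"
    assume S: "finite S" "S \<subseteq> Zd d"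
    have "(\<Sum>x\<in>S. \<Sum>y\<in>S. walk_riesz d j k N (y - x) * f x * h y) = (\<Sum>y\<in>S. \<Sum>x\<in>S. walk_riesz d j k N (x - y) * h y * f x)"
      by (subst sum.swap) (auto simp: ev mult_ac intro!: sum.cong)
    also have "\<dots> \<le> (q - 1) * ((\<Sum>x\<in>S. \<bar>h x\<bar> powr q) / q + (\<Sum>x\<in>S. \<bar>f x\<bar> powr (q/(q - 1))) / (q/(q - 1)))"
      using form_bound_walk_riesz_ge2[OF jk q, of N] S unfolding form_bound_def by blast
    finally show "(\<Sum>x\<in>S. \<Sum>y\<in>S. walk_riesz d j k N (y - x) * f x * h y)
      \<le> (q - 1) * ((\<Sum>x\<in>S. \<bar>f x\<bar> powr p) / p + (\<Sum>x\<in>S. \<bar>h x\<bar> powr (p/(p - 1))) / (p/(p - 1)))"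
      unfolding qq q_def[symmetric] by (simp add: add.commute)
  qed
qed

section \<open>Gaussians on the integers\<close>

lemma sum_geometric_int_le:
  assumes "0 \<le> \<rho>" "\<rho> < (1::real)" "finite A"
  shows "(\<Sum>a\<in>A. \<rho> ^ nat \<bar>a\<bar>) \<le> (1 + \<rho>) / (1 - \<rho>)"
proof -
  have half: "(\<Sum>a\<in>B. \<rho> ^ nat \<bar>a\<bar>) \<le> 1 / (1 - \<rho>)" if "finite B" "inj_on (\<lambda>a. nat \<bar>a\<bar>) B" for B
  proof -
    have "(\<Sum>a\<in>B. \<rho> ^ nat \<bar>a\<bar>) = (\<Sum>n\<in>(\<lambda>a. nat \<bar>a\<bar>) ` B. \<rho> ^ n)"
      using that by (simp add: sum.reindex)
    also have "\<dots> \<le> (\<Sum>n. \<rho> ^ n)"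
      by (rule sum_le_suminf) (use assms that in \<open>auto intro: summable_geometric\<close>)
    also have "\<dots> = 1 / (1 - \<rho>)" using assms by (simp add: suminf_geometric)
    finally show ?thesis .
  qed
  have pos: "(\<Sum>a\<in>A \<inter> {0..}. \<rho> ^ nat \<bar>a\<bar>) \<le> 1 / (1 - \<rho>)"
    by (rule half) (use assms in \<open>auto simp: inj_on_def\<close>)
  have "(\<Sum>a\<in>A \<inter> {..<0}. \<rho> ^ nat \<bar>a\<bar>) = (\<Sum>a\<in>A \<inter> {..<0}. \<rho> * \<rho> ^ nat \<bar>a + 1\<bar>)"
  proof (rule sum.cong[OF refl])
    fix a assume "a \<in> A \<inter> {..<0}"
    hence "nat \<bar>a\<bar> = Suc (nat \<bar>a + 1\<bar>)" by auto
    thus "\<rho> ^ nat \<bar>a\<bar> = \<rho> * \<rho> ^ nat \<bar>a + 1\<bar>" by (simp only: power_Suc)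
  qed
  also have "\<dots> = \<rho> * (\<Sum>a\<in>(\<lambda>a. a + 1) ` (A \<inter> {..<0}). \<rho> ^ nat \<bar>a\<bar>)"
    by (subst sum.reindex) (auto simp: sum_distrib_left)
  also have "\<dots> \<le> \<rho> * (1 / (1 - \<rho>))"
    by (intro mult_left_mono half) (use assms in \<open>auto simp: inj_on_def\<close>)
  finally have neg: "(\<Sum>a\<in>A \<inter> {..<0}. \<rho> ^ nat \<bar>a\<bar>) \<le> \<rho> / (1 - \<rho>)" by simp
  have "(\<Sum>a\<in>A. \<rho> ^ nat \<bar>a\<bar>) = (\<Sum>a\<in>A \<inter> {0..}. \<rho> ^ nat \<bar>a\<bar>) + (\<Sum>a\<in>A \<inter> {..<0}. \<rho> ^ nat \<bar>a\<bar>)"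
    by (subst sum.union_disjoint[symmetric]) (use assms in \<open>auto intro!: sum.cong\<close>)
  thus ?thesis using pos neg by (simp add: add_divide_distrib)
qed

text \<open>The exponent is a quarter of that of the Gaussian, which leaves room to absorb
  polynomial factors and unit shifts.\<close>
definition maj :: "real \<Rightarrow> int \<Rightarrow> real" where
  "maj s a = sqrt s * exp (- s * (real_of_int a)\<^sup>2 / 4)"

definition gauss :: "real \<Rightarrow> int \<Rightarrow> real" where
  "gauss s a = sqrt (s / pi) * exp (- s * (real_of_int a)\<^sup>2)"

text \<open>This is \<open>-s \<partial>\<^sub>s\<close> of the Gaussian, the heat-flow counterpart
  of one step of the walk.\<close>
definition dgauss :: "real \<Rightarrow> int \<Rightarrow> real" where
  "dgauss s a = (s * (real_of_int a)\<^sup>2 - 1/2) * gauss s a"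

lemma maj_nonneg: "s \<ge> 0 \<Longrightarrow> maj s a \<ge> 0" by (simp add: maj_def)

lemma gauss_nonneg: "s \<ge> 0 \<Longrightarrow> gauss s a \<ge> 0" by (simp add: gauss_def)

text \<open>The square root in front makes the mass bounded for all \<open>s \<le> 1\<close>; the
  Gaussian is compared with a geometric sequence of ratio about \<open>1 - sqrt s /
  2\<close>.\<close>
lemma sum_maj_le:
  assumes "0 < s" "s \<le> 1" "finite A"
  shows "(\<Sum>a\<in>A. maj s a) \<le> 12"
proof -
  define x where "x = sqrt s / 2"
  have x: "0 < x" "x \<le> 1/2" using assms by (auto simp: x_def)
  define \<rho> where "\<rho> = exp (- x)"
  have rho: "0 \<le> \<rho>" "\<rho> < 1" using x by (auto simp: \<rho>_def)
  have "1 + x \<le> exp x" by (rule exp_ge_add_one_self)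
  hence "\<rho> \<le> 1 / (1 + x)" using x by (simp add: \<rho>_def exp_minus field_simps)
  hence "1 - \<rho> \<ge> x / (1 + x)" using x by (simp add: field_simps)
  also have "x / (1 + x) \<ge> x / (3/2)" using x by (intro divide_left_mono) auto
  finally have r: "1 - \<rho> \<ge> 2 * x / 3" using x by simp
  have m: "maj s a \<le> sqrt s * (exp (1/4) * \<rho> ^ nat \<bar>a\<bar>)" for a
  proof -
    define t where "t = x * \<bar>real_of_int a\<bar>"
    have "s * (real_of_int a)\<^sup>2 / 4 = t\<^sup>2" using assms by (simp add: t_def x_def power_mult_distrib power_divide)
    moreover have "0 \<le> (t - 1/2)\<^sup>2" by simp
    ultimately have "- s * (real_of_int a)\<^sup>2 / 4 \<le> 1/4 + - t" by (simp add: power2_eq_square algebra_simps)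
    hence "exp (- s * (real_of_int a)\<^sup>2 / 4) \<le> exp (1/4) * exp (- t)" by (metis exp_add exp_le_cancel_iff)
    also have "exp (- t) = \<rho> ^ nat \<bar>a\<bar>" by (simp add: \<rho>_def t_def exp_of_nat_mult[symmetric] mult.commute)
    finally show ?thesis unfolding maj_def using assms by (intro mult_left_mono) auto
  qed
  have "(\<Sum>a\<in>A. maj s a) \<le> (\<Sum>a\<in>A. sqrt s * (exp (1/4) * \<rho> ^ nat \<bar>a\<bar>))" by (intro sum_mono m)
  also have "\<dots> = sqrt s * exp (1/4) * (\<Sum>a\<in>A. \<rho> ^ nat \<bar>a\<bar>)" by (simp add: sum_distrib_left mult.assoc)
  also have "\<dots> \<le> sqrt s * exp (1/4) * ((1 + \<rho>) / (1 - \<rho>))"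
    by (intro mult_left_mono sum_geometric_int_le rho) (use assms in auto)
  also have "\<dots> \<le> sqrt s * exp (1/4) * (2 / (1 - \<rho>))"
    by (intro mult_left_mono divide_right_mono) (use assms rho in auto)
  also have "\<dots> \<le> sqrt s * exp (1/4) * (2 / (2 * x / 3))"
    by (intro mult_left_mono divide_left_mono r) (use x rho assms in auto)
  also have "\<dots> = 6 * exp (1/4)" using x assms by (simp add: x_def)
  also have "exp (1/4::real) \<le> exp 1 powr (1/4)" by (simp add: powr_def)
  also have "exp (1::real) powr (1/4) \<le> 16 powr (1/4)" by (rule powr_mono2) (use exp_le in auto)
  also have "(16::real) powr (1/4) = 2"
  proof -
    have "(16::real) = 2 powr 4" by simp
    thus ?thesis by (simp only: powr_powr) simp
  qed
  finally show ?thesis by simp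
qed

lemma power_le_exp:
  assumes "x \<ge> (0::real)" "k \<ge> 1" "c > 0"
  shows "x ^ k \<le> (real k / c) ^ k * exp (c * x)"
proof -
  have "c * x / real k \<le> exp (c * x / real k)" using exp_ge_add_one_self[of "c * x / real k"] by linarith
  hence "(c * x / real k) ^ k \<le> exp (c * x / real k) ^ k" by (rule power_mono) (use assms in auto)
  also have "\<dots> = exp (c * x)" using assms by (simp add: exp_of_nat_mult[symmetric])
  finally have "(real k / c) ^ k * (c * x / real k) ^ k \<le> (real k / c) ^ k * exp (c * x)"
    by (rule mult_left_mono) (use assms in auto)
  thus ?thesis using assms by (simp add: power_mult_distrib[symmetric])
qed

lemma gauss_le: "0 < s \<Longrightarrow> gauss s a \<le> exp (- s * (real_of_int a)\<^sup>2 / 4) * maj s a"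
proof -
  assume s: "0 < s"
  have "gauss s a \<le> sqrt s * exp (- s * (real_of_int a)\<^sup>2)"
    unfolding gauss_def using s pi_ge_two by (intro mult_right_mono real_sqrt_le_mono) (auto simp: field_simps)
  also have "\<dots> \<le> sqrt s * (exp (- s * (real_of_int a)\<^sup>2 / 4) * exp (- s * (real_of_int a)\<^sup>2 / 4))"
    unfolding exp_add[symmetric] using s by (intro mult_left_mono) auto
  finally show ?thesis by (simp add: maj_def mult_ac)
qed

lemma dgauss_le: "0 < s \<Longrightarrow> \<bar>dgauss s a\<bar> \<le> 3 * (exp (- s * (real_of_int a)\<^sup>2 / 4) * maj s a)"
proof -
  assume s: "0 < s"
  define x where "x = s * (real_of_int a)\<^sup>2"
  have x: "x \<ge> 0" using s by (simp add: x_def)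
  have "x \<le> 2 * exp (x/2)" using power_le_exp[of x 1 "1/2"] x by simp
  moreover have "1 \<le> exp (x/2)" using x by simp
  ultimately have "\<bar>x - 1/2\<bar> \<le> 3 * exp (x/2)" using x by linarith
  hence "\<bar>x - 1/2\<bar> * exp (- x) \<le> 3 * exp (x/2) * exp (- x)" by (rule mult_right_mono) auto
  also have "\<dots> = 3 * (exp (- x/4) * exp (- x/4))" by (simp add: mult.assoc exp_add[symmetric])
  finally have 1: "\<bar>x - 1/2\<bar> * exp (- x) \<le> 3 * (exp (- x/4) * exp (- x/4))" .
  have "\<bar>dgauss s a\<bar> = sqrt (s/pi) * (\<bar>x - 1/2\<bar> * exp (- x))"
    using s by (simp add: dgauss_def gauss_def abs_mult x_def)
  also have "\<dots> \<le> sqrt s * (3 * (exp (- x/4) * exp (- x/4)))"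
    by (rule mult_mono) (use s pi_ge_two 1 in \<open>auto simp: field_simps real_sqrt_le_mono\<close>)
  finally show ?thesis by (simp add: maj_def mult_ac x_def)
qed

lemma exp_shift_le:
  assumes "0 < s" "s \<le> 1" "a \<le> t" "t \<le> a + (1::real)"
  shows "exp (- (s * t\<^sup>2) / 2) \<le> 2 * exp (- s * a\<^sup>2 / 4)"
proof -
  have "(t - a)\<^sup>2 \<le> 1" using assms by (simp add: abs_square_le_1)
  moreover have "0 \<le> (t + (t - a))\<^sup>2" "a = t - (t - a)" by auto
  ultimately have "a\<^sup>2 \<le> 2 * t\<^sup>2 + 2" by (simp add: power2_eq_square algebra_simps)
  hence "s * a\<^sup>2 \<le> s * (2 * t\<^sup>2 + 2)" using assms by (intro mult_left_mono) auto
  hence "s * a\<^sup>2 \<le> 2 * (s * t\<^sup>2) + 2" using assms by (simp add: algebra_simps)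
  hence "exp (- (s * t\<^sup>2) / 2) \<le> exp (1/2) * exp (- s * a\<^sup>2 / 4)" unfolding exp_add[symmetric] by simp
  also have "exp (1/2::real) \<le> 2"
  proof -
    have "exp (1/2::real)^2 = exp 1" by (simp add: power2_eq_square exp_add[symmetric])
    also have "\<dots> \<le> 2^2" using exp_le by simp
    finally show ?thesis by (rule power2_le_imp_le) simp
  qed
  finally show ?thesis by simp
qed

text \<open>A profile at scale \<open>1 / sqrt s\<close> changes under a unit shift only by
  \<open>sqrt s\<close> times its size, by the mean value theorem.\<close>
lemma gauss_poly_shift:
  fixes f' :: "real \<Rightarrow> real"
  assumes s: "0 < s" "s \<le> 1"
    and D: "\<And>u. (f has_real_derivative f' u) (at u)"
    and B: "\<And>u. \<bar>f' u\<bar> \<le> B * exp (- u\<^sup>2 / 2)" and B0: "B \<ge> 0"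
  shows "\<bar>sqrt s * f (sqrt s * (a + 1)) - sqrt s * f (sqrt s * a)\<bar> \<le> 2 * B * (sqrt s * (sqrt s * exp (- s * a\<^sup>2 / 4)))"
proof -
  have "((\<lambda>t. sqrt s * f (sqrt s * t)) has_real_derivative sqrt s * (f' (sqrt s * t) * sqrt s)) (at t)" for t
    by (intro DERIV_cmult DERIV_chain2[OF D]) (auto intro!: derivative_eq_intros)
  from MVT2[of a "a + 1" "\<lambda>t. sqrt s * f (sqrt s * t)", OF _ this]
  obtain z where z: "a < z" "z < a + 1"
    "sqrt s * f (sqrt s * (a + 1)) - sqrt s * f (sqrt s * a) = sqrt s * (f' (sqrt s * z) * sqrt s)" by auto
  have "\<bar>sqrt s * (f' (sqrt s * z) * sqrt s)\<bar> = sqrt s * (sqrt s * \<bar>f' (sqrt s * z)\<bar>)"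
    using s by (simp add: abs_mult)
  also have "\<dots> \<le> sqrt s * (sqrt s * (B * exp (- (sqrt s * z)\<^sup>2 / 2)))"
    using s by (intro mult_left_mono B) auto
  also have "(sqrt s * z)\<^sup>2 = s * z\<^sup>2" using s by (simp add: power_mult_distrib)
  also have "sqrt s * (sqrt s * (B * exp (- (s * z\<^sup>2) / 2))) \<le> sqrt s * (sqrt s * (B * (2 * exp (- s * a\<^sup>2 / 4))))"
    using s B0 by (intro mult_left_mono exp_shift_le) (use z in auto)
  finally show ?thesis unfolding z(3) by (simp add: mult_ac)
qed

lemma gauss_shift:
  assumes s: "0 < s" "s \<le> 1"
  shows "\<bar>gauss s (a + 1) - gauss s a\<bar> \<le> 4 * (sqrt s * maj s a)"
proof -
  have "\<bar>sqrt s * exp (- (sqrt s * (real_of_int a + 1))\<^sup>2) - sqrt s * exp (- (sqrt s * real_of_int a)\<^sup>2)\<bar>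
     \<le> 2 * 2 * (sqrt s * (sqrt s * exp (- s * (real_of_int a)\<^sup>2 / 4)))"
  proof (rule gauss_poly_shift[OF s, where f' = "\<lambda>u. - 2 * u * exp (- u\<^sup>2)"])
    fix u :: real
    show "((\<lambda>u. exp (- u\<^sup>2)) has_real_derivative - 2 * u * exp (- u\<^sup>2)) (at u)"
      by (auto intro!: derivative_eq_intros)
    have "\<bar>u\<bar> \<le> exp (u\<^sup>2/2)"
    proof -
      have "0 \<le> (\<bar>u\<bar> - 1)\<^sup>2" by simp
      hence "\<bar>u\<bar> \<le> 1 + u\<^sup>2/2" by (simp add: power2_eq_square algebra_simps)
      thus ?thesis using exp_ge_add_one_self[of "u\<^sup>2/2"] by linarith
    qed
    hence "2 * (\<bar>u\<bar> * exp (- u\<^sup>2)) \<le> 2 * (exp (u\<^sup>2/2) * exp (- u\<^sup>2))" by (intro mult_left_mono mult_right_mono) auto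
    also have "\<dots> = 2 * exp (- u\<^sup>2 / 2)" by (simp add: exp_add[symmetric])
    finally show "\<bar>- 2 * u * exp (- u\<^sup>2)\<bar> \<le> 2 * exp (- u\<^sup>2 / 2)" by (simp add: abs_mult)
  qed auto
  hence 1: "\<bar>sqrt s * exp (- s * (real_of_int (a + 1))\<^sup>2) - sqrt s * exp (- s * (real_of_int a)\<^sup>2)\<bar> \<le> 4 * (sqrt s * maj s a)"
    using s by (simp add: power_mult_distrib maj_def)
  have "\<bar>gauss s (a + 1) - gauss s a\<bar> = sqrt (1/pi) * \<bar>sqrt s * exp (- s * (real_of_int (a + 1))\<^sup>2) - sqrt s * exp (- s * (real_of_int a)\<^sup>2)\<bar>"
  proof -
    have "gauss s b = sqrt (1/pi) * (sqrt s * exp (- s * (real_of_int b)\<^sup>2))" for b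
      by (simp add: gauss_def real_sqrt_divide)
    thus ?thesis by (simp only: right_diff_distrib[symmetric] abs_mult) simp
  qed
  also have "\<dots> \<le> 1 * \<bar>sqrt s * exp (- s * (real_of_int (a + 1))\<^sup>2) - sqrt s * exp (- s * (real_of_int a)\<^sup>2)\<bar>"
    by (rule mult_right_mono) (use pi_ge_two in auto)
  finally show ?thesis using 1 by simp
qed

lemma dgauss_shift:
  assumes s: "0 < s" "s \<le> 1"
  shows "\<bar>dgauss s (a + 1) - dgauss s a\<bar> \<le> 40 * (sqrt s * maj s a)"
proof -
  have "\<bar>sqrt s * (((sqrt s * (real_of_int a + 1))\<^sup>2 - 1/2) * exp (- (sqrt s * (real_of_int a + 1))\<^sup>2))
       - sqrt s * (((sqrt s * real_of_int a)\<^sup>2 - 1/2) * exp (- (sqrt s * real_of_int a)\<^sup>2))\<bar>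
     \<le> 2 * 20 * (sqrt s * (sqrt s * exp (- s * (real_of_int a)\<^sup>2 / 4)))"
  proof (rule gauss_poly_shift[OF s, where f' = "\<lambda>u. (3 * u - 2 * u^3) * exp (- u\<^sup>2)"])
    fix u :: real
    show "((\<lambda>u. (u\<^sup>2 - 1/2) * exp (- u\<^sup>2)) has_real_derivative (3 * u - 2 * u^3) * exp (- u\<^sup>2)) (at u)"
      by (auto intro!: derivative_eq_intros simp: algebra_simps power2_eq_square power3_eq_cube)
    have e: "\<bar>3 * u - 2 * u^3\<bar> \<le> 20 * exp (u\<^sup>2/2)"
    proof -
      have q: "1 + u\<^sup>2/2 + (u\<^sup>2/2)\<^sup>2/2 \<le> exp (u\<^sup>2/2)" by (rule exp_lower_Taylor_quadratic) simp
      have "0 \<le> (\<bar>u\<bar> - 1)\<^sup>2" by simp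
      hence u: "\<bar>u\<bar> \<le> 1 + u\<^sup>2/2" by (simp add: power2_eq_square algebra_simps)
      have "\<bar>u\<bar>^3 = u\<^sup>2 * \<bar>u\<bar>" by (simp add: power3_eq_cube power2_eq_square)
      also have "\<dots> \<le> u\<^sup>2 * (1 + u\<^sup>2/2)" by (rule mult_left_mono[OF u]) simp
      also have "\<dots> = u\<^sup>2 + 4 * ((u\<^sup>2/2)\<^sup>2/2)" by (simp add: power2_eq_square field_simps)
      finally have u3: "\<bar>u\<bar>^3 \<le> u\<^sup>2 + 4 * ((u\<^sup>2/2)\<^sup>2/2)" .
      have "\<bar>3 * u - 2 * u^3\<bar> \<le> 3 * \<bar>u\<bar> + 2 * \<bar>u\<bar>^3"
        using abs_triangle_ineq4[of "3 * u" "2 * u^3"] by (simp add: abs_mult power_abs)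
      also have "\<dots> \<le> 3 * (1 + u\<^sup>2/2) + 2 * (u\<^sup>2 + 4 * ((u\<^sup>2/2)\<^sup>2/2))"
        by (intro add_mono mult_left_mono u u3) auto
      also have "\<dots> \<le> 20 * (1 + u\<^sup>2/2 + (u\<^sup>2/2)\<^sup>2/2)" by simp
      also have "\<dots> \<le> 20 * exp (u\<^sup>2/2)" by (rule mult_left_mono[OF q]) simp
      finally show ?thesis .
    qed
    have "\<bar>(3 * u - 2 * u^3) * exp (- u\<^sup>2)\<bar> \<le> (20 * exp (u\<^sup>2/2)) * exp (- u\<^sup>2)"
      using mult_right_mono[OF e, of "exp (- u\<^sup>2)"] by (simp add: abs_mult)
    also have "\<dots> = 20 * exp (- u\<^sup>2 / 2)" by (simp add: mult.assoc exp_add[symmetric])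
    finally show "\<bar>(3 * u - 2 * u^3) * exp (- u\<^sup>2)\<bar> \<le> 20 * exp (- u\<^sup>2 / 2)" .
  qed auto
  moreover define X where "X b = sqrt s * ((s * (real_of_int b)\<^sup>2 - 1/2) * exp (- s * (real_of_int b)\<^sup>2))" for b
  ultimately have 1: "\<bar>X (a + 1) - X a\<bar> \<le> 40 * (sqrt s * maj s a)"
    using s by (simp add: power_mult_distrib maj_def)
  have "\<bar>dgauss s (a + 1) - dgauss s a\<bar> = sqrt (1/pi) * \<bar>X (a + 1) - X a\<bar>"
  proof -
    have "dgauss s b = sqrt (1/pi) * X b" for b
      by (simp add: gauss_def dgauss_def X_def real_sqrt_divide)
    thus ?thesis by (simp only: right_diff_distrib[symmetric] abs_mult) simp
  qed
  also have "\<dots> \<le> 1 * \<bar>X (a + 1) - X a\<bar>"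
    by (rule mult_right_mono) (use pi_ge_two in auto)
  finally show ?thesis using 1 by simp
qed

section \<open>A local limit theorem for central binomial weights\<close>

lemma cbin_nonneg: "cbin n a \<ge> 0"
  by (induction n arbitrary: a) auto

lemma cbin_ratio: "(real n + 1 + a) * cbin n (a + 1) = (real n - a) * cbin n a"
proof (induction n arbitrary: a)
  case 0 thus ?case by (auto simp: algebra_simps)
next
  case (Suc n)
  have 1: "(real n + 2 + a) * cbin n (a + 1 + 1) = (real n - a - 1) * cbin n (a + 1)"
    using Suc[of "a + 1"] by (simp add: algebra_simps)
  have 2: "(real n + a) * cbin n a = (real n - a + 1) * cbin n (a - 1)"
    using Suc[of "a - 1"] by (simp add: algebra_simps)
  have "(real n + 2 + a) * (2 * cbin n (a + 1) + cbin n a + cbin n (a + 1 + 1))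
      = (real n + 1 - a) * (2 * cbin n a + cbin n (a - 1) + cbin n (a + 1))"
    using 1 2 Suc[of a] by algebra
  moreover have "cbin (Suc n) (a + 1) = (2 * cbin n (a + 1) + cbin n a + cbin n (a + 1 + 1)) / 4"
    "cbin (Suc n) a = (2 * cbin n a + cbin n (a - 1) + cbin n (a + 1)) / 4" by auto
  moreover have "real (Suc n) + 1 + a = real n + 2 + a" "real (Suc n) - a = real n + 1 - a" by auto
  ultimately show ?case by (simp only: times_divide_eq_right)
qed

text \<open>The two ratios of neighbouring weights turn one step in time into multiplication by an
  explicit function. Near the centre, \<open>(n+1)\<^sup>2 - a\<^sup>2\<close> is about
  \<open>n(n+1)\<close>, and \<open>n\<close> times the step becomes \<open>-s
  \<partial>\<^sub>s\<close> of the Gaussian at \<open>s = 1/n\<close>.\<close>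
lemma cbin_time:
  "((real n + 1)\<^sup>2 - (real_of_int a)\<^sup>2) * (cbin (Suc n) a - cbin n a) = (a\<^sup>2 - (real n + 1) / 2) * cbin n a"
proof -
  have 1: "(real n + 1 + a) * cbin n (a + 1) = (real n - a) * cbin n a" by (rule cbin_ratio)
  have 2: "(real n + a) * cbin n a = (real n - a + 1) * cbin n (a - 1)"
    using cbin_ratio[of n "a - 1"] by (simp add: algebra_simps)
  have 3: "4 * (cbin (Suc n) a - cbin n a) = cbin n (a - 1) + cbin n (a + 1) - 2 * cbin n a" by simp
  have "4 * (((real n + 1)\<^sup>2 - (real_of_int a)\<^sup>2) * (cbin (Suc n) a - cbin n a)) = 4 * ((a\<^sup>2 - (real n + 1) / 2) * cbin n a)"
    using 1 2 3 by (simp add: power2_eq_square) algebra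
  thus ?thesis by simp
qed

lemma cbin_outside: "\<bar>a\<bar> > int n \<Longrightarrow> cbin n a = 0"
  by (induction n arbitrary: a) auto

lemma cbin_center_step: "cbin (Suc n) 0 * (2 * real n + 2) = cbin n 0 * (2 * real n + 1)"
  using cbin_ratio[of n 0] cbin_even[of n 1] by (simp add: cbin.simps(2) algebra_simps)

text \<open>From here on, the weights are computed through their ratios, not by the recursion.\<close>

declare cbin.simps(2) [simp del]

text \<open>The central weight is a partial Wallis product.\<close>
lemma cbin_center_wallis: "(2 * real n + 1) * (cbin n 0)\<^sup>2 * (\<Prod>k=1..n. (4*real k^2) / (4*real k^2 - 1)) = 1"
proof (induction n)
  case 0 thus ?case by simp
next
  case (Suc n)
  have c: "cbin (Suc n) 0 = cbin n 0 * ((2 * real n + 1) / (2 * real n + 2))"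
    using cbin_center_step[of n] by (simp add: field_simps)
  define P where "P = (\<Prod>k=1..n. (4*real k^2) / (4*real k^2 - 1))"
  have "4 * real (Suc n)^2 - 1 = (2 * real n + 1) * (2 * real n + 3)" by (simp add: power2_eq_square algebra_simps)
  moreover have "4 * real (Suc n)^2 = (2 * real n + 2)\<^sup>2" by (simp add: power2_eq_square algebra_simps)
  ultimately have pr: "(\<Prod>k=1..Suc n. (4*real k^2) / (4*real k^2 - 1)) = P * ((2 * real n + 2)\<^sup>2 / ((2 * real n + 1) * (2 * real n + 3)))"
    unfolding P_def by (simp add: prod.atLeast_Suc_atMost_Suc_shift)
  have r: "2 * real (Suc n) + 1 = 2 * real n + 3" by simp
  have "(2 * real (Suc n) + 1) * (cbin (Suc n) 0)\<^sup>2 * (\<Prod>k=1..Suc n. (4*real k^2) / (4*real k^2 - 1))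
     = (2 * real n + 3) * (cbin n 0 * ((2 * real n + 1) / (2 * real n + 2)))\<^sup>2 * (P * ((2 * real n + 2)\<^sup>2 / ((2 * real n + 1) * (2 * real n + 3))))"
    by (simp only: c pr r)
  also have "\<dots> = (2 * real n + 1) * (cbin n 0)\<^sup>2 * P"
  proof -
    have "2 * real n + 1 \<noteq> 0" "2 * real n + 2 \<noteq> 0" "2 * real n + 3 \<noteq> 0" by linarith+
    thus ?thesis by (simp add: power2_eq_square divide_simps)
  qed
  also have "\<dots> = 1" using Suc unfolding P_def .
  finally show ?case .
qed

text \<open>Wallis' product gives the common limit \<open>2/\<pi>\<close> of the decreasing sequence
  \<open>(2n+1) cbin(n,0)\<^sup>2\<close> and the increasing sequence \<open>2n
  cbin(n,0)\<^sup>2\<close>.\<close>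
lemma cbin_center_bounds:
  assumes "n \<ge> 1"
  shows "cbin n 0 \<le> 1 / sqrt (pi * n)" "cbin n 0 \<ge> 1 / sqrt (pi * (n + 1/2))"
proof -
  define x where "x n = (2 * real n + 1) * (cbin n 0)\<^sup>2" for n
  define y where "y n = (2 * real n) * (cbin n 0)\<^sup>2" for n
  let ?W = "\<lambda>n. \<Prod>k=1..n. (4*real k^2) / (4*real k^2 - 1)"
  have W: "?W n \<noteq> 0" "x n = 1 / ?W n" for n
  proof -
    show "?W n \<noteq> 0" using cbin_center_wallis[of n] by (metis mult_zero_right zero_neq_one)
    thus "x n = 1 / ?W n" using cbin_center_wallis[of n] unfolding x_def by (simp add: field_simps)
  qed
  have xl: "x \<longlonglongrightarrow> 2 / pi"
  proof -
    have "(\<lambda>n. 1 / ?W n) \<longlonglongrightarrow> 1 / (pi / 2)" by (intro tendsto_divide tendsto_const wallis) simp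
    thus ?thesis unfolding W(2)[abs_def, symmetric] using W by (simp add: W(2)[abs_def])
  qed
  have step: "(cbin (Suc n) 0)\<^sup>2 = (cbin n 0)\<^sup>2 * ((2 * real n + 1)\<^sup>2 / (2 * real n + 2)\<^sup>2)" for n
  proof -
    have "cbin (Suc n) 0 = cbin n 0 * ((2 * real n + 1) / (2 * real n + 2))"
      using cbin_center_step[of n] by (simp add: field_simps del: cbin.simps)
    thus ?thesis by (simp only: power_mult_distrib power_divide)
  qed
  have xd: "x (Suc n) \<le> x n" for n
  proof -
    have B: "(2 * real n + 3) * ((2 * real n + 1)\<^sup>2 / (2 * real n + 2)\<^sup>2) \<le> 2 * real n + 1"
      by (simp add: divide_simps) (simp add: power2_eq_square algebra_simps)
    have "x (Suc n) = (cbin n 0)\<^sup>2 * ((2 * real n + 3) * ((2 * real n + 1)\<^sup>2 / (2 * real n + 2)\<^sup>2))"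
      unfolding x_def step by (simp add: mult_ac)
    also have "\<dots> \<le> (cbin n 0)\<^sup>2 * (2 * real n + 1)" by (rule mult_left_mono[OF B]) simp
    also have "\<dots> = x n" by (simp add: x_def)
    finally show ?thesis .
  qed
  have yi: "y n \<le> y (Suc n)" if "n \<ge> 1" for n
  proof -
    have B: "2 * real n \<le> (2 * real n + 2) * ((2 * real n + 1)\<^sup>2 / (2 * real n + 2)\<^sup>2)"
      by (simp add: divide_simps) (simp add: power2_eq_square algebra_simps)
    have "y n = (cbin n 0)\<^sup>2 * (2 * real n)" by (simp add: y_def)
    also have "\<dots> \<le> (cbin n 0)\<^sup>2 * ((2 * real n + 2) * ((2 * real n + 1)\<^sup>2 / (2 * real n + 2)\<^sup>2))"
      by (rule mult_left_mono[OF B]) simp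
    also have "\<dots> = y (Suc n)" unfolding y_def step by (simp add: mult_ac)
    finally show ?thesis .
  qed
  have "x n \<ge> 2 / pi"
    by (rule decseq_ge[OF _ xl]) (simp add: decseq_Suc_iff xd)
  hence "(2 / pi) / (2 * real n + 1) \<le> (cbin n 0)\<^sup>2" by (subst pos_divide_le_eq) (auto simp: x_def mult.commute)
  moreover have "1 / (pi * (n + 1/2)) = (2 / pi) / (2 * real n + 1)" by (simp add: field_simps)
  ultimately have "(cbin n 0)\<^sup>2 \<ge> 1 / (pi * (n + 1/2))" by simp
  hence "sqrt (1 / (pi * (n + 1/2))) \<le> sqrt ((cbin n 0)\<^sup>2)" by (rule real_sqrt_le_mono)
  thus "cbin n 0 \<ge> 1 / sqrt (pi * (n + 1/2))" using cbin_nonneg[of n 0] by (simp add: real_sqrt_divide)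
  have yl: "y \<longlonglongrightarrow> 2 / pi"
  proof -
    have "(\<lambda>n. x n * (2 * real n / (2 * real n + 1))) \<longlonglongrightarrow> (2 / pi) * 1"
      by (intro tendsto_mult xl) real_asymp
    moreover have "x n * (2 * real n / (2 * real n + 1)) = y n" for n
      by (simp add: x_def y_def divide_simps)
    ultimately show ?thesis by simp
  qed
  have "y n \<le> 2 / pi"
  proof (rule LIMSEQ_le_const[OF yl])
    have "y n \<le> y m" if "n \<le> m" for m
      using that by (induction m rule: dec_induct) (use yi assms in \<open>auto intro: order_trans\<close>)
    thus "\<exists>N. \<forall>m\<ge>N. y n \<le> y m" by blast
  qed
  hence "(cbin n 0)\<^sup>2 \<le> 1 / (pi * n)" using assms by (simp add: y_def field_simps)
  hence "sqrt ((cbin n 0)\<^sup>2) \<le> sqrt (1 / (pi * n))" by (rule real_sqrt_le_mono)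
  thus "cbin n 0 \<le> 1 / sqrt (pi * n)" using cbin_nonneg[of n 0] by (simp add: real_sqrt_divide)
qed

text \<open>The ratio of neighbouring weights is at most an exponential, by \<open>1 + x \<le>
  e\<^sup>x\<close>; the exponents \<open>2i + 1\<close> add up to a square. The parameter
  \<open>a\<close> keeps the denominator fixed during the induction.\<close>
lemma cbin_upper:
  assumes "i \<le> a" "a \<le> n" "n \<ge> 1"
  shows "cbin n (int i) \<le> cbin n 0 * exp (- (real i)\<^sup>2 / (n + a))"
  using assms(1)
proof (induction i)
  case 0 thus ?case by simp
next
  case (Suc i)
  have i: "real i + 1 \<le> real a" "real a \<le> real n" using Suc.prems assms by linarith+
  have "cbin n (int (Suc i)) = cbin n (int i) * ((real n - i) / (real n + 1 + i))"
    using cbin_ratio[of n "int i"] by (simp add: field_simps add.commute)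
  also have "(real n - i) / (real n + 1 + i) = 1 - (2 * real i + 1) / (real n + 1 + i)" by (simp add: field_simps)
  also have "\<dots> \<le> 1 + - ((2 * real i + 1) / (real n + a))"
    using i by (simp add: divide_left_mono)
  also have "\<dots> \<le> exp (- ((2 * real i + 1) / (real n + a)))" by (rule exp_ge_add_one_self)
  finally have "cbin n (int (Suc i)) \<le> cbin n (int i) * exp (- ((2 * real i + 1) / (real n + a)))"
    using cbin_nonneg by (simp add: mult_left_mono)
  also have "\<dots> \<le> (cbin n 0 * exp (- (real i)\<^sup>2 / (n + a))) * exp (- ((2 * real i + 1) / (real n + a)))"
    by (rule mult_right_mono) (use Suc in auto)
  also have "\<dots> = cbin n 0 * exp (- (real (Suc i))\<^sup>2 / (n + a))"
  proof -
    have "- (real i)\<^sup>2 / (n + a) + - ((2 * real i + 1) / (real n + a)) = - (real (Suc i))\<^sup>2 / (n + a)"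
      by (simp add: power2_eq_square add_divide_distrib[symmetric] diff_divide_distrib[symmetric] algebra_simps)
    thus ?thesis by (simp only: mult.assoc exp_add[symmetric])
  qed
  finally show ?case .
qed

text \<open>The same inequality \<open>1 + x \<le> e\<^sup>x\<close>, applied to the inverse
  ratio.\<close>
lemma cbin_lower:
  assumes "i \<le> a" "a \<le> n" "n \<ge> 1"
  shows "cbin n (int i) \<ge> cbin n 0 * exp (- (real i)\<^sup>2 / (real n + 1 - real a))"
  using assms(1)
proof (induction i)
  case 0 thus ?case by simp
next
  case (Suc i)
  have i: "real i + 1 \<le> real a" "real a \<le> real n" using Suc.prems assms by linarith+
  have c: "cbin n (int (Suc i)) = cbin n (int i) * ((real n - i) / (real n + 1 + i))"
    using cbin_ratio[of n "int i"] by (simp add: field_simps add.commute)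
  have "exp (- ((2 * real i + 1) / (real n + 1 - real a))) \<le> exp (- ((2 * real i + 1) / (real n - i)))"
    using i by (simp add: divide_left_mono)
  also have "\<dots> \<le> (real n - i) / (real n + 1 + i)"
  proof -
    have "(real n + 1 + i) / (real n - i) = 1 + (2 * real i + 1) / (real n - i)" using i by (simp add: field_simps)
    also have "\<dots> \<le> exp ((2 * real i + 1) / (real n - i))" by (rule exp_ge_add_one_self)
    finally show ?thesis using i by (simp add: exp_minus field_simps)
  qed
  finally have e: "exp (- ((2 * real i + 1) / (real n + 1 - real a))) \<le> (real n - i) / (real n + 1 + i)" .
  have "cbin n 0 * exp (- (real (Suc i))\<^sup>2 / (real n + 1 - real a)) =
    (cbin n 0 * exp (- (real i)\<^sup>2 / (real n + 1 - real a))) * exp (- ((2 * real i + 1) / (real n + 1 - real a)))"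
  proof -
    have "- (real i)\<^sup>2 / (real n + 1 - real a) + - ((2 * real i + 1) / (real n + 1 - real a)) = - (real (Suc i))\<^sup>2 / (real n + 1 - real a)"
      by (simp add: power2_eq_square add_divide_distrib[symmetric] diff_divide_distrib[symmetric] algebra_simps)
    thus ?thesis by (simp only: mult.assoc exp_add[symmetric])
  qed
  also have "\<dots> \<le> cbin n (int i) * exp (- ((2 * real i + 1) / (real n + 1 - real a)))"
    by (rule mult_right_mono) (use Suc in auto)
  also have "\<dots> \<le> cbin n (int i) * ((real n - i) / (real n + 1 + i))"
    by (rule mult_left_mono[OF e cbin_nonneg])
  finally show ?case unfolding c .
qed

lemma exp_diff_le: "exp (- u) - exp (- v) \<le> exp (- u) * (v - u)" for u v :: real
proof -
  have "exp (- v) = exp (- u) * exp (u - v)" by (simp add: exp_add[symmetric])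
  moreover have "exp (- u) * (1 + (u - v)) \<le> exp (- u) * exp (u - v)"
    by (intro mult_left_mono exp_ge_add_one_self) auto
  ultimately show ?thesis by (simp add: algebra_simps)
qed

text \<open>The exponents of the upper and the lower bound differ from \<open>s a\<^sup>2\<close> by
  \<open>O(a\<^sup>3 / n\<^sup>2)\<close>. For \<open>2a \<ge> n\<close> that error term exceeds the
  Gaussian itself, so that the lower bound is trivial.\<close>
lemma cbin_center_gauss_nat:
  fixes n a :: nat and s :: real
  assumes n: "n \<ge> 1" and s: "1 / (real n + 1) \<le> s" "s \<le> 1 / real n"
  defines "x \<equiv> s * (real a)\<^sup>2"
  shows "\<bar>cbin n (int a) - cbin n 0 * exp (- x)\<bar> \<le> 8 * (cbin n 0 * (real a ^ 3 / (real n)\<^sup>2)) * exp (- x / 2)"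
proof -
  define P where "P = cbin n 0"
  have P: "P \<ge> 0" by (simp add: P_def cbin_nonneg)
  have N: "real n \<ge> 1" using n by simp
  have s0: "s > 0" using s N by (smt (verit) divide_pos_pos)
  have x: "x \<ge> 0" using s0 by (simp add: x_def)
  define T where "T = real a ^ 3 / (real n)\<^sup>2"
  have T: "T \<ge> 0" by (simp add: T_def)
  have big: "P * exp (- x) \<le> 8 * (P * T) * exp (- x / 2)" if "2 * real a \<ge> real n"
  proof -
    have "real n ^ 2 \<le> real n ^ 3" using N by (simp add: power_increasing)
    also have "\<dots> \<le> (2 * real a) ^ 3" by (rule power_mono) (use that in auto)
    finally have "1 \<le> 8 * T" using N by (simp add: T_def power_mult_distrib field_simps)
    moreover have "exp (- x) \<le> exp (- x / 2)" using x by simp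
    ultimately have "1 * exp (- x) \<le> (8 * T) * exp (- x / 2)" by (intro mult_mono) auto
    hence "P * (1 * exp (- x)) \<le> P * ((8 * T) * exp (- x / 2))" by (rule mult_left_mono) (rule P)
    thus ?thesis by (simp add: mult_ac)
  qed
  have "\<bar>cbin n (int a) - P * exp (- x)\<bar> \<le> 8 * (P * T) * exp (- x / 2)"
  proof (cases "a \<le> n")
    case False
    thus ?thesis using big P by (simp add: cbin_outside)
  next
    case True
    hence an: "real a \<le> real n" by simp
    define u where "u = (real a)\<^sup>2 / (real n + real a)"
    have ux: "u \<ge> x / 2"
    proof -
      have "x \<le> (1 / real n) * (real a)\<^sup>2" unfolding x_def by (rule mult_right_mono) (use s in auto)
      hence "x / 2 \<le> (real a)\<^sup>2 / (2 * real n)" by simp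
      also have "\<dots> \<le> u" unfolding u_def by (rule divide_left_mono) (use an N in auto)
      finally show ?thesis .
    qed
    have "x - u \<le> T"
    proof -
      have "x \<le> (1 / real n) * (real a)\<^sup>2" unfolding x_def by (rule mult_right_mono) (use s in auto)
      hence "x - u \<le> (real a)\<^sup>2 / real n - (real a)\<^sup>2 / (real n + real a)" by (simp add: u_def)
      also have "\<dots> = real a ^ 3 / (real n * (real n + real a))"
        using N by (simp add: divide_simps) (simp add: power2_eq_square power3_eq_cube algebra_simps)
      also have "\<dots> \<le> real a ^ 3 / (real n * real n)" by (intro divide_left_mono mult_left_mono) (use N in auto)
      finally show ?thesis by (simp add: T_def power2_eq_square)
    qed
    hence "exp (- u) - exp (- x) \<le> exp (- u) * T"
      using exp_diff_le[of u x] by (meson exp_ge_zero mult_left_mono order_trans)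
    also have "\<dots> \<le> exp (- x/2) * T" using ux T by (intro mult_right_mono) auto
    finally have "P * (exp (- u) - exp (- x)) \<le> P * (exp (- x/2) * T)" by (rule mult_left_mono) (rule P)
    moreover have "cbin n (int a) \<le> P * exp (- u)"
      using cbin_upper[OF order_refl True n] by (simp add: P_def u_def)
    moreover have "P * (exp (- x/2) * T) \<ge> 0" using P T by simp
    ultimately have up: "cbin n (int a) - P * exp (- x) \<le> 8 * (P * T) * exp (- x / 2)"
      by (simp add: algebra_simps)
    have lo: "P * exp (- x) - cbin n (int a) \<le> 8 * (P * T) * exp (- x / 2)"
    proof (cases "2 * real a \<ge> real n")
      case True
      thus ?thesis using big cbin_nonneg[of n "int a"] by linarith
    next
      case False
      define w where "w = (real a)\<^sup>2 / (real n + 1 - real a)"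
      have "w - x \<le> 8 * T"
      proof -
        have "(1 / (real n + 1)) * (real a)\<^sup>2 \<le> x" unfolding x_def by (rule mult_right_mono) (use s in auto)
        hence "w - x \<le> (real a)\<^sup>2 / (real n + 1 - real a) - (real a)\<^sup>2 / (real n + 1)" by (simp add: w_def)
        also have "\<dots> = real a ^ 3 / ((real n + 1) * (real n + 1 - real a))"
          using N an by (simp add: divide_simps) (simp add: power2_eq_square power3_eq_cube algebra_simps)
        also have "\<dots> \<le> real a ^ 3 / (real n * (real n / 2))"
          by (intro divide_left_mono mult_mono mult_pos_pos) (use N an False in auto)
        also have "\<dots> = 2 * T" by (simp add: T_def power2_eq_square)
        finally show ?thesis using T by simp
      qed
      hence "exp (- x) - exp (- w) \<le> exp (- x) * (8 * T)"
        using exp_diff_le[of x w] by (meson exp_ge_zero mult_left_mono order_trans)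
      also have "\<dots> \<le> exp (- x/2) * (8 * T)" using x T by (intro mult_right_mono) auto
      finally have "P * (exp (- x) - exp (- w)) \<le> P * (exp (- x/2) * (8 * T))" by (rule mult_left_mono) (rule P)
      moreover have "cbin n (int a) \<ge> P * exp (- w)"
        using cbin_lower[OF order_refl True n] by (simp add: P_def w_def)
      ultimately show ?thesis by (simp add: algebra_simps)
    qed
    show ?thesis using up lo by (simp add: abs_le_iff)
  qed
  thus ?thesis by (simp add: P_def T_def)
qed

text \<open>The cubic error \<open>a\<^sup>3/n\<^sup>2\<close> times the central weight, of size
  \<open>1/sqrt n\<close>, is \<open>s\<close> times a polynomial in \<open>x = s a\<^sup>2\<close>;
  the central weight itself differs from \<open>sqrt (s/\<pi>)\<close> by
  \<open>O(1/n)\<close>.\<close>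
lemma cbin_gauss_nat:
  fixes n a :: nat and s :: real
  assumes n: "n \<ge> 1" and s: "1 / (real n + 1) \<le> s" "s \<le> 1 / real n"
  defines "x \<equiv> s * (real a)\<^sup>2"
  shows "\<bar>cbin n (int a) - gauss s (int a)\<bar> \<le> 34 * (s * (1 + x)\<^sup>2 * exp (- x / 2))"
proof -
  have N: "real n \<ge> 1" using n by simp
  have s0: "s > 0" using s N by (smt (verit) divide_pos_pos)
  have x: "x \<ge> 0" using s0 by (simp add: x_def)
  have "1 / real n \<le> 2 * (1 / (real n + 1))" using N by (simp add: field_simps)
  hence ns: "1 / real n \<le> 2 * s" using s by linarith
  define P where "P = cbin n 0"
  have P: "P \<ge> 0" by (simp add: P_def cbin_nonneg)
  define sp where "sp = sqrt pi"
  have sp: "sp \<ge> 1" using pi_ge_two by (simp add: sp_def)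
  define r where "r = sqrt (real n)"
  have r: "r \<ge> 1" "r * r = real n" using N by (auto simp: r_def)
  define r1 where "r1 = sqrt (real n + 1)"
  have r1: "r1 \<ge> r" "r1 \<ge> 1" using N by (auto simp: r_def r1_def)
  have "r1 \<le> sqrt (real n) + sqrt 1" unfolding r1_def by (rule sqrt_add_le_add_sqrt) auto
  hence r1r: "r1 \<le> r + 1" by (simp add: r_def)
  have Pu: "P \<le> 1 / (sp * r)" using cbin_center_bounds(1)[OF n] by (simp add: P_def sp_def r_def real_sqrt_mult)
  have Pl: "P \<ge> 1 / (sp * r1)"
  proof -
    have "1 / (sp * r1) \<le> 1 / sqrt (pi * (n + 1/2))"
      unfolding sp_def r1_def real_sqrt_mult[symmetric]
      by (intro divide_left_mono real_sqrt_le_mono mult_left_mono) auto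
    thus ?thesis using cbin_center_bounds(2)[OF n] by (simp add: P_def)
  qed
  define g where "g = sqrt (s / pi)"
  have gu: "g \<le> 1 / (sp * r)"
  proof -
    have "g \<le> sqrt ((1 / real n) / pi)" unfolding g_def by (intro real_sqrt_le_mono divide_right_mono s) auto
    thus ?thesis by (simp add: real_sqrt_divide real_sqrt_mult sp_def r_def mult.commute)
  qed
  have gl: "g \<ge> 1 / (sp * r1)"
  proof -
    have "sqrt ((1 / (real n + 1)) / pi) \<le> g" unfolding g_def by (intro real_sqrt_le_mono divide_right_mono s) auto
    thus ?thesis by (simp add: real_sqrt_divide real_sqrt_mult sp_def r1_def mult.commute)
  qed
  have "1 / (sp * r) - 1 / (sp * r1) \<le> 1 / real n"
  proof -
    have "1 / (sp * r) - 1 / (sp * r1) = (1/sp) * ((r1 - r) / (r * r1))" using r r1 sp by (simp add: field_simps)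
    also have "\<dots> \<le> 1 * (1 / (r * r))"
      by (intro mult_mono frac_le) (use r r1 r1r sp N in \<open>auto intro!: mult_left_mono divide_nonneg_nonneg\<close>)
    finally show ?thesis using r by simp
  qed
  hence Pg: "\<bar>P - g\<bar> \<le> 2 * s" using Pu Pl gu gl ns by linarith
  have "P * (real a ^ 3 / (real n)\<^sup>2) \<le> 4 * (s * (1 + x)\<^sup>2)"
  proof -
    have "1 / (sp * r) \<le> 1 / (1 * r)" by (intro divide_left_mono mult_right_mono) (use sp r in auto)
    hence "P \<le> 1 / r" using Pu by simp
    hence "P * (real a ^ 3 / (real n)\<^sup>2) \<le> (1/r) * (real a ^ 3 / (real n)\<^sup>2)" by (rule mult_right_mono) auto
    also have "\<dots> = ((real a)\<^sup>2 / (real n)\<^sup>2) * (real a / r)" by (simp add: power2_eq_square power3_eq_cube)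
    also have "real a / r \<le> ((real a)\<^sup>2 / real n + 1) / 2"
    proof -
      have "2 * t \<le> t\<^sup>2 + 1" for t :: real using zero_le_power2[of "t - 1"] by (simp add: power2_eq_square algebra_simps)
      moreover have "(real a / r)\<^sup>2 = (real a)\<^sup>2 / real n" using r by (simp add: power_divide power2_eq_square)
      ultimately have "2 * (real a / r) \<le> (real a)\<^sup>2 / real n + 1" by metis
      thus ?thesis by (simp add: mult.commute)
    qed
    hence "((real a)\<^sup>2 / (real n)\<^sup>2) * (real a / r) \<le> ((real a)\<^sup>2 / (real n)\<^sup>2) * (((real a)\<^sup>2 / real n + 1) / 2)"
      by (rule mult_left_mono) auto
    also have "\<dots> = (1 / real n) * ((real a)\<^sup>2 * (1 / real n)) * (((real a)\<^sup>2 * (1 / real n) + 1) / 2)"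
      by (simp add: power2_eq_square)
    also have "\<dots> \<le> (2 * s) * ((real a)\<^sup>2 * (2 * s)) * (((real a)\<^sup>2 * (2 * s) + 1) / 2)"
      by (intro mult_mono divide_right_mono add_mono mult_left_mono ns) (use s0 in auto)
    also have "\<dots> = s * (2 * x * (2 * x + 1))" by (simp add: x_def power2_eq_square algebra_simps)
    also have "\<dots> \<le> s * (4 * (1 + x)\<^sup>2)"
      using s0 x by (intro mult_left_mono) (auto simp: power2_eq_square algebra_simps)
    finally show ?thesis by simp
  qed
  hence "8 * (P * (real a ^ 3 / (real n)\<^sup>2)) * exp (- x / 2) \<le> 8 * (4 * (s * (1 + x)\<^sup>2)) * exp (- x / 2)"
    by (intro mult_right_mono mult_left_mono) auto
  hence 1: "\<bar>cbin n (int a) - P * exp (- x)\<bar> \<le> 32 * (s * (1 + x)\<^sup>2 * exp (- x / 2))"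
    using cbin_center_gauss_nat[OF n s, of a] by (simp add: P_def x_def)
  have 2: "\<bar>P * exp (- x) - g * exp (- x)\<bar> \<le> 2 * (s * (1 + x)\<^sup>2 * exp (- x / 2))"
  proof -
    have "\<bar>P * exp (- x) - g * exp (- x)\<bar> = \<bar>P - g\<bar> * exp (- x)" by (simp add: left_diff_distrib[symmetric] abs_mult)
    also have "\<dots> \<le> (2 * s * (1 + x)\<^sup>2) * exp (- x / 2)"
    proof (rule mult_mono)
      have "1 \<le> (1 + x)\<^sup>2" using x by simp
      hence "2 * s * 1 \<le> 2 * s * (1 + x)\<^sup>2" by (rule mult_left_mono) (use s0 in auto)
      thus "\<bar>P - g\<bar> \<le> 2 * s * (1 + x)\<^sup>2" using Pg by simp
    qed (use x s0 in auto)
    finally show ?thesis by simp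
  qed
  have "gauss s (int a) = g * exp (- x)" by (simp add: gauss_def g_def x_def)
  thus ?thesis using 1 2 by linarith
qed

text \<open>For \<open>a \<le> n\<close> the time step is an explicit multiple \<open>R\<close> of
  the weight, and \<open>R\<close> is \<open>x - 1/2\<close> up to \<open>s\<close> times a
  polynomial. For \<open>a > n\<close> one has \<open>s x \<ge> 1\<close>, so the error term
  dominates both sides; the value at \<open>a = n + 1\<close> is the only nonzero weight
  left.\<close>
lemma cbin_dgauss_nat:
  fixes n a :: nat and s :: real
  assumes n: "n \<ge> 1" and s: "1 / (real n + 1) \<le> s" "s \<le> 1 / real n"
  defines "x \<equiv> s * (real a)\<^sup>2"
  shows "\<bar>real n * (real n + 1) * s * (cbin (Suc n) (int a) - cbin n (int a)) - dgauss s (int a)\<bar>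
     \<le> 50 * (s * (1 + x)^3 * exp (- x / 2))"
proof -
  have N: "real n \<ge> 1" using n by simp
  have s0: "s > 0" using s N by (smt (verit) divide_pos_pos)
  have s1: "real n * s \<le> 1" "(real n + 1) * s \<ge> 1" using s N by (simp_all add: field_simps)
  have sle1: "s \<le> 1" using s(2) N by (smt (verit) divide_le_eq_1)
  have x: "x \<ge> 0" using s0 by (simp add: x_def)
  have pw: "(1 + x)^2 \<le> (1 + x)^3" using x by (intro power_increasing) auto
  define c where "c = cbin n (int a)"
  have lamx: "dgauss s (int a) = (x - 1/2) * gauss s (int a)" by (simp add: dgauss_def x_def)
  show ?thesis
  proof (cases "a \<le> n")
    case True
    hence an: "real a \<le> real n" by simp
    define D where "D = (real n + 1)\<^sup>2 - (real a)\<^sup>2"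
    have D: "D \<ge> real n + 1"
    proof -
      have "(real a)\<^sup>2 \<le> (real n)\<^sup>2" using an by (intro power_mono) auto
      thus ?thesis by (simp add: D_def power2_eq_square algebra_simps)
    qed
    define R where "R = real n * (real n + 1) * s * (((real a)\<^sup>2 - (real n + 1) / 2) / D)"
    have "D * (cbin (Suc n) (int a) - c) = ((real a)\<^sup>2 - (real n + 1) / 2) * c"
      using cbin_time[of n "int a"] by (simp add: D_def c_def)
    hence diff: "cbin (Suc n) (int a) - c = (((real a)\<^sup>2 - (real n + 1) / 2) / D) * c"
      using D N by (simp add: field_simps)
    \<comment> \<open>the relative error of replacing \<open>D\<close> by \<open>n(n+1)\<close>\<close>
    define th where "th = real n * (real n + 1) / D - 1"
    have th: "th = ((real a)\<^sup>2 - (real n + 1)) / D"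
      unfolding th_def using D N by (simp add: D_def field_simps power2_eq_square)
    have R: "R - (x - 1/2) = th * (x - s * (real n + 1) / 2) + (1/2 - s * (real n + 1) / 2)"
    proof -
      have "R = (th + 1) * (s * ((real a)\<^sup>2 - (real n + 1) / 2))" by (simp add: R_def th_def)
      thus ?thesis unfolding x_def by (simp add: field_simps)
    qed
    have thle: "\<bar>th\<bar> \<le> 4 * s * (1 + x)\<^sup>2"
    proof -
      have a1: "\<bar>th\<bar> \<le> ((real a)\<^sup>2 + (real n + 1)) / D"
        unfolding th using D N by (simp add: divide_right_mono abs_le_iff)
      have a2: "(real a)\<^sup>2 \<le> (real n + 1) * x"
        using mult_right_mono[OF s1(2), of "(real a)\<^sup>2"] by (simp add: x_def mult_ac)
      show ?thesis
      proof (cases "2 * real a \<le> real n + 1")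
        case True
        have "(2 * real a)\<^sup>2 \<le> (real n + 1)\<^sup>2" by (rule power_mono[OF True]) auto
        hence D34: "D \<ge> (3/4) * (real n + 1)\<^sup>2" by (simp add: D_def power_mult_distrib)
        have "((real a)\<^sup>2 + (real n + 1)) / D \<le> ((real n + 1) * (1 + x)) / ((3/4) * (real n + 1)\<^sup>2)"
          by (intro frac_le D34) (use a2 x N in \<open>auto simp: algebra_simps\<close>)
        also have "\<dots> = (4/3) * ((1 / (real n + 1)) * (1 + x))"
        proof -
          have "(M * (1 + x)) / ((3/4) * M\<^sup>2) = (4/3) * ((1 / M) * (1 + x))" if "M > 0" for M :: real
            using that by (simp add: power2_eq_square field_simps)
          thus ?thesis using N by (simp del: of_nat_Suc)
        qed
        also have "\<dots> \<le> (4/3) * (s * (1 + x))" by (intro mult_left_mono mult_right_mono s) (use x in auto)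
        also have "\<dots> \<le> 4 * (s * (1 + x)\<^sup>2)"
        proof -
          have "(1 + x) \<le> (1 + x)\<^sup>2" using x by (simp add: power2_eq_square)
          hence "s * (1 + x) \<le> s * (1 + x)\<^sup>2" using s0 by (intro mult_left_mono) auto
          moreover have "0 \<le> s * (1 + x)" using s0 x by simp
          ultimately show ?thesis by linarith
        qed
        finally show ?thesis using a1 by simp
      next
        case False
        have "((real a)\<^sup>2 + (real n + 1)) / D \<le> ((real n + 1) * (1 + x)) / (real n + 1)"
          by (intro frac_le D) (use a2 x N in \<open>auto simp: algebra_simps\<close>)
        also have "\<dots> = 1 + x" using N by simp
        also have "\<dots> \<le> (4 * (s * x)) * (1 + x)"
        proof -
          have "s * (real n + 1) \<le> s * (2 * real a)" by (rule mult_left_mono) (use s0 False in auto)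
          hence "1 \<le> (s * (2 * real a))" using s1(2) by (simp add: mult.commute)
          hence "1 * 1 \<le> (s * (2 * real a)) * (s * (2 * real a))" by (intro mult_mono) auto
          also have "\<dots> = 4 * (s * x)" by (simp add: x_def power2_eq_square)
          finally have "1 \<le> 4 * (s * x)" by simp
          from mult_right_mono[OF this, of "1 + x"] show ?thesis using x by simp
        qed
        also have "\<dots> = 4 * s * (x * (1 + x))" by simp
        also have "\<dots> \<le> 4 * s * (1 + x)\<^sup>2" using s0 x by (intro mult_left_mono) (auto simp: power2_eq_square algebra_simps)
        finally show ?thesis using a1 by simp
      qed
    qed
    have sn: "s * (real n + 1) \<le> 1 + s" using s1 by (simp add: algebra_simps)
    have Rle: "\<bar>R - (x - 1/2)\<bar> \<le> 5 * s * (1 + x)^3"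
    proof -
      have "\<bar>x - s * (real n + 1) / 2\<bar> \<le> 1 + x" using sn s1 x sle1 by (simp add: abs_le_iff mult.commute)
      hence "\<bar>th * (x - s * (real n + 1) / 2)\<bar> \<le> (4 * s * (1 + x)\<^sup>2) * (1 + x)"
        unfolding abs_mult by (intro mult_mono thle) (use s0 in auto)
      also have "\<dots> = 4 * s * (1 + x)^3" by (simp add: power2_eq_square power3_eq_cube)
      finally have 1: "\<bar>th * (x - s * (real n + 1) / 2)\<bar> \<le> 4 * s * (1 + x)^3" .
      have "\<bar>1/2 - s * (real n + 1) / 2\<bar> \<le> s" using sn s1(2) s0 by (simp add: abs_le_iff mult.commute)
      moreover have "s * 1 \<le> s * (1 + x)^3" using s0 x by (intro mult_left_mono) auto
      ultimately show ?thesis unfolding R using 1 by linarith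
    qed
    have cle: "c \<le> exp (- x / 2)"
    proof -
      have "c \<le> cbin n 0 * exp (- (real a)\<^sup>2 / (n + a))" unfolding c_def by (rule cbin_upper[OF order_refl True n])
      also have "\<dots> \<le> 1 * exp (- x / 2)"
      proof (rule mult_mono)
        have "1 * 1 \<le> pi * real n" by (intro mult_mono) (use N pi_ge_two in auto)
        hence "1 / sqrt (pi * real n) \<le> 1" by simp
        thus "cbin n 0 \<le> 1" using cbin_center_bounds(1)[OF n] by linarith
        have "x \<le> (1 / real n) * (real a)\<^sup>2" unfolding x_def by (rule mult_right_mono) (use s in auto)
        hence "x / 2 \<le> (real a)\<^sup>2 / (2 * real n)" by simp
        also have "\<dots> \<le> (real a)\<^sup>2 / (n + a)" by (rule divide_left_mono) (use an N in auto)
        finally show "exp (- (real a)\<^sup>2 / (n + a)) \<le> exp (- x / 2)" by simp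
      qed auto
      finally show ?thesis by simp
    qed
    have "real n * (real n + 1) * s * (cbin (Suc n) (int a) - cbin n (int a)) - dgauss s (int a)
       = (R - (x - 1/2)) * c + (x - 1/2) * (c - gauss s (int a))"
      using diff by (simp add: R_def c_def[symmetric] lamx algebra_simps)
    also have "\<bar>\<dots>\<bar> \<le> (5 * s * (1 + x)^3) * exp (- x / 2) + (1 + x) * (34 * (s * (1 + x)\<^sup>2 * exp (- x / 2)))"
    proof (rule order_trans[OF abs_triangle_ineq add_mono])
      show "\<bar>(R - (x - 1/2)) * c\<bar> \<le> (5 * s * (1 + x)^3) * exp (- x / 2)"
        unfolding abs_mult by (intro mult_mono Rle) (use cle cbin_nonneg s0 x in \<open>auto simp: c_def\<close>)
      show "\<bar>(x - 1/2) * (c - gauss s (int a))\<bar> \<le> (1 + x) * (34 * (s * (1 + x)\<^sup>2 * exp (- x / 2)))"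
        unfolding abs_mult
      proof (rule mult_mono)
        show "\<bar>c - gauss s (int a)\<bar> \<le> 34 * (s * (1 + x)\<^sup>2 * exp (- x / 2))"
          unfolding c_def x_def by (rule cbin_gauss_nat[OF n s])
      qed (use x in auto)
    qed
    also have "\<dots> = 39 * (s * (1 + x)^3 * exp (- x / 2))" by (simp add: power2_eq_square power3_eq_cube algebra_simps)
    also have "\<dots> \<le> 50 * (s * (1 + x)^3 * exp (- x / 2))" using s0 x by (intro mult_right_mono) auto
    finally show ?thesis .
  next
    case False
    hence an: "real a \<ge> real n + 1" by linarith
    have c0: "c = 0" unfolding c_def by (rule cbin_outside) (use False in auto)
    have "s * (real n + 1) \<le> s * real a" by (rule mult_left_mono[OF an]) (use s0 in auto)
    hence "1 \<le> s * real a" using s1(2) by (simp add: mult.commute)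
    hence "1 * 1 \<le> (s * real a) * (s * real a)" by (intro mult_mono) auto
    also have "\<dots> = s * x" by (simp add: x_def power2_eq_square)
    finally have sx: "1 \<le> s * x" by simp
    have lb: "\<bar>dgauss s (int a)\<bar> \<le> s * (1 + x)^2 * exp (- x / 2)"
    proof -
      have "sqrt (s/pi) \<le> 1" using sle1 s0 pi_ge_two by simp
      hence g: "gauss s (int a) \<le> 1 * exp (- x)" unfolding gauss_def x_def by (intro mult_mono) auto
      have "\<bar>dgauss s (int a)\<bar> \<le> (1 + x) * exp (- x)"
        unfolding lamx abs_mult by (rule mult_mono) (use g gauss_nonneg[of s "int a"] s0 x in auto)
      also have "\<dots> \<le> (s * x * (1 + x)) * exp (- x / 2)"
        by (rule mult_mono) (use mult_right_mono[OF sx, of "1 + x"] x s0 in auto)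
      also have "\<dots> \<le> s * (1 + x)^2 * exp (- x / 2)"
        using s0 x by (intro mult_right_mono) (auto simp: power2_eq_square algebra_simps)
      finally show ?thesis .
    qed
    have cb: "\<bar>real n * (real n + 1) * s * cbin (Suc n) (int a)\<bar> \<le> 9 * (s * (1 + x)^2 * exp (- x / 2))"
    proof (cases "a = Suc n")
      case False
      hence "cbin (Suc n) (int a) = 0" by (intro cbin_outside) (use \<open>\<not> a \<le> n\<close> in auto)
      thus ?thesis using s0 by simp
    next
      case True
      have "cbin (Suc n) (int a) \<le> cbin (Suc n) 0 * exp (- (real a)\<^sup>2 / real (Suc n + a))"
        using cbin_upper[of a a "Suc n"] True by simp
      also have "\<dots> \<le> 1 * exp (- (real a)\<^sup>2 / real (Suc n + a))"
      proof (rule mult_right_mono)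
        have "1 * 1 \<le> pi * real (Suc n)" by (intro mult_mono) (use N pi_ge_two in auto)
        hence "1 / sqrt (pi * real (Suc n)) \<le> 1" by simp
        thus "cbin (Suc n) 0 \<le> 1" using cbin_center_bounds(1)[of "Suc n"] by linarith
      qed auto
      also have "(real a)\<^sup>2 / real (Suc n + a) = (real n + 1) / 2" using True by (simp add: power2_eq_square field_simps)
      hence "exp (- (real a)\<^sup>2 / real (Suc n + a)) = exp (- ((real n + 1) / 2))" by (simp del: of_nat_add of_nat_Suc)
      also have "x \<le> real n + 4"
      proof -
        have "x \<le> (1 / real n) * (real a)\<^sup>2" unfolding x_def by (rule mult_right_mono) (use s in auto)
        also have "\<dots> \<le> real n + 4" using True N by (simp add: power2_eq_square field_simps)
        finally show ?thesis .
      qed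
      hence "exp (- ((real n + 1) / 2)) \<le> exp (2 + - x / 2)" by (simp add: field_simps)
      also have "\<dots> = exp 1 * exp 1 * exp (- x / 2)" by (simp add: exp_add[symmetric])
      also have "\<dots> \<le> 3 * 3 * exp (- x / 2)" by (intro mult_mono exp_le) auto
      finally have c9: "cbin (Suc n) (int a) \<le> 9 * exp (- x / 2)" by simp
      have "real n * (real n + 1) * s = (real n * s) * (real n + 1)" by simp
      also have "\<dots> \<le> 1 * (real n + 1)" by (rule mult_right_mono[OF s1(1)]) simp
      also have "real n + 1 \<le> x"
      proof -
        have "1 * (real n + 1) \<le> ((real n + 1) * s) * (real n + 1)" by (rule mult_right_mono[OF s1(2)]) simp
        thus ?thesis using True by (simp add: x_def power2_eq_square algebra_simps)
      qed
      also have "x \<le> (s * x) * x" using mult_right_mono[OF sx x] by simp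
      also have "\<dots> \<le> s * (1 + x)^2" using s0 x by (simp add: power2_eq_square algebra_simps)
      finally have nn: "real n * (real n + 1) * s \<le> s * (1 + x)^2" by simp
      have "(real n * (real n + 1) * s) * cbin (Suc n) (int a) \<le> (s * (1 + x)^2) * (9 * exp (- x / 2))"
        by (rule mult_mono[OF nn c9]) (use s0 cbin_nonneg in auto)
      thus ?thesis using s0 cbin_nonneg[of "Suc n" "int a"] by (simp add: abs_mult)
    qed
    have "\<bar>real n * (real n + 1) * s * (cbin (Suc n) (int a) - cbin n (int a)) - dgauss s (int a)\<bar>
      \<le> 10 * (s * (1 + x)^2 * exp (- x / 2))"
      using lb cb c0 unfolding c_def by (simp add: abs_le_iff)
    also have "\<dots> \<le> 50 * (s * (1 + x)^3 * exp (- x / 2))"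
      using s0 x by (intro mult_mono mult_left_mono pw) auto
    finally show ?thesis .
  qed
qed

text \<open>Turns the polynomial errors of the local limit theorem into the majorant; the additional
  \<open>sqrt s\<close> is the gain.\<close>
lemma poly_gauss_le_maj:
  assumes "0 < s" "k \<le> 3"
  shows "s * (1 + s * (real_of_int a)\<^sup>2)^k * exp (- (s * (real_of_int a)\<^sup>2) / 2) \<le> 3456 * (sqrt s * maj s a)"
proof -
  define x where "x = s * (real_of_int a)\<^sup>2"
  have x: "x \<ge> 0" using assms by (simp add: x_def)
  have "(1 + x)^k \<le> (1 + x)^3" using x assms by (intro power_increasing) auto
  also have "\<dots> \<le> 1728 * exp ((1/4) * (1 + x))" using power_le_exp[of "1 + x" 3 "1/4"] x by simp
  also have "exp ((1/4) * (1 + x)) = exp (1/4) * exp (x/4)" by (simp add: exp_add[symmetric] field_simps)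
  also have "exp (1/4 :: real) \<le> 2"
    using exp_bound[of "1/4::real"] by (simp add: power2_eq_square)
  finally have "(1 + x)^k \<le> 3456 * exp (x/4)" by simp
  hence "(1 + x)^k * exp (- x/2) \<le> 3456 * exp (x/4) * exp (- x/2)" by (rule mult_right_mono) auto
  also have "\<dots> = 3456 * exp (- x/4)" by (simp add: mult.assoc exp_add[symmetric])
  finally have "s * ((1 + x)^k * exp (- x/2)) \<le> s * (3456 * exp (- x/4))" by (rule mult_left_mono) (use assms in auto)
  moreover have "3456 * (sqrt s * maj s a) = (sqrt s * sqrt s) * (3456 * exp (- x/4))"
    unfolding maj_def x_def by (simp only: ac_simps) simp
  moreover have "sqrt s * sqrt s = s" using assms by simp
  ultimately show ?thesis by (simp add: x_def mult.assoc)
qed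

lemma cbin_gauss:
  assumes n: "n \<ge> 1" and s: "1 / (real n + 1) \<le> s" "s \<le> 1 / real n"
  shows "\<bar>cbin n a - gauss s a\<bar> \<le> 200000 * (sqrt s * maj s a)"
proof -
  have s0: "s > 0" using s n by (smt (verit) divide_pos_pos of_nat_0_le_iff)
  define b where "b = nat \<bar>a\<bar>"
  have b: "\<bar>a\<bar> = int b" "(real b)\<^sup>2 = (real_of_int a)\<^sup>2" by (simp_all add: b_def)
  have "cbin n a = cbin n (int b)" using cbin_even[of n a] b(1) by (metis abs_if)
  moreover have "gauss s a = gauss s (int b)" using b by (simp add: gauss_def)
  ultimately have "\<bar>cbin n a - gauss s a\<bar> \<le> 34 * (s * (1 + s * (real b)\<^sup>2)\<^sup>2 * exp (- (s * (real b)\<^sup>2) / 2))"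
    using cbin_gauss_nat[OF n s, of b] by simp
  also have "\<dots> \<le> 34 * (3456 * (sqrt s * maj s a))"
    unfolding b(2) by (intro mult_left_mono poly_gauss_le_maj s0) auto
  also have "\<dots> \<le> 200000 * (sqrt s * maj s a)" using s0 maj_nonneg[of s a] by simp
  finally show ?thesis .
qed

lemma cbin_dgauss:
  assumes n: "n \<ge> 1" and s: "1 / (real n + 1) \<le> s" "s \<le> 1 / real n"
  shows "\<bar>real n * (real n + 1) * s * (cbin (Suc n) a - cbin n a) - dgauss s a\<bar> \<le> 200000 * (sqrt s * maj s a)"
proof -
  have s0: "s > 0" using s n by (smt (verit) divide_pos_pos of_nat_0_le_iff)
  define b where "b = nat \<bar>a\<bar>"
  have b: "\<bar>a\<bar> = int b" "(real b)\<^sup>2 = (real_of_int a)\<^sup>2" by (simp_all add: b_def)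
  have "cbin n a = cbin n (int b)" for n using cbin_even[of n a] b(1) by (metis abs_if)
  moreover have "dgauss s a = dgauss s (int b)" using b by (simp add: gauss_def dgauss_def)
  ultimately have "\<bar>real n * (real n + 1) * s * (cbin (Suc n) a - cbin n a) - dgauss s a\<bar>
     \<le> 50 * (s * (1 + s * (real b)\<^sup>2)^3 * exp (- (s * (real b)\<^sup>2) / 2))"
    using cbin_dgauss_nat[OF n s, of b] by simp
  also have "\<dots> \<le> 50 * (3456 * (sqrt s * maj s a))"
    unfolding b(2) by (intro mult_left_mono poly_gauss_le_maj s0) auto
  also have "\<dots> \<le> 200000 * (sqrt s * maj s a)" using s0 maj_nonneg[of s a] by simp
  finally show ?thesis .
qed

section \<open>Product kernels on the lattice\<close>

definition Zbox :: "nat \<Rightarrow> (nat \<Rightarrow> int set) \<Rightarrow> (nat \<Rightarrow> int) set" where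
  "Zbox d A = {m \<in> Zd d. \<forall>i\<in>{1..d}. m i \<in> A i}"

lemma Zbox_bij: "bij_betw (\<lambda>g i. if i \<in> {1..d} then g i else 0) (PiE {1..d} A) (Zbox d A)"
  by (rule bij_betw_byWitness[of _ "\<lambda>m. restrict m {1..d}"])
     (auto simp: Zbox_def Zd_def PiE_def extensional_def fun_eq_iff)

lemma finite_Zbox: "(\<And>i. i \<in> {1..d} \<Longrightarrow> finite (A i)) \<Longrightarrow> finite (Zbox d A)"
  using bij_betw_finite[OF Zbox_bij[of d A]] finite_PiE[of "{1..d}" A] by auto

lemma sum_prod_Zbox:
  fixes \<phi> :: "nat \<Rightarrow> int \<Rightarrow> real"
  assumes "\<And>i. i \<in> {1..d} \<Longrightarrow> finite (A i)"
  shows "(\<Sum>m\<in>Zbox d A. \<Prod>i\<in>{1..d}. \<phi> i (m i)) = (\<Prod>i\<in>{1..d}. \<Sum>a\<in>A i. \<phi> i a)"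
proof -
  have "(\<Sum>m\<in>Zbox d A. \<Prod>i\<in>{1..d}. \<phi> i (m i)) = (\<Sum>g\<in>PiE {1..d} A. \<Prod>i\<in>{1..d}. \<phi> i (g i))"
    by (subst sum.reindex_bij_betw[OF Zbox_bij, symmetric]) (auto intro!: sum.cong prod.cong)
  also have "\<dots> = (\<Prod>i\<in>{1..d}. \<Sum>a\<in>A i. \<phi> i a)"
    by (rule prod_sum_PiE[symmetric]) (use assms in auto)
  finally show ?thesis .
qed

lemma card_Zbox:
  assumes "\<And>i. i \<in> {1..d} \<Longrightarrow> finite (A i)"
  shows "card (Zbox d A) = (\<Prod>i\<in>{1..d}. card (A i))"
  using bij_betw_same_card[OF Zbox_bij[of d A]] card_PiE[of "{1..d}" A] by simp

lemma finite_subset_Zbox: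
  assumes "finite F" "F \<subseteq> Zd d"
  obtains M where "F \<subseteq> Zbox d (\<lambda>_. {- int M .. int M})"
proof -
  define M where "M = (\<Sum>m\<in>F. \<Sum>i\<in>{1..d}. nat \<bar>m i\<bar>)"
  have "F \<subseteq> Zbox d (\<lambda>_. {- int M .. int M})"
  proof
    fix m assume m: "m \<in> F"
    have "nat \<bar>m i\<bar> \<le> M" if "i \<in> {1..d}" for i
    proof -
      have "nat \<bar>m i\<bar> \<le> (\<Sum>i\<in>{1..d}. nat \<bar>m i\<bar>)" by (rule member_le_sum) (use that in auto)
      also have "\<dots> \<le> M" unfolding M_def
        by (rule member_le_sum[of m F "\<lambda>m. \<Sum>i\<in>{1..d}. nat \<bar>m i\<bar>"]) (use m assms in auto)
      finally show ?thesis .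
    qed
    hence "m i \<in> {- int M .. int M}" if "i \<in> {1..d}" for i using that by (force simp: abs_le_iff nat_le_iff)
    thus "m \<in> Zbox d (\<lambda>_. {- int M .. int M})" using m assms by (auto simp: Zbox_def)
  qed
  thus thesis by (rule that)
qed

text \<open>Finite sets of lattice points are enclosed in boxes, on which the sum
  factorizes.\<close>
lemma sum_prod_Zd_le:
  fixes \<phi> :: "int \<Rightarrow> real"
  assumes F: "finite F" "F \<subseteq> Zd d" and pos: "\<And>a. \<phi> a \<ge> 0"
    and B: "\<And>A. finite A \<Longrightarrow> (\<Sum>a\<in>A. \<phi> a) \<le> B"
  shows "(\<Sum>m\<in>F. \<Prod>i\<in>{1..d}. \<phi> (m i)) \<le> B ^ d"
proof -
  obtain M where M: "F \<subseteq> Zbox d (\<lambda>_. {- int M .. int M})" using finite_subset_Zbox[OF F] .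
  have "(\<Sum>m\<in>F. \<Prod>i\<in>{1..d}. \<phi> (m i)) \<le> (\<Sum>m\<in>Zbox d (\<lambda>_. {- int M .. int M}). \<Prod>i\<in>{1..d}. \<phi> (m i))"
    by (rule sum_mono2[OF finite_Zbox M]) (auto intro!: prod_nonneg pos)
  also have "\<dots> = (\<Prod>i\<in>{1..d}. \<Sum>a\<in>{- int M .. int M}. \<phi> a)" by (rule sum_prod_Zbox) auto
  also have "\<dots> \<le> (\<Prod>i\<in>{1..d}. B)" by (rule prod_mono) (auto intro!: sum_nonneg pos B)
  finally show ?thesis by simp
qed

definition Gmaj :: "nat \<Rightarrow> real \<Rightarrow> (nat \<Rightarrow> int) \<Rightarrow> real" where
  "Gmaj d s m = (\<Prod>i\<in>{1..d}. maj s (m i))"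

definition sqnorm :: "nat \<Rightarrow> (nat \<Rightarrow> int) \<Rightarrow> real" where
  "sqnorm d m = (\<Sum>i\<in>{1..d}. (real_of_int (m i))\<^sup>2)"

lemma Gmaj_nonneg: "s \<ge> 0 \<Longrightarrow> Gmaj d s m \<ge> 0"
  unfolding Gmaj_def by (intro prod_nonneg) (auto intro: maj_nonneg)

lemma sum_Gmaj_le:
  assumes "0 < s" "s \<le> 1" "finite F" "F \<subseteq> Zd d"
  shows "(\<Sum>m\<in>F. Gmaj d s m) \<le> 12 ^ d"
  unfolding Gmaj_def by (rule sum_prod_Zd_le) (use assms sum_maj_le maj_nonneg in auto)

text \<open>The integrand of the Gaussian representation of the kernel.\<close>
definition dens :: "nat \<Rightarrow> nat \<Rightarrow> nat \<Rightarrow> real \<Rightarrow> (nat \<Rightarrow> int) \<Rightarrow> real" where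
  "dens d j k s m = ((real_of_int (m j))\<^sup>2 - (real_of_int (m k))\<^sup>2) * (\<Prod>i\<in>{1..d}. gauss s (m i))"

text \<open>The product Gaussian in which coordinate \<open>j\<close> carries \<open>-s
  \<partial>\<^sub>s\<close>; it is the heat-flow version of a step of the walk in that coordinate,
  multiplied by the time.\<close>
definition lprod :: "nat \<Rightarrow> nat \<Rightarrow> real \<Rightarrow> (nat \<Rightarrow> int) \<Rightarrow> real" where
  "lprod d j s m = (\<Prod>i\<in>{1..d}. if i = j then dgauss s (m i) else gauss s (m i))"

lemma lprod_eq:
  assumes "j \<in> {1..d}"
  shows "lprod d j s m = (s * (real_of_int (m j))\<^sup>2 - 1/2) * (\<Prod>i\<in>{1..d}. gauss s (m i))"
proof -
  have "lprod d j s m = dgauss s (m j) * (\<Prod>i\<in>{1..d} - {j}. gauss s (m i))"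
    unfolding lprod_def using assms by (subst prod.remove[of _ j]) (auto intro!: prod.cong)
  also have "\<dots> = (s * (real_of_int (m j))\<^sup>2 - 1/2) * (gauss s (m j) * (\<Prod>i\<in>{1..d} - {j}. gauss s (m i)))"
    by (simp add: dgauss_def)
  also have "gauss s (m j) * (\<Prod>i\<in>{1..d} - {j}. gauss s (m i)) = (\<Prod>i\<in>{1..d}. gauss s (m i))"
    using assms by (subst (2) prod.remove[of _ j]) auto
  finally show ?thesis .
qed

lemma dens_eq:
  assumes "j \<in> {1..d}" "k \<in> {1..d}"
  shows "s * dens d j k s m = lprod d j s m - lprod d k s m"
  using assms by (simp add: lprod_eq dens_def algebra_simps)

lemma lprod_le:
  assumes s: "0 < s" and j: "j \<in> {1..d}"
  shows "\<bar>lprod d j s m\<bar> \<le> 3 * (exp (- s * sqnorm d m / 4) * Gmaj d s m)"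
proof -
  define e where "e a = exp (- s * (real_of_int a)\<^sup>2 / 4) * maj s a" for a
  have e0: "e a \<ge> 0" for a using s by (simp add: e_def maj_nonneg)
  have "\<bar>lprod d j s m\<bar> = (\<Prod>i\<in>{1..d}. \<bar>if i = j then dgauss s (m i) else gauss s (m i)\<bar>)"
    unfolding lprod_def by (rule abs_prod)
  also have "\<dots> \<le> (\<Prod>i\<in>{1..d}. (if i = j then 3 else 1) * e (m i))"
    by (rule prod_mono) (use s dgauss_le gauss_le gauss_nonneg in \<open>auto simp: e_def\<close>)
  also have "\<dots> = 3 * (\<Prod>i\<in>{1..d}. e (m i))"
    using j by (simp add: prod.distrib)
  also have "(\<Prod>i\<in>{1..d}. e (m i)) = exp (- s * sqnorm d m / 4) * Gmaj d s m"
    unfolding e_def prod.distrib Gmaj_def sqnorm_def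
    by (simp add: exp_sum[symmetric] sum_distrib_left sum_divide_distrib sum_negf)
  finally show ?thesis .
qed

text \<open>The exponential factor in front of the majorant provides the decay away from the origin
  that the weak-type estimate needs.\<close>
lemma dens_le:
  assumes s: "0 < s" and jk: "j \<in> {1..d}" "k \<in> {1..d}"
  shows "\<bar>dens d j k s m\<bar> \<le> 6 / s * (exp (- s * sqnorm d m / 4) * Gmaj d s m)"
proof -
  have "s * \<bar>dens d j k s m\<bar> = \<bar>s * dens d j k s m\<bar>" using s by (simp add: abs_mult)
  also have "\<dots> \<le> 6 * (exp (- s * sqnorm d m / 4) * Gmaj d s m)"
    unfolding dens_eq[OF jk] using lprod_le[OF s jk(1), of m] lprod_le[OF s jk(2), of m] by linarith
  finally show ?thesis using s by (simp add: field_simps)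
qed

lemma lprod_shift:
  assumes s: "0 < s" "s \<le> 1" and j: "j \<in> {1..d}" and i: "i \<in> {1..d}"
  shows "\<bar>lprod d j s (m + unitv i) - lprod d j s m\<bar> \<le> 120 * (sqrt s * Gmaj d s m)"
proof -
  define \<phi> where "\<phi> l = (if l = j then dgauss s else gauss s)" for l
  define R where "R = (\<Prod>l\<in>{1..d} - {i}. \<phi> l (m l))"
  have L: "lprod d j s m' = \<phi> i (m' i) * R" if "\<And>l. l \<noteq> i \<Longrightarrow> m' l = m l" for m'
  proof -
    have "lprod d j s m' = (\<Prod>l\<in>{1..d}. \<phi> l (m' l))" unfolding lprod_def \<phi>_def by (intro prod.cong) auto
    also have "\<dots> = \<phi> i (m' i) * R" unfolding R_def using i that by (subst prod.remove[of _ i]) (auto intro!: prod.cong)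
    finally show ?thesis .
  qed
  have p3: "\<bar>\<phi> l a\<bar> \<le> (if l = j then 3 else 1) * maj s a" for l a
  proof -
    have "exp (- s * (real_of_int a)\<^sup>2 / 4) * maj s a \<le> 1 * maj s a"
      using s by (intro mult_right_mono maj_nonneg) auto
    thus ?thesis unfolding \<phi>_def using dgauss_le[of s a] gauss_le[of s a] gauss_nonneg[of s a] s by auto
  qed
  have "\<bar>R\<bar> \<le> (\<Prod>l\<in>{1..d} - {i}. (if l = j then 3 else 1) * maj s (m l))"
    unfolding R_def abs_prod by (rule prod_mono) (use p3 in auto)
  also have "\<dots> = (\<Prod>l\<in>{1..d} - {i}. (if l = j then 3 else 1)) * (\<Prod>l\<in>{1..d} - {i}. maj s (m l))"
    by (simp add: prod.distrib)
  also have "(\<Prod>l\<in>{1..d} - {i}. (if l = j then 3 else 1)) \<le> (3::real)"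
    by (simp add: prod.delta)
  hence "(\<Prod>l\<in>{1..d} - {i}. (if l = j then 3 else 1)) * (\<Prod>l\<in>{1..d} - {i}. maj s (m l)) \<le> 3 * (\<Prod>l\<in>{1..d} - {i}. maj s (m l))"
    by (rule mult_right_mono) (use s maj_nonneg[of s] in \<open>intro prod_nonneg, simp\<close>)
  finally have R: "\<bar>R\<bar> \<le> 3 * (\<Prod>l\<in>{1..d} - {i}. maj s (m l))" .
  have sh: "\<bar>\<phi> i (m i + 1) - \<phi> i (m i)\<bar> \<le> 40 * (sqrt s * maj s (m i))"
  proof -
    have "0 \<le> sqrt s * maj s (m i)" using s by (simp add: maj_nonneg)
    thus ?thesis unfolding \<phi>_def using dgauss_shift[OF s, of "m i"] gauss_shift[OF s, of "m i"] by auto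
  qed
  have "lprod d j s (m + unitv i) - lprod d j s m = (\<phi> i (m i + 1) - \<phi> i (m i)) * R"
    using L[of "m + unitv i"] L[of m] by (simp add: unitv_def algebra_simps)
  hence "\<bar>lprod d j s (m + unitv i) - lprod d j s m\<bar> = \<bar>\<phi> i (m i + 1) - \<phi> i (m i)\<bar> * \<bar>R\<bar>" by (simp add: abs_mult)
  also have "\<dots> \<le> (40 * (sqrt s * maj s (m i))) * (3 * (\<Prod>l\<in>{1..d} - {i}. maj s (m l)))"
    by (intro mult_mono sh R) (use s in \<open>auto simp: maj_nonneg\<close>)
  also have "\<dots> = 120 * (sqrt s * Gmaj d s m)"
    unfolding Gmaj_def using i by (subst (2) prod.remove[of _ i]) auto
  finally show ?thesis .
qed

text \<open>One power of \<open>sqrt s\<close> better than the size bound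
  \<open>6/s\<close>.\<close>
lemma dens_shift:
  assumes s: "0 < s" "s \<le> 1" and jk: "j \<in> {1..d}" "k \<in> {1..d}" and i: "i \<in> {1..d}"
  shows "\<bar>dens d j k s (m + unitv i) - dens d j k s m\<bar> \<le> 240 / sqrt s * Gmaj d s m"
proof -
  have "s * \<bar>dens d j k s (m + unitv i) - dens d j k s m\<bar> = \<bar>s * dens d j k s (m + unitv i) - s * dens d j k s m\<bar>"
    using s by (simp add: abs_mult right_diff_distrib[symmetric])
  also have "\<dots> \<le> 240 * (sqrt s * Gmaj d s m)"
    unfolding dens_eq[OF jk] using lprod_shift[OF s jk(1) i, of m] lprod_shift[OF s jk(2) i, of m] by linarith
  finally have "\<bar>dens d j k s (m + unitv i) - dens d j k s m\<bar> \<le> 240 * (sqrt s * Gmaj d s m) / s"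
    using s by (simp add: field_simps)
  also have "\<dots> = 240 / sqrt s * Gmaj d s m" using s by (simp add: real_div_sqrt field_simps)
  finally show ?thesis .
qed

text \<open>After division by the majorants all factors have absolute value at most
  \<open>1\<close>, and for such factors the difference of two products is at most the sum of the
  differences.\<close>
lemma prod_diff_le:
  fixes x y g :: "'i \<Rightarrow> real"
  assumes g: "\<And>i. i \<in> I \<Longrightarrow> g i > 0"
    and x: "\<And>i. i \<in> I \<Longrightarrow> \<bar>x i\<bar> \<le> g i" and y: "\<And>i. i \<in> I \<Longrightarrow> \<bar>y i\<bar> \<le> g i"
    and xy: "\<And>i. i \<in> I \<Longrightarrow> \<bar>x i - y i\<bar> \<le> \<delta> * g i"
  shows "\<bar>(\<Prod>i\<in>I. x i) - (\<Prod>i\<in>I. y i)\<bar> \<le> real (card I) * \<delta> * (\<Prod>i\<in>I. g i)"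
proof -
  have "norm ((\<Prod>i\<in>I. x i / g i) - (\<Prod>i\<in>I. y i / g i)) \<le> (\<Sum>i\<in>I. norm (x i / g i - y i / g i))"
  proof (rule norm_prod_diff)
    fix i assume i: "i \<in> I"
    show "norm (x i / g i) \<le> 1" "norm (y i / g i) \<le> 1"
      using g[OF i] x[OF i] y[OF i] by (simp_all add: abs_divide)
  qed
  also have "\<dots> \<le> (\<Sum>i\<in>I. \<delta>)"
  proof (rule sum_mono)
    fix i assume i: "i \<in> I"
    have "norm (x i / g i - y i / g i) = \<bar>x i - y i\<bar> / g i"
      using g[OF i] by (simp add: diff_divide_distrib[symmetric] abs_divide)
    also have "\<dots> \<le> \<delta>" using g[OF i] xy[OF i] by (simp add: pos_divide_le_eq)
    finally show "norm (x i / g i - y i / g i) \<le> \<delta>" .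
  qed
  finally have 1: "\<bar>(\<Prod>i\<in>I. x i / g i) - (\<Prod>i\<in>I. y i / g i)\<bar> \<le> real (card I) * \<delta>" by simp
  have gp: "(\<Prod>i\<in>I. g i) > 0" by (rule prod_pos) (use g in auto)
  have "\<bar>(\<Prod>i\<in>I. x i) - (\<Prod>i\<in>I. y i)\<bar> = \<bar>(\<Prod>i\<in>I. x i / g i) - (\<Prod>i\<in>I. y i / g i)\<bar> * (\<Prod>i\<in>I. g i)"
    using gp by (simp add: prod_dividef diff_divide_distrib[symmetric] abs_mult)
  also have "\<dots> \<le> real (card I) * \<delta> * (\<Prod>i\<in>I. g i)"
    by (rule mult_right_mono[OF 1]) (use gp in auto)
  finally show ?thesis .
qed

text \<open>Both terms of the step kernel are products of one-dimensional weights, and each factor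
  is within \<open>O(sqrt s)\<close> of its Gaussian counterpart relative to the majorant. After
  division by \<open>s\<close> the error is \<open>O(1/sqrt s)\<close>, which is integrable on
  \<open>[0, 1]\<close>.\<close>
lemma step_kernel_dens:
  assumes jk: "j \<in> {1..d}" "k \<in> {1..d}" "j \<noteq> k" and m: "m \<in> Zd d"
    and n: "n \<ge> 1" and s: "1 / (real n + 1) \<le> s" "s \<le> 1 / real n"
  shows "\<bar>real n * (real n + 1) * step_kernel d j k n m - dens d j k s m\<bar>
     \<le> 2 * real d * 1000000 ^ d / sqrt s * Gmaj d s m"
proof -
  have N: "real n \<ge> 1" using n by simp
  have s0: "s > 0" using s N by (smt (verit) divide_pos_pos)
  have sle1: "s \<le> 1" using s(2) N by (smt (verit) divide_le_eq_1)
  have ss: "sqrt s \<le> 1" "sqrt s > 0" "s \<le> sqrt s"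
  proof -
    show 1: "sqrt s \<le> 1" "sqrt s > 0" using s0 sle1 by auto
    have "sqrt s * sqrt s \<le> 1 * sqrt s" using 1 by (intro mult_right_mono) auto
    thus "s \<le> sqrt s" using s0 by simp
  qed
  define c where "c = real n * (real n + 1) * s"
  have "real n * ((real n + 1) * (1 / (real n + 1))) \<le> real n * ((real n + 1) * s)"
    by (intro mult_left_mono s) auto
  hence cn: "c \<ge> real n" using N by (simp add: c_def mult.assoc)
  have "1 / c \<le> 1 / real n" using cn N by (intro divide_left_mono) auto
  also have "\<dots> \<le> 2 * (1 / (real n + 1))" using N by (simp add: field_simps)
  also have "\<dots> \<le> 2 * s" using s by simp
  also have "\<dots> \<le> 2 * sqrt s" using ss by simp
  finally have c1: "1 / c \<le> 2 * sqrt s" .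
  define L where "L a = c * (cbin (Suc n) a - cbin n a)" for a
  define B :: real where "B = 1000000"
  have mj: "maj s a > 0" for a using s0 by (simp add: maj_def)
  have g1: "\<bar>gauss s a\<bar> \<le> maj s a" "\<bar>dgauss s a\<bar> \<le> 3 * maj s a" for a
  proof -
    have "exp (- s * (real_of_int a)\<^sup>2 / 4) * maj s a \<le> 1 * maj s a"
      using s0 by (intro mult_right_mono maj_nonneg) auto
    thus "\<bar>gauss s a\<bar> \<le> maj s a" "\<bar>dgauss s a\<bar> \<le> 3 * maj s a"
      using dgauss_le[of s a] gauss_le[of s a] gauss_nonneg[of s a] s0 by auto
  qed
  have sm: "sqrt s * maj s a \<le> maj s a" "sqrt s * maj s a \<ge> 0" for a
    using mult_right_mono[OF ss(1), of "maj s a"] mj[of a] ss by auto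
  have e1: "\<bar>cbin n a - gauss s a\<bar> \<le> sqrt s * (B * maj s a)" for a
    using cbin_gauss[OF n s, of a] sm(2)[of a] unfolding B_def by simp
  have e2: "\<bar>L a - dgauss s a\<bar> \<le> sqrt s * (B * maj s a)" for a
    using cbin_dgauss[OF n s, of a] sm(2)[of a] unfolding B_def L_def c_def by simp
  have e3: "\<bar>cbin (Suc n) a - gauss s a\<bar> \<le> sqrt s * (B * maj s a)" for a
  proof -
    have "\<bar>L a\<bar> \<le> 3 * maj s a + 200000 * maj s a"
      using cbin_dgauss[OF n s, of a] g1(2)[of a] sm(1)[of a] unfolding L_def c_def by linarith
    hence "(1 / c) * \<bar>L a\<bar> \<le> (2 * sqrt s) * (200003 * maj s a)"
      by (intro mult_mono c1) (use ss mj less_imp_le in auto)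
    moreover have "(1 / c) * \<bar>L a\<bar> = \<bar>cbin (Suc n) a - cbin n a\<bar>"
      using cn N by (simp add: L_def abs_mult)
    ultimately show ?thesis using cbin_gauss[OF n s, of a] sm(2)[of a] unfolding B_def by simp
  qed
  have b0: "\<bar>gauss s a\<bar> \<le> B * maj s a" "\<bar>dgauss s a\<bar> \<le> B * maj s a" for a
    using g1[of a] mj[of a] unfolding B_def by auto
  have b1: "\<bar>cbin n a\<bar> \<le> B * maj s a" for a
    using cbin_gauss[OF n s, of a] sm(1)[of a] g1(1)[of a] mj[of a] unfolding B_def by linarith
  have b2: "\<bar>L a\<bar> \<le> B * maj s a" for a
    using cbin_dgauss[OF n s, of a] g1(2)[of a] sm(1)[of a] mj[of a] unfolding L_def c_def B_def by linarith
  have b3: "\<bar>cbin (Suc n) a\<bar> \<le> B * maj s a" for a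
  proof -
    have "\<bar>L a\<bar> \<le> 3 * maj s a + 200000 * maj s a"
      using cbin_dgauss[OF n s, of a] g1(2)[of a] sm(1)[of a] unfolding L_def c_def by linarith
    hence "(1 / c) * \<bar>L a\<bar> \<le> (2 * sqrt s) * (200003 * maj s a)"
      by (intro mult_mono c1) (use ss mj less_imp_le in auto)
    also have "\<dots> \<le> 2 * (200003 * maj s a)" using sm(1)[of a] by simp
    finally have "\<bar>cbin (Suc n) a - cbin n a\<bar> \<le> 400006 * maj s a"
      using cn N by (simp add: L_def abs_mult)
    thus ?thesis using cbin_gauss[OF n s, of a] sm(1)[of a] g1(1)[of a] mj[of a] unfolding B_def by linarith
  qed
  define X where "X i = (if i = j then L (m i) else cbin n (m i))" for i
  define Y where "Y i = (if i = k then L (m i) else if i = j then cbin (Suc n) (m i) else cbin n (m i))" for i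
  have K: "c * step_kernel d j k n m = (\<Prod>i\<in>{1..d}. X i) - (\<Prod>i\<in>{1..d}. Y i)"
  proof -
    define R where "R = (\<Prod>i\<in>{1..d} - {j} - {k}. cbin n (m i))"
    have split: "(\<Prod>i\<in>{1..d}. z i) = z j * (z k * (\<Prod>i\<in>{1..d} - {j} - {k}. z i))" for z :: "nat \<Rightarrow> real"
      using jk by (subst prod.remove[of _ j], simp, simp, subst prod.remove[of _ k]) auto
    have "walk d (\<lambda>_. n) m = cbin n (m j) * (cbin n (m k) * R)"
      using m unfolding walk_def by (subst split) (auto simp: R_def)
    moreover have "walk d ((\<lambda>_. n)(j := Suc n)) m = cbin (Suc n) (m j) * (cbin n (m k) * R)"
      using m jk unfolding walk_def by (subst split) (auto simp: R_def intro!: prod.cong)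
    moreover have "walk d ((\<lambda>_. n)(j := Suc n, k := Suc n)) m = cbin (Suc n) (m j) * (cbin (Suc n) (m k) * R)"
      using m jk unfolding walk_def by (subst split) (auto simp: R_def intro!: prod.cong)
    moreover have "(\<Prod>i\<in>{1..d}. X i) = L (m j) * (cbin n (m k) * R)"
      using jk by (subst split) (auto simp: R_def X_def intro!: prod.cong)
    moreover have "(\<Prod>i\<in>{1..d}. Y i) = cbin (Suc n) (m j) * (L (m k) * R)"
      using jk by (subst split) (auto simp: R_def Y_def intro!: prod.cong)
    ultimately show ?thesis unfolding step_kernel_def L_def by (simp add: algebra_simps)
  qed
  have P1: "\<bar>(\<Prod>i\<in>{1..d}. X i) - lprod d j s m\<bar> \<le> real (card {1..d}) * sqrt s * (\<Prod>i\<in>{1..d}. B * maj s (m i))"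
    unfolding lprod_def
    by (rule prod_diff_le) (use b0 b1 b2 e1 e2 mj in \<open>auto simp: X_def B_def\<close>)
  have P2: "\<bar>(\<Prod>i\<in>{1..d}. Y i) - lprod d k s m\<bar> \<le> real (card {1..d}) * sqrt s * (\<Prod>i\<in>{1..d}. B * maj s (m i))"
    unfolding lprod_def
    by (rule prod_diff_le) (use b0 b1 b2 b3 e1 e2 e3 mj jk in \<open>auto simp: Y_def B_def\<close>)
  have BG: "(\<Prod>i\<in>{1..d}. B * maj s (m i)) = B ^ d * Gmaj d s m" by (simp add: prod.distrib Gmaj_def)
  have "s * \<bar>real n * (real n + 1) * step_kernel d j k n m - dens d j k s m\<bar> = \<bar>c * step_kernel d j k n m - s * dens d j k s m\<bar>"
  proof -
    have "s * (real n * (real n + 1) * step_kernel d j k n m - dens d j k s m) = c * step_kernel d j k n m - s * dens d j k s m"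
      by (simp add: c_def algebra_simps)
    thus ?thesis using s0 by (metis abs_mult abs_of_pos)
  qed
  also have "\<dots> \<le> 2 * (real d * sqrt s * (B ^ d * Gmaj d s m))"
    unfolding K dens_eq[OF jk(1,2)] using P1 P2 unfolding BG by simp
  finally have "\<bar>real n * (real n + 1) * step_kernel d j k n m - dens d j k s m\<bar> \<le> 2 * (real d * sqrt s * (B ^ d * Gmaj d s m)) / s"
    using s0 by (simp add: field_simps)
  also have "\<dots> = 2 * real d * B ^ d / sqrt s * Gmaj d s m" using s0 by (simp add: real_div_sqrt field_simps)
  finally show ?thesis by (simp add: B_def)
qed

section \<open>The large-time part of the kernel\<close>

definition far :: "nat \<Rightarrow> nat \<Rightarrow> nat \<Rightarrow> (nat \<Rightarrow> int) \<Rightarrow> real" where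
  "far d j k m = integral {0..1} (\<lambda>s. dens d j k s m)"

lemma continuous_dens: "continuous_on A (\<lambda>s. dens d j k s m)"
  unfolding dens_def gauss_def by (intro continuous_intros) auto

lemma dens_integrable: "(\<lambda>s. dens d j k s m) integrable_on {a..b}"
  by (rule integrable_continuous_interval) (rule continuous_dens)

lemma gauss_le_1: "0 \<le> s \<Longrightarrow> s \<le> 1 \<Longrightarrow> gauss s a \<le> 1"
  unfolding gauss_def using pi_ge_two
  by (intro mult_le_one) (auto simp: divide_le_eq_1)

lemma dens_le_coeff:
  assumes "0 \<le> s" "s \<le> 1"
  shows "\<bar>dens d j k s m\<bar> \<le> \<bar>(real_of_int (m j))\<^sup>2 - (real_of_int (m k))\<^sup>2\<bar>"
proof -
  have "(\<Prod>i\<in>{1..d}. gauss s (m i)) \<le> 1" by (rule prod_le_1) (use assms gauss_le_1 gauss_nonneg in auto)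
  moreover have "(\<Prod>i\<in>{1..d}. gauss s (m i)) \<ge> 0" by (rule prod_nonneg) (use assms gauss_nonneg in auto)
  ultimately show ?thesis unfolding dens_def abs_mult by (intro mult_left_le) auto
qed

lemma far_split:
  "far d j k m = integral {0..1 / real (Suc N)} (\<lambda>s. dens d j k s m)
     + (\<Sum>n\<in>{1..N}. integral {1 / real (Suc n)..1 / real n} (\<lambda>s. dens d j k s m))"
proof (induction N)
  case 0 thus ?case by (simp add: far_def)
next
  case (Suc N)
  have "integral {0..1 / real (Suc (Suc N))} (\<lambda>s. dens d j k s m) + integral {1 / real (Suc (Suc N))..1 / real (Suc N)} (\<lambda>s. dens d j k s m)
     = integral {0..1 / real (Suc N)} (\<lambda>s. dens d j k s m)"
    by (rule Henstock_Kurzweil_Integration.integral_combine) (auto simp: frac_le dens_integrable)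
  thus ?case using Suc by simp
qed

text \<open>The left side is the length of \<open>[1/(n+1), 1/n]\<close> times \<open>1/sqrt
  s\<close>, so a discrete form of \<open>\<integral> ds / sqrt s\<close>; bounding it by a
  telescoping term makes the sum over \<open>n\<close> bounded.\<close>
lemma sqrt_telescope:
  assumes "n \<ge> 1"
  shows "sqrt (real (Suc n)) * (1 / real n - 1 / real (Suc n)) \<le> 3 * (1 / sqrt (real n) - 1 / sqrt (real (Suc n)))"
proof -
  define a where "a = sqrt (real n)"
  define b where "b = sqrt (real (Suc n))"
  have a: "a > 0" "b > 0" "a \<le> b" "real n = a\<^sup>2" "real (Suc n) = b\<^sup>2" using assms by (auto simp: a_def b_def)
  have ab: "b\<^sup>2 = a\<^sup>2 + 1" using a by simp
  have b2: "b \<le> 2 * a"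
  proof -
    have "1 \<le> a\<^sup>2" using assms by (simp add: a_def)
    hence "b\<^sup>2 \<le> (2 * a)\<^sup>2" using ab by (simp add: power_mult_distrib)
    thus ?thesis by (rule power2_le_imp_le) (use a in auto)
  qed
  have "b * (1 / a\<^sup>2 - 1 / b\<^sup>2) = ((b - a) / (a * b)) * ((a + b) / a)"
    using a(1,2) by (simp add: divide_simps) (simp add: power2_eq_square algebra_simps)
  also have "\<dots> \<le> ((b - a) / (a * b)) * 3"
    using a b2 by (intro mult_left_mono) (auto simp: field_simps)
  also have "\<dots> = 3 * (1 / a - 1 / b)" using a(1,2) by (simp add: field_simps)
  finally show ?thesis unfolding a(4,5) using a by simp
qed

lemma maj_compare:
  assumes "n \<ge> 1" "1 / real (Suc n) \<le> s" "s \<le> 1 / real n"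
  shows "maj s a \<le> 2 * maj (1 / real (Suc n)) a"
proof -
  have "s \<le> 4 * (1 / real (Suc n))"
  proof -
    have "1 / real n \<le> 4 * (1 / real (Suc n))" using assms(1) by (simp add: field_simps)
    thus ?thesis using assms by linarith
  qed
  hence "sqrt s \<le> sqrt 4 * sqrt (1 / real (Suc n))" unfolding real_sqrt_mult[symmetric] by (rule real_sqrt_le_mono)
  hence 1: "sqrt s \<le> 2 * sqrt (1 / real (Suc n))" by simp
  have "(1 / real (Suc n)) * (real_of_int a)\<^sup>2 \<le> s * (real_of_int a)\<^sup>2" by (rule mult_right_mono[OF assms(2)]) simp
  from divide_right_mono[OF this, of 4]
  have 2: "exp (- s * (real_of_int a)\<^sup>2 / 4) \<le> exp (- (1 / real (Suc n)) * (real_of_int a)\<^sup>2 / 4)"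
    by (simp only: exp_le_cancel_iff mult_minus_left minus_divide_left[symmetric] neg_le_iff_le)
  have "maj s a \<le> (2 * sqrt (1 / real (Suc n))) * exp (- (1 / real (Suc n)) * (real_of_int a)\<^sup>2 / 4)"
    unfolding maj_def by (rule mult_mono[OF 1 2]) auto
  thus ?thesis by (simp add: maj_def)
qed

text \<open>The interval has length \<open>1/(n(n+1))\<close>, which is the factor that makes the
  \<open>n\<close>-th step of the walk match the heat flow over it.\<close>
lemma step_kernel_integral:
  assumes jk: "j \<in> {1..d}" "k \<in> {1..d}" "j \<noteq> k" and m: "m \<in> Zd d" and n: "n \<ge> 1"
  shows "\<bar>integral {1 / real (Suc n)..1 / real n} (\<lambda>s. dens d j k s m) - step_kernel d j k n m\<bar>
    \<le> 2 * real d * 2000000 ^ d * Gmaj d (1 / real (Suc n)) m * (sqrt (real (Suc n)) * (1 / real n - 1 / real (Suc n)))"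
proof -
  let ?a = "1 / real (Suc n)" and ?b = "1 / real n"
  have N: "real n \<ge> 1" using n by simp
  have ab: "?a \<le> ?b" "?a > 0" using N by (auto simp: field_simps)
  define c where "c = real n * (real n + 1) * step_kernel d j k n m"
  define B where "B = 2 * real d * 2000000 ^ d * Gmaj d ?a m * sqrt (real (Suc n))"
  have B: "B \<ge> 0" using Gmaj_nonneg[of ?a d m] by (simp add: B_def)
  have i1: "((\<lambda>s. dens d j k s m) has_integral integral {?a..?b} (\<lambda>s. dens d j k s m)) {?a..?b}"
    using dens_integrable by (rule integrable_integral)
  have i2: "((\<lambda>s. c) has_integral (?b - ?a) * c) {?a..?b}"
    using has_integral_const_real[of c ?a ?b] ab by simp
  have cc: "(?b - ?a) * c = step_kernel d j k n m"
  proof -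
    have "?b - ?a = 1 / (real n * (real n + 1))" using N by (simp add: field_simps)
    thus ?thesis using N by (simp add: c_def)
  qed
  have "norm (integral {?a..?b} (\<lambda>s. dens d j k s m) - step_kernel d j k n m) \<le> B * measure lborel {?a..?b}"
  proof (rule has_integral_bound_real[OF B finite.emptyI has_integral_diff[OF i1 i2[unfolded cc]]])
    fix s assume "s \<in> {?a..?b} - {}"
    hence s: "s \<in> {?a..?b}" by simp
    hence s0: "s > 0" using ab by (meson atLeastAtMost_iff less_le_trans)
    have "norm (dens d j k s m - c) \<le> 2 * real d * 1000000 ^ d / sqrt s * Gmaj d s m"
      using step_kernel_dens[OF jk m n, of s] s by (simp add: c_def abs_minus_commute add.commute)
    also have "\<dots> = (2 * real d * 1000000 ^ d) * ((1 / sqrt s) * Gmaj d s m)" by simp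
    also have "\<dots> \<le> (2 * real d * 1000000 ^ d) * (sqrt (real (Suc n)) * (2 ^ d * Gmaj d ?a m))"
    proof (intro mult_left_mono mult_mono)
      have "sqrt ?a \<le> sqrt s" using s by simp
      hence "1 / sqrt s \<le> 1 / sqrt ?a" by (intro divide_left_mono) (use ab s0 in auto)
      thus "1 / sqrt s \<le> sqrt (real (Suc n))" by (simp add: real_sqrt_divide)
      have "Gmaj d s m \<le> (\<Prod>i\<in>{1..d}. 2 * maj ?a (m i))"
        unfolding Gmaj_def
      proof (rule prod_mono)
        fix i assume "i \<in> {1..d}"
        show "0 \<le> maj s (m i) \<and> maj s (m i) \<le> 2 * maj ?a (m i)"
          using maj_compare[OF n, of s "m i"] s s0 by (auto intro: maj_nonneg)
      qed
      thus "Gmaj d s m \<le> 2 ^ d * Gmaj d ?a m" by (simp add: prod.distrib Gmaj_def)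
    qed (use s0 in \<open>auto intro: Gmaj_nonneg\<close>)
    also have "\<dots> = B"
    proof -
      have "(2000000::real) ^ d = 1000000 ^ d * 2 ^ d" by (simp flip: power_mult_distrib)
      thus ?thesis by (simp add: B_def)
    qed
    finally show "norm (dens d j k s m - c) \<le> B" .
  qed
  thus ?thesis using ab by (simp add: B_def mult_ac)
qed

text \<open>The last summand comes from the heat parameters \<open>s < 1/(N+1)\<close> that the
  first \<open>N\<close> steps do not reach. It is not uniform in \<open>F\<close>, but it
  disappears for fixed \<open>F\<close> as \<open>N\<close> grows.\<close>
lemma far_walk_riesz:
  assumes jk: "j \<in> {1..d}" "k \<in> {1..d}" "j \<noteq> k" and F: "finite F" "F \<subseteq> Zd d"
  shows "(\<Sum>m\<in>F. \<bar>far d j k m - walk_riesz d j k N m\<bar>)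
    \<le> 1000000000 ^ d + (\<Sum>m\<in>F. \<bar>(real_of_int (m j))\<^sup>2 - (real_of_int (m k))\<^sup>2\<bar>) / real (Suc N)"
proof -
  define A where "A = 2 * real d * 2000000 ^ d"
  define w where "w n = sqrt (real (Suc n)) * (1 / real n - 1 / real (Suc n))" for n
  define c where "c m = \<bar>(real_of_int (m j))\<^sup>2 - (real_of_int (m k))\<^sup>2\<bar>" for m :: "nat \<Rightarrow> int"
  have w0: "w n \<ge> 0" if "n \<ge> 1" for n
    unfolding w_def using that by (intro mult_nonneg_nonneg) (auto simp: frac_le)
  have "\<bar>far d j k m - walk_riesz d j k N m\<bar> \<le> c m / real (Suc N) + (\<Sum>n\<in>{1..N}. A * Gmaj d (1 / real (Suc n)) m * w n)"
    if m: "m \<in> F" for m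
  proof -
    define I where "I n = integral {1 / real (Suc n)..1 / real n} (\<lambda>s. dens d j k s m)" for n
    have "far d j k m - walk_riesz d j k N m = integral {0..1 / real (Suc N)} (\<lambda>s. dens d j k s m)
       + (\<Sum>n\<in>{1..N}. I n - step_kernel d j k n m)"
      unfolding far_split[of d j k m N] walk_riesz_def I_def by (simp add: sum_subtractf)
    also have "\<bar>\<dots>\<bar> \<le> c m / real (Suc N) + (\<Sum>n\<in>{1..N}. A * Gmaj d (1 / real (Suc n)) m * w n)"
    proof (rule order_trans[OF abs_triangle_ineq add_mono])
      have "norm (integral {0..1 / real (Suc N)} (\<lambda>s. dens d j k s m)) \<le> c m * measure lborel {0..1 / real (Suc N)}"
      proof (rule has_integral_bound_real[OF _ finite.emptyI integrable_integral[OF dens_integrable]])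
        fix s assume s: "s \<in> {0..1 / real (Suc N)} - {}"
        have "1 / real (Suc N) \<le> 1" by simp
        hence "s \<le> 1" using s by (meson DiffD1 atLeastAtMost_iff order_trans)
        thus "norm (dens d j k s m) \<le> c m" using s dens_le_coeff[of s d j k m] by (simp add: c_def)
      qed (simp add: c_def)
      thus "\<bar>integral {0..1 / real (Suc N)} (\<lambda>s. dens d j k s m)\<bar> \<le> c m / real (Suc N)" by simp
      have "\<bar>\<Sum>n\<in>{1..N}. I n - step_kernel d j k n m\<bar> \<le> (\<Sum>n\<in>{1..N}. \<bar>I n - step_kernel d j k n m\<bar>)" by (rule sum_abs)
      also have "\<dots> \<le> (\<Sum>n\<in>{1..N}. A * Gmaj d (1 / real (Suc n)) m * w n)"
        unfolding I_def A_def w_def by (rule sum_mono, rule step_kernel_integral[OF jk]) (use m F in auto)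
      finally show "\<bar>\<Sum>n\<in>{1..N}. I n - step_kernel d j k n m\<bar> \<le> (\<Sum>n\<in>{1..N}. A * Gmaj d (1 / real (Suc n)) m * w n)" .
    qed
    finally show ?thesis .
  qed
  hence "(\<Sum>m\<in>F. \<bar>far d j k m - walk_riesz d j k N m\<bar>) \<le> (\<Sum>m\<in>F. c m / real (Suc N) + (\<Sum>n\<in>{1..N}. A * Gmaj d (1 / real (Suc n)) m * w n))"
    by (rule sum_mono)
  also have "\<dots> = (\<Sum>m\<in>F. c m) / real (Suc N) + (\<Sum>n\<in>{1..N}. (A * w n) * (\<Sum>m\<in>F. Gmaj d (1 / real (Suc n)) m))"
    unfolding sum.distrib sum_divide_distrib[symmetric] by (subst sum.swap) (simp add: sum_distrib_left mult_ac)
  also have "(\<Sum>n\<in>{1..N}. (A * w n) * (\<Sum>m\<in>F. Gmaj d (1 / real (Suc n)) m)) \<le> (\<Sum>n\<in>{1..N}. (A * w n) * 12 ^ d)"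
    by (intro sum_mono mult_left_mono sum_Gmaj_le F) (use w0 in \<open>auto simp: A_def\<close>)
  also have "\<dots> = A * 12 ^ d * (\<Sum>n\<in>{1..N}. w n)"
    unfolding sum_distrib_left by (intro sum.cong refl) (simp only: ac_simps)
  also have "(\<Sum>n\<in>{1..N}. w n) \<le> 3 * (1 - 1 / sqrt (real (Suc N)))"
  proof (induction N)
    case (Suc N)
    thus ?case using sqrt_telescope[of "Suc N"] unfolding w_def by (simp add: algebra_simps)
  qed simp
  hence "A * 12 ^ d * (\<Sum>n\<in>{1..N}. w n) \<le> A * 12 ^ d * 3"
  proof (rule mult_left_mono[OF order_trans])
    show "3 * (1 - 1 / sqrt (real (Suc N))) \<le> 3" by simp
  qed (simp add: A_def)
  also have "A * 12 ^ d * 3 \<le> 1000000000 ^ d"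
  proof -
    have d1: "d \<ge> 1" using jk by auto
    have "real d \<le> 2 ^ d" by (simp add: less_imp_le of_nat_less_two_power)
    have "A * 12 ^ d * 3 = 6 * (real d * (24000000 ^ d))" by (simp add: A_def flip: power_mult_distrib)
    also have "\<dots> \<le> 6 ^ d * (2 ^ d * (24000000 ^ d))"
      using d1 \<open>real d \<le> 2 ^ d\<close> self_le_power[of "6::real" d] by (intro mult_mono) auto
    also have "\<dots> = 288000000 ^ d" by (simp flip: power_mult_distrib)
    also have "\<dots> \<le> 1000000000 ^ d" by (rule power_mono) auto
    finally show ?thesis .
  qed
  finally show ?thesis by (simp add: c_def)
qed

text \<open>The Schur test: convolution with an \<open>\<ell>\<^sup>1\<close> kernel, weighted by
  Young's inequality.\<close>
lemma form_perturb:
  fixes f h :: "(nat \<Rightarrow> int) \<Rightarrow> real"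
  assumes p: "p > 1" and q: "q = p/(p - 1)" and S: "finite S"
  defines "F \<equiv> (\<lambda>(x, y). y - x) ` (S \<times> S)"
  shows "(\<Sum>x\<in>S. \<Sum>y\<in>S. e (y - x) * f x * h y)
    \<le> (\<Sum>m\<in>F. \<bar>e m\<bar>) * ((\<Sum>x\<in>S. \<bar>f x\<bar> powr p) / p + (\<Sum>x\<in>S. \<bar>h x\<bar> powr q) / q)"
proof -
  define E where "E = (\<Sum>m\<in>F. \<bar>e m\<bar>)"
  have F: "finite F" using S by (simp add: F_def)
  have q0: "q > 0" unfolding q using p by simp
  have in1: "(\<Sum>y\<in>S. \<bar>e (y - x)\<bar>) \<le> E" if "x \<in> S" for x
  proof -
    have "(\<Sum>y\<in>S. \<bar>e (y - x)\<bar>) = (\<Sum>m\<in>(\<lambda>y. y - x) ` S. \<bar>e m\<bar>)"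
      by (subst sum.reindex) (auto simp: inj_on_def)
    also have "\<dots> \<le> E" unfolding E_def by (rule sum_mono2[OF F]) (use that in \<open>auto simp: F_def\<close>)
    finally show ?thesis .
  qed
  have in2: "(\<Sum>x\<in>S. \<bar>e (y - x)\<bar>) \<le> E" if "y \<in> S" for y
  proof -
    have "(\<Sum>x\<in>S. \<bar>e (y - x)\<bar>) = (\<Sum>m\<in>(\<lambda>x. y - x) ` S. \<bar>e m\<bar>)"
      by (subst sum.reindex) (auto simp: inj_on_def)
    also have "\<dots> \<le> E" unfolding E_def by (rule sum_mono2[OF F]) (use that in \<open>auto simp: F_def\<close>)
    finally show ?thesis .
  qed
  have "(\<Sum>x\<in>S. \<Sum>y\<in>S. e (y - x) * f x * h y) \<le> (\<Sum>x\<in>S. \<Sum>y\<in>S. \<bar>e (y - x)\<bar> * (\<bar>f x\<bar> powr p / p + \<bar>h y\<bar> powr q / q))"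
  proof (intro sum_mono)
    fix x y
    have "e (y - x) * f x * h y \<le> \<bar>e (y - x)\<bar> * (\<bar>f x\<bar> * \<bar>h y\<bar>)" by (metis abs_ge_self abs_mult mult.assoc)
    also have "\<dots> \<le> \<bar>e (y - x)\<bar> * (\<bar>f x\<bar> powr p / p + \<bar>h y\<bar> powr q / q)"
      using young_abs[OF p q, of "\<bar>f x\<bar>" "\<bar>h y\<bar>"] by (intro mult_left_mono) auto
    finally show "e (y - x) * f x * h y \<le> \<dots>" .
  qed
  also have "\<dots> = (\<Sum>x\<in>S. (\<bar>f x\<bar> powr p / p) * (\<Sum>y\<in>S. \<bar>e (y - x)\<bar>)) + (\<Sum>y\<in>S. (\<bar>h y\<bar> powr q / q) * (\<Sum>x\<in>S. \<bar>e (y - x)\<bar>))"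
  proof -
    have "(\<Sum>x\<in>S. \<Sum>y\<in>S. \<bar>e (y - x)\<bar> * (\<bar>f x\<bar> powr p / p + \<bar>h y\<bar> powr q / q))
       = (\<Sum>x\<in>S. \<Sum>y\<in>S. (\<bar>f x\<bar> powr p / p) * \<bar>e (y - x)\<bar>) + (\<Sum>x\<in>S. \<Sum>y\<in>S. (\<bar>h y\<bar> powr q / q) * \<bar>e (y - x)\<bar>)"
      unfolding sum.distrib[symmetric] by (intro sum.cong refl) (simp only: distrib_left mult.commute)
    also have "(\<Sum>x\<in>S. \<Sum>y\<in>S. (\<bar>h y\<bar> powr q / q) * \<bar>e (y - x)\<bar>) = (\<Sum>y\<in>S. \<Sum>x\<in>S. (\<bar>h y\<bar> powr q / q) * \<bar>e (y - x)\<bar>)"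
      by (rule sum.swap)
    finally show ?thesis by (simp only: sum_distrib_left)
  qed
  also have "\<dots> \<le> (\<Sum>x\<in>S. (\<bar>f x\<bar> powr p / p) * E) + (\<Sum>y\<in>S. (\<bar>h y\<bar> powr q / q) * E)"
    by (intro add_mono sum_mono mult_left_mono in1 in2) (use p q0 in auto)
  also have "\<dots> = E * ((\<Sum>x\<in>S. \<bar>f x\<bar> powr p) / p + (\<Sum>x\<in>S. \<bar>h x\<bar> powr q) / q)"
    by (simp add: sum_distrib_left sum_distrib_right sum_divide_distrib distrib_left mult.commute)
  finally show ?thesis by (simp add: E_def)
qed

lemma Zd_difference_set: "S \<subseteq> Zd d \<Longrightarrow> (\<lambda>(x, y). y - x) ` (S \<times> S) \<subseteq> Zd d"
  by (auto intro!: Zd_diff)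

lemma form_bound_add_l1:
  assumes p: "p > 1" and fb: "form_bound d p C k1"
    and E: "\<And>F. finite F \<Longrightarrow> F \<subseteq> Zd d \<Longrightarrow> (\<Sum>m\<in>F. \<bar>k m - k1 m\<bar>) \<le> E"
  shows "form_bound d p (C + E) k"
  unfolding form_bound_def
proof (intro allI impI)
  fix S and f h :: "(nat \<Rightarrow> int) \<Rightarrow> real"
  assume S: "finite S" "S \<subseteq> Zd d"
  define Y where "Y = (\<Sum>x\<in>S. \<bar>f x\<bar> powr p) / p + (\<Sum>x\<in>S. \<bar>h x\<bar> powr (p/(p - 1))) / (p/(p - 1))"
  have Y: "Y \<ge> 0" using p by (simp add: Y_def sum_nonneg)
  let ?F = "(\<lambda>(x, y). y - x) ` (S \<times> S)"
  have "(\<Sum>x\<in>S. \<Sum>y\<in>S. k (y - x) * f x * h y)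
    = (\<Sum>x\<in>S. \<Sum>y\<in>S. k1 (y - x) * f x * h y) + (\<Sum>x\<in>S. \<Sum>y\<in>S. (k (y - x) - k1 (y - x)) * f x * h y)"
    unfolding sum.distrib[symmetric] by (simp add: algebra_simps)
  also have "\<dots> \<le> C * Y + (\<Sum>m\<in>?F. \<bar>k m - k1 m\<bar>) * Y"
    using fb S form_perturb[OF p refl S(1), of "\<lambda>m. k m - k1 m" f h] unfolding Y_def form_bound_def
    by (intro add_mono) auto
  also have "\<dots> \<le> C * Y + E * Y"
    by (intro add_left_mono mult_right_mono E Y Zd_difference_set S) (use S in auto)
  finally show "(\<Sum>x\<in>S. \<Sum>y\<in>S. k (y - x) * f x * h y) \<le> (C + E) * ((\<Sum>x\<in>S. \<bar>f x\<bar> powr p) / p + (\<Sum>x\<in>S. \<bar>h x\<bar> powr (p/(p - 1))) / (p/(p - 1)))"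
    by (simp add: Y_def distrib_right)
qed

text \<open>A bilinear form on a finite set only sees the kernel on a finite set of differences, so
  \<open>N\<close> can tend to infinity.\<close>
lemma form_bound_far:
  assumes jk: "j \<in> {1..d}" "k \<in> {1..d}" "j \<noteq> k" and p: "p > 1"
  shows "form_bound d p (max p (p/(p - 1)) - 1 + 1000000000 ^ d) (far d j k)"
  unfolding form_bound_def
proof (intro allI impI)
  fix S and f h :: "(nat \<Rightarrow> int) \<Rightarrow> real"
  assume S: "finite S" "S \<subseteq> Zd d"
  define Y where "Y = (\<Sum>x\<in>S. \<bar>f x\<bar> powr p) / p + (\<Sum>x\<in>S. \<bar>h x\<bar> powr (p/(p - 1))) / (p/(p - 1))"
  have Y: "Y \<ge> 0" using p by (simp add: Y_def sum_nonneg)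
  define C where "C = max p (p/(p - 1)) - 1"
  let ?F = "(\<lambda>(x, y). y - x) ` (S \<times> S)"
  define c where "c = (\<Sum>m\<in>?F. \<bar>(real_of_int (m j))\<^sup>2 - (real_of_int (m k))\<^sup>2\<bar>)"
  have *: "(\<Sum>x\<in>S. \<Sum>y\<in>S. far d j k (y - x) * f x * h y) \<le> C * Y + (1000000000 ^ d + c / real (Suc N)) * Y" for N
  proof -
    have "(\<Sum>x\<in>S. \<Sum>y\<in>S. far d j k (y - x) * f x * h y)
      = (\<Sum>x\<in>S. \<Sum>y\<in>S. walk_riesz d j k N (y - x) * f x * h y) + (\<Sum>x\<in>S. \<Sum>y\<in>S. (far d j k (y - x) - walk_riesz d j k N (y - x)) * f x * h y)"
      unfolding sum.distrib[symmetric] by (simp add: algebra_simps)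
    also have "\<dots> \<le> C * Y + (\<Sum>m\<in>?F. \<bar>far d j k m - walk_riesz d j k N m\<bar>) * Y"
      using form_bound_walk_riesz[OF jk p, of N] S form_perturb[OF p refl S(1), of "\<lambda>m. far d j k m - walk_riesz d j k N m" f h]
      unfolding Y_def form_bound_def C_def by (intro add_mono) auto
    also have "\<dots> \<le> C * Y + (1000000000 ^ d + c / real (Suc N)) * Y"
      unfolding c_def by (intro add_left_mono mult_right_mono far_walk_riesz jk Y Zd_difference_set S) (use S in auto)
    finally show ?thesis .
  qed
  have "(\<lambda>N. C * Y + (1000000000 ^ d + c / real (Suc N)) * Y) \<longlonglongrightarrow> C * Y + (1000000000 ^ d + 0) * Y"
    by (intro tendsto_intros LIMSEQ_Suc[OF lim_const_over_n])
  hence "(\<Sum>x\<in>S. \<Sum>y\<in>S. far d j k (y - x) * f x * h y) \<le> C * Y + (1000000000 ^ d + 0) * Y"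
    by (rule LIMSEQ_le_const) (use * in auto)
  thus "(\<Sum>x\<in>S. \<Sum>y\<in>S. far d j k (y - x) * f x * h y) \<le> (max p (p/(p - 1)) - 1 + 1000000000 ^ d) * ((\<Sum>x\<in>S. \<bar>f x\<bar> powr p) / p + (\<Sum>x\<in>S. \<bar>h x\<bar> powr (p/(p - 1))) / (p/(p - 1)))"
    by (simp add: Y_def C_def distrib_right)
qed

section \<open>The small-time part of the kernel\<close>

text \<open>At the origin the quotient is \<open>0/0\<close>, so the kernel has the value
  \<open>0\<close> there.\<close>
definition kern :: "nat \<Rightarrow> nat \<Rightarrow> nat \<Rightarrow> (nat \<Rightarrow> int) \<Rightarrow> real" where
  "kern d j k m = riesz_const d * (((real_of_int (m j))\<^sup>2 - (real_of_int (m k))\<^sup>2) / eucl_norm d m ^ (d + 2))"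

definition near :: "nat \<Rightarrow> nat \<Rightarrow> nat \<Rightarrow> (nat \<Rightarrow> int) \<Rightarrow> real" where
  "near d j k m = kern d j k m - far d j k m"

lemma riesz_const_pos: "riesz_const d > 0"
  unfolding riesz_const_def by (intro divide_pos_pos Gamma_real_pos) auto

lemma sqnorm_nonneg: "sqnorm d m \<ge> 0" by (simp add: sqnorm_def sum_nonneg)

lemma sqnorm_int: "sqnorm d m = real_of_int (\<Sum>i\<in>{1..d}. (m i)\<^sup>2)" by (simp add: sqnorm_def)

lemma coord_le_sqnorm: "i \<in> {1..d} \<Longrightarrow> (real_of_int (m i))\<^sup>2 \<le> sqnorm d m"
  unfolding sqnorm_def by (rule member_le_sum) auto

lemma coord_diff_le_sqnorm: "j \<in> {1..d} \<Longrightarrow> k \<in> {1..d} \<Longrightarrow>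
   \<bar>(real_of_int (m j))\<^sup>2 - (real_of_int (m k))\<^sup>2\<bar> \<le> sqnorm d m"
  using coord_le_sqnorm[of j d m] coord_le_sqnorm[of k d m] by (simp add: abs_le_iff) (smt (verit) zero_le_power2)

lemma sqnorm_eq_0: "m \<in> Zd d \<Longrightarrow> sqnorm d m = 0 \<longleftrightarrow> m = (\<lambda>_. 0)"
  by (auto simp: sqnorm_def sum_nonneg_eq_0_iff Zd_def fun_eq_iff)

lemma eucl_norm_pow: "sqnorm d m > 0 \<Longrightarrow> eucl_norm d m ^ (d + 2) = sqnorm d m powr (real d / 2 + 1)"
proof -
  assume N: "sqnorm d m > 0"
  have "eucl_norm d m = sqrt (sqnorm d m)" by (simp add: eucl_norm_def L2_set_def sqnorm_def)
  also have "\<dots> = sqnorm d m powr (1/2)" using N by (simp add: powr_half_sqrt)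
  finally have "eucl_norm d m ^ (d + 2) = (sqnorm d m powr (1/2)) powr (real (d + 2))"
    using N powr_realpow[of "sqnorm d m powr (1/2)" "d + 2"] by simp
  also have "\<dots> = sqnorm d m powr (real d / 2 + 1)" unfolding powr_powr by (simp add: field_simps)
  finally show ?thesis .
qed

text \<open>Euler's integral, which produces the constant \<open>c\<^sub>d\<close> of the
  operator.\<close>
lemma gamma_scaled:
  assumes a: "a > (0::real)" and N: "N > 0"
  shows "((\<lambda>s. s powr (a - 1) * exp (- N * s)) has_integral Gamma a / N powr a) {0..}"
proof -
  let ?f = "\<lambda>t::real. t powr (a - 1) / exp t"
  have f: "(?f has_integral Gamma a) {0..}" by (rule Gamma_integral_real[OF a])
  have "?f absolutely_integrable_on {0..}"
    by (rule nonnegative_absolutely_integrable_1) (use f in \<open>auto simp: has_integral_integrable\<close>)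
  moreover have im: "(\<lambda>s. N * s) ` {0..} = {0..}"
  proof
    show "{0..} \<subseteq> (\<lambda>s. N * s) ` {0..}"
    proof
      fix x :: real assume "x \<in> {0..}"
      thus "x \<in> (\<lambda>s. N * s) ` {0..}" using N by (intro image_eqI[of _ _ "x / N"]) auto
    qed
  qed (use N in auto)
  ultimately have "?f absolutely_integrable_on ((\<lambda>s. N * s) ` {0..}) \<and> integral ((\<lambda>s. N * s) ` {0..}) ?f = Gamma a"
    using f by (simp add: integral_unique)
  hence *: "(\<lambda>s. \<bar>N\<bar> * ?f (N * s)) absolutely_integrable_on {0..} \<and> integral {0..} (\<lambda>s. \<bar>N\<bar> * ?f (N * s)) = Gamma a"
    by (subst has_absolute_integral_change_of_variables_1')
       (use N in \<open>auto intro!: derivative_eq_intros simp: inj_on_def\<close>)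
  hence "((\<lambda>s. \<bar>N\<bar> * ?f (N * s)) has_integral Gamma a) {0..}"
    by (metis absolutely_integrable_on_def has_integral_integral)
  hence "((\<lambda>s. N powr (- a) * (\<bar>N\<bar> * ?f (N * s))) has_integral N powr (- a) * Gamma a) {0..}"
    by (rule has_integral_mult_right)
  moreover have "N powr (- a) * (\<bar>N\<bar> * ?f (N * s)) = s powr (a - 1) * exp (- N * s)" if "s \<in> {0..}" for s
  proof -
    have "(N * s) powr (a - 1) = N powr (a - 1) * s powr (a - 1)" by (rule powr_mult)
    moreover have "N powr (- a) * (N * N powr (a - 1)) = 1"
    proof -
      have "N * N powr (a - 1) = N powr a" using N by (simp add: powr_diff)
      thus ?thesis using N by (simp add: powr_minus)
    qed
    moreover have "1 / exp (N * s) = exp (- N * s)" by (simp add: exp_minus inverse_eq_divide)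
    ultimately show ?thesis using N
      by (simp add: divide_inverse exp_minus mult.assoc[symmetric])
  qed
  ultimately show ?thesis using N by (subst has_integral_cong[where g = "\<lambda>s. N powr (- a) * (\<bar>N\<bar> * ?f (N * s))"])
      (auto simp: powr_minus divide_inverse mult.commute)
qed

lemma dens_powr:
  assumes "s \<ge> 0" and d: "d \<noteq> 0"
  shows "dens d j k s m = ((real_of_int (m j))\<^sup>2 - (real_of_int (m k))\<^sup>2) / pi powr (real d / 2)
     * (s powr (real d / 2) * exp (- sqnorm d m * s))"
proof -
  have "(\<Prod>i\<in>{1..d}. gauss s (m i)) = sqrt (s / pi) ^ d * exp (- sqnorm d m * s)"
    unfolding gauss_def prod.distrib sqnorm_def
    by (simp add: exp_sum[symmetric] sum_distrib_left sum_negf mult.commute)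
  also have "sqrt (s / pi) ^ d = (s / pi) powr (real d / 2)"
  proof (cases "s = 0")
    case True thus ?thesis using d by simp
  next
    case s: False
    hence "sqrt (s / pi) ^ d = sqrt (s / pi) powr real d" using assms by (simp add: powr_realpow)
    also have "\<dots> = ((s / pi) powr (1/2)) powr real d" using assms s by (simp add: powr_half_sqrt)
    finally show ?thesis by (simp add: powr_powr)
  qed
  also have "(s / pi) powr (real d / 2) = s powr (real d / 2) / pi powr (real d / 2)"
    using assms by (simp add: powr_divide)
  finally show ?thesis by (simp add: dens_def)
qed

lemma dens_has_integral:
  assumes "sqnorm d m > 0"
  shows "((\<lambda>s. dens d j k s m) has_integral kern d j k m) {0..}"
proof -
  let ?D = "(real_of_int (m j))\<^sup>2 - (real_of_int (m k))\<^sup>2"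
  have "((\<lambda>s. ?D / pi powr (real d / 2) * (s powr (real d / 2 + 1 - 1) * exp (- sqnorm d m * s)))
     has_integral ?D / pi powr (real d / 2) * (Gamma (real d / 2 + 1) / sqnorm d m powr (real d / 2 + 1))) {0..}"
    by (rule has_integral_mult_right[OF gamma_scaled]) (use assms in auto)
  moreover have "?D / pi powr (real d / 2) * (Gamma (real d / 2 + 1) / sqnorm d m powr (real d / 2 + 1)) = kern d j k m"
  proof -
    have "Gamma ((real d + 2) / 2) = Gamma (real d / 2 + 1)" by (simp add: add_divide_distrib)
    thus ?thesis unfolding kern_def eucl_norm_pow[OF assms] riesz_const_def by simp
  qed
  moreover have "d \<noteq> 0" using assms by (cases d) (auto simp: sqnorm_def)
  ultimately show ?thesis by (subst has_integral_cong[OF dens_powr]) auto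
qed

lemma near_has_integral:
  assumes "sqnorm d m > 0"
  shows "((\<lambda>s. if s \<le> 1 then 0 else dens d j k s m) has_integral near d j k m) {0..}"
proof -
  have "((\<lambda>s. dens d j k s m) has_integral far d j k m) {0..1}"
    unfolding far_def by (rule integrable_integral[OF dens_integrable])
  hence "((\<lambda>s. if s \<in> {0..1} then dens d j k s m else 0) has_integral far d j k m) {0..}"
    by (subst has_integral_restrict) auto
  from has_integral_diff[OF dens_has_integral[OF assms] this]
  have "((\<lambda>s. dens d j k s m - (if s \<in> {0..1} then dens d j k s m else 0)) has_integral near d j k m) {0..}"
    by (simp add: near_def)
  thus ?thesis by (rule has_integral_eq[rotated]) auto
qed

text \<open>The integrand has the sign of \<open>m\<^sub>j\<^sup>2 - m\<^sub>k\<^sup>2\<close> for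
  every \<open>s\<close>.\<close>
lemma near_mono_sign:
  assumes "sqnorm d m > 0"
  shows "\<bar>m k\<bar> \<le> \<bar>m j\<bar> \<Longrightarrow> near d j k m \<ge> 0" "\<bar>m j\<bar> \<le> \<bar>m k\<bar> \<Longrightarrow> near d j k m \<le> 0"
proof -
  have P: "(\<Prod>i\<in>{1..d}. gauss s (m i)) \<ge> 0" if "s \<ge> 0" for s by (rule prod_nonneg) (use that gauss_nonneg in auto)
  {
    assume "\<bar>m k\<bar> \<le> \<bar>m j\<bar>"
    hence "\<bar>real_of_int (m k)\<bar> \<le> \<bar>real_of_int (m j)\<bar>" by linarith
    hence "(real_of_int (m k))\<^sup>2 \<le> (real_of_int (m j))\<^sup>2" by (simp only: abs_le_square_iff)
    hence "dens d j k s m \<ge> 0" if "s \<ge> 0" for s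
      unfolding dens_def by (intro mult_nonneg_nonneg P that) simp
    thus "near d j k m \<ge> 0" by (intro has_integral_nonneg[OF near_has_integral[OF assms]]) simp
  next
    assume "\<bar>m j\<bar> \<le> \<bar>m k\<bar>"
    hence "\<bar>real_of_int (m j)\<bar> \<le> \<bar>real_of_int (m k)\<bar>" by linarith
    hence "(real_of_int (m j))\<^sup>2 \<le> (real_of_int (m k))\<^sup>2" by (simp only: abs_le_square_iff)
    hence "dens d j k s m \<le> 0" if "s \<ge> 0" for s
      unfolding dens_def by (intro mult_nonpos_nonneg P that) simp
    thus "near d j k m \<le> 0"
      by (intro has_integral_le[OF near_has_integral[OF assms] has_integral_0]) simp
  }
qed

text \<open>For \<open>n = |m|\<^sup>2 \<ge> N\<^sub>0\<close> the Gaussian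
  \<open>e\<^sup>-\<^sup>n\<^sup>s\<close> is split at \<open>s = 7\<close>: beyond it part of the
  decay in \<open>n\<close> is traded for \<open>e^(-N\<^sub>0 s)\<close>, before it the factor
  \<open>e^(-10000 s)\<close> can be afforded at a constant price. Both resulting integrals are
  Gamma integrals, so that \<open>c\<^sub>d\<close> appears with the factors
  \<open>N\<^sub>0^(-d/2)\<close> and \<open>10000^(-d/2)\<close>. The number \<open>7\<close> makes
  the remaining sum over the lattice cost only \<open>(65/63)\<^sup>d\<close>, and
  \<open>10000\<close> outweighs the cost \<open>5\<^sup>d\<close> in the second term.\<close>
lemma near_le:
  assumes jk: "j \<in> {1..d}" "k \<in> {1..d}" and N0: "N0 \<ge> 1" and N: "sqnorm d m \<ge> N0"
  shows "\<bar>near d j k m\<bar> \<le> riesz_const d * (exp (7 * N0) / N0 powr (real d / 2 + 1) * (sqnorm d m * exp (- 7 * sqnorm d m))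
     + exp 70000 / 10000 powr (real d / 2 + 1) * (sqnorm d m * exp (- sqnorm d m)))"
proof -
  define n where "n = sqnorm d m"
  have n: "n > 0" using N N0 by (simp add: n_def)
  define P where "P = pi powr (real d / 2)"
  have P: "P > 0" by (simp add: P_def)
  define A where "A = n / P * exp (7 * N0 - 7 * n)"
  define B where "B = n / P * exp (70000 - n)"
  let ?g = "\<lambda>s. A * (s powr (real d / 2 + 1 - 1) * exp (- N0 * s)) + B * (s powr (real d / 2 + 1 - 1) * exp (- 10000 * s))"
  let ?I = "A * (Gamma (real d / 2 + 1) / N0 powr (real d / 2 + 1)) + B * (Gamma (real d / 2 + 1) / 10000 powr (real d / 2 + 1))"
  have g: "(?g has_integral ?I) {0..}"
    by (intro has_integral_add has_integral_mult_right gamma_scaled) (use N0 in auto)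
  have le: "\<bar>if s \<le> 1 then 0 else dens d j k s m\<bar> \<le> ?g s" if s: "s \<in> {0..}" for s
  proof (cases "s \<le> 1")
    case True thus ?thesis using n P by (simp add: A_def B_def)
  next
    case False
    have e: "exp (- n * s) \<le> exp (7 * N0 - 7 * n) * exp (- N0 * s) + exp (70000 - n) * exp (- 10000 * s)"
    proof (cases "s \<ge> 7")
      case True
      have "(n - N0) * 7 \<le> (n - N0) * s" by (rule mult_left_mono[OF True]) (use N in \<open>simp add: n_def\<close>)
      hence "- n * s \<le> (7 * N0 - 7 * n) + - N0 * s" by (simp add: algebra_simps)
      hence "exp (- n * s) \<le> exp (7 * N0 - 7 * n) * exp (- N0 * s)" by (simp only: exp_add[symmetric] exp_le_cancel_iff)
      moreover have "0 \<le> exp (70000 - n) * exp (- 10000 * s)" by simp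
      ultimately show ?thesis by linarith
    next
      case s7: False
      have "n * 1 \<le> n * s" by (rule mult_left_mono) (use n False in auto)
      hence "- n * s \<le> (70000 - n) + - 10000 * s" using s7 by simp
      hence "exp (- n * s) \<le> exp (70000 - n) * exp (- 10000 * s)" by (simp only: exp_add[symmetric] exp_le_cancel_iff)
      moreover have "0 \<le> exp (7 * N0 - 7 * n) * exp (- N0 * s)" by simp
      ultimately show ?thesis by linarith
    qed
    have "\<bar>dens d j k s m\<bar> = \<bar>(real_of_int (m j))\<^sup>2 - (real_of_int (m k))\<^sup>2\<bar> / P * (s powr (real d / 2) * exp (- n * s))"
      using s P jk by (subst dens_powr) (auto simp: abs_mult P_def n_def)
    also have "\<dots> \<le> n / P * (s powr (real d / 2) * (exp (7 * N0 - 7 * n) * exp (- N0 * s) + exp (70000 - n) * exp (- 10000 * s)))"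
      using coord_diff_le_sqnorm[OF jk, of m] P e
      by (intro mult_mono divide_right_mono) (auto simp: n_def[symmetric] intro!: mult_nonneg_nonneg)
    also have "\<dots> = ?g s" by (simp add: A_def B_def algebra_simps)
    finally show ?thesis using False by simp
  qed
  have sq: "sqnorm d m > 0" using n by (simp add: n_def)
  have "near d j k m \<le> ?I"
    by (rule has_integral_le[OF near_has_integral[OF sq] g]) (rule abs_le_D1[OF le])
  moreover have "- ?I \<le> near d j k m"
    by (rule has_integral_le[OF has_integral_neg[OF g] near_has_integral[OF sq]])
       (subst minus_le_iff, rule abs_le_D2[OF le])
  ultimately have "\<bar>near d j k m\<bar> \<le> ?I" by (simp add: abs_le_iff)
  also have "?I = riesz_const d * (exp (7 * N0) / N0 powr (real d / 2 + 1) * (n * exp (- 7 * n))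
     + exp 70000 / 10000 powr (real d / 2 + 1) * (n * exp (- n)))"
  proof -
    have "Gamma ((real d + 2) / 2) = Gamma (real d / 2 + 1)" by (simp add: add_divide_distrib)
    hence rc: "riesz_const d = Gamma (real d / 2 + 1) / P" by (simp add: riesz_const_def P_def)
    have "exp (7 * N0 - 7 * n) = exp (7 * N0) * exp (- 7 * n)" "exp (70000 - n) = exp 70000 * exp (- n)"
      by (simp_all only: exp_add[symmetric] mult_minus_left diff_conv_add_uminus)
    thus ?thesis unfolding rc A_def B_def by (simp add: algebra_simps)
  qed
  finally show ?thesis by (simp add: n_def)
qed

lemma sum_gauss_Zd_le:
  assumes F: "finite F" "F \<subseteq> Zd d" and c: "c > 0" and r: "exp (- c) \<le> \<rho>" "\<rho> < 1"
  shows "(\<Sum>m\<in>F. exp (- c * sqnorm d m)) \<le> ((1 + \<rho>) / (1 - \<rho>)) ^ d"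
proof -
  have r0: "\<rho> \<ge> 0" using r(1) by (smt (verit) exp_gt_zero)
  have "exp (- c * sqnorm d m) = (\<Prod>i\<in>{1..d}. exp (- c * (real_of_int (m i))\<^sup>2))" for m
    by (simp add: sqnorm_def exp_sum[symmetric] sum_distrib_left sum_negf)
  moreover have "(\<Sum>m\<in>F. \<Prod>i\<in>{1..d}. exp (- c * (real_of_int (m i))\<^sup>2)) \<le> ((1 + \<rho>) / (1 - \<rho>)) ^ d"
  proof (rule sum_prod_Zd_le[OF F])
    fix A :: "int set" assume A: "finite A"
    have "exp (- c * (real_of_int a)\<^sup>2) \<le> \<rho> ^ nat \<bar>a\<bar>" for a
    proof -
      have "\<bar>a\<bar> * 1 \<le> \<bar>a\<bar> * \<bar>a\<bar>" by (cases "a = 0") (simp, rule mult_left_mono, auto)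
      hence "\<bar>real_of_int a\<bar> \<le> (real_of_int a)\<^sup>2" by (simp add: power2_eq_square flip: of_int_abs of_int_mult)
      hence "c * \<bar>real_of_int a\<bar> \<le> c * (real_of_int a)\<^sup>2" using c by (intro mult_left_mono) auto
      hence "exp (- c * (real_of_int a)\<^sup>2) \<le> exp (- (c * \<bar>real_of_int a\<bar>))" by simp
      also have "\<dots> = exp (- c) ^ nat \<bar>a\<bar>" by (simp add: exp_of_nat_mult[symmetric] mult.commute)
      also have "\<dots> \<le> \<rho> ^ nat \<bar>a\<bar>" by (rule power_mono[OF r(1)]) simp
      finally show ?thesis .
    qed
    hence "(\<Sum>a\<in>A. exp (- c * (real_of_int a)\<^sup>2)) \<le> (\<Sum>a\<in>A. \<rho> ^ nat \<bar>a\<bar>)" by (rule sum_mono)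
    also have "\<dots> \<le> (1 + \<rho>) / (1 - \<rho>)" by (rule sum_geometric_int_le[OF r0 r(2) A])
    finally show "(\<Sum>a\<in>A. exp (- c * (real_of_int a)\<^sup>2)) \<le> (1 + \<rho>) / (1 - \<rho>)" .
  qed auto
  ultimately show ?thesis by simp
qed

lemma sum_near_le:
  assumes jk: "j \<in> {1..d}" "k \<in> {1..d}" and N0: "N0 \<ge> 1" and F: "finite F" "F \<subseteq> Zd d"
    and N: "\<And>m. m \<in> F \<Longrightarrow> sqnorm d m \<ge> N0"
  shows "(\<Sum>m\<in>F. \<bar>near d j k m\<bar>) \<le> riesz_const d * (exp (7 * N0) * ((65/63) / sqrt N0) ^ d + 2 * exp 70000 * (1/20) ^ d)"
proof -
  have c0: "riesz_const d \<ge> 0" using riesz_const_pos[of d] by simp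
  define A where "A = exp (7 * N0) / N0 powr (real d / 2 + 1)"
  define B where "B = exp 70000 / (10000::real) powr (real d / 2 + 1)"
  have AB: "A \<ge> 0" "B \<ge> 0" by (auto simp: A_def B_def)
  have e2: "(2::real) \<le> exp 1" using exp_ge_add_one_self[of 1] by simp
  have t1: "(\<Sum>m\<in>F. sqnorm d m * exp (- 7 * sqnorm d m)) \<le> (65/63) ^ d"
  proof -
    have "sqnorm d m * exp (- 7 * sqnorm d m) \<le> exp (- 6 * sqnorm d m)" for m
    proof -
      have "sqnorm d m \<le> exp (sqnorm d m)" using exp_ge_add_one_self[of "sqnorm d m"] by linarith
      hence "sqnorm d m * exp (- 7 * sqnorm d m) \<le> exp (sqnorm d m) * exp (- 7 * sqnorm d m)" by (rule mult_right_mono) simp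
      thus ?thesis by (simp add: exp_add[symmetric])
    qed
    hence "(\<Sum>m\<in>F. sqnorm d m * exp (- 7 * sqnorm d m)) \<le> (\<Sum>m\<in>F. exp (- 6 * sqnorm d m))" by (rule sum_mono)
    also have "\<dots> \<le> ((1 + 1/64) / (1 - 1/64)) ^ d"
    proof (rule sum_gauss_Zd_le[OF F])
      have "(2::real) ^ 6 \<le> exp 1 ^ 6" by (rule power_mono[OF e2]) simp
      also have "\<dots> = exp 6" by (simp add: exp_of_nat_mult[symmetric])
      finally show "exp (- 6::real) \<le> 1/64" by (simp add: exp_minus field_simps)
    qed auto
    finally show ?thesis by simp
  qed
  have t2: "(\<Sum>m\<in>F. sqnorm d m * exp (- sqnorm d m)) \<le> 2 * 5 ^ d"
  proof -
    have "sqnorm d m * exp (- sqnorm d m) \<le> 2 * exp (- (1/2) * sqnorm d m)" for m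
    proof -
      have "sqnorm d m / 2 \<le> exp (sqnorm d m / 2)" using exp_ge_add_one_self[of "sqnorm d m / 2"] by linarith
      hence "sqnorm d m * exp (- sqnorm d m) \<le> 2 * exp (sqnorm d m / 2) * exp (- sqnorm d m)" by (intro mult_right_mono) auto
      also have "\<dots> = 2 * exp (- (1/2) * sqnorm d m)" by (simp add: mult.assoc exp_add[symmetric])
      finally show ?thesis .
    qed
    hence "(\<Sum>m\<in>F. sqnorm d m * exp (- sqnorm d m)) \<le> (\<Sum>m\<in>F. 2 * exp (- (1/2) * sqnorm d m))" by (rule sum_mono)
    also have "\<dots> = 2 * (\<Sum>m\<in>F. exp (- (1/2) * sqnorm d m))" by (simp add: sum_distrib_left)
    also have "(\<Sum>m\<in>F. exp (- (1/2) * sqnorm d m)) \<le> ((1 + 2/3) / (1 - 2/3)) ^ d"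
    proof (rule sum_gauss_Zd_le[OF F])
      have "3/2 \<le> exp (1/2::real)" using exp_ge_add_one_self[of "1/2::real"] by simp
      thus "exp (- (1/2)::real) \<le> 2/3" by (simp add: exp_minus field_simps)
    qed auto
    finally show ?thesis by simp
  qed
  have pw: "x powr (real d / 2 + 1) \<ge> sqrt x ^ d" if "x \<ge> 1" for x
  proof -
    have "sqrt x ^ d = sqrt x powr real d" using that by (simp add: powr_realpow)
    also have "\<dots> = x powr (real d / 2)" using that by (simp add: powr_half_sqrt[symmetric] powr_powr)
    also have "\<dots> \<le> x powr (real d / 2 + 1)" by (rule powr_mono) (use that in auto)
    finally show ?thesis .
  qed
  have "(\<Sum>m\<in>F. \<bar>near d j k m\<bar>) \<le> (\<Sum>m\<in>F. riesz_const d * (A * (sqnorm d m * exp (- 7 * sqnorm d m)) + B * (sqnorm d m * exp (- sqnorm d m))))"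
    unfolding A_def B_def by (intro sum_mono near_le jk N0 N)
  also have "\<dots> = riesz_const d * (A * (\<Sum>m\<in>F. sqnorm d m * exp (- 7 * sqnorm d m)) + B * (\<Sum>m\<in>F. sqnorm d m * exp (- sqnorm d m)))"
    by (simp only: sum_distrib_left[symmetric] sum.distrib)
  also have "\<dots> \<le> riesz_const d * (A * (65/63) ^ d + B * (2 * 5 ^ d))"
    by (intro mult_left_mono add_mono t1 t2 AB c0)
  also have "\<dots> \<le> riesz_const d * ((exp (7 * N0) / sqrt N0 ^ d) * (65/63) ^ d + (exp 70000 / sqrt 10000 ^ d) * (2 * 5 ^ d))"
  proof -
    have "A \<le> exp (7 * N0) / sqrt N0 ^ d" unfolding A_def
      by (intro divide_left_mono pw N0 mult_pos_pos) (use N0 in auto)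
    moreover have "B \<le> exp 70000 / sqrt 10000 ^ d" unfolding B_def by (intro divide_left_mono pw) auto
    ultimately show ?thesis by (intro mult_left_mono add_mono mult_right_mono c0) auto
  qed
  also have "\<dots> = riesz_const d * (exp (7 * N0) * ((65/63) / sqrt N0) ^ d + 2 * exp 70000 * (1/20) ^ d)"
  proof -
    have s: "sqrt (10000::real) = 100" by (rule real_sqrt_unique) auto
    have q: "(5::real) ^ d / 100 ^ d = (1/20) ^ d" by (simp add: power_divide[symmetric])
    have g: "(E / h) * (2 * F) = 2 * E * (F / h)" for E h F :: real by simp
    have "(exp 70000 / sqrt 10000 ^ d) * (2 * 5 ^ d) = 2 * exp 70000 * (1/20 :: real) ^ d"
      unfolding s g q ..
    moreover have "(exp (7 * N0) / sqrt N0 ^ d) * (65/63) ^ d = exp (7 * N0) * ((65/63) / sqrt N0) ^ d"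
      by (simp only: power_divide[of "65/63" "sqrt N0"] times_divide_eq_left times_divide_eq_right)
    ultimately show ?thesis by (simp only:)
  qed
  finally show ?thesis .
qed

definition near_const :: real where "near_const = exp 35 + 2 * exp 70000"

text \<open>Squared norms are integers, so the points outside the shells of \<open>1\<close> and
  \<open>2\<close> satisfy \<open>|m|\<^sup>2 \<ge> 3\<close>, and \<open>(65/63)/sqrt 3\<close> is
  below \<open>(19/20)/sqrt 2\<close>. For the lower bound on \<open>\<ell>\<^sup>p\<close> the rate
  must beat \<open>1/2\<close>, which \<open>|m|\<^sup>2 \<ge> 5\<close> achieves.\<close>
lemma sum_near_le_3_5:
  assumes jk: "j \<in> {1..d}" "k \<in> {1..d}" and F: "finite F" "F \<subseteq> Zd d"
  shows "(\<And>m. m \<in> F \<Longrightarrow> sqnorm d m \<ge> 3) \<Longrightarrow>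
      (\<Sum>m\<in>F. \<bar>near d j k m\<bar>) \<le> near_const * riesz_const d * ((19/20) / sqrt 2) ^ d"
    and "(\<And>m. m \<in> F \<Longrightarrow> sqnorm d m \<ge> 5) \<Longrightarrow>
      (\<Sum>m\<in>F. \<bar>near d j k m\<bar>) \<le> near_const * riesz_const d * ((19/20) / 2) ^ d"
proof -
  have *: "(\<Sum>m\<in>F. \<bar>near d j k m\<bar>) \<le> near_const * riesz_const d * b ^ d"
    if N: "\<And>m. m \<in> F \<Longrightarrow> sqnorm d m \<ge> N0" and N0: "1 \<le> N0" "N0 \<le> 5" and b: "(65/63) / sqrt N0 \<le> b" "1/20 \<le> b" for N0 b
  proof -
    have c0: "riesz_const d \<ge> 0" using riesz_const_pos[of d] by simp
    have "(\<Sum>m\<in>F. \<bar>near d j k m\<bar>) \<le> riesz_const d * (exp (7 * N0) * ((65/63) / sqrt N0) ^ d + 2 * exp 70000 * (1/20) ^ d)"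
      by (rule sum_near_le[OF jk N0(1) F N])
    also have "\<dots> \<le> riesz_const d * (exp 35 * b ^ d + 2 * exp 70000 * b ^ d)"
      by (intro mult_left_mono add_mono mult_mono power_mono b c0) (use N0 in auto)
    finally show ?thesis by (simp add: near_const_def algebra_simps)
  qed
  have a: "(65/63) / sqrt x \<le> y" if "x > 0" "y > 0" "(65/63)\<^sup>2 \<le> y\<^sup>2 * x" for x y :: real
  proof -
    have "sqrt ((65/63)\<^sup>2) \<le> sqrt (y\<^sup>2 * x)" by (rule real_sqrt_le_mono) (rule that)
    moreover have "sqrt ((65/63)\<^sup>2) = (65/63::real)" by (simp only: real_sqrt_abs)
    ultimately show ?thesis using that by (simp add: real_sqrt_mult field_simps)
  qed
  have s2: "((19/20) / sqrt 2)\<^sup>2 = (361/800::real)" by (simp add: power_divide)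
  have s2': "(1/20::real) \<le> (19/20) / sqrt 2" using sqrt2_less_2 by (simp add: field_simps)
  {
    assume "\<And>m. m \<in> F \<Longrightarrow> sqnorm d m \<ge> 3"
    from *[OF this _ _ a s2'] show "(\<Sum>m\<in>F. \<bar>near d j k m\<bar>) \<le> near_const * riesz_const d * ((19/20) / sqrt 2) ^ d"
      unfolding s2 by (simp add: power2_eq_square)
  next
    assume "\<And>m. m \<in> F \<Longrightarrow> sqnorm d m \<ge> 5"
    from *[OF this _ _ a, of "(19/20)/2"] show "(\<Sum>m\<in>F. \<bar>near d j k m\<bar>) \<le> near_const * riesz_const d * ((19/20) / 2) ^ d"
      by (simp add: power2_eq_square)
  }
qed

section \<open>The innermost shells and the growth of the constant\<close>

text \<open>The quotient of a power and \<open>c\<^sub>d\<close> decreases from \<open>d\<close> to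
  \<open>d + 2\<close> once \<open>d\<close> is large, by the functional equation of the Gamma
  function.\<close>
lemma power_le_riesz_const:
  assumes "B \<ge> 0"
  shows "\<exists>M>0. \<forall>d. B ^ d \<le> M * riesz_const d"
proof -
  define A where "A = B * sqrt pi"
  have A: "A \<ge> 0" using assms by (simp add: A_def)
  \<comment> \<open>\<open>B\<^sup>d / c\<^sub>d\<close>\<close>
  define a where "a d = A ^ d / Gamma (real d / 2 + 1)" for d :: nat
  have G: "Gamma (real d / 2 + 1) > 0" for d :: nat by (rule Gamma_real_pos) simp
  have a0: "a d \<ge> 0" for d using A G[of d] by (simp add: a_def)
  obtain D :: nat where D: "real D \<ge> 2 * A\<^sup>2" using real_arch_simple by blast
  define M where "M = 1 + (\<Sum>d\<le>D + 2. a d)"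
  have aM: "a d \<le> M" for d
  proof (induction d rule: less_induct)
    case (less d)
    show ?case
    proof (cases "d \<le> D + 2")
      case True
      have "a d \<le> (\<Sum>d\<le>D + 2. a d)" by (rule member_le_sum) (use True a0 in auto)
      thus ?thesis by (simp add: M_def)
    next
      case False
      define e where "e = d - 2"
      have e: "d = e + 2" "e < d" "e > D" using False by (auto simp: e_def)
      have "Gamma ((real e / 2 + 1) + 1) = (real e / 2 + 1) * Gamma (real e / 2 + 1)"
        by (rule Gamma_plus1) (auto simp: nonpos_Ints_def)
      hence "Gamma (real d / 2 + 1) = (real e / 2 + 1) * Gamma (real e / 2 + 1)"
        by (simp add: e(1) add_divide_distrib algebra_simps)
      hence "a d = a e * (A\<^sup>2 / (real e / 2 + 1))" by (simp add: a_def e(1) power_add power2_eq_square mult_ac)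
      also have "\<dots> \<le> a e * 1"
      proof (rule mult_left_mono[OF _ a0])
        have "real D \<le> real e" using e by simp
        hence "A\<^sup>2 \<le> real e / 2 + 1" using D by simp
        thus "A\<^sup>2 / (real e / 2 + 1) \<le> 1" by simp
      qed
      also have "a e \<le> M" by (rule less.IH[OF e(2)])
      finally show ?thesis by simp
    qed
  qed
  have "B ^ d \<le> M * riesz_const d" for d
  proof -
    have "riesz_const d = Gamma (real d / 2 + 1) / sqrt pi ^ d"
    proof -
      have "sqrt pi ^ d = pi powr (real d / 2)"
        by (simp add: powr_half_sqrt[symmetric] powr_powr flip: powr_realpow)
      moreover have "Gamma ((real d + 2) / 2) = Gamma (real d / 2 + 1)" by (simp add: add_divide_distrib)
      ultimately show ?thesis by (simp add: riesz_const_def)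
    qed
    moreover have "A ^ d \<le> M * Gamma (real d / 2 + 1)"
      using aM[of d] G[of d] by (simp add: a_def pos_divide_le_eq)
    moreover have "A ^ d = B ^ d * sqrt pi ^ d" by (simp add: A_def power_mult_distrib)
    ultimately show ?thesis by (simp add: pos_le_divide_eq)
  qed
  moreover have "M > 0" unfolding M_def by (intro add_pos_nonneg sum_nonneg a0) simp
  ultimately show ?thesis by blast
qed

definition shell :: "nat \<Rightarrow> (nat \<Rightarrow> int) set" where
  "shell d = {m \<in> Zd d. sqnorm d m = 1 \<or> sqnorm d m = 2}"

lemma shell_subset_Zbox: "shell d \<subseteq> Zbox d (\<lambda>_. {-1..1})"
proof
  fix m assume m: "m \<in> shell d"
  have "m i \<in> {-1..1}" if "i \<in> {1..d}" for i
  proof (rule ccontr)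
    assume "m i \<notin> {-1..1}"
    hence "2\<^sup>2 \<le> \<bar>m i\<bar>\<^sup>2" by (intro power_mono) auto
    hence "4 \<le> (m i)\<^sup>2" by simp
    hence "real_of_int 4 \<le> real_of_int ((m i)\<^sup>2)" by (simp only: of_int_le_iff)
    thus False using m coord_le_sqnorm[OF that, of m] by (auto simp: shell_def)
  qed
  thus "m \<in> Zbox d (\<lambda>_. {-1..1})" using m by (auto simp: shell_def Zbox_def)
qed

lemma finite_shell: "finite (shell d)"
  using finite_Zbox[of d "\<lambda>_. {-1..1}"] shell_subset_Zbox finite_subset by blast

lemma sum_squares_one_elem:
  fixes m :: "nat \<Rightarrow> int"
  assumes "finite I" "a \<in> I" "m a \<noteq> 0" "(\<Sum>i\<in>I. (m i)\<^sup>2) \<le> 3"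
  shows "(m a)\<^sup>2 = 1" "(\<Sum>i\<in>I - {a}. (m i)\<^sup>2) = (\<Sum>i\<in>I. (m i)\<^sup>2) - 1" "m a \<in> {-1, 1}"
proof -
  have s: "(\<Sum>i\<in>I. (m i)\<^sup>2) = (m a)\<^sup>2 + (\<Sum>i\<in>I - {a}. (m i)\<^sup>2)" using assms by (simp add: sum.remove)
  have r: "(\<Sum>i\<in>I - {a}. (m i)\<^sup>2) \<ge> 0" by (rule sum_nonneg) simp
  have "\<bar>m a\<bar> = 1"
  proof (rule ccontr)
    assume "\<bar>m a\<bar> \<noteq> 1"
    hence "2\<^sup>2 \<le> \<bar>m a\<bar>\<^sup>2" using assms(3) by (intro power_mono) auto
    thus False using s r assms(4) by simp
  qed
  thus 1: "m a \<in> {-1, 1}" by auto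
  thus "(m a)\<^sup>2 = 1" by auto
  thus "(\<Sum>i\<in>I - {a}. (m i)\<^sup>2) = (\<Sum>i\<in>I. (m i)\<^sup>2) - 1" using s by simp
qed

definition spike :: "nat \<Rightarrow> int \<Rightarrow> nat \<Rightarrow> int" where
  "spike a \<sigma> = (\<lambda>i. if i = a then \<sigma> else 0)"

lemma sqnorm_spike: "a \<in> {1..d} \<Longrightarrow> sqnorm d (spike a \<sigma>) = (real_of_int \<sigma>)\<^sup>2"
  unfolding sqnorm_def spike_def by (subst sum.remove[of _ a]) auto

lemma sqnorm_two_spikes:
  assumes "a \<in> {1..d}" "b \<in> {1..d}" "a \<noteq> b"
  shows "sqnorm d (spike a \<sigma> + spike b \<tau>) = (real_of_int \<sigma>)\<^sup>2 + (real_of_int \<tau>)\<^sup>2"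
proof -
  have "sqnorm d (spike a \<sigma> + spike b \<tau>) = (real_of_int \<sigma>)\<^sup>2 + (\<Sum>i\<in>{1..d} - {a}. (real_of_int ((spike a \<sigma> + spike b \<tau>) i))\<^sup>2)"
    unfolding sqnorm_def using assms by (subst sum.remove[of _ a]) (auto simp: spike_def)
  also have "(\<Sum>i\<in>{1..d} - {a}. (real_of_int ((spike a \<sigma> + spike b \<tau>) i))\<^sup>2) = (real_of_int \<tau>)\<^sup>2"
    using assms by (subst sum.remove[of _ b]) (auto simp: spike_def)
  finally show ?thesis .
qed

text \<open>On the first shell only the four points \<open>\<plusminus>e\<^sub>j,
  \<plusminus>e\<^sub>k\<close> have a nonzero kernel, of absolute value \<open>c\<^sub>d\<close>.
  On the second, these are the \<open>8(d-2)\<close> points with one nonzero coordinate in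
  \<open>{j, k}\<close> and the other outside, of absolute value \<open>c\<^sub>d / 2^(d/2 +
  1)\<close>.\<close>
lemma shell_kern_sum:
  assumes jk: "j \<in> {1..d}" "k \<in> {1..d}" "j \<noteq> k"
  shows "(\<Sum>m\<in>shell d. \<bar>kern d j k m\<bar>) = 4 * riesz_const d * (1 + (real d - 2) / 2 powr (real d / 2))"
proof -
  define P1 where "P1 = ({j, k} \<times> {-1, 1 :: int})"
  define P2 where "P2 = ({j, k} \<times> {-1, 1 :: int}) \<times> (({1..d} - {j, k}) \<times> {-1, 1 :: int})"
  define f1 where "f1 = (\<lambda>(a, \<sigma>). spike a \<sigma>)"
  define f2 where "f2 = (\<lambda>((a, \<sigma>), (b, \<tau>)). spike a \<sigma> + spike b \<tau>)"
  have fin: "finite P1" "finite P2" by (auto simp: P1_def P2_def)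
  have i1: "inj_on f1 P1"
    by (auto simp: inj_on_def P1_def f1_def spike_def fun_eq_iff split: if_splits)
  have i2: "inj_on f2 P2"
  proof (rule inj_onI)
    fix u v assume u: "u \<in> P2" and v: "v \<in> P2" and e: "f2 u = f2 v"
    obtain a \<sigma> b \<tau> where u': "u = ((a, \<sigma>), (b, \<tau>))" by (metis surj_pair)
    obtain a' \<sigma>' b' \<tau>' where v': "v = ((a', \<sigma>'), (b', \<tau>'))" by (metis surj_pair)
    have E: "spike a \<sigma> i + spike b \<tau> i = spike a' \<sigma>' i + spike b' \<tau>' i" for i
      using e unfolding u' v' f2_def by (auto simp: fun_eq_iff)
    have "a = a'" "\<sigma> = \<sigma>'" "b = b'" "\<tau> = \<tau>'"
      using u v E[of a] E[of a'] E[of b] E[of b'] unfolding u' v' P2_def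
      by (auto simp: spike_def split: if_splits)
    thus "u = v" by (simp add: u' v')
  qed
  have k1: "\<bar>kern d j k (f1 u)\<bar> = riesz_const d" if "u \<in> P1" for u
  proof -
    obtain a \<sigma> where "u = (a, \<sigma>)" by (cases u)
    hence u: "u = (a, \<sigma>)" "a \<in> {j, k}" "\<sigma> \<in> {-1, 1}" using that by (auto simp: P1_def)
    have sq: "sqnorm d (f1 u) = 1" using u jk by (auto simp: f1_def sqnorm_spike)
    hence "eucl_norm d (f1 u) ^ (d + 2) = 1" using eucl_norm_pow[of d "f1 u"] by simp
    moreover have "\<bar>(real_of_int (f1 u j))\<^sup>2 - (real_of_int (f1 u k))\<^sup>2\<bar> = 1"
      using u jk by (auto simp: f1_def spike_def)
    ultimately show ?thesis using riesz_const_pos[of d] unfolding kern_def by (simp only: abs_mult abs_divide)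
  qed
  have k2: "\<bar>kern d j k (f2 u)\<bar> = riesz_const d / 2 powr (real d / 2 + 1)" if "u \<in> P2" for u
  proof -
    obtain a \<sigma> b \<tau> where "u = ((a, \<sigma>), (b, \<tau>))" by (metis surj_pair)
    hence u: "u = ((a, \<sigma>), (b, \<tau>))" "a \<in> {j, k}" "\<sigma> \<in> {-1, 1}" "b \<in> {1..d} - {j, k}" "\<tau> \<in> {-1, 1}"
      using that by (auto simp: P2_def)
    have sq: "sqnorm d (f2 u) = 2" using u jk by (auto simp: f2_def sqnorm_two_spikes)
    hence "eucl_norm d (f2 u) ^ (d + 2) = 2 powr (real d / 2 + 1)" using eucl_norm_pow[of d "f2 u"] by simp
    moreover have "\<bar>(real_of_int (f2 u j))\<^sup>2 - (real_of_int (f2 u k))\<^sup>2\<bar> = 1"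
      using u jk by (auto simp: f2_def spike_def)
    ultimately show ?thesis using riesz_const_pos[of d] unfolding kern_def by (simp only: abs_mult abs_divide) simp
  qed
  have sq1: "sqnorm d m = 1" if "m \<in> f1 ` P1" for m using that jk by (auto simp: f1_def P1_def sqnorm_spike)
  have sq2: "sqnorm d m = 2" if m: "m \<in> f2 ` P2" for m
  proof -
    obtain u where u: "u \<in> P2" "m = f2 u" using m by blast
    obtain a \<sigma> b \<tau> where u0: "u = ((a, \<sigma>), (b, \<tau>))" by (metis surj_pair)
    hence "a \<in> {1..d}" "b \<in> {1..d}" "a \<noteq> b" "\<sigma> \<in> {-1, 1}" "\<tau> \<in> {-1, 1}"
      using u jk by (auto simp: P2_def)
    thus ?thesis using sqnorm_two_spikes[of a d b \<sigma> \<tau>] u u0 by (auto simp: f2_def)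
  qed
  have z1: "m \<in> Zd d" if "m \<in> f1 ` P1" for m using that jk by (auto simp: f1_def P1_def spike_def Zd_def)
  have z2: "m \<in> Zd d" if "m \<in> f2 ` P2" for m using that jk by (auto simp: f2_def P2_def spike_def Zd_def)
  have sub1: "f1 ` P1 \<subseteq> shell d" using sq1 z1 unfolding shell_def by blast
  have sub2: "f2 ` P2 \<subseteq> shell d" using sq2 z2 unfolding shell_def by blast
  have disj: "f1 ` P1 \<inter> f2 ` P2 = {}" using sq1 sq2 by force
  have zero: "kern d j k m = 0" if m: "m \<in> shell d" "m \<notin> f1 ` P1 \<union> f2 ` P2" for m
  proof (rule ccontr)
    assume "kern d j k m \<noteq> 0"
    hence ne: "(real_of_int (m j))\<^sup>2 \<noteq> (real_of_int (m k))\<^sup>2" by (auto simp: kern_def)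
    then obtain a where a: "a \<in> {j, k}" "m a \<noteq> 0" by (cases "m j = 0") auto
    have aI: "a \<in> {1..d}" using a jk by auto
    define n where "n = (\<Sum>i\<in>{1..d}. (m i)\<^sup>2)"
    have nr: "sqnorm d m = real_of_int n" unfolding n_def by (rule sqnorm_int)
    have "real_of_int n = 1 \<or> real_of_int n = 2" using m(1) unfolding shell_def nr[symmetric] by blast
    hence n: "n = 1 \<or> n = 2" by linarith
    note A = sum_squares_one_elem[of "{1..d}" a m, folded n_def, OF _ aI a(2)]
    have mz: "m i = 0" if "i \<notin> {1..d}" for i using that m(1) by (auto simp: shell_def Zd_def)
    show False
    proof (cases "n = 1")
      case True
      hence "(\<Sum>i\<in>{1..d} - {a}. (m i)\<^sup>2) = 0" using A by simp
      hence "m i = 0" if "i \<noteq> a" for i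
        using that mz[of i] by (cases "i \<in> {1..d}") (auto simp: sum_nonneg_eq_0_iff)
      hence "m = f1 (a, m a)" by (auto simp: f1_def spike_def)
      moreover have "(a, m a) \<in> P1" using a A n True by (auto simp: P1_def)
      ultimately show False using m(2) by blast
    next
      case False
      hence n2: "n = 2" using n by simp
      have s1: "(\<Sum>i\<in>{1..d} - {a}. (m i)\<^sup>2) = 1" using A n2 by simp
      then obtain b where b: "b \<in> {1..d} - {a}" "m b \<noteq> 0"
        by (metis (no_types, lifting) power_zero_numeral sum.neutral zero_neq_one)
      note B = sum_squares_one_elem[of "{1..d} - {a}" b m, unfolded s1, OF _ b]
      have "(\<Sum>i\<in>{1..d} - {a} - {b}. (m i)\<^sup>2) = 0" using B by simp
      hence z: "m i = 0" if "i \<noteq> a" "i \<noteq> b" for i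
        using that mz[of i] by (cases "i \<in> {1..d}") (auto simp: sum_nonneg_eq_0_iff)
      have bjk: "b \<notin> {j, k}"
      proof
        assume "b \<in> {j, k}"
        hence "{a, b} = {j, k}" using a b by auto
        hence "(m j)\<^sup>2 = (m k)\<^sup>2" using A(1) B(1) n2 by (auto simp: doubleton_eq_iff)
        thus False using ne by (metis of_int_power)
      qed
      have "m = f2 ((a, m a), (b, m b))" using z b by (auto simp: f2_def spike_def fun_eq_iff)
      moreover have "((a, m a), (b, m b)) \<in> P2" using a A B b n2 bjk by (auto simp: P2_def)
      ultimately show False using m(2) by blast
    qed
  qed
  have "(\<Sum>m\<in>shell d. \<bar>kern d j k m\<bar>) = (\<Sum>m\<in>f1 ` P1 \<union> f2 ` P2. \<bar>kern d j k m\<bar>)"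
    by (rule sum.mono_neutral_right[OF finite_shell]) (use sub1 sub2 zero in auto)
  also have "\<dots> = (\<Sum>m\<in>f1 ` P1. \<bar>kern d j k m\<bar>) + (\<Sum>m\<in>f2 ` P2. \<bar>kern d j k m\<bar>)"
    by (rule sum.union_disjoint) (use fin disj in auto)
  also have "\<dots> = (\<Sum>u\<in>P1. \<bar>kern d j k (f1 u)\<bar>) + (\<Sum>u\<in>P2. \<bar>kern d j k (f2 u)\<bar>)"
    by (simp add: sum.reindex i1 i2)
  also have "\<dots> = real (card P1) * riesz_const d + real (card P2) * (riesz_const d / 2 powr (real d / 2 + 1))"
    by (simp add: k1 k2)
  also have "real (card P1) = 4" using jk by (simp add: P1_def)
  also have "real (card P2) = 8 * (real d - 2)"
  proof -
    have "card ({1..d} - {j, k}) = d - 2" using jk by (subst card_Diff_subset) auto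
    moreover have "card {j, k} \<le> card {1..d}" by (rule card_mono) (use jk in auto)
    hence "d \<ge> 2" using jk by simp
    ultimately show ?thesis using jk by (simp add: P2_def card_cartesian_product of_nat_diff)
  qed
  also have "(2::real) powr (real d / 2 + 1) = 2 * 2 powr (real d / 2)" by (simp add: powr_add)
  also have "4 * riesz_const d + 8 * (real d - 2) * (riesz_const d / (2 * 2 powr (real d / 2)))
     = 4 * riesz_const d * (1 + (real d - 2) / 2 powr (real d / 2))" by (simp add: field_simps)
  finally show ?thesis .
qed

lemma abs_far_le:
  assumes "j \<in> {1..d}" "k \<in> {1..d}"
  shows "\<bar>far d j k m\<bar> \<le> sqnorm d m"
proof -
  have "norm (far d j k m) \<le> sqnorm d m * measure lborel {0..1::real}"
    unfolding far_def
  proof (rule has_integral_bound_real[OF sqnorm_nonneg finite.emptyI integrable_integral[OF dens_integrable]])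
    fix s :: real assume "s \<in> {0..1} - {}"
    hence "\<bar>dens d j k s m\<bar> \<le> \<bar>(real_of_int (m j))\<^sup>2 - (real_of_int (m k))\<^sup>2\<bar>" by (intro dens_le_coeff) auto
    thus "norm (dens d j k s m) \<le> sqnorm d m" using coord_diff_le_sqnorm[OF assms, of m] by simp
  qed
  thus ?thesis by simp
qed

lemma card_shell: "card (shell d) \<le> 3 ^ d"
proof -
  have "card (shell d) \<le> card (Zbox d (\<lambda>_. {-1..1}))" by (rule card_mono[OF finite_Zbox shell_subset_Zbox]) auto
  also have "\<dots> = 3 ^ d" by (subst card_Zbox) auto
  finally show ?thesis .
qed

text \<open>Near and far part have the same sign, so the near part is dominated by the kernel. The
  far part is at most \<open>|m|\<^sup>2 \<le> 2\<close> at each of the at most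
  \<open>3\<^sup>d\<close> points.\<close>
lemma shell_near_kern:
  assumes jk: "j \<in> {1..d}" "k \<in> {1..d}"
  shows "(\<Sum>m\<in>shell d. \<bar>near d j k m\<bar>) \<le> (\<Sum>m\<in>shell d. \<bar>kern d j k m\<bar>)"
    "(\<Sum>m\<in>shell d. \<bar>near d j k m\<bar>) \<ge> (\<Sum>m\<in>shell d. \<bar>kern d j k m\<bar>) - 2 * 3 ^ d"
proof -
  have sg: "\<bar>near d j k m\<bar> \<le> \<bar>kern d j k m\<bar>" if m: "m \<in> shell d" for m
  proof -
    have sq: "sqnorm d m > 0" using m by (auto simp: shell_def)
    have P: "(\<Prod>i\<in>{1..d}. gauss s (m i)) \<ge> 0" if "s \<ge> 0" for s by (rule prod_nonneg) (use that gauss_nonneg in auto)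
    show ?thesis
    proof (cases "\<bar>m k\<bar> \<le> \<bar>m j\<bar>")
      case True
      have "far d j k m \<ge> 0" unfolding far_def
      proof (rule integral_nonneg[OF dens_integrable])
        fix s :: real assume "s \<in> {0..1}"
        have "\<bar>real_of_int (m k)\<bar> \<le> \<bar>real_of_int (m j)\<bar>" using True by linarith
        hence "(real_of_int (m k))\<^sup>2 \<le> (real_of_int (m j))\<^sup>2" by (simp only: abs_le_square_iff)
        thus "dens d j k s m \<ge> 0" unfolding dens_def by (intro mult_nonneg_nonneg P) (use \<open>s \<in> {0..1}\<close> in auto)
      qed
      thus ?thesis using near_mono_sign(1)[OF sq True] by (simp add: near_def)
    next
      case False
      hence le: "\<bar>m j\<bar> \<le> \<bar>m k\<bar>" by simp
      have "- far d j k m \<ge> 0" unfolding far_def integral_neg[symmetric]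
      proof (rule integral_nonneg[OF integrable_neg[OF dens_integrable]])
        fix s :: real assume "s \<in> {0..1}"
        have "\<bar>real_of_int (m j)\<bar> \<le> \<bar>real_of_int (m k)\<bar>" using le by linarith
        hence "(real_of_int (m j))\<^sup>2 \<le> (real_of_int (m k))\<^sup>2" by (simp only: abs_le_square_iff)
        hence "dens d j k s m \<le> 0" unfolding dens_def by (intro mult_nonpos_nonneg P) (use \<open>s \<in> {0..1}\<close> in auto)
        thus "- dens d j k s m \<ge> 0" by simp
      qed
      thus ?thesis using near_mono_sign(2)[OF sq le] by (simp add: near_def)
    qed
  qed
  thus "(\<Sum>m\<in>shell d. \<bar>near d j k m\<bar>) \<le> (\<Sum>m\<in>shell d. \<bar>kern d j k m\<bar>)" by (rule sum_mono)
  have "(\<Sum>m\<in>shell d. \<bar>kern d j k m\<bar>) - (\<Sum>m\<in>shell d. \<bar>near d j k m\<bar>) \<le> (\<Sum>m\<in>shell d. 2)"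
    unfolding sum_subtractf[symmetric]
  proof (rule sum_mono)
    fix m assume "m \<in> shell d"
    hence "sqnorm d m \<le> 2" by (auto simp: shell_def)
    hence "\<bar>far d j k m\<bar> \<le> 2" using abs_far_le[OF jk, of m] by linarith
    thus "\<bar>kern d j k m\<bar> - \<bar>near d j k m\<bar> \<le> 2" by (simp add: near_def)
  qed
  also have "\<dots> = 2 * real (card (shell d))" by simp
  also have "real (card (shell d)) \<le> real (3 ^ d)" using card_shell[of d] by (rule of_nat_mono)
  also have "real (3 ^ d) = 3 ^ d" by simp
  finally show "(\<Sum>m\<in>shell d. \<bar>near d j k m\<bar>) \<ge> (\<Sum>m\<in>shell d. \<bar>kern d j k m\<bar>) - 2 * 3 ^ d" by simp
qed

lemma sqnorm_cases:
  assumes "m \<in> Zd d"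
  shows "m = (\<lambda>_. 0) \<or> m \<in> shell d \<or> sqnorm d m \<ge> 3"
proof -
  define n where "n = (\<Sum>i\<in>{1..d}. (m i)\<^sup>2)"
  have n: "sqnorm d m = real_of_int n" "n \<ge> 0" by (simp_all add: sqnorm_int n_def sum_nonneg)
  have "n = 0 \<or> n = 1 \<or> n = 2 \<or> n \<ge> 3" using n(2) by linarith
  thus ?thesis using assms n(1) sqnorm_eq_0[OF assms] by (auto simp: shell_def)
qed

lemma near_0: "near d j k (\<lambda>_. 0) = 0" "kern d j k (\<lambda>_. 0) = 0" "far d j k (\<lambda>_. 0) = 0"
  by (simp_all add: near_def kern_def far_def dens_def)

lemma sum_near_total:
  assumes jk: "j \<in> {1..d}" "k \<in> {1..d}" "j \<noteq> k" and F: "finite F" "F \<subseteq> Zd d"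
  shows "(\<Sum>m\<in>F. \<bar>near d j k m\<bar>) \<le> 4 * riesz_const d * (1 + (real d - 2) / 2 powr (real d / 2))
     + near_const * riesz_const d * ((19/20) / sqrt 2) ^ d"
proof -
  let ?G = "{m\<in>F. sqnorm d m \<ge> 3}"
  have "(\<Sum>m\<in>F. \<bar>near d j k m\<bar>) = (\<Sum>m\<in>F - {\<lambda>_. 0}. \<bar>near d j k m\<bar>)"
    by (rule sum.mono_neutral_right) (use F near_0 in auto)
  also have "\<dots> \<le> (\<Sum>m\<in>shell d \<union> ?G. \<bar>near d j k m\<bar>)"
    by (rule sum_mono2) (use F finite_shell sqnorm_cases in auto)
  also have "\<dots> = (\<Sum>m\<in>shell d. \<bar>near d j k m\<bar>) + (\<Sum>m\<in>?G. \<bar>near d j k m\<bar>)"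
    by (rule sum.union_disjoint) (use F finite_shell in \<open>auto simp: shell_def\<close>)
  also have "\<dots> \<le> (\<Sum>m\<in>shell d. \<bar>kern d j k m\<bar>) + near_const * riesz_const d * ((19/20) / sqrt 2) ^ d"
    by (intro add_mono shell_near_kern sum_near_le_3_5(1) jk) (use F in auto)
  finally show ?thesis unfolding shell_kern_sum[OF jk] .
qed

section \<open>From bilinear forms to operator norms\<close>

text \<open>Duality: the form is tested with the function \<open>sgn g |g|^(p-1)\<close> extremal
  for \<open>g\<close>, and the factor \<open>l\<close> between the two arguments makes the
  Young-type right side as good as a product of norms.\<close>
lemma form_bound_real_norm:
  fixes f :: "(nat \<Rightarrow> int) \<Rightarrow> real"
  assumes p: "p > 1" and C: "C > 0" and fb: "form_bound d p C k"
    and S: "finite S" "S \<subseteq> Zd d" and F: "finite F" "F \<subseteq> Zd d"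
  shows "(\<Sum>y\<in>F. \<bar>\<Sum>x\<in>S. k (y - x) * f x\<bar> powr p) \<le> C powr p * (\<Sum>x\<in>S. \<bar>f x\<bar> powr p)"
proof -
  define q where "q = p/(p - 1)"
  have q: "q > 1" using p by (simp add: q_def field_simps)
  have iq: "1/q = 1 - 1/p" using p by (simp add: q_def field_simps)
  define T where "T = S \<union> F"
  have T: "finite T" "T \<subseteq> Zd d" using S F by (auto simp: T_def)
  define g where "g y = (\<Sum>x\<in>S. k (y - x) * f x)" for y
  define X where "X = (\<Sum>y\<in>F. \<bar>g y\<bar> powr p)"
  define Y where "Y = (\<Sum>x\<in>S. \<bar>f x\<bar> powr p)"
  define l where "l = C powr (1/q)"
  have l: "l > 0" using C by (simp add: l_def)
  define u where "u x = (if x \<in> S then l * f x else 0)" for x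
  define v where "v y = (if y \<in> F then sgn (g y) * \<bar>g y\<bar> powr (p - 1) / l else 0)" for y
  have gp: "g y * (sgn (g y) * \<bar>g y\<bar> powr (p - 1)) = \<bar>g y\<bar> powr p" for y
  proof -
    have "g y * (sgn (g y) * \<bar>g y\<bar> powr (p - 1)) = \<bar>g y\<bar> * \<bar>g y\<bar> powr (p - 1)"
      by (simp add: abs_sgn mult.assoc)
    also have "\<dots> = \<bar>g y\<bar> powr p" using p by (cases "g y = 0") (auto simp: powr_diff)
    finally show ?thesis .
  qed
  have "(\<Sum>x\<in>T. \<Sum>y\<in>T. k (y - x) * u x * v y) = (\<Sum>x\<in>S. \<Sum>y\<in>F. k (y - x) * u x * v y)"
  proof -
    have "(\<Sum>x\<in>T. \<Sum>y\<in>T. k (y - x) * u x * v y) = (\<Sum>x\<in>S. \<Sum>y\<in>T. k (y - x) * u x * v y)"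
      by (rule sum.mono_neutral_right) (use T in \<open>auto simp: T_def u_def\<close>)
    also have "\<dots> = (\<Sum>x\<in>S. \<Sum>y\<in>F. k (y - x) * u x * v y)"
      by (intro sum.cong refl sum.mono_neutral_right) (use T in \<open>auto simp: T_def v_def\<close>)
    finally show ?thesis .
  qed
  also have "\<dots> = (\<Sum>y\<in>F. \<Sum>x\<in>S. (k (y - x) * f x) * (sgn (g y) * \<bar>g y\<bar> powr (p - 1)))"
    using l by (subst sum.swap) (auto simp: u_def v_def intro!: sum.cong)
  also have "\<dots> = (\<Sum>y\<in>F. g y * (sgn (g y) * \<bar>g y\<bar> powr (p - 1)))"
    by (simp only: sum_distrib_right[symmetric] g_def[symmetric])
  also have "\<dots> = X" by (simp add: gp X_def)
  finally have 1: "X = (\<Sum>x\<in>T. \<Sum>y\<in>T. k (y - x) * u x * v y)" ..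
  have 2: "(\<Sum>x\<in>T. \<bar>u x\<bar> powr p) = l powr p * Y"
  proof -
    have "(\<Sum>x\<in>T. \<bar>u x\<bar> powr p) = (\<Sum>x\<in>S. \<bar>u x\<bar> powr p)"
      by (rule sum.mono_neutral_right) (use T in \<open>auto simp: T_def u_def\<close>)
    also have "\<dots> = (\<Sum>x\<in>S. l powr p * \<bar>f x\<bar> powr p)"
      using l by (intro sum.cong refl) (simp add: u_def abs_mult powr_mult)
    finally show ?thesis by (simp add: sum_distrib_left Y_def)
  qed
  have 3: "(\<Sum>y\<in>T. \<bar>v y\<bar> powr q) = (1/C) * X"
  proof -
    have "(\<Sum>y\<in>T. \<bar>v y\<bar> powr q) = (\<Sum>y\<in>F. \<bar>v y\<bar> powr q)"
      by (rule sum.mono_neutral_right) (use T in \<open>auto simp: T_def v_def\<close>)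
    also have "\<dots> = (\<Sum>y\<in>F. (1/C) * \<bar>g y\<bar> powr p)"
    proof (intro sum.cong refl)
      fix y assume y: "y \<in> F"
      have "\<bar>v y\<bar> = (if g y = 0 then 0 else \<bar>g y\<bar> powr (p - 1) / l)"
        using y l by (auto simp: v_def abs_mult sgn_if)
      also have "\<dots> = \<bar>g y\<bar> powr (p - 1) / l" by simp
      finally have "\<bar>v y\<bar> powr q = (\<bar>g y\<bar> powr (p - 1)) powr q / l powr q"
        using l by (simp add: powr_divide)
      also have "l powr q = C" using C q by (simp add: l_def powr_powr)
      also have "(\<bar>g y\<bar> powr (p - 1)) powr q = \<bar>g y\<bar> powr p" using p by (simp add: powr_powr q_def)
      finally show "\<bar>v y\<bar> powr q = (1/C) * \<bar>g y\<bar> powr p" by simp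
    qed
    finally show ?thesis by (simp add: sum_distrib_left[symmetric] sum_divide_distrib[symmetric] X_def)
  qed
  have "X \<le> C * ((\<Sum>x\<in>T. \<bar>u x\<bar> powr p) / p + (\<Sum>x\<in>T. \<bar>v x\<bar> powr q) / q)"
    unfolding 1 using fb T unfolding form_bound_def q_def by blast
  also have "\<dots> = C * l powr p * Y / p + X * (1/q)" unfolding 2 3 using C by (simp add: field_simps)
  also have "C * l powr p = C powr p"
  proof -
    have "l powr p = C powr (p * (1/q))" by (simp add: l_def powr_powr mult.commute)
    also have "p * (1/q) = p - 1" unfolding iq using p by (simp add: field_simps)
    finally show ?thesis using C by (simp add: powr_diff)
  qed
  finally have "X * (1/p) \<le> C powr p * Y * (1/p)" unfolding iq by (simp add: algebra_simps)
  hence "X \<le> C powr p * Y" using p by (simp add: divide_le_cancel)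
  thus ?thesis by (simp add: X_def Y_def g_def)
qed

lemma integral_cos_powr_shift:
  assumes p: "p > 0" and phi: "0 \<le> \<phi>" "\<phi> \<le> 2 * pi"
  shows "integral {0..2 * pi} (\<lambda>t. \<bar>cos (t - \<phi>)\<bar> powr p) = integral {0..2 * pi} (\<lambda>t. \<bar>cos t\<bar> powr p)"
proof -
  let ?g = "\<lambda>t. \<bar>cos t\<bar> powr p"
  have cont: "continuous_on A ?g" for A
    by (intro continuous_on_powr' continuous_intros) (use p in auto)
  have int: "?g integrable_on {a..b}" for a b by (rule integrable_continuous_interval[OF cont])
  have 1: "integral {0..2 * pi} (\<lambda>t. \<bar>cos (t - \<phi>)\<bar> powr p) = integral {- \<phi>..2 * pi - \<phi>} ?g"
    using integral_shift[OF cont, of 0 "2 * pi" "- \<phi>"] by (simp add: o_def)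
  have 2: "integral {- \<phi>..0} ?g = integral {2 * pi - \<phi>..2 * pi} ?g"
  proof -
    have "(\<lambda>x. ?g (x + 2 * pi)) = ?g" by (auto simp: cos_add)
    thus ?thesis using integral_shift[OF cont, of "- \<phi>" 0 "2 * pi"] by (simp add: o_def)
  qed
  have "integral {- \<phi>..0} ?g + integral {0..2 * pi - \<phi>} ?g = integral {- \<phi>..2 * pi - \<phi>} ?g"
    by (rule Henstock_Kurzweil_Integration.integral_combine) (use phi int in auto)
  moreover have "integral {0..2 * pi - \<phi>} ?g + integral {2 * pi - \<phi>..2 * pi} ?g = integral {0..2 * pi} ?g"
    by (rule Henstock_Kurzweil_Integration.integral_combine) (use phi int in auto)
  ultimately show ?thesis unfolding 1 2[symmetric] by simp
qed

text \<open>The average does not depend on the argument of \<open>z\<close>.\<close>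
lemma rotation_average:
  assumes p: "p > 0"
  shows "((\<lambda>t. \<bar>Re (cis (- t) * z)\<bar> powr p) has_integral
     norm z powr p * integral {0..2 * pi} (\<lambda>t. \<bar>cos t\<bar> powr p)) {0..2 * pi}"
proof -
  define \<phi> where "\<phi> = Arg2pi z"
  have phi: "0 \<le> \<phi>" "\<phi> \<le> 2 * pi" using Arg2pi_ge_0[of z] Arg2pi_lt_2pi[of z] by (auto simp: \<phi>_def)
  have z: "z = of_real (norm z) * cis \<phi>"
    using Arg2pi_eq[of z] by (simp add: \<phi>_def cis_conv_exp)
  have e: "\<bar>Re (cis (- t) * z)\<bar> powr p = norm z powr p * \<bar>cos (t - \<phi>)\<bar> powr p" for t
  proof -
    have "Re (cis (- t) * z) = norm z * cos (t - \<phi>)"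
      by (subst z) (simp add: cos_diff algebra_simps)
    thus ?thesis by (simp add: abs_mult powr_mult)
  qed
  have cont: "continuous_on {0..2 * pi} (\<lambda>t. \<bar>cos (t - \<phi>)\<bar> powr p)"
    by (intro continuous_on_powr' continuous_intros) (use p in auto)
  have "((\<lambda>t. \<bar>cos (t - \<phi>)\<bar> powr p) has_integral integral {0..2 * pi} (\<lambda>t. \<bar>cos t\<bar> powr p)) {0..2 * pi}"
    using integrable_integral[OF integrable_continuous_interval[OF cont]]
    unfolding integral_cos_powr_shift[OF p phi] .
  from has_integral_mult_right[OF this, of "norm z powr p"] show ?thesis unfolding e .
qed

lemma integral_cos_powr_pos:
  assumes p: "p > 0" shows "integral {0..2 * pi} (\<lambda>t. \<bar>cos t\<bar> powr p) > 0"
proof -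
  have cont: "continuous_on {0..2 * pi} (\<lambda>t. \<bar>cos t\<bar> powr p)"
    by (intro continuous_on_powr' continuous_intros) (use p in auto)
  have ge: "integral {0..2 * pi} (\<lambda>t. \<bar>cos t\<bar> powr p) \<ge> 0"
    by (rule integral_nonneg[OF integrable_continuous_interval[OF cont]]) auto
  have "integral {0..2 * pi} (\<lambda>t. \<bar>cos t\<bar> powr p) \<noteq> 0"
  proof
    assume "integral {0..2 * pi} (\<lambda>t. \<bar>cos t\<bar> powr p) = 0"
    hence "\<forall>x\<in>{0..2 * pi}. \<bar>cos x\<bar> powr p = 0"
      by (subst (asm) integral_eq_0_iff[OF cont]) auto
    hence "\<bar>cos 0\<bar> powr p = (0::real)" by (rule bspec) auto
    thus False by simp
  qed
  with ge show ?thesis by simp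
qed

text \<open>The real estimate for \<open>Re (e^(-it) f)\<close>, integrated over \<open>t\<close>:
  both sides pick up the same positive constant, so a convolution with a real kernel has the same
  norm on complex functions.\<close>
lemma form_bound_complex_norm:
  fixes f :: "(nat \<Rightarrow> int) \<Rightarrow> complex"
  assumes p: "p > 1" and C: "C > 0" and fb: "form_bound d p C k"
    and S: "finite S" "S \<subseteq> Zd d" and F: "finite F" "F \<subseteq> Zd d"
  shows "(\<Sum>y\<in>F. norm (\<Sum>x\<in>S. of_real (k (y - x)) * f x) powr p) \<le> C powr p * (\<Sum>x\<in>S. norm (f x) powr p)"
proof -
  define c where "c = integral {0..2 * pi} (\<lambda>t. \<bar>cos t\<bar> powr p)"
  have c: "c > 0" unfolding c_def by (rule integral_cos_powr_pos) (use p in auto)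
  define g where "g y = (\<Sum>x\<in>S. of_real (k (y - x)) * f x)" for y
  have rot: "((\<lambda>t. \<bar>Re (cis (- t) * z)\<bar> powr p) has_integral norm z powr p * c) {0..2 * pi}" for z
    unfolding c_def by (rule rotation_average) (use p in auto)
  have L: "((\<lambda>t. \<Sum>y\<in>F. \<bar>Re (cis (- t) * g y)\<bar> powr p) has_integral (\<Sum>y\<in>F. norm (g y) powr p * c)) {0..2 * pi}"
    by (rule has_integral_sum[OF F(1)]) (rule rot)
  have R: "((\<lambda>t. C powr p * (\<Sum>x\<in>S. \<bar>Re (cis (- t) * f x)\<bar> powr p)) has_integral C powr p * (\<Sum>x\<in>S. norm (f x) powr p * c)) {0..2 * pi}"
    by (intro has_integral_mult_right has_integral_sum S rot)
  have "(\<Sum>y\<in>F. norm (g y) powr p * c) \<le> C powr p * (\<Sum>x\<in>S. norm (f x) powr p * c)"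
  proof (rule has_integral_le[OF L R])
    fix t :: real
    have "Re (cis (- t) * g y) = (\<Sum>x\<in>S. k (y - x) * Re (cis (- t) * f x))" for y
      unfolding g_def sum_distrib_left Re_sum by (intro sum.cong refl) (simp add: algebra_simps)
    thus "(\<Sum>y\<in>F. \<bar>Re (cis (- t) * g y)\<bar> powr p) \<le> C powr p * (\<Sum>x\<in>S. \<bar>Re (cis (- t) * f x)\<bar> powr p)"
      using form_bound_real_norm[OF p C fb S F, of "\<lambda>x. Re (cis (- t) * f x)"] by simp
  qed
  hence "(\<Sum>y\<in>F. norm (g y) powr p) * c \<le> (C powr p * (\<Sum>x\<in>S. norm (f x) powr p)) * c"
    by (simp add: sum_distrib_right[symmetric] mult.assoc)
  thus ?thesis using c by (simp add: g_def)
qed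

lemma eucl_norm_sq: "(eucl_norm d m)\<^sup>2 = sqnorm d m" "eucl_norm d m \<ge> 0"
  by (simp_all add: eucl_norm_def L2_set_def sqnorm_def sum_nonneg)

lemma eucl_norm_ge1:
  assumes "m \<in> Zd d" "m \<noteq> (\<lambda>_. 0)" shows "eucl_norm d m \<ge> 1"
proof -
  have "sqnorm d m \<ge> 1" using sqnorm_cases[OF assms(1)] assms(2) by (auto simp: shell_def)
  hence "1\<^sup>2 \<le> (eucl_norm d m)\<^sup>2" by (simp add: eucl_norm_sq)
  thus ?thesis by (rule power2_le_imp_le) (rule eucl_norm_sq)
qed

definition mono_kern :: "nat \<Rightarrow> nat \<Rightarrow> (nat \<Rightarrow> int) \<Rightarrow> real" where
  "mono_kern d j m = real_of_int (m j * m j) / eucl_norm d m ^ (d + 2)"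

text \<open>Every \<open>1 + |m\<^sub>i|\<close> is at most \<open>2|m|\<close>; this replaces the
  radial decay by a product, whose \<open>q\<close>-th power is summable coordinatewise for every
  \<open>q > 1\<close>.\<close>
lemma mono_kern_le:
  assumes m: "m \<in> Zd d" "m \<noteq> (\<lambda>_. 0)" and j: "j \<in> {1..d}"
  shows "0 \<le> mono_kern d j m" "mono_kern d j m \<le> 1" "mono_kern d j m \<le> 2 ^ d * (\<Prod>i\<in>{1..d}. inverse (1 + \<bar>real_of_int (m i)\<bar>))"
proof -
  define e where "e = eucl_norm d m"
  have e: "e \<ge> 1" using eucl_norm_ge1[OF m] by (simp add: e_def)
  show "0 \<le> mono_kern d j m" using e by (simp add: mono_kern_def e_def flip: of_int_mult)
  have "real_of_int (m j * m j) \<le> e\<^sup>2" unfolding e_def eucl_norm_sq using coord_le_sqnorm[OF j, of m] by (simp add: power2_eq_square)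
  hence "mono_kern d j m \<le> e\<^sup>2 / e ^ (d + 2)" unfolding mono_kern_def e_def[symmetric] using e by (intro divide_right_mono) auto
  also have "\<dots> = 1 / e ^ d" using e by (simp add: power_add power2_eq_square)
  finally have le: "mono_kern d j m \<le> 1 / e ^ d" .
  also have "\<dots> \<le> 1" using e by simp
  finally show "mono_kern d j m \<le> 1" .
  have "(\<Prod>i\<in>{1..d}. (1 + \<bar>real_of_int (m i)\<bar>)) \<le> (\<Prod>i\<in>{1..d}. 2 * e)"
  proof (rule prod_mono)
    fix i assume i: "i \<in> {1..d}"
    have "\<bar>real_of_int (m i)\<bar>\<^sup>2 \<le> e\<^sup>2" unfolding e_def eucl_norm_sq using coord_le_sqnorm[OF i, of m] by simp
    hence "\<bar>real_of_int (m i)\<bar> \<le> e" by (rule power2_le_imp_le) (use e in auto)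
    thus "0 \<le> 1 + \<bar>real_of_int (m i)\<bar> \<and> 1 + \<bar>real_of_int (m i)\<bar> \<le> 2 * e" using e by simp
  qed
  also have "\<dots> = 2 ^ d * e ^ d" by (simp add: power_mult_distrib)
  finally have le2: "(\<Prod>i\<in>{1..d}. (1 + \<bar>real_of_int (m i)\<bar>)) \<le> 2 ^ d * e ^ d" .
  have pos: "(\<Prod>i\<in>{1..d}. (1 + \<bar>real_of_int (m i)\<bar>)) > 0" by (rule prod_pos) (auto intro: add_pos_nonneg)
  have "1 / e ^ d = 2 ^ d / (2 ^ d * e ^ d)" by simp
  also have "\<dots> \<le> 2 ^ d / (\<Prod>i\<in>{1..d}. (1 + \<bar>real_of_int (m i)\<bar>))"
    by (rule divide_left_mono[OF le2]) (use pos e in auto)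
  finally have "1 / e ^ d \<le> 2 ^ d * (\<Prod>i\<in>{1..d}. inverse (1 + \<bar>real_of_int (m i)\<bar>))"
    by (simp add: divide_inverse prod_inversef[symmetric] o_def)
  thus "mono_kern d j m \<le> 2 ^ d * (\<Prod>i\<in>{1..d}. inverse (1 + \<bar>real_of_int (m i)\<bar>))" using le by linarith
qed

lemma sum_int_powr_bounded:
  assumes q: "q > 1"
  obtains B where "\<And>A. finite A \<Longrightarrow> (\<Sum>a\<in>A. (1 + \<bar>real_of_int a\<bar>) powr (- q)) \<le> B"
proof -
  define h where "h n = (1 + real n) powr (- q)" for n
  have sm: "summable h"
  proof -
    have "summable (\<lambda>n. real n powr (- q))" using q by (simp add: summable_real_powr_iff)
    hence "summable (\<lambda>n. real (Suc n) powr (- q))" by (subst summable_Suc_iff)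
    thus ?thesis by (simp add: h_def[abs_def] add.commute)
  qed
  have half: "(\<Sum>a\<in>A. h (nat \<bar>a\<bar>)) \<le> suminf h" if "finite A" "inj_on (\<lambda>a. nat \<bar>a\<bar>) A" for A
  proof -
    have "(\<Sum>a\<in>A. h (nat \<bar>a\<bar>)) = (\<Sum>n\<in>(\<lambda>a. nat \<bar>a\<bar>) ` A. h n)" using that by (simp add: sum.reindex)
    also have "\<dots> \<le> suminf h" by (rule sum_le_suminf[OF sm]) (use that in \<open>auto simp: h_def\<close>)
    finally show ?thesis .
  qed
  have "(\<Sum>a\<in>A. (1 + \<bar>real_of_int a\<bar>) powr (- q)) \<le> 2 * suminf h" if A: "finite A" for A
  proof -
    have "(\<Sum>a\<in>A. (1 + \<bar>real_of_int a\<bar>) powr (- q)) = (\<Sum>a\<in>A. h (nat \<bar>a\<bar>))"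
      by (intro sum.cong refl) (simp add: h_def)
    also have "\<dots> = (\<Sum>a\<in>A \<inter> {0..}. h (nat \<bar>a\<bar>)) + (\<Sum>a\<in>A \<inter> {..<0}. h (nat \<bar>a\<bar>))"
      by (subst sum.union_disjoint[symmetric]) (use A in \<open>auto intro!: sum.cong\<close>)
    also have "\<dots> \<le> suminf h + suminf h" by (intro add_mono half) (use A in \<open>auto simp: inj_on_def\<close>)
    finally show ?thesis by simp
  qed
  thus thesis by (rule that)
qed

lemma mono_kern_powr_summable:
  assumes j: "j \<in> {1..d}" and q: "q > 1"
  shows "(\<lambda>m. mono_kern d j m powr q) summable_on (Zd d - {\<lambda>_. 0})"
proof -
  obtain B where B: "\<And>A. finite A \<Longrightarrow> (\<Sum>a\<in>A. (1 + \<bar>real_of_int a\<bar>) powr (- q)) \<le> B"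
    using sum_int_powr_bounded[OF q] by blast
  show ?thesis
  proof (rule nonneg_bdd_above_summable_on)
    show "bdd_above (sum (\<lambda>m. mono_kern d j m powr q) ` {F. F \<subseteq> Zd d - {\<lambda>_. 0} \<and> finite F})"
    proof (rule bdd_aboveI2)
      fix F assume "F \<in> {F. F \<subseteq> Zd d - {\<lambda>_. 0} \<and> finite F}"
      hence F: "finite F" "F \<subseteq> Zd d" "(\<lambda>_. 0) \<notin> F" by auto
      have "(\<Sum>m\<in>F. mono_kern d j m powr q) \<le> (\<Sum>m\<in>F. (2 ^ d) powr q * (\<Prod>i\<in>{1..d}. (1 + \<bar>real_of_int (m i)\<bar>) powr (- q)))"
      proof (rule sum_mono)
        fix m assume "m \<in> F"
        hence m: "m \<in> Zd d" "m \<noteq> (\<lambda>_. 0)" using F by auto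
        have "mono_kern d j m powr q \<le> (2 ^ d * (\<Prod>i\<in>{1..d}. inverse (1 + \<bar>real_of_int (m i)\<bar>))) powr q"
          by (rule powr_mono2) (use mono_kern_le[OF m j] q in auto)
        also have "\<dots> = (2 ^ d) powr q * (\<Prod>i\<in>{1..d}. inverse (1 + \<bar>real_of_int (m i)\<bar>) powr q)"
          by (simp add: powr_mult prod_powr_distrib)
        also have "(\<Prod>i\<in>{1..d}. inverse (1 + \<bar>real_of_int (m i)\<bar>) powr q) = (\<Prod>i\<in>{1..d}. (1 + \<bar>real_of_int (m i)\<bar>) powr (- q))"
          by (intro prod.cong refl) (simp add: powr_minus inverse_powr)
        finally show "mono_kern d j m powr q \<le> (2 ^ d) powr q * (\<Prod>i\<in>{1..d}. (1 + \<bar>real_of_int (m i)\<bar>) powr (- q))" .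
      qed
      also have "\<dots> = (2 ^ d) powr q * (\<Sum>m\<in>F. \<Prod>i\<in>{1..d}. (1 + \<bar>real_of_int (m i)\<bar>) powr (- q))"
        by (simp add: sum_distrib_left)
      also have "\<dots> \<le> (2 ^ d) powr q * B ^ d"
        by (intro mult_left_mono sum_prod_Zd_le F) (use B in auto)
      finally show "(\<Sum>m\<in>F. mono_kern d j m powr q) \<le> (2 ^ d) powr q * B ^ d" .
    qed
  qed auto
qed

lemma reflect_bij: "n \<in> Zd d \<Longrightarrow> bij_betw (\<lambda>x. n - x) (Zd d - {n}) (Zd d - {\<lambda>_. 0})"
  by (rule bij_betw_byWitness[of _ "\<lambda>m. n - m"]) (auto simp: Zd_def fun_eq_iff)

text \<open>For \<open>p > 1\<close> by Young's inequality against the \<open>q\<close>-summable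
  kernel, for \<open>p = 1\<close> by boundedness of the kernel.\<close>
lemma mono_kern_conv_summable:
  fixes f :: "(nat \<Rightarrow> int) \<Rightarrow> complex"
  assumes j: "j \<in> {1..d}" and p: "p \<ge> 1" and n: "n \<in> Zd d"
    and f: "(\<lambda>x. norm (f x) powr p) summable_on Zd d"
  shows "(\<lambda>m. of_real (mono_kern d j m) * f (n - m)) summable_on (Zd d - {\<lambda>_. 0})"
proof (rule abs_summable_summable)
  have fs: "(\<lambda>m. norm (f (n - m)) powr p) summable_on (Zd d - {\<lambda>_. 0})"
  proof -
    have "(\<lambda>x. norm (f x) powr p) summable_on Zd d - {n}" by (rule summable_on_subset_banach[OF f]) auto
    hence "(\<lambda>x. norm (f (n - (n - x))) powr p) summable_on Zd d - {n}" by simp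
    thus ?thesis using summable_on_reindex_bij_betw[OF reflect_bij[OF n], of "\<lambda>m. norm (f (n - m)) powr p"] by simp
  qed
  show "(\<lambda>m. norm (of_real (mono_kern d j m) * f (n - m))) summable_on (Zd d - {\<lambda>_. 0})"
  proof (cases "p = 1")
    case True
    show ?thesis
      by (rule summable_on_comparison_test[OF fs])
         (use mono_kern_le[OF _ _ j] True in \<open>auto simp: norm_mult intro!: mult_left_le_one_le\<close>)
  next
    case False
    hence p1: "p > 1" using p by simp
    define q where "q = p/(p - 1)"
    have q: "q > 1" using p1 by (simp add: q_def field_simps)
    have "(\<lambda>m. (1/p) * (norm (f (n - m)) powr p) + (1/q) * (mono_kern d j m powr q)) summable_on (Zd d - {\<lambda>_. 0})"
      by (intro summable_on_add summable_on_cmult_right fs mono_kern_powr_summable j q)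
    thus ?thesis
    proof (rule summable_on_comparison_test)
      fix m assume m: "m \<in> Zd d - {\<lambda>_. 0}"
      have "norm (f (n - m)) * mono_kern d j m \<le> norm (f (n - m)) powr p / p + mono_kern d j m powr q / q"
        using young_abs[OF p1 q_def, of "norm (f (n - m))" "mono_kern d j m"] mono_kern_le(1)[OF _ _ j, of m] m by auto
      thus "norm (of_real (mono_kern d j m) * f (n - m)) \<le> (1/p) * (norm (f (n - m)) powr p) + (1/q) * (mono_kern d j m powr q)"
        using mono_kern_le(1)[OF _ _ j, of m] m by (simp add: norm_mult mult.commute)
    qed auto
  qed
qed

lemma kern_mono: "kern d j k m = riesz_const d * (mono_kern d j m - mono_kern d k m)"
  by (simp add: kern_def mono_kern_def power2_eq_square diff_divide_distrib)

lemma conv_has_sum: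
  fixes f :: "(nat \<Rightarrow> int) \<Rightarrow> complex"
  assumes jk: "j \<in> {1..d}" "k \<in> {1..d}" and p: "p \<ge> 1" and n: "n \<in> Zd d"
    and f: "(\<lambda>x. norm (f x) powr p) summable_on Zd d"
  shows "((\<lambda>x. of_real (kern d j k (n - x)) * f x) has_sum R_dis_diff d j k f n) (Zd d)"
proof -
  define c :: complex where "c = of_real (riesz_const d)"
  let ?Z = "Zd d - {\<lambda>_. 0}"
  have H: "((\<lambda>m. c * (of_real (mono_kern d i m) * f (n - m))) has_sum R_dis d i i f n) ?Z" if "i \<in> {1..d}" for i
    unfolding R_dis_def c_def mono_kern_def[symmetric]
    by (intro has_sum_cmult_right has_sum_infsum mono_kern_conv_summable[OF that p n f])
  have "((\<lambda>m. c * (of_real (mono_kern d j m) * f (n - m)) + (-1) * (c * (of_real (mono_kern d k m) * f (n - m))))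
     has_sum R_dis d j j f n + (-1) * R_dis d k k f n) ?Z"
    by (intro has_sum_add has_sum_cmult_right H jk)
  hence "((\<lambda>m. of_real (kern d j k m) * f (n - m)) has_sum R_dis_diff d j k f n) ?Z"
    by (simp add: R_dis_diff_def kern_mono c_def algebra_simps)
  hence "((\<lambda>x. of_real (kern d j k (n - x)) * f (n - (n - x))) has_sum R_dis_diff d j k f n) (Zd d - {n})"
    using has_sum_reindex_bij_betw[OF reflect_bij[OF n], of "\<lambda>m. of_real (kern d j k m) * f (n - m)"] by simp
  hence 1: "((\<lambda>x. of_real (kern d j k (n - x)) * f x) has_sum R_dis_diff d j k f n) (Zd d - {n})" by simp
  have "n - n = (\<lambda>_. 0)" by (auto simp: fun_eq_iff)
  hence "kern d j k (n - n) = 0" using near_0(2) by simp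
  hence "((\<lambda>x. of_real (kern d j k (n - x)) * f x) has_sum R_dis_diff d j k f n) (Zd d - {n})
    \<longleftrightarrow> ((\<lambda>x. of_real (kern d j k (n - x)) * f x) has_sum R_dis_diff d j k f n) (Zd d)"
    by (intro has_sum_cong_neutral) auto
  thus ?thesis using 1 by blast
qed

lemma lp_norm_le_1:
  assumes "lp_norm d p f \<le> 1" "p > 0"
  shows "(\<lambda>x. norm (f x) powr p) summable_on Zd d" "(\<Sum>\<^sub>\<infinity>x\<in>Zd d. norm (f x) powr p) \<le> 1"
proof -
  show s: "(\<lambda>x. norm (f x) powr p) summable_on Zd d" using assms by (auto simp: lp_norm_def split: if_splits)
  define A where "A = (\<Sum>\<^sub>\<infinity>x\<in>Zd d. norm (f x) powr p)"
  have A: "A \<ge> 0" unfolding A_def by (rule infsum_nonneg) auto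
  have "ereal (A powr (1/p)) \<le> 1" using assms(1) s by (simp add: lp_norm_def A_def)
  hence "A powr (1/p) \<le> 1" by simp
  hence "(A powr (1/p)) powr p \<le> 1 powr p" by (rule powr_mono2[rotated 2]) (use assms in auto)
  thus "(\<Sum>\<^sub>\<infinity>x\<in>Zd d. norm (f x) powr p) \<le> 1" using A assms(2) by (simp add: powr_powr A_def)
qed

text \<open>Bounds for finite sets of outputs and inputs pass to the limit, first in the
  input.\<close>
lemma lp_opnorm_le:
  assumes jk: "j \<in> {1..d}" "k \<in> {1..d}" and p: "p > 1" and C: "C > 0" and fb: "form_bound d p C (kern d j k)"
  shows "lp_opnorm d p (R_dis_diff d j k) \<le> ereal C"
  unfolding lp_opnorm_def
proof (rule SUP_least)
  fix f assume "f \<in> {f. lp_norm d p f \<le> 1}"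
  hence f: "(\<lambda>x. norm (f x) powr p) summable_on Zd d" "(\<Sum>\<^sub>\<infinity>x\<in>Zd d. norm (f x) powr p) \<le> 1"
    using lp_norm_le_1[of d p f] p by auto
  let ?T = "R_dis_diff d j k f"
  have bd: "(\<Sum>y\<in>F. norm (?T y) powr p) \<le> C powr p" if F: "finite F" "F \<subseteq> Zd d" for F
  proof -
    have "((\<lambda>S. \<Sum>y\<in>F. norm (\<Sum>x\<in>S. of_real (kern d j k (y - x)) * f x) powr p) \<longlongrightarrow> (\<Sum>y\<in>F. norm (?T y) powr p)) (finite_subsets_at_top (Zd d))"
    proof (intro tendsto_sum tendsto_powr' tendsto_norm tendsto_const)
      fix y assume "y \<in> F"
      hence y: "y \<in> Zd d" using F by auto
      have p1: "p \<ge> 1" using p by simp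
      have "((\<lambda>x. of_real (kern d j k (y - x)) * f x) has_sum ?T y) (Zd d)"
        by (rule conv_has_sum[OF jk p1 y f(1)])
      thus "((\<lambda>S. \<Sum>x\<in>S. of_real (kern d j k (y - x)) * f x) \<longlongrightarrow> ?T y) (finite_subsets_at_top (Zd d))"
        unfolding has_sum_def .
    qed (use p in auto)
    moreover have "\<forall>\<^sub>F S in finite_subsets_at_top (Zd d). (\<Sum>y\<in>F. norm (\<Sum>x\<in>S. of_real (kern d j k (y - x)) * f x) powr p) \<le> C powr p"
    proof (rule eventually_mono[OF eventually_finite_subsets_at_top_weakI])
      fix S assume S: "finite S" "S \<subseteq> Zd d"
      have "(\<Sum>x\<in>S. norm (f x) powr p) \<le> (\<Sum>\<^sub>\<infinity>x\<in>Zd d. norm (f x) powr p)"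
        by (rule finite_sum_le_infsum[OF f(1) S]) auto
      hence "C powr p * (\<Sum>x\<in>S. norm (f x) powr p) \<le> C powr p * 1" using f(2) by (intro mult_left_mono) auto
      thus "(\<Sum>y\<in>F. norm (\<Sum>x\<in>S. of_real (kern d j k (y - x)) * f x) powr p) \<le> C powr p"
        using form_bound_complex_norm[OF p C fb S F, of f] by simp
    qed
    ultimately show ?thesis by (rule tendsto_upperbound) simp
  qed
  have s: "(\<lambda>y. norm (?T y) powr p) summable_on Zd d"
    by (rule nonneg_bdd_above_summable_on) (auto intro!: bdd_aboveI2[of _ _ "C powr p"] bd)
  have "(\<Sum>\<^sub>\<infinity>y\<in>Zd d. norm (?T y) powr p) \<le> C powr p"
    by (rule infsum_le_finite_sums[OF s]) (use bd in auto)
  hence "(\<Sum>\<^sub>\<infinity>y\<in>Zd d. norm (?T y) powr p) powr (1/p) \<le> (C powr p) powr (1/p)"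
    by (intro powr_mono2) (use p in \<open>auto intro: infsum_nonneg\<close>)
  also have "\<dots> = C" using C p by (simp add: powr_powr)
  finally show "lp_norm d p ?T \<le> ereal C" using s by (simp add: lp_norm_def)
qed

text \<open>The far part contributes \<open>p* - 1\<close> and an exponential, the near part its
  \<open>\<ell>\<^sup>1\<close> norm.\<close>
lemma lp_opnorm_upper:
  assumes jk: "j \<in> {1..d}" "k \<in> {1..d}" "j \<noteq> k" and p: "p > 1"
  shows "lp_opnorm d p (R_dis_diff d j k) \<le> ereal ((max p (p/(p - 1)) - 1) + 1000000000 ^ d
     + (4 * riesz_const d * (1 + (real d - 2) / 2 powr (real d / 2)) + near_const * riesz_const d * ((19/20) / sqrt 2) ^ d))"
proof (rule lp_opnorm_le[OF jk(1,2) p])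
  let ?E = "4 * riesz_const d * (1 + (real d - 2) / 2 powr (real d / 2)) + near_const * riesz_const d * ((19/20) / sqrt 2) ^ d"
  have "?E \<ge> 0" using sum_near_total[OF jk, of "{}"] by simp
  moreover have "(1000000000::real) ^ d > 0" "max p (p/(p - 1)) > 1" using p by auto
  ultimately show "0 < max p (p/(p - 1)) - 1 + 1000000000 ^ d + ?E" by linarith
  show "form_bound d p (max p (p/(p - 1)) - 1 + 1000000000 ^ d + ?E) (kern d j k)"
  proof (rule form_bound_add_l1[OF p form_bound_far[OF jk p]])
    fix F assume "finite F" "F \<subseteq> Zd d"
    thus "(\<Sum>m\<in>F. \<bar>kern d j k m - far d j k m\<bar>) \<le> ?E"
      using sum_near_total[OF jk, of F] by (simp add: near_def)
  qed
qed

section \<open>Smoothness of the large-time part\<close>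

lemma Zd_add: "m \<in> Zd d \<Longrightarrow> n \<in> Zd d \<Longrightarrow> m + n \<in> Zd d" by (auto simp: Zd_def)

lemma unitv_Zd: "i \<in> {1..d} \<Longrightarrow> unitv i \<in> Zd d" by (auto simp: Zd_def unitv_def)

text \<open>Telescoping along a lattice path from \<open>0\<close> to \<open>v\<close>.\<close>
lemma sum_shift_le:
  fixes D :: "(nat \<Rightarrow> int) \<Rightarrow> real"
  assumes B: "\<And>i F. i \<in> {1..d} \<Longrightarrow> finite F \<Longrightarrow> F \<subseteq> Zd d \<Longrightarrow> (\<Sum>m\<in>F. \<bar>D (m + unitv i) - D m\<bar>) \<le> B"
    and F: "finite F" "F \<subseteq> Zd d" and v: "v \<in> Zd d"
  shows "(\<Sum>m\<in>F. \<bar>D (m + v) - D m\<bar>) \<le> real (\<Sum>i\<in>{1..d}. nat \<bar>v i\<bar>) * B"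
  using v
proof (induction "\<Sum>i\<in>{1..d}. nat \<bar>v i\<bar>" arbitrary: v)
  case 0
  hence "v i = 0" for i by (cases "i \<in> {1..d}") (auto simp: Zd_def)
  hence "v = 0" by (auto simp: fun_eq_iff)
  thus ?case by simp
next
  case (Suc n)
  then obtain i where i: "i \<in> {1..d}" "v i \<noteq> 0"
    by (metis (no_types, lifting) abs_zero nat_0 nat.distinct(1) sum.neutral)
  define \<sigma> where "\<sigma> = (if v i > 0 then unitv i else - unitv i)"
  define v' where "v' = v - \<sigma>"
  have sZ: "\<sigma> \<in> Zd d" using unitv_Zd[OF i(1)] by (auto simp: \<sigma>_def Zd_uminus)
  have v'Z: "v' \<in> Zd d" using Suc.prems sZ by (auto simp: v'_def intro: Zd_diff)
  have vv: "v = v' + \<sigma>" by (simp add: v'_def)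
  have other: "v' l = v l" if "l \<noteq> i" for l using that by (simp add: v'_def \<sigma>_def unitv_def)
  have "nat \<bar>v i\<bar> = Suc (nat \<bar>v' i\<bar>)" using i(2) by (auto simp: v'_def \<sigma>_def unitv_def)
  hence "(\<Sum>i\<in>{1..d}. nat \<bar>v i\<bar>) = Suc (\<Sum>i\<in>{1..d}. nat \<bar>v' i\<bar>)"
  proof -
    have "(\<Sum>l\<in>{1..d}. nat \<bar>w l\<bar>) = nat \<bar>w i\<bar> + (\<Sum>l\<in>{1..d} - {i}. nat \<bar>w l\<bar>)" for w :: "nat \<Rightarrow> int"
      by (rule sum.remove) (use i in auto)
    moreover have "(\<Sum>l\<in>{1..d} - {i}. nat \<bar>v l\<bar>) = (\<Sum>l\<in>{1..d} - {i}. nat \<bar>v' l\<bar>)"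
      by (intro sum.cong refl) (simp add: other)
    ultimately show ?thesis using \<open>nat \<bar>v i\<bar> = Suc (nat \<bar>v' i\<bar>)\<close> by (metis add_Suc)
  qed
  hence n: "n = (\<Sum>i\<in>{1..d}. nat \<bar>v' i\<bar>)" using Suc.hyps(2) by simp
  have step: "(\<Sum>m\<in>G. \<bar>D (m + \<sigma>) - D m\<bar>) \<le> B" if G: "finite G" "G \<subseteq> Zd d" for G
  proof (cases "v i > 0")
    case True thus ?thesis using B[OF i(1) G] by (simp add: \<sigma>_def)
  next
    case False
    have "(\<Sum>m\<in>G. \<bar>D (m + \<sigma>) - D m\<bar>) = (\<Sum>m\<in>(\<lambda>m. m - unitv i) ` G. \<bar>D (m + unitv i) - D m\<bar>)"
      using False by (subst sum.reindex) (auto simp: inj_on_def \<sigma>_def abs_minus_commute)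
    also have "\<dots> \<le> B" by (rule B[OF i(1)]) (use G unitv_Zd[OF i(1)] in \<open>auto intro!: Zd_diff\<close>)
    finally show ?thesis .
  qed
  have "(\<Sum>m\<in>F. \<bar>D (m + v) - D m\<bar>) \<le> (\<Sum>m\<in>F. \<bar>D ((m + v') + \<sigma>) - D (m + v')\<bar> + \<bar>D (m + v') - D m\<bar>)"
    unfolding vv by (intro sum_mono) (simp add: add.assoc)
  also have "\<dots> = (\<Sum>m\<in>(\<lambda>m. m + v') ` F. \<bar>D (m + \<sigma>) - D m\<bar>) + (\<Sum>m\<in>F. \<bar>D (m + v') - D m\<bar>)"
    by (subst sum.reindex) (auto simp: inj_on_def sum.distrib)
  also have "\<dots> \<le> B + real n * B"
    using Suc.hyps(1)[OF n v'Z] n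
    by (intro add_mono step) (use F v'Z in \<open>auto intro!: Zd_add\<close>)
  finally show ?case unfolding Suc.hyps(2)[symmetric] by (simp add: algebra_simps)
qed

lemma has_integral_inverse_sqrt:
  assumes "a \<ge> 0" shows "((\<lambda>s. 1 / sqrt s) has_integral 2 * sqrt a) {0..a}"
proof -
  have "((\<lambda>s. 1 / sqrt s) has_integral 2 * sqrt a - 2 * sqrt 0) {0..a}"
  proof (rule fundamental_theorem_of_calculus_interior[OF assms])
    show "continuous_on {0..a} (\<lambda>s. 2 * sqrt s)" by (intro continuous_intros)
    fix x assume "x \<in> {0<..<a}"
    hence "((\<lambda>s. 2 * sqrt s) has_real_derivative 1 / sqrt x) (at x)"
      by (auto intro!: derivative_eq_intros simp: field_simps)
    thus "((\<lambda>s. 2 * sqrt s) has_vector_derivative 1 / sqrt x) (at x)"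
      by (simp add: has_real_derivative_iff_has_vector_derivative)
  qed
  thus ?thesis by simp
qed

lemma has_integral_inverse_square:
  fixes a :: real
  assumes "0 < a" "a \<le> 1" shows "((\<lambda>s. 1 / s\<^sup>2) has_integral 1 / a - 1) {a..1}"
proof -
  have "((\<lambda>s. 1 / s\<^sup>2) has_integral (- 1 / 1) - (- 1 / a)) {a..1}"
  proof (rule fundamental_theorem_of_calculus[OF assms(2)])
    fix x assume "x \<in> {a..1}"
    hence x: "x > 0" using assms by auto
    hence "((\<lambda>s. - 1 / s) has_real_derivative 1 / x\<^sup>2) (at x within {a..1})"
      by (auto intro!: derivative_eq_intros simp: field_simps power2_eq_square)
    thus "((\<lambda>s. - 1 / s) has_vector_derivative 1 / x\<^sup>2) (at x within {a..1})"
      by (simp add: has_real_derivative_iff_has_vector_derivative)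
  qed
  thus ?thesis by simp
qed

lemma sum_abs_integral_le:
  fixes h :: "'i \<Rightarrow> real \<Rightarrow> real"
  assumes F: "finite F" and c: "\<And>z. z \<in> F \<Longrightarrow> continuous_on {a..b} (h z)"
    and B: "(B has_integral I) {a..b}" and le: "\<And>s. s \<in> {a..b} \<Longrightarrow> (\<Sum>z\<in>F. \<bar>h z s\<bar>) \<le> B s"
  shows "(\<Sum>z\<in>F. \<bar>integral {a..b} (h z)\<bar>) \<le> I"
proof -
  have ci: "(\<lambda>s. \<bar>h z s\<bar>) integrable_on {a..b}" if "z \<in> F" for z
    by (rule integrable_continuous_interval) (intro continuous_intros c that)
  have "(\<Sum>z\<in>F. \<bar>integral {a..b} (h z)\<bar>) \<le> (\<Sum>z\<in>F. integral {a..b} (\<lambda>s. \<bar>h z s\<bar>))"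
  proof (rule sum_mono)
    fix z assume z: "z \<in> F"
    have "norm (integral {a..b} (h z)) \<le> integral {a..b} (\<lambda>s. \<bar>h z s\<bar>)"
      by (rule integral_norm_bound_integral[OF integrable_continuous_interval[OF c[OF z]] ci[OF z]]) simp
    thus "\<bar>integral {a..b} (h z)\<bar> \<le> integral {a..b} (\<lambda>s. \<bar>h z s\<bar>)" by simp
  qed
  also have "\<dots> = integral {a..b} (\<lambda>s. \<Sum>z\<in>F. \<bar>h z s\<bar>)" by (rule integral_sum[symmetric, OF F ci])
  also have "\<dots> \<le> I"
    by (rule has_integral_le[OF integrable_integral[OF integrable_sum[OF F ci]] B]) (use le in auto)
  finally show ?thesis .
qed

lemma dens_zero_time: "d \<noteq> 0 \<Longrightarrow> dens d j k 0 m = 0"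
  unfolding dens_def by (simp add: gauss_def)

text \<open>Hoermander's condition at scale \<open>l\<close>, with the heat parameter split at
  \<open>s = l\<^sup>-\<^sup>2\<close>. For smaller \<open>s\<close> the smoothness of the Gaussian
  gains \<open>l sqrt s\<close>; for larger \<open>s\<close> both terms are small separately,
  because a coordinate of size \<open>l\<close> gives the decay \<open>1/(s
  l\<^sup>2)\<close>.\<close>
lemma hormander_far:
  assumes jk: "j \<in> {1..d}" "k \<in> {1..d}" and y: "y \<in> Zd d" and c: "c \<in> Zd d" and l: "l \<ge> (1::int)"
    and yc: "\<And>i. i \<in> {1..d} \<Longrightarrow> \<bar>y i - c i\<bar> \<le> l"
    and F: "finite F" "F \<subseteq> Zd d"
    and zy: "\<And>z. z \<in> F \<Longrightarrow> \<exists>i\<in>{1..d}. \<bar>z i - y i\<bar> \<ge> l" and zc: "\<And>z. z \<in> F \<Longrightarrow> \<exists>i\<in>{1..d}. \<bar>z i - c i\<bar> \<ge> l"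
  shows "(\<Sum>z\<in>F. \<bar>far d j k (z - y) - far d j k (z - c)\<bar>) \<le> 12672 ^ d"
proof -
  define L where "L = real_of_int l"
  have L: "L \<ge> 1" using l by (simp add: L_def)
  define a where "a = 1 / L\<^sup>2"
  have a: "0 < a" "a \<le> 1" using L by (auto simp: a_def divide_le_eq)
  have d0: "d \<ge> 1" using jk by auto
  have sqa: "sqrt a = 1 / L" using L by (simp add: a_def real_sqrt_divide)
  have fsp: "far d j k m = integral {0..a} (\<lambda>s. dens d j k s m) + integral {a..1} (\<lambda>s. dens d j k s m)" for m
    unfolding far_def by (rule Henstock_Kurzweil_Integration.integral_combine[symmetric]) (use a dens_integrable in auto)
  have P1: "(\<Sum>z\<in>F. \<bar>integral {0..a} (\<lambda>s. dens d j k s (z - y) - dens d j k s (z - c))\<bar>) \<le> (240 * 12 ^ d * (real d * L)) * (2 * sqrt a)"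
  proof (rule sum_abs_integral_le[OF F(1)])
    show "((\<lambda>s. (240 * 12 ^ d * (real d * L)) * (1 / sqrt s)) has_integral (240 * 12 ^ d * (real d * L)) * (2 * sqrt a)) {0..a}"
      by (rule has_integral_mult_right[OF has_integral_inverse_sqrt]) (use a in auto)
    show "continuous_on {0..a} (\<lambda>s. dens d j k s (z - y) - dens d j k s (z - c))" for z
      by (intro continuous_intros continuous_dens)
    fix s assume s: "s \<in> {0..a}"
    show "(\<Sum>z\<in>F. \<bar>dens d j k s (z - y) - dens d j k s (z - c)\<bar>) \<le> (240 * 12 ^ d * (real d * L)) * (1 / sqrt s)"
    proof (cases "s = 0")
      case True thus ?thesis using d0 by (simp add: dens_zero_time)
    next
      case False
      hence s0: "0 < s" "s \<le> 1" using s a by auto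
      define G where "G = (\<lambda>z. z - y) ` F"
      have G: "finite G" "G \<subseteq> Zd d" using F y by (auto simp: G_def intro!: Zd_diff)
      have ycZ: "y - c \<in> Zd d" using y c by (rule Zd_diff)
      have B: "(\<Sum>m\<in>G. \<bar>dens d j k s (m + unitv i) - dens d j k s m\<bar>) \<le> 240 / sqrt s * 12 ^ d"
        if "i \<in> {1..d}" "finite G" "G \<subseteq> Zd d" for i G
      proof -
        have "(\<Sum>m\<in>G. \<bar>dens d j k s (m + unitv i) - dens d j k s m\<bar>) \<le> (\<Sum>m\<in>G. 240 / sqrt s * Gmaj d s m)"
          by (intro sum_mono dens_shift s0 jk that)
        also have "\<dots> = 240 / sqrt s * (\<Sum>m\<in>G. Gmaj d s m)" by (simp add: sum_distrib_left)
        also have "\<dots> \<le> 240 / sqrt s * 12 ^ d"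
          by (intro mult_left_mono sum_Gmaj_le s0 that) (use s0 in auto)
        finally show ?thesis .
      qed
      have "(\<Sum>z\<in>F. \<bar>dens d j k s (z - y) - dens d j k s (z - c)\<bar>) = (\<Sum>m\<in>G. \<bar>dens d j k s (m + (y - c)) - dens d j k s m\<bar>)"
        unfolding G_def by (subst sum.reindex) (auto simp: inj_on_def abs_minus_commute)
      also have "\<dots> \<le> real (\<Sum>i\<in>{1..d}. nat \<bar>(y - c) i\<bar>) * (240 / sqrt s * 12 ^ d)"
        by (rule sum_shift_le[OF B G ycZ])
      also have "\<dots> \<le> (real d * L) * (240 / sqrt s * 12 ^ d)"
      proof (rule mult_right_mono)
        have "(\<Sum>i\<in>{1..d}. nat \<bar>(y - c) i\<bar>) \<le> (\<Sum>i\<in>{1..d}. nat l)"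
          by (intro sum_mono nat_mono) (use yc in simp)
        also have "\<dots> = d * nat l" by simp
        finally have "real (\<Sum>i\<in>{1..d}. nat \<bar>(y - c) i\<bar>) \<le> real (d * nat l)" by (rule of_nat_mono)
        thus "real (\<Sum>i\<in>{1..d}. nat \<bar>(y - c) i\<bar>) \<le> real d * L" using l by (simp add: L_def)
      qed (use s0 in auto)
      finally show ?thesis by (simp add: mult_ac)
    qed
  qed
  have P2: "(\<Sum>z\<in>F. \<bar>integral {a..1} (\<lambda>s. dens d j k s (z - w))\<bar>) \<le> (24 * 12 ^ d * a) * (1 / a - 1)"
    if w: "w \<in> Zd d" and zw: "\<And>z. z \<in> F \<Longrightarrow> \<exists>i\<in>{1..d}. \<bar>z i - w i\<bar> \<ge> l" for w
  proof (rule sum_abs_integral_le[OF F(1)])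
    show "((\<lambda>s. (24 * 12 ^ d * a) * (1 / s\<^sup>2)) has_integral (24 * 12 ^ d * a) * (1 / a - 1)) {a..1}"
      by (rule has_integral_mult_right[OF has_integral_inverse_square[OF a]])
    show "continuous_on {a..1} (\<lambda>s. dens d j k s (z - w))" for z by (rule continuous_dens)
    fix s assume s: "s \<in> {a..1}"
    hence s0: "0 < s" "s \<le> 1" using a by auto
    define G where "G = (\<lambda>z. z - w) ` F"
    have G: "finite G" "G \<subseteq> Zd d" using F w by (auto simp: G_def intro!: Zd_diff)
    have "(\<Sum>z\<in>F. \<bar>dens d j k s (z - w)\<bar>) = (\<Sum>m\<in>G. \<bar>dens d j k s m\<bar>)"
      unfolding G_def by (subst sum.reindex) (auto simp: inj_on_def)
    also have "\<dots> \<le> (\<Sum>m\<in>G. 6 / s * (4 / (s * L\<^sup>2) * Gmaj d s m))"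
    proof (rule sum_mono)
      fix m assume "m \<in> G"
      then obtain z where z: "z \<in> F" "m = z - w" by (auto simp: G_def)
      obtain i where i: "i \<in> {1..d}" "\<bar>z i - w i\<bar> \<ge> l" using zw[OF z(1)] by auto
      have "L \<le> \<bar>real_of_int (m i)\<bar>" using i(2) z(2) unfolding L_def by (simp flip: of_int_diff of_int_abs)
      hence "L\<^sup>2 \<le> \<bar>real_of_int (m i)\<bar>\<^sup>2" by (rule power_mono) (use L in auto)
      also have "\<dots> \<le> sqnorm d m" using coord_le_sqnorm[OF i(1), of m] by simp
      finally have "s * L\<^sup>2 \<le> s * sqnorm d m" using s0 by (intro mult_left_mono) auto
      hence "exp (- s * sqnorm d m / 4) \<le> exp (- (s * L\<^sup>2 / 4))" by simp
      also have "\<dots> \<le> 1 / (s * L\<^sup>2 / 4)"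
      proof -
        have "exp (- u) \<le> 1 / u" if "u > 0" for u :: real
        proof -
          have "u \<le> exp u" using exp_ge_add_one_self[of u] by linarith
          hence "1 / exp u \<le> 1 / u" using that by (intro divide_left_mono) auto
          thus ?thesis by (simp add: exp_minus inverse_eq_divide)
        qed
        moreover have "s * L\<^sup>2 / 4 > 0" using s0 L by (intro divide_pos_pos mult_pos_pos) auto
        ultimately show ?thesis by blast
      qed
      finally have e: "exp (- s * sqnorm d m / 4) \<le> 4 / (s * L\<^sup>2)" by simp
      have "\<bar>dens d j k s m\<bar> \<le> 6 / s * (exp (- s * sqnorm d m / 4) * Gmaj d s m)" by (rule dens_le[OF s0(1) jk])
      also have "\<dots> \<le> 6 / s * (4 / (s * L\<^sup>2) * Gmaj d s m)"
        by (intro mult_left_mono mult_right_mono e Gmaj_nonneg) (use s0 in auto)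
      finally show "\<bar>dens d j k s m\<bar> \<le> 6 / s * (4 / (s * L\<^sup>2) * Gmaj d s m)" .
    qed
    also have "\<dots> = 24 * a * (1 / s\<^sup>2) * (\<Sum>m\<in>G. Gmaj d s m)"
      unfolding sum_distrib_left by (intro sum.cong refl) (simp add: a_def power2_eq_square)
    also have "\<dots> \<le> 24 * a * (1 / s\<^sup>2) * 12 ^ d"
      by (intro mult_left_mono sum_Gmaj_le s0 G) (use a in auto)
    finally show "(\<Sum>z\<in>F. \<bar>dens d j k s (z - w)\<bar>) \<le> (24 * 12 ^ d * a) * (1 / s\<^sup>2)" by (simp add: mult_ac)
  qed
  have bound2: "(24 * 12 ^ d * a) * (1 / a - 1) \<le> 24 * 12 ^ d"
  proof -
    have "a * (1 / a - 1) \<le> 1" using a by (simp add: right_diff_distrib)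
    hence "24 * 12 ^ d * (a * (1 / a - 1)) \<le> 24 * 12 ^ d * 1" by (intro mult_left_mono) auto
    thus ?thesis by (simp add: mult.assoc)
  qed
  have "(\<Sum>z\<in>F. \<bar>far d j k (z - y) - far d j k (z - c)\<bar>)
     \<le> (\<Sum>z\<in>F. \<bar>integral {0..a} (\<lambda>s. dens d j k s (z - y) - dens d j k s (z - c))\<bar>
        + \<bar>integral {a..1} (\<lambda>s. dens d j k s (z - y))\<bar> + \<bar>integral {a..1} (\<lambda>s. dens d j k s (z - c))\<bar>)"
  proof (rule sum_mono)
    fix z
    have "integral {0..a} (\<lambda>s. dens d j k s (z - y) - dens d j k s (z - c)) = integral {0..a} (\<lambda>s. dens d j k s (z - y)) - integral {0..a} (\<lambda>s. dens d j k s (z - c))"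
      by (rule Henstock_Kurzweil_Integration.integral_diff) (rule dens_integrable)+
    thus "\<bar>far d j k (z - y) - far d j k (z - c)\<bar> \<le> \<bar>integral {0..a} (\<lambda>s. dens d j k s (z - y) - dens d j k s (z - c))\<bar>
        + \<bar>integral {a..1} (\<lambda>s. dens d j k s (z - y))\<bar> + \<bar>integral {a..1} (\<lambda>s. dens d j k s (z - c))\<bar>"
      unfolding fsp by linarith
  qed
  also have "\<dots> \<le> (240 * 12 ^ d * (real d * L)) * (2 * sqrt a) + (24 * 12 ^ d * a) * (1 / a - 1) + (24 * 12 ^ d * a) * (1 / a - 1)"
    unfolding sum.distrib by (intro add_mono P1 P2 y c zy zc)
  also have "\<dots> \<le> 480 * (real d * 12 ^ d) + 24 * 12 ^ d + 24 * 12 ^ d"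
    using bound2 L by (simp add: sqa)
  also have "\<dots> \<le> 480 * 24 ^ d + 24 * 24 ^ d + 24 * 24 ^ d"
  proof -
    have "real d \<le> 2 ^ d" by (simp add: less_imp_le of_nat_less_two_power)
    hence "real d * 12 ^ d \<le> 2 ^ d * 12 ^ d" by (intro mult_right_mono) auto
    also have "(2::real) ^ d * 12 ^ d = 24 ^ d" by (simp flip: power_mult_distrib)
    finally have "real d * 12 ^ d \<le> 24 ^ d" .
    moreover have "(12::real) ^ d \<le> 24 ^ d" by (rule power_mono) auto
    ultimately show ?thesis by linarith
  qed
  also have "\<dots> = 528 * 24 ^ d" by simp
  also have "\<dots> \<le> 528 ^ d * 24 ^ d" using self_le_power[of "528::real" d] d0 by (intro mult_right_mono) auto
  also have "\<dots> = 12672 ^ d" by (simp flip: power_mult_distrib)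
  finally show ?thesis .
qed

section \<open>The Calderon-Zygmund decomposition\<close>

text \<open>The dyadic cube of side \<open>2\<^sup>l\<close> containing \<open>x\<close>; the
  lattice has a smallest scale, so cubes are indexed by natural numbers.\<close>
definition cell :: "nat \<Rightarrow> nat \<Rightarrow> (nat \<Rightarrow> int) \<Rightarrow> (nat \<Rightarrow> int) set" where
  "cell d l x = {y \<in> Zd d. \<forall>i\<in>{1..d}. y i div 2 ^ l = x i div 2 ^ l}"

lemma div_fiber: "b > 0 \<Longrightarrow> {y::int. y div b = c} = {c * b ..< c * b + b}"
proof -
  assume b: "b > 0"
  have "y div b = c \<longleftrightarrow> c * b \<le> y \<and> y < c * b + b" for y
  proof
    assume "y div b = c"
    hence "c * b + y mod b = y" using div_mult_mod_eq[of y b] by simp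
    thus "c * b \<le> y \<and> y < c * b + b"
      using pos_mod_bound[OF b, of y] pos_mod_sign[OF b, of y] by linarith
  next
    assume A: "c * b \<le> y \<and> y < c * b + b"
    have 1: "y = b * c + (y - c * b)" by algebra
    have 2: "0 \<le> y - c * b" "y - c * b < b" using A by linarith+
    show "y div b = c" by (rule int_div_pos_eq[OF 1 2])
  qed
  thus ?thesis by (intro set_eqI) (simp only: mem_Collect_eq atLeastLessThan_iff)
qed

lemma cell_Zbox: "cell d l x = Zbox d (\<lambda>i. {(x i div 2 ^ l) * 2 ^ l ..< (x i div 2 ^ l) * 2 ^ l + 2 ^ l})"
  unfolding cell_def Zbox_def by (subst div_fiber[symmetric]) auto

lemma finite_cell: "finite (cell d l x)"
  unfolding cell_Zbox by (rule finite_Zbox) auto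

lemma card_cell: "card (cell d l x) = 2 ^ (l * d)"
proof -
  show ?thesis unfolding cell_Zbox by (subst card_Zbox) (auto simp: power_mult nat_power_eq)
qed

lemma cell_self: "x \<in> Zd d \<Longrightarrow> x \<in> cell d l x" by (simp add: cell_def)

lemma cell_eq: "y \<in> cell d l x \<Longrightarrow> cell d l y = cell d l x"
  by (auto simp: cell_def)

lemma cell_mono: "l \<le> l' \<Longrightarrow> cell d l x \<subseteq> cell d l' x"
proof
  fix y assume l: "l \<le> l'" and y: "y \<in> cell d l x"
  have "z div 2 ^ l' = (z div 2 ^ l) div 2 ^ (l' - l)" for z :: int
    using l by (simp add: zdiv_zmult2_eq[symmetric] power_add[symmetric])
  thus "y \<in> cell d l' x" using y by (auto simp: cell_def)
qed

definition cell_avg :: "nat \<Rightarrow> ((nat \<Rightarrow> int) \<Rightarrow> complex) \<Rightarrow> nat \<Rightarrow> (nat \<Rightarrow> int) \<Rightarrow> real" where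
  "cell_avg d f l x = (\<Sum>y\<in>cell d l x. norm (f y)) / 2 ^ (l * d)"

lemma cell_zero: "x \<in> Zd d \<Longrightarrow> cell d 0 x = {x}"
  by (auto simp: cell_def Zd_def fun_eq_iff) (metis atLeastAtMost_iff)

text \<open>The Calderon-Zygmund argument. The bad set consists of the maximal dyadic cubes on which
  the average of \<open>|f|\<close> exceeds \<open>\<tau>\<close>; maximal ones exist since
  \<open>f\<close> has finite support. The good function is bounded by \<open>2\<^sup>d
  \<tau>\<close> and handled by the \<open>\<ell>\<^sup>2\<close> bound for the far part. The bad
  function has mean zero on each cube and is handled outside the tripled cubes by Hoermander's
  condition.\<close>
lemma cz_weak_type_far:
  fixes f :: "(nat \<Rightarrow> int) \<Rightarrow> complex"
  assumes jk: "j \<in> {1..d}" "k \<in> {1..d}" "j \<noteq> k"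
    and S: "finite S" "S \<subseteq> Zd d" and fS: "\<And>x. x \<notin> S \<Longrightarrow> f x = 0"
    and tau: "\<tau> > 0" and F: "finite F" "F \<subseteq> Zd d"
    and big: "\<And>z. z \<in> F \<Longrightarrow> norm (\<Sum>x\<in>S. of_real (far d j k (z - x)) * f x) > \<tau>"
  shows "\<tau> * real (card F) \<le> (10 ^ 20) ^ d * (\<Sum>x\<in>S. norm (f x))"
proof -
  have d1: "d \<ge> 1" using jk by auto
  define nf where "nf = (\<Sum>x\<in>S. norm (f x))"
  have nf0: "nf \<ge> 0" unfolding nf_def by (rule sum_nonneg) simp
  have cs: "(\<Sum>y\<in>A. norm (f y)) \<le> nf" if "finite A" for A
  proof -
    have "(\<Sum>y\<in>A. norm (f y)) = (\<Sum>y\<in>A \<inter> S. norm (f y))"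
      by (rule sum.mono_neutral_right) (use that fS in auto)
    also have "\<dots> \<le> nf" unfolding nf_def by (rule sum_mono2) (use S in auto)
    finally show ?thesis .
  qed
  define hi where "hi x = {l. cell_avg d f l x > \<tau>}" for x
  obtain L0 :: nat where L0: "nf / \<tau> < 2 ^ L0" using real_arch_pow[of 2] by auto
  have hi_sub: "hi x \<subseteq> {..L0}" for x
  proof
    fix l assume "l \<in> hi x"
    hence "\<tau> < (\<Sum>y\<in>cell d l x. norm (f y)) / 2 ^ (l * d)" by (simp add: hi_def cell_avg_def)
    also have "\<dots> \<le> nf / 2 ^ (l * d)" by (intro divide_right_mono cs finite_cell) auto
    finally have A: "\<tau> * 2 ^ (l * d) < nf" by (simp add: pos_less_divide_eq)
    have B: "\<tau> * 2 ^ l \<le> \<tau> * 2 ^ (l * d)" using tau d1 by (intro mult_left_mono power_increasing) auto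
    have "2 ^ l < nf / \<tau>" using le_less_trans[OF B A] tau by (simp add: pos_less_divide_eq mult.commute)
    hence "(2::real) ^ l < 2 ^ L0" using L0 by linarith
    thus "l \<in> {..L0}" by simp
  qed
  have fin_hi: "finite (hi x)" for x using hi_sub finite_subset by blast
  \<comment> \<open>the largest scale at which the average around \<open>x\<close> is too big\<close>
  define top where "top x = Max (hi x)" for x
  define Bad where "Bad = {x \<in> Zd d. hi x \<noteq> {}}"
  define cube where "cube x = cell d (top x) x" for x
  have top_in: "top x \<in> hi x" if "x \<in> Bad" for x
    unfolding top_def by (rule Max_in[OF fin_hi]) (use that in \<open>auto simp: Bad_def\<close>)
  have top_max: "l \<le> top x" if "l \<in> hi x" for l x
    unfolding top_def by (rule Max_ge[OF fin_hi that])
  have same: "y \<in> Bad \<and> top y = top x \<and> cube y = cube x" if x: "x \<in> Bad" and y: "y \<in> cube x" for x y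
  proof -
    have ce: "cell d l y = cell d l x" if "l \<ge> top x" for l
      by (rule cell_eq) (use cell_mono[OF that, of d x] y in \<open>auto simp: cube_def\<close>)
    hence ca: "l \<in> hi y \<longleftrightarrow> l \<in> hi x" if "l \<ge> top x" for l using that by (simp add: hi_def cell_avg_def)
    have "top x \<in> hi y" using ca[of "top x"] top_in[OF x] by simp
    hence yB: "y \<in> Bad" using y by (auto simp: Bad_def cube_def cell_def)
    have "top x \<le> top y" by (rule top_max) fact
    moreover have "top y \<le> top x" using ca[of "top y"] top_in[OF yB] top_max[of "top y" x] \<open>top x \<le> top y\<close> by simp
    ultimately have "top y = top x" by simp
    thus ?thesis using yB ce[of "top x"] by (simp add: cube_def)
  qed
  have self: "x \<in> cube x" if "x \<in> Bad" for x using that cell_self by (auto simp: cube_def Bad_def)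
  have fin_cube: "finite (cube x)" for x by (simp add: cube_def finite_cell)
  have cube_Bad: "cube x \<subseteq> Bad" if "x \<in> Bad" for x using same[OF that] by auto
  have cube_gt: "\<tau> * real (card (cube x)) < (\<Sum>y\<in>cube x. norm (f y))" if "x \<in> Bad" for x
  proof -
    have "\<tau> < (\<Sum>y\<in>cube x. norm (f y)) / 2 ^ (top x * d)"
      using top_in[OF that] by (simp add: hi_def cell_avg_def cube_def)
    thus ?thesis by (simp add: pos_less_divide_eq cube_def card_cell)
  qed
  have Bad_fin: "finite Bad"
  proof (rule finite_subset)
    show "Bad \<subseteq> (\<Union>y\<in>S. \<Union>l\<in>{..L0}. cell d l y)"
    proof
      fix x assume x: "x \<in> Bad"
      have "0 \<le> \<tau> * real (card (cube x))" using tau by simp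
      hence "0 < (\<Sum>y\<in>cube x. norm (f y))" using cube_gt[OF x] by linarith
      then obtain y where y: "y \<in> cube x" "f y \<noteq> 0"
        by (metis (mono_tags, lifting) norm_zero order_less_irrefl sum.neutral)
      have "y \<in> S" using y(2) fS by blast
      moreover have "x \<in> cell d (top x) y" using cell_eq[of y d "top x" x] y(1) self[OF x] by (simp add: cube_def)
      moreover have "top x \<le> L0" using hi_sub[of x] top_in[OF x] by auto
      ultimately show "x \<in> (\<Union>y\<in>S. \<Union>l\<in>{..L0}. cell d l y)" by blast
    qed
    show "finite (\<Union>y\<in>S. \<Union>l\<in>{..L0}. cell d l y)" using S finite_cell by blast
  qed
  define Q where "Q = cube ` Bad"
  have finQ: "finite Q" by (simp add: Q_def Bad_fin)
  have UQ: "\<Union>Q = Bad" using cube_Bad self by (auto simp: Q_def)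
  have disjQ: "\<forall>A\<in>Q. \<forall>B\<in>Q. A \<noteq> B \<longrightarrow> A \<inter> B = {}"
  proof (intro ballI impI)
    fix A B assume A: "A \<in> Q" and B: "B \<in> Q" and ne: "A \<noteq> B"
    then obtain a b where ab: "a \<in> Bad" "A = cube a" "b \<in> Bad" "B = cube b" by (auto simp: Q_def)
    show "A \<inter> B = {}"
    proof (rule ccontr)
      assume "A \<inter> B \<noteq> {}"
      then obtain z where "z \<in> cube a" "z \<in> cube b" using ab by auto
      hence "cube a = cube b" using same[OF ab(1)] same[OF ab(3)] by metis
      thus False using ne ab by simp
    qed
  qed
  have sumQ: "(\<Sum>x\<in>Bad. h x) = (\<Sum>A\<in>Q. \<Sum>x\<in>A. h x)" for h :: "(nat \<Rightarrow> int) \<Rightarrow> 'a::comm_monoid_add"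
  proof -
    have "sum h (\<Union>Q) = (sum \<circ> sum) h Q"
      by (rule sum.Union_disjoint[OF _ disjQ]) (auto simp: Q_def fin_cube)
    thus ?thesis by (simp add: UQ)
  qed
  have cardBad: "(\<Sum>A\<in>Q. real (card A)) \<le> nf / \<tau>"
  proof -
    have "\<tau> * (\<Sum>A\<in>Q. real (card A)) = (\<Sum>A\<in>Q. \<tau> * real (card A))" by (simp add: sum_distrib_left)
    also have "\<dots> \<le> (\<Sum>A\<in>Q. \<Sum>y\<in>A. norm (f y))"
      by (rule sum_mono) (use cube_gt in \<open>auto simp: Q_def less_imp_le\<close>)
    also have "\<dots> = (\<Sum>y\<in>Bad. norm (f y))" by (rule sumQ[symmetric])
    also have "\<dots> \<le> nf" by (rule cs[OF Bad_fin])
    finally show ?thesis using tau by (simp add: pos_le_divide_eq mult.commute)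
  qed
  define mean where "mean A = (\<Sum>y\<in>A. f y) / of_nat (card A)" for A :: "(nat \<Rightarrow> int) set"
  define b where "b x = (if x \<in> Bad then f x - mean (cube x) else 0)" for x
  define g where "g x = f x - b x" for x
  define T where "T = S \<union> Bad"
  have T: "finite T" "T \<subseteq> Zd d" using S Bad_fin by (auto simp: T_def Bad_def)
  have cardpos: "card A > 0" if "A \<in> Q" for A using that by (auto simp: Q_def cube_def card_cell)
  have cubeQ: "cube x = A" if A: "A \<in> Q" and x: "x \<in> A" for A x
  proof -
    obtain a where a: "a \<in> Bad" "A = cube a" using A by (auto simp: Q_def)
    thus ?thesis using same[OF a(1), of x] x by simp
  qed
  have b0: "(\<Sum>y\<in>A. b y) = 0" if A: "A \<in> Q" for A
  proof -
    have "(\<Sum>y\<in>A. b y) = (\<Sum>y\<in>A. f y - mean A)"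
    proof (rule sum.cong[OF refl])
      fix y assume y: "y \<in> A"
      hence "y \<in> Bad" using UQ A by blast
      thus "b y = f y - mean A" using cubeQ[OF A y] by (simp add: b_def)
    qed
    also have "\<dots> = 0" using cardpos[OF A] by (simp add: sum_subtractf mean_def)
    finally show ?thesis .
  qed
  have mean_le: "norm (mean A) * real (card A) \<le> (\<Sum>y\<in>A. norm (f y))" if A: "A \<in> Q" for A
  proof -
    have "norm (mean A) * real (card A) = norm (\<Sum>y\<in>A. f y)" using cardpos[OF A] by (simp add: mean_def norm_divide)
    thus ?thesis using norm_sum[of f A] by simp
  qed
  have bsum: "(\<Sum>A\<in>Q. \<Sum>y\<in>A. norm (b y)) \<le> 2 * nf"
  proof -
    have "(\<Sum>y\<in>A. norm (b y)) \<le> 2 * (\<Sum>y\<in>A. norm (f y))" if A: "A \<in> Q" for A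
    proof -
      have "(\<Sum>y\<in>A. norm (b y)) \<le> (\<Sum>y\<in>A. norm (f y) + norm (mean A))"
      proof (rule sum_mono)
        fix y assume y: "y \<in> A"
        hence "y \<in> Bad" using UQ A by blast
        hence "b y = f y - mean A" using cubeQ[OF A y] by (simp add: b_def)
        thus "norm (b y) \<le> norm (f y) + norm (mean A)" by (simp add: norm_triangle_ineq4)
      qed
      also have "\<dots> = (\<Sum>y\<in>A. norm (f y)) + norm (mean A) * real (card A)" by (simp add: sum.distrib)
      finally show ?thesis using mean_le[OF A] by simp
    qed
    hence "(\<Sum>A\<in>Q. \<Sum>y\<in>A. norm (b y)) \<le> (\<Sum>A\<in>Q. 2 * (\<Sum>y\<in>A. norm (f y)))" by (rule sum_mono)
    also have "\<dots> = 2 * (\<Sum>y\<in>Bad. norm (f y))" by (simp add: sumQ sum_distrib_left)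
    also have "\<dots> \<le> 2 * nf" using cs[OF Bad_fin] by simp
    finally show ?thesis .
  qed
  have g_le: "norm (g x) \<le> 2 ^ d * \<tau>" if x: "x \<in> T" for x
  proof (cases "x \<in> Bad")
    case False
    hence "0 \<notin> hi x" using x T by (auto simp: Bad_def)
    hence "norm (f x) \<le> \<tau>" using cell_zero[of x d] x T by (auto simp: hi_def cell_avg_def)
    also have "\<dots> \<le> 2 ^ d * \<tau>" using tau by simp
    finally show ?thesis using False by (simp add: g_def b_def)
  next
    case True
    have AQ: "cube x \<in> Q" using True by (simp add: Q_def)
    have "Suc (top x) \<notin> hi x" using top_max[of "Suc (top x)" x] by auto
    hence "cell_avg d f (Suc (top x)) x \<le> \<tau>" by (simp add: hi_def)
    hence up: "(\<Sum>y\<in>cell d (Suc (top x)) x. norm (f y)) \<le> \<tau> * 2 ^ (Suc (top x) * d)"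
      by (simp add: cell_avg_def pos_divide_le_eq)
    have "(\<Sum>y\<in>cube x. norm (f y)) \<le> (\<Sum>y\<in>cell d (Suc (top x)) x. norm (f y))"
      unfolding cube_def by (rule sum_mono2[OF finite_cell cell_mono]) auto
    also have "\<dots> \<le> (2 ^ d * \<tau>) * 2 ^ (top x * d)" using up by (simp add: power_add mult_ac)
    finally have 1: "(\<Sum>y\<in>cube x. norm (f y)) \<le> (2 ^ d * \<tau>) * 2 ^ (top x * d)" .
    have "real (card (cube x)) = 2 ^ (top x * d)" by (simp add: cube_def card_cell)
    hence "norm (mean (cube x)) * 2 ^ (top x * d) \<le> (2 ^ d * \<tau>) * 2 ^ (top x * d)"
      using order_trans[OF mean_le[OF AQ] 1] by (simp only:)
    hence "norm (mean (cube x)) \<le> 2 ^ d * \<tau>" by (rule mult_right_le_imp_le) simp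
    thus ?thesis using True by (simp add: g_def b_def)
  qed
  have gsum: "(\<Sum>x\<in>T. norm (g x)) \<le> nf"
  proof -
    have "(\<Sum>x\<in>T. norm (g x)) = (\<Sum>x\<in>S - Bad. norm (g x)) + (\<Sum>x\<in>Bad. norm (g x))"
      unfolding T_def by (subst sum.union_disjoint[symmetric]) (use S Bad_fin in \<open>auto intro!: sum.cong\<close>)
    also have "(\<Sum>x\<in>S - Bad. norm (g x)) = (\<Sum>x\<in>S - Bad. norm (f x))" by (intro sum.cong) (auto simp: g_def b_def)
    also have "(\<Sum>x\<in>Bad. norm (g x)) = (\<Sum>A\<in>Q. \<Sum>x\<in>A. norm (g x))" by (rule sumQ)
    also have "\<dots> \<le> (\<Sum>A\<in>Q. \<Sum>x\<in>A. norm (f x))"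
    proof (rule sum_mono)
      fix A assume A: "A \<in> Q"
      have "(\<Sum>x\<in>A. norm (g x)) = (\<Sum>x\<in>A. norm (mean A))"
      proof (rule sum.cong[OF refl])
        fix y assume y: "y \<in> A"
        hence "y \<in> Bad" using UQ A by blast
        thus "norm (g y) = norm (mean A)" using cubeQ[OF A y] by (simp add: g_def b_def)
      qed
      thus "(\<Sum>x\<in>A. norm (g x)) \<le> (\<Sum>x\<in>A. norm (f x))" using mean_le[OF A] by (simp add: mult.commute)
    qed
    also have "\<dots> = (\<Sum>x\<in>Bad. norm (f x))" by (rule sumQ[symmetric])
    also have "(\<Sum>x\<in>S - Bad. norm (f x)) + (\<Sum>x\<in>Bad. norm (f x)) = (\<Sum>x\<in>T. norm (f x))"
      unfolding T_def by (subst sum.union_disjoint[symmetric]) (use S Bad_fin in \<open>auto intro!: sum.cong\<close>)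
    also have "\<dots> \<le> nf" by (rule cs[OF T(1)])
    finally show ?thesis by simp
  qed
  define KG where "KG z = (\<Sum>x\<in>T. of_real (far d j k (z - x)) * g x)" for z
  define KB where "KB z = (\<Sum>x\<in>Bad. of_real (far d j k (z - x)) * b x)" for z
  have split: "(\<Sum>x\<in>S. of_real (far d j k (z - x)) * f x) = KG z + KB z" for z
  proof -
    have "(\<Sum>x\<in>S. of_real (far d j k (z - x)) * f x) = (\<Sum>x\<in>T. of_real (far d j k (z - x)) * f x)"
      by (rule sum.mono_neutral_left) (use T fS in \<open>auto simp: T_def\<close>)
    also have "\<dots> = KG z + (\<Sum>x\<in>T. of_real (far d j k (z - x)) * b x)"
      unfolding KG_def by (simp add: g_def sum.distrib[symmetric] algebra_simps)
    also have "(\<Sum>x\<in>T. of_real (far d j k (z - x)) * b x) = KB z"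
      unfolding KB_def by (rule sum.mono_neutral_right) (use T in \<open>auto simp: T_def b_def\<close>)
    finally show ?thesis .
  qed
  define A2 :: real where "A2 = 1 + 1000000000 ^ d"
  have A2: "A2 > 0" by (simp add: A2_def add_pos_pos)
  define FG where "FG = {z \<in> F. norm (KG z) > \<tau> / 2}"
  have good: "\<tau> * real (card FG) \<le> 4 * A2\<^sup>2 * 2 ^ d * nf"
  proof -
    have fb: "form_bound d 2 A2 (far d j k)"
      using form_bound_far[OF jk, of 2] by (simp add: A2_def)
    have "real (card FG) * (\<tau> / 2)\<^sup>2 = (\<Sum>z\<in>FG. (\<tau> / 2)\<^sup>2)" by simp
    also have "\<dots> \<le> (\<Sum>z\<in>FG. norm (KG z) powr 2)"
      by (rule sum_mono) (use tau in \<open>auto simp: FG_def powr_numeral intro!: power_mono\<close>)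
    also have "\<dots> \<le> A2 powr 2 * (\<Sum>x\<in>T. norm (g x) powr 2)"
      unfolding KG_def by (rule form_bound_complex_norm[OF _ A2 fb T]) (use F in \<open>auto simp: FG_def\<close>)
    also have "(\<Sum>x\<in>T. norm (g x) powr 2) \<le> (\<Sum>x\<in>T. (2 ^ d * \<tau>) * norm (g x))"
      by (rule sum_mono) (use g_le in \<open>auto simp: powr_numeral power2_eq_square intro!: mult_right_mono\<close>)
    also have "\<dots> = (2 ^ d * \<tau>) * (\<Sum>x\<in>T. norm (g x))" by (simp add: sum_distrib_left)
    also have "\<dots> \<le> (2 ^ d * \<tau>) * nf" by (rule mult_left_mono[OF gsum]) (use tau in auto)
    finally have "real (card FG) * (\<tau> / 2)\<^sup>2 \<le> A2\<^sup>2 * ((2 ^ d * \<tau>) * nf)"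
      using A2 by (simp add: powr_numeral mult_left_mono)
    hence "\<tau> * (\<tau> * real (card FG)) \<le> \<tau> * (4 * A2\<^sup>2 * 2 ^ d * nf)" by (simp add: power2_eq_square algebra_simps)
    thus ?thesis using tau by simp
  qed
  \<comment> \<open>a marked point of each bad cube, at which the kernel is subtracted\<close>
  define rep where "rep A = (SOME x. x \<in> Bad \<and> cube x = A)" for A
  have rep: "rep A \<in> Bad" "cube (rep A) = A" if "A \<in> Q" for A
  proof -
    have "\<exists>x. x \<in> Bad \<and> cube x = A" using that by (auto simp: Q_def)
    from someI_ex[OF this] show "rep A \<in> Bad" "cube (rep A) = A" by (auto simp: rep_def)
  qed
  define trip where "trip A = Zbox d (\<lambda>i. {(rep A i div 2 ^ top (rep A) - 1) * 2 ^ top (rep A) ..< (rep A i div 2 ^ top (rep A) + 2) * 2 ^ top (rep A)})" for A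
  have card_trip: "card (trip A) = 3 ^ d * card A" if "A \<in> Q" for A
  proof -
    define t where "t = top (rep A)"
    have "card (trip A) = (\<Prod>i\<in>{1..d}. nat (3 * 2 ^ t))"
      unfolding trip_def t_def[symmetric] by (subst card_Zbox) (auto simp: algebra_simps)
    also have "nat (3 * 2 ^ t) = 3 * 2 ^ t" by (simp add: nat_mult_distrib nat_power_eq)
    also have "(\<Prod>i\<in>{1..d}. 3 * 2 ^ t) = 3 ^ d * (2 ^ (t * d))" by (simp add: power_mult_distrib power_mult)
    also have "(2::nat) ^ (t * d) = card (cube (rep A))" by (simp add: cube_def card_cell t_def)
    also have "cube (rep A) = A" by (rule rep(2)[OF that])
    finally show ?thesis by simp
  qed
  define E where "E = (\<Union>A\<in>Q. trip A)"
  have finE: "finite E" unfolding E_def trip_def by (intro finite_UN_I finQ finite_Zbox) auto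
  have cardE: "\<tau> * real (card E) \<le> 3 ^ d * nf"
  proof -
    have "card E \<le> (\<Sum>A\<in>Q. card (trip A))" unfolding E_def by (rule card_UN_le[OF finQ])
    also have "\<dots> = 3 ^ d * (\<Sum>A\<in>Q. card A)" by (simp add: card_trip sum_distrib_left)
    finally have "real (card E) \<le> real (3 ^ d * (\<Sum>A\<in>Q. card A))" by (rule of_nat_mono)
    also have "\<dots> = 3 ^ d * (\<Sum>A\<in>Q. real (card A))" by simp
    also have "\<dots> \<le> 3 ^ d * (nf / \<tau>)" by (rule mult_left_mono[OF cardBad]) simp
    finally show ?thesis using tau by (simp add: pos_le_divide_eq mult.commute)
  qed
  define FB where "FB = {z \<in> F - E. norm (KB z) > \<tau> / 2}"
  have bad: "\<tau> * real (card FB) \<le> 4 * 12672 ^ d * nf"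
  proof -
    have FB: "finite FB" "FB \<subseteq> Zd d" using F by (auto simp: FB_def)
    have KB: "norm (KB z) \<le> (\<Sum>A\<in>Q. \<Sum>y\<in>A. norm (b y) * \<bar>far d j k (z - y) - far d j k (z - rep A)\<bar>)" for z
    proof -
      have "KB z = (\<Sum>A\<in>Q. \<Sum>y\<in>A. of_real (far d j k (z - y)) * b y)" unfolding KB_def by (rule sumQ)
      also have "\<dots> = (\<Sum>A\<in>Q. \<Sum>y\<in>A. of_real (far d j k (z - y) - far d j k (z - rep A)) * b y)"
      proof (rule sum.cong[OF refl])
        fix A assume A: "A \<in> Q"
        have "(\<Sum>y\<in>A. of_real (far d j k (z - y) - far d j k (z - rep A)) * b y)
          = (\<Sum>y\<in>A. of_real (far d j k (z - y)) * b y) - of_real (far d j k (z - rep A)) * (\<Sum>y\<in>A. b y)"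
          unfolding of_real_diff left_diff_distrib sum_subtractf sum_distrib_left[symmetric] ..
        thus "(\<Sum>y\<in>A. of_real (far d j k (z - y)) * b y) = (\<Sum>y\<in>A. of_real (far d j k (z - y) - far d j k (z - rep A)) * b y)"
          using b0[OF A] by simp
      qed
      also have "norm \<dots> \<le> (\<Sum>A\<in>Q. \<Sum>y\<in>A. norm (of_real (far d j k (z - y) - far d j k (z - rep A)) * b y))"
        by (intro sum_norm_le norm_sum)
      finally show ?thesis by (simp only: norm_mult norm_of_real mult.commute)
    qed
    have H: "(\<Sum>z\<in>FB. \<bar>far d j k (z - y) - far d j k (z - rep A)\<bar>) \<le> 12672 ^ d" if A: "A \<in> Q" and y: "y \<in> A" for A y
    proof -
      define t where "t = top (rep A)"
      define r where "r = rep A"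
      have yc: "y \<in> cell d t r" "r \<in> cell d t r"
        using y rep[OF A] self[of r] by (auto simp: cube_def t_def r_def)
      have far_z: "\<exists>i\<in>{1..d}. \<bar>z i - w i\<bar> \<ge> 2 ^ t" if z: "z \<in> FB" and w: "w \<in> cell d t r" for z w
      proof -
        have "z \<notin> trip A" "z \<in> Zd d" using z A F by (auto simp: FB_def E_def)
        then obtain i where i: "i \<in> {1..d}" "\<not> ((r i div 2 ^ t - 1) * 2 ^ t \<le> z i \<and> z i < (r i div 2 ^ t + 2) * 2 ^ t)"
          by (auto simp: trip_def Zbox_def t_def r_def)
        have "w i \<in> {u. u div 2 ^ t = r i div 2 ^ t}" using w i(1) by (simp add: cell_def)
        hence "(r i div 2 ^ t) * 2 ^ t \<le> w i" "w i < (r i div 2 ^ t) * 2 ^ t + 2 ^ t"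
          unfolding div_fiber[of "2 ^ t" "r i div 2 ^ t", simplified] by auto
        hence "\<bar>z i - w i\<bar> \<ge> 2 ^ t" using i(2) by (simp add: algebra_simps) linarith
        thus ?thesis using i(1) by blast
      qed
      have near_yc: "\<bar>y i - r i\<bar> \<le> 2 ^ t" if "i \<in> {1..d}" for i
      proof -
        have "y i \<in> {u. u div 2 ^ t = r i div 2 ^ t}" "r i \<in> {u. u div 2 ^ t = r i div 2 ^ t}" using yc that by (auto simp: cell_def)
        thus ?thesis unfolding div_fiber[of "2 ^ t" "r i div 2 ^ t", simplified] by auto
      qed
      show ?thesis unfolding r_def[symmetric]
        by (rule hormander_far[OF jk(1,2), where l = "2 ^ t"])
           (use yc near_yc FB far_z in \<open>auto simp: cell_def\<close>)
    qed
    have "real (card FB) * (\<tau> / 2) = (\<Sum>z\<in>FB. \<tau> / 2)" by simp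
    also have "\<dots> \<le> (\<Sum>z\<in>FB. \<Sum>A\<in>Q. \<Sum>y\<in>A. norm (b y) * \<bar>far d j k (z - y) - far d j k (z - rep A)\<bar>)"
    proof (rule sum_mono)
      fix z assume "z \<in> FB"
      hence "\<tau> / 2 \<le> norm (KB z)" by (simp add: FB_def)
      thus "\<tau> / 2 \<le> (\<Sum>A\<in>Q. \<Sum>y\<in>A. norm (b y) * \<bar>far d j k (z - y) - far d j k (z - rep A)\<bar>)"
        using KB[of z] by (rule order_trans)
    qed
    also have "\<dots> = (\<Sum>A\<in>Q. \<Sum>y\<in>A. norm (b y) * (\<Sum>z\<in>FB. \<bar>far d j k (z - y) - far d j k (z - rep A)\<bar>))"
      unfolding sum_distrib_left by (subst sum.swap) (intro sum.cong refl sum.swap)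
    also have "\<dots> \<le> (\<Sum>A\<in>Q. \<Sum>y\<in>A. norm (b y) * 12672 ^ d)"
      by (intro sum_mono mult_left_mono H) auto
    also have "\<dots> = 12672 ^ d * (\<Sum>A\<in>Q. \<Sum>y\<in>A. norm (b y))"
      unfolding sum_distrib_left by (intro sum.cong refl mult.commute)
    also have "\<dots> \<le> 12672 ^ d * (2 * nf)" by (rule mult_left_mono[OF bsum]) simp
    finally show ?thesis by (simp add: mult_ac)
  qed
  have "F \<subseteq> E \<union> FG \<union> FB"
  proof
    fix z assume z: "z \<in> F"
    have "\<tau> < norm (KG z + KB z)" using big[OF z] unfolding split .
    also have "\<dots> \<le> norm (KG z) + norm (KB z)" by (rule norm_triangle_ineq)
    finally have "norm (KG z) > \<tau> / 2 \<or> norm (KB z) > \<tau> / 2" by linarith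
    thus "z \<in> E \<union> FG \<union> FB" using z by (auto simp: FG_def FB_def)
  qed
  hence "card F \<le> card (E \<union> FG \<union> FB)" by (rule card_mono[rotated]) (use finE F in \<open>auto simp: FG_def FB_def\<close>)
  also have "\<dots> \<le> card E + card FG + card FB" using card_Un_le[of "E \<union> FG" FB] card_Un_le[of E FG] by linarith
  finally have "real (card F) \<le> real (card E) + real (card FG) + real (card FB)" by linarith
  hence "\<tau> * real (card F) \<le> \<tau> * (real (card E) + real (card FG) + real (card FB))"
    by (rule mult_left_mono) (use tau in simp)
  also have "\<dots> \<le> 3 ^ d * nf + 4 * A2\<^sup>2 * 2 ^ d * nf + 4 * 12672 ^ d * nf"
    using cardE good bad by (simp add: distrib_left)
  also have "\<dots> = (3 ^ d + 4 * A2\<^sup>2 * 2 ^ d + 4 * 12672 ^ d) * nf" by (simp add: distrib_right)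
  also have "\<dots> \<le> (10 ^ 20) ^ d * nf"
  proof (rule mult_right_mono[OF _ nf0])
    have "A2 \<le> 2 * 1000000000 ^ d" by (simp add: A2_def)
    hence "A2\<^sup>2 \<le> (2 * 1000000000 ^ d)\<^sup>2" by (rule power_mono) (use A2 in simp)
    also have "\<dots> = 4 * 1000000000000000000 ^ d" by (simp add: power_mult_distrib power2_eq_square flip: power_mult_distrib)
    finally have "4 * A2\<^sup>2 * 2 ^ d \<le> 16 * (1000000000000000000 ^ d * 2 ^ d)" by simp
    also have "(1000000000000000000::real) ^ d * 2 ^ d = 2000000000000000000 ^ d" by (simp flip: power_mult_distrib)
    finally have 1: "4 * A2\<^sup>2 * 2 ^ d \<le> 16 * 2000000000000000000 ^ d" .
    have 2: "(3::real) ^ d \<le> 2000000000000000000 ^ d" by (rule power_mono) auto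
    have 3: "(12672::real) ^ d \<le> 2000000000000000000 ^ d" by (rule power_mono) auto
    have "3 ^ d + 4 * A2\<^sup>2 * 2 ^ d + 4 * 12672 ^ d \<le> 21 * 2000000000000000000 ^ d" using 1 2 3 by linarith
    also have "\<dots> \<le> 21 ^ d * 2000000000000000000 ^ d" using self_le_power[of "21::real" d] d1 by (intro mult_right_mono) auto
    also have "\<dots> = 42000000000000000000 ^ d" by (simp flip: power_mult_distrib)
    also have "\<dots> \<le> (10 ^ 20) ^ d" by (rule power_mono) auto
    finally show "3 ^ d + 4 * A2\<^sup>2 * 2 ^ d + 4 * 12672 ^ d \<le> (10 ^ 20) ^ d" .
  qed
  finally show ?thesis by (simp add: nf_def)
qed

section \<open>The weak-type norm\<close>

text \<open>A point above level \<open>\<tau>\<close> is above level \<open>(1-\<eta>)\<tau>\<close>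
  for the near part, where Chebyshev's inequality applies, or above level
  \<open>\<eta>\<tau>\<close> for the far part.\<close>
lemma kern_weak_type_finite:
  fixes f :: "(nat \<Rightarrow> int) \<Rightarrow> complex"
  assumes jk: "j \<in> {1..d}" "k \<in> {1..d}" "j \<noteq> k"
    and S: "finite S" "S \<subseteq> Zd d"
    and tau: "\<tau> > 0" and F: "finite F" "F \<subseteq> Zd d" and eta: "0 < \<eta>" "\<eta> < 1"
    and E: "\<And>F. finite F \<Longrightarrow> F \<subseteq> Zd d \<Longrightarrow> (\<Sum>m\<in>F. \<bar>near d j k m\<bar>) \<le> E"
    and big: "\<And>z. z \<in> F \<Longrightarrow> norm (\<Sum>x\<in>S. of_real (kern d j k (z - x)) * f x) > \<tau>"
  shows "\<tau> * real (card F) \<le> (E / (1 - \<eta>) + (10 ^ 20) ^ d / \<eta>) * (\<Sum>x\<in>S. norm (f x))"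
proof -
  define nf where "nf = (\<Sum>x\<in>S. norm (f x))"
  define g where "g x = (if x \<in> S then f x else 0)" for x
  define U where "U z = (\<Sum>x\<in>S. of_real (near d j k (z - x)) * f x)" for z
  define V where "V z = (\<Sum>x\<in>S. of_real (far d j k (z - x)) * f x)" for z
  define FU where "FU = {z \<in> F. norm (U z) > (1 - \<eta>) * \<tau>}"
  define FV where "FV = {z \<in> F. norm (V z) > \<eta> * \<tau>}"
  have fin: "finite FU" "finite FV" "FV \<subseteq> Zd d" using F by (auto simp: FU_def FV_def)
  have "(1 - \<eta>) * \<tau> * real (card FU) = (\<Sum>z\<in>FU. (1 - \<eta>) * \<tau>)" by simp
  also have "\<dots> \<le> (\<Sum>z\<in>FU. norm (U z))" by (rule sum_mono) (auto simp: FU_def)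
  also have "\<dots> \<le> (\<Sum>z\<in>FU. \<Sum>x\<in>S. \<bar>near d j k (z - x)\<bar> * norm (f x))"
    unfolding U_def by (intro sum_mono sum_norm_le) (simp add: norm_mult)
  also have "\<dots> = (\<Sum>x\<in>S. \<Sum>z\<in>FU. \<bar>near d j k (z - x)\<bar> * norm (f x))" by (rule sum.swap)
  also have "\<dots> \<le> (\<Sum>x\<in>S. E * norm (f x))"
  proof (rule sum_mono)
    fix x assume x: "x \<in> S"
    have "(\<Sum>z\<in>FU. \<bar>near d j k (z - x)\<bar>) = (\<Sum>m\<in>(\<lambda>z. z - x) ` FU. \<bar>near d j k m\<bar>)"
      by (subst sum.reindex) (auto simp: inj_on_def)
    also have "\<dots> \<le> E" by (rule E) (use fin F S x in \<open>auto simp: FU_def intro!: Zd_diff\<close>)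
    finally show "(\<Sum>z\<in>FU. \<bar>near d j k (z - x)\<bar> * norm (f x)) \<le> E * norm (f x)"
      unfolding sum_distrib_right[symmetric] by (rule mult_right_mono) simp
  qed
  also have "\<dots> = E * nf" by (simp add: nf_def sum_distrib_left)
  finally have 1: "\<tau> * real (card FU) \<le> E / (1 - \<eta>) * nf" using eta by (simp add: field_simps)
  have gS: "(\<Sum>x\<in>S. of_real (far d j k (z - x)) * g x) = V z" for z
    unfolding V_def by (intro sum.cong refl) (simp add: g_def)
  have "\<eta> * \<tau> * real (card FV) \<le> (10 ^ 20) ^ d * (\<Sum>x\<in>S. norm (g x))"
    by (rule cz_weak_type_far[OF jk S, of g "\<eta> * \<tau>" FV]) (use eta tau fin gS in \<open>auto simp: g_def FV_def\<close>)
  also have "(\<Sum>x\<in>S. norm (g x)) = nf" unfolding nf_def by (intro sum.cong refl) (simp add: g_def)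
  finally have 2: "\<tau> * real (card FV) \<le> (10 ^ 20) ^ d / \<eta> * nf" using eta by (simp add: field_simps)
  have "F \<subseteq> FU \<union> FV"
  proof
    fix z assume z: "z \<in> F"
    have "(\<Sum>x\<in>S. of_real (kern d j k (z - x)) * f x) = U z + V z"
      unfolding U_def V_def sum.distrib[symmetric] by (intro sum.cong refl) (simp add: near_def algebra_simps)
    hence "\<tau> < norm (U z + V z)" using big[OF z] by simp
    also have "\<dots> \<le> norm (U z) + norm (V z)" by (rule norm_triangle_ineq)
    finally have "(1 - \<eta>) * \<tau> + \<eta> * \<tau> < norm (U z) + norm (V z)" by (simp add: algebra_simps)
    hence "norm (U z) > (1 - \<eta>) * \<tau> \<or> norm (V z) > \<eta> * \<tau>" by linarith
    thus "z \<in> FU \<union> FV" using z by (auto simp: FU_def FV_def)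
  qed
  hence "card F \<le> card (FU \<union> FV)" by (rule card_mono[rotated]) (use fin in auto)
  also have "\<dots> \<le> card FU + card FV" by (rule card_Un_le)
  finally have "real (card F) \<le> real (card FU) + real (card FV)" by linarith
  hence "\<tau> * real (card F) \<le> \<tau> * (real (card FU) + real (card FV))" by (rule mult_left_mono) (use tau in simp)
  thus ?thesis using 1 2 by (simp add: algebra_simps nf_def)
qed

text \<open>Only finitely many points are tested at a time, and the strict inequality at each of
  them survives a truncation of \<open>f\<close>.\<close>
lemma weak_opnorm_upper:
  assumes jk: "j \<in> {1..d}" "k \<in> {1..d}" "j \<noteq> k" and eta: "0 < \<eta>" "\<eta> < 1"
    and E: "\<And>F. finite F \<Longrightarrow> F \<subseteq> Zd d \<Longrightarrow> (\<Sum>m\<in>F. \<bar>near d j k m\<bar>) \<le> E"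
  shows "weak_opnorm d (R_dis_diff d j k) \<le> ereal (E / (1 - \<eta>) + (10 ^ 20) ^ d / \<eta>)"
proof -
  define A where "A = E / (1 - \<eta>) + (10 ^ 20) ^ d / \<eta>"
  have "E \<ge> 0" using E[of "{}"] by simp
  hence A0: "A \<ge> 0" using eta by (simp add: A_def)
  show ?thesis unfolding weak_opnorm_def A_def[symmetric]
  proof (rule SUP_least)
    fix f assume "f \<in> {f. lp_norm d 1 f \<le> 1}"
    hence f: "(\<lambda>x. norm (f x) powr 1) summable_on Zd d" "(\<Sum>\<^sub>\<infinity>x\<in>Zd d. norm (f x) powr 1) \<le> 1"
      using lp_norm_le_1[of d 1 f] by auto
    let ?T = "R_dis_diff d j k f"
    have key: "\<tau> * real (card F) \<le> A" if tau: "\<tau> > 0" and F: "finite F" "F \<subseteq> {n \<in> Zd d. norm (?T n) > \<tau>}" for \<tau> F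
    proof -
      have "\<forall>\<^sub>F S in finite_subsets_at_top (Zd d). \<forall>z\<in>F. norm (\<Sum>x\<in>S. of_real (kern d j k (z - x)) * f x) > \<tau>"
      proof (subst eventually_ball_finite_distrib[OF F(1)], intro ballI)
        fix z assume z: "z \<in> F"
        hence zZ: "z \<in> Zd d" using F by auto
        have "((\<lambda>x. of_real (kern d j k (z - x)) * f x) has_sum ?T z) (Zd d)"
          by (rule conv_has_sum[OF jk(1,2) order_refl zZ f(1)])
        hence "((\<lambda>S. norm (\<Sum>x\<in>S. of_real (kern d j k (z - x)) * f x)) \<longlongrightarrow> norm (?T z)) (finite_subsets_at_top (Zd d))"
          unfolding has_sum_def by (rule tendsto_norm)
        thus "\<forall>\<^sub>F S in finite_subsets_at_top (Zd d). norm (\<Sum>x\<in>S. of_real (kern d j k (z - x)) * f x) > \<tau>"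
          by (rule order_tendstoD(1)) (use z F in auto)
      qed
      moreover have "\<forall>\<^sub>F S in finite_subsets_at_top (Zd d). finite S \<and> S \<subseteq> Zd d"
        by (rule eventually_finite_subsets_at_top_weakI) auto
      ultimately have "\<forall>\<^sub>F S in finite_subsets_at_top (Zd d). \<tau> * real (card F) \<le> A"
      proof eventually_elim
        case (elim S)
        have "\<tau> * real (card F) \<le> A * (\<Sum>x\<in>S. norm (f x))"
          unfolding A_def by (rule kern_weak_type_finite[OF jk _ _ tau _ _ eta E]) (use elim F in auto)
        also have "(\<Sum>x\<in>S. norm (f x)) \<le> 1"
        proof -
          have "(\<Sum>x\<in>S. norm (f x) powr 1) \<le> (\<Sum>\<^sub>\<infinity>x\<in>Zd d. norm (f x) powr 1)"
            by (rule finite_sum_le_infsum[OF f(1)]) (use elim in auto)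
          thus ?thesis using f(2) by simp
        qed
        hence "A * (\<Sum>x\<in>S. norm (f x)) \<le> A * 1" by (rule mult_left_mono[OF _ A0])
        finally show ?case by simp
      qed
      thus ?thesis by simp
    qed
    show "weak_l1_norm d ?T \<le> ereal A" unfolding weak_l1_norm_def
    proof (rule SUP_least)
      fix \<tau> :: real assume "\<tau> \<in> {0<..}"
      hence tau: "\<tau> > 0" by simp
      let ?X = "{n \<in> Zd d. norm (?T n) > \<tau>}"
      have "finite ?X"
      proof (rule ccontr)
        assume inf: "infinite ?X"
        obtain M :: nat where M: "real M > A / \<tau>" using reals_Archimedean2 by blast
        obtain F where F: "F \<subseteq> ?X" "finite F" "card F = M" using infinite_arbitrarily_large[OF inf] by metis
        have "\<tau> * real M \<le> A" using key[OF tau F(2,1)] F(3) by simp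
        thus False using M tau by (simp add: pos_divide_less_eq mult.commute)
      qed
      thus "(if finite ?X then ereal (\<tau> * real (card ?X)) else \<infinity>) \<le> ereal A"
        using key[OF tau, of ?X] by simp
    qed
  qed
qed

lemma lp_norm_finite_support:
  assumes S: "finite S" "S \<subseteq> Zd d" and f: "\<And>x. x \<in> Zd d \<Longrightarrow> x \<notin> S \<Longrightarrow> f x = 0"
  shows "(\<lambda>x. norm (f x) powr p) summable_on Zd d" "(\<Sum>\<^sub>\<infinity>x\<in>Zd d. norm (f x) powr p) = (\<Sum>x\<in>S. norm (f x) powr p)"
proof -
  have "(\<lambda>x. norm (f x) powr p) summable_on S" by (rule summable_on_finite[OF S(1)])
  moreover have "(\<lambda>x. norm (f x) powr p) summable_on S \<longleftrightarrow> (\<lambda>x. norm (f x) powr p) summable_on Zd d"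
    by (rule summable_on_cong_neutral) (use S f in auto)
  ultimately show "(\<lambda>x. norm (f x) powr p) summable_on Zd d" by blast
  have "(\<Sum>\<^sub>\<infinity>x\<in>Zd d. norm (f x) powr p) = (\<Sum>\<^sub>\<infinity>x\<in>S. norm (f x) powr p)"
    by (rule infsum_cong_neutral) (use S f in auto)
  thus "(\<Sum>\<^sub>\<infinity>x\<in>Zd d. norm (f x) powr p) = (\<Sum>x\<in>S. norm (f x) powr p)" using S by simp
qed

lemma conv_finite_support:
  assumes jk: "j \<in> {1..d}" "k \<in> {1..d}" and S: "finite S" "S \<subseteq> Zd d" and f: "\<And>x. x \<in> Zd d \<Longrightarrow> x \<notin> S \<Longrightarrow> f x = 0"
    and n: "n \<in> Zd d"
  shows "R_dis_diff d j k f n = (\<Sum>x\<in>S. of_real (kern d j k (n - x)) * f x)"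
proof -
  have 1: "((\<lambda>x. of_real (kern d j k (n - x)) * f x) has_sum R_dis_diff d j k f n) (Zd d)"
    by (rule conv_has_sum[OF jk order_refl n lp_norm_finite_support(1)[OF S f]])
  have "((\<lambda>x. of_real (kern d j k (n - x)) * f x) has_sum R_dis_diff d j k f n) (Zd d)
    \<longleftrightarrow> ((\<lambda>x. of_real (kern d j k (n - x)) * f x) has_sum R_dis_diff d j k f n) S"
    by (rule has_sum_cong_neutral) (use S f in auto)
  hence "((\<lambda>x. of_real (kern d j k (n - x)) * f x) has_sum R_dis_diff d j k f n) S" using 1 by blast
  thus ?thesis using S(1) by (metis has_sum_finite has_sum_unique)
qed

text \<open>The image of the indicator of the origin is the kernel itself, which has absolute value
  \<open>c\<^sub>d\<close> at the four points \<open>\<plusminus>e\<^sub>j,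
  \<plusminus>e\<^sub>k\<close>. The level set is defined by a strict inequality, so levels approach
  \<open>c\<^sub>d\<close> from below.\<close>
lemma weak_opnorm_lower:
  assumes jk: "j \<in> {1..d}" "k \<in> {1..d}" "j \<noteq> k"
  shows "ereal (4 * riesz_const d) \<le> weak_opnorm d (R_dis_diff d j k)"
proof -
  define c where "c = riesz_const d"
  have c: "c > 0" by (simp add: c_def riesz_const_pos)
  define f :: "(nat \<Rightarrow> int) \<Rightarrow> complex" where "f x = (if x = (\<lambda>_. 0) then 1 else 0)" for x
  have Z0: "{\<lambda>_. 0} \<subseteq> Zd d" by (auto simp: Zd_def)
  have f0: "f x = 0" if "x \<notin> {\<lambda>_. 0}" for x using that by (simp add: f_def)
  have a1: "(\<lambda>x. norm (f x) powr 1) summable_on Zd d"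
    by (rule lp_norm_finite_support(1)[OF _ Z0]) (simp_all add: f_def)
  have "(\<Sum>\<^sub>\<infinity>x\<in>Zd d. norm (f x) powr 1) = (\<Sum>x\<in>{\<lambda>_. 0}. norm (f x) powr 1)"
    by (rule lp_norm_finite_support(2)[OF _ Z0]) (simp_all add: f_def)
  hence a2: "(\<Sum>\<^sub>\<infinity>x\<in>Zd d. norm (f x) powr 1) = 1" by (simp add: f_def)
  have nf: "lp_norm d 1 f \<le> 1" unfolding lp_norm_def a2 using a1 by (simp only: if_True) simp
  have T: "R_dis_diff d j k f n = of_real (kern d j k n)" if "n \<in> Zd d" for n
  proof -
    have 1: "n - (\<lambda>_. 0) = n" by (auto simp: fun_eq_iff)
    have "R_dis_diff d j k f n = (\<Sum>x\<in>{\<lambda>_. 0}. of_real (kern d j k (n - x)) * f x)"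
      by (rule conv_finite_support[OF jk(1,2) _ Z0 _ that]) (simp_all add: f_def)
    also have "\<dots> = of_real (kern d j k n)" using 1 by (simp add: f_def)
    finally show ?thesis .
  qed
  define P where "P = (\<lambda>(a, \<sigma>). spike a \<sigma>) ` ({j, k} \<times> {-1, 1 :: int})"
  have inj: "inj_on (\<lambda>(a, \<sigma>). spike a \<sigma>) ({j, k} \<times> {-1, 1 :: int})"
    by (auto simp: inj_on_def spike_def fun_eq_iff split: if_splits)
  have cardP: "card P = 4" unfolding P_def using jk by (subst card_image[OF inj]) simp
  have PZ: "P \<subseteq> Zd d" using jk by (auto simp: P_def spike_def Zd_def)
  have kP: "\<bar>kern d j k m\<bar> = c" if m: "m \<in> P" for m
  proof -
    obtain q where q: "q \<in> {j, k} \<times> {-1, 1 :: int}" "m = (\<lambda>(a, \<sigma>). spike a \<sigma>) q"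
      using m unfolding P_def by (elim imageE)
    define a \<sigma> where "a = fst q" and "\<sigma> = snd q"
    have u: "a \<in> {j, k}" "\<sigma> \<in> {-1, 1}" "m = spike a \<sigma>"
      using q by (auto simp: a_def \<sigma>_def mem_Times_iff case_prod_beta)
    have "a \<in> {1..d}" using u jk by auto
    hence "sqnorm d m = 1" using u by (auto simp: sqnorm_spike)
    hence "eucl_norm d m ^ (d + 2) = 1" using eucl_norm_pow[of d m] by simp
    moreover have "\<bar>(real_of_int (m j))\<^sup>2 - (real_of_int (m k))\<^sup>2\<bar> = 1"
      using u jk by (auto simp: spike_def)
    ultimately show ?thesis using c unfolding kern_def c_def by (simp add: abs_mult)
  qed
  have lev: "ereal (4 * \<tau>) \<le> weak_opnorm d (R_dis_diff d j k)" if tau: "0 < \<tau>" "\<tau> < c" for \<tau>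
  proof -
    let ?X = "{n \<in> Zd d. norm (R_dis_diff d j k f n) > \<tau>}"
    have PX: "P \<subseteq> ?X" using PZ T kP tau by auto
    have "ereal (4 * \<tau>) \<le> (if finite ?X then ereal (\<tau> * real (card ?X)) else \<infinity>)"
    proof (cases "finite ?X")
      case True
      have "real 4 \<le> real (card ?X)" using card_mono[OF True PX] cardP by linarith
      hence "\<tau> * 4 \<le> \<tau> * real (card ?X)" using tau by (intro mult_left_mono) auto
      thus ?thesis using True by (simp add: mult.commute)
    qed simp
    also have "\<dots> \<le> weak_l1_norm d (R_dis_diff d j k f)"
      unfolding weak_l1_norm_def by (rule SUP_upper) (use tau in auto)
    also have "\<dots> \<le> weak_opnorm d (R_dis_diff d j k)"
      unfolding weak_opnorm_def by (rule SUP_upper) (use nf in auto)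
    finally show ?thesis .
  qed
  have "(\<lambda>i. ereal (4 * (c - c / real (Suc (Suc i))))) \<longlonglongrightarrow> ereal (4 * (c - 0))"
    by (intro tendsto_intros LIMSEQ_Suc[OF LIMSEQ_Suc[OF lim_const_over_n]])
  hence "ereal (4 * (c - 0)) \<le> weak_opnorm d (R_dis_diff d j k)"
  proof (rule LIMSEQ_le_const2)
    have "0 < c - c / real (Suc (Suc i))" "c - c / real (Suc (Suc i)) < c" for i
      using c by (auto simp: field_simps intro!: add_pos_nonneg)
    thus "\<exists>N. \<forall>n\<ge>N. ereal (4 * (c - c / real (Suc (Suc n)))) \<le> weak_opnorm d (R_dis_diff d j k)"
      using lev by blast
  qed
  thus ?thesis by (simp add: c_def)
qed

section \<open>Invariance under permutations of the coordinates\<close>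

lemma lp_norm_permute:
  assumes pi: "\<pi> permutes {1..d}"
  shows "lp_norm d p (\<lambda>x. g (x \<circ> \<pi>)) = lp_norm d p g"
proof -
  have bij: "bij_betw (\<lambda>x. x \<circ> \<pi>) (Zd d) (Zd d)"
  proof (rule bij_betw_byWitness[of _ "\<lambda>x. x \<circ> inv \<pi>"])
    have o: "\<pi> \<circ> inv \<pi> = id" "inv \<pi> \<circ> \<pi> = id" using permutes_inv_o[OF pi] by auto
    show "\<forall>x\<in>Zd d. (x \<circ> \<pi>) \<circ> inv \<pi> = x" "\<forall>x\<in>Zd d. (x \<circ> inv \<pi>) \<circ> \<pi> = x"
      by (simp_all add: o comp_assoc)
    show "(\<lambda>x. x \<circ> \<pi>) ` Zd d \<subseteq> Zd d" using permutes_not_in[OF pi] by (auto simp: Zd_def)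
    show "(\<lambda>x. x \<circ> inv \<pi>) ` Zd d \<subseteq> Zd d" using permutes_not_in[OF permutes_inv[OF pi]] by (auto simp: Zd_def)
  qed
  have "(\<lambda>x. norm (g (x \<circ> \<pi>)) powr p) summable_on Zd d \<longleftrightarrow> (\<lambda>x. norm (g x) powr p) summable_on Zd d"
    by (rule summable_on_reindex_bij_betw[OF bij, of "\<lambda>x. norm (g x) powr p"])
  moreover have "(\<Sum>\<^sub>\<infinity>x\<in>Zd d. norm (g (x \<circ> \<pi>)) powr p) = (\<Sum>\<^sub>\<infinity>x\<in>Zd d. norm (g x) powr p)"
    by (rule infsum_reindex_bij_betw[OF bij, of "\<lambda>x. norm (g x) powr p"])
  ultimately show ?thesis by (simp add: lp_norm_def)
qed

lemma sum_permute_sq: "\<pi> permutes {1..d} \<Longrightarrow> eucl_norm d (m \<circ> \<pi>) = eucl_norm d m"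
  unfolding eucl_norm_def L2_set_def
  using sum.permute[of \<pi> "{1..d}" "\<lambda>i. (real_of_int (m i))\<^sup>2"] by (simp add: o_def)

lemma R_dis_permute:
  assumes pi: "\<pi> permutes {1..d}"
  shows "R_dis d (\<pi> j) (\<pi> j) (\<lambda>x. g (x \<circ> \<pi>)) n = R_dis d j j g (n \<circ> \<pi>)"
proof -
  have bij: "bij_betw (\<lambda>x. x \<circ> \<pi>) (Zd d - {\<lambda>_. 0}) (Zd d - {\<lambda>_. 0})"
  proof (rule bij_betw_byWitness[of _ "\<lambda>x. x \<circ> inv \<pi>"])
    have o: "\<pi> \<circ> inv \<pi> = id" "inv \<pi> \<circ> \<pi> = id" using permutes_inv_o[OF pi] by auto
    show "\<forall>x\<in>Zd d - {\<lambda>_. 0}. (x \<circ> \<pi>) \<circ> inv \<pi> = x" "\<forall>x\<in>Zd d - {\<lambda>_. 0}. (x \<circ> inv \<pi>) \<circ> \<pi> = x"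
      by (simp_all add: o comp_assoc)
    have s: "surj \<pi>" "surj (inv \<pi>)" using permutes_surj[OF pi] permutes_surj[OF permutes_inv[OF pi]] by auto
    have z: "x = (\<lambda>_. 0)" if "x \<circ> q = (\<lambda>_. 0)" "surj q" for x :: "nat \<Rightarrow> int" and q
      using that by (metis comp_apply surjD ext)
    show "(\<lambda>x. x \<circ> \<pi>) ` (Zd d - {\<lambda>_. 0}) \<subseteq> Zd d - {\<lambda>_. 0}"
      using permutes_not_in[OF pi] z[OF _ s(1)] by (auto simp: Zd_def)
    show "(\<lambda>x. x \<circ> inv \<pi>) ` (Zd d - {\<lambda>_. 0}) \<subseteq> Zd d - {\<lambda>_. 0}"
      using permutes_not_in[OF permutes_inv[OF pi]] z[OF _ s(2)] by (auto simp: Zd_def)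
  qed
  have "(\<Sum>\<^sub>\<infinity>m\<in>Zd d - {\<lambda>_. 0}. of_real (real_of_int (m (\<pi> j) * m (\<pi> j)) / eucl_norm d m ^ (d + 2)) * g ((n - m) \<circ> \<pi>))
     = (\<Sum>\<^sub>\<infinity>m\<in>Zd d - {\<lambda>_. 0}. of_real (real_of_int ((m \<circ> \<pi>) j * (m \<circ> \<pi>) j) / eucl_norm d (m \<circ> \<pi>) ^ (d + 2)) * g ((n \<circ> \<pi>) - (m \<circ> \<pi>)))"
  proof (rule infsum_cong)
    fix m :: "nat \<Rightarrow> int"
    have "(n - m) \<circ> \<pi> = (n \<circ> \<pi>) - (m \<circ> \<pi>)" by (auto simp: fun_eq_iff)
    thus "of_real (real_of_int (m (\<pi> j) * m (\<pi> j)) / eucl_norm d m ^ (d + 2)) * g ((n - m) \<circ> \<pi>)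
      = of_real (real_of_int ((m \<circ> \<pi>) j * (m \<circ> \<pi>) j) / eucl_norm d (m \<circ> \<pi>) ^ (d + 2)) * g ((n \<circ> \<pi>) - (m \<circ> \<pi>))"
      by (simp add: sum_permute_sq[OF pi])
  qed
  also have "\<dots> = (\<Sum>\<^sub>\<infinity>m\<in>Zd d - {\<lambda>_. 0}. of_real (real_of_int (m j * m j) / eucl_norm d m ^ (d + 2)) * g ((n \<circ> \<pi>) - m))"
    by (rule infsum_reindex_bij_betw[OF bij, of "\<lambda>m. of_real (real_of_int (m j * m j) / eucl_norm d m ^ (d + 2)) * g ((n \<circ> \<pi>) - m)"])
  finally show ?thesis by (simp add: R_dis_def)
qed

lemma lp_opnorm_permute_le:
  assumes pi: "\<pi> permutes {1..d}"
  shows "lp_opnorm d p (R_dis_diff d j k) \<le> lp_opnorm d p (R_dis_diff d (\<pi> j) (\<pi> k))"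
  unfolding lp_opnorm_def
proof (rule SUP_least)
  fix f assume f: "f \<in> {f. lp_norm d p f \<le> 1}"
  let ?f = "\<lambda>x. f (x \<circ> \<pi>)"
  have "R_dis_diff d (\<pi> j) (\<pi> k) ?f = (\<lambda>n. R_dis_diff d j k f (n \<circ> \<pi>))"
    by (auto simp: R_dis_diff_def R_dis_permute[OF pi])
  hence "lp_norm d p (R_dis_diff d (\<pi> j) (\<pi> k) ?f) = lp_norm d p (R_dis_diff d j k f)"
    using lp_norm_permute[OF pi, of p "R_dis_diff d j k f"] by simp
  moreover have "?f \<in> {f. lp_norm d p f \<le> 1}" using f lp_norm_permute[OF pi, of p f] by simp
  ultimately show "lp_norm d p (R_dis_diff d j k f) \<le> (SUP f\<in>{f. lp_norm d p f \<le> 1}. lp_norm d p (R_dis_diff d (\<pi> j) (\<pi> k) f))"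
    by (metis SUP_upper)
qed

text \<open>There is a permutation that moves any pair of distinct indices to any other.\<close>
lemma lp_opnorm_indep:
  assumes "j \<in> {1..d}" "k \<in> {1..d}" "j \<noteq> k"
  shows "lp_opnorm d p (R_dis_diff d j k) = lp_opnorm d p (R_dis_diff d 1 2)"
proof -
  have ge: "lp_opnorm d p (R_dis_diff d a b) \<le> lp_opnorm d p (R_dis_diff d a' b')"
    if ab: "a \<in> {1..d}" "b \<in> {1..d}" "a \<noteq> b" "a' \<in> {1..d}" "b' \<in> {1..d}" "a' \<noteq> b'" for a b a' b'
  proof -
    define b1 where "b1 = Transposition.transpose a a' b"
    have b1: "b1 \<in> {1..d}" "b1 \<noteq> a'"
      using ab by (auto simp: b1_def Transposition.transpose_def)
    define \<pi> where "\<pi> = Transposition.transpose b1 b' \<circ> Transposition.transpose a a'"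
    have "\<pi> permutes {1..d}" unfolding \<pi>_def using ab b1 by (intro permutes_compose permutes_swap_id) auto
    moreover have "\<pi> a = a'" using ab b1 by (auto simp: \<pi>_def Transposition.transpose_def)
    moreover have "\<pi> b = b'" by (simp add: \<pi>_def b1_def[symmetric])
    ultimately show ?thesis using lp_opnorm_permute_le[of \<pi> d p a b] by simp
  qed
  have "d \<ge> 2" using assms by auto
  thus ?thesis using assms by (intro antisym ge) auto
qed

section \<open>The lower bound from alternating signs\<close>

text \<open>The character \<open>(-1)^a\<close>.\<close>
definition psign :: "int \<Rightarrow> real" where "psign a = (if even a then 1 else -1)"

lemma psign_diff: "psign (a - b) = psign a * psign b" by (auto simp: psign_def)

lemma abs_psign: "\<bar>psign a\<bar> = 1" by (auto simp: psign_def)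

lemma psign_Suc: "psign (a + 1) = - psign a" by (auto simp: psign_def)

text \<open>Summation by parts: twice an alternating sum is an alternating sum of differences plus
  boundary terms.\<close>
lemma alternating_sum_le:
  fixes \<phi> :: "int \<Rightarrow> real"
  assumes "\<alpha> \<le> \<beta> + 1"
  shows "\<bar>\<Sum>a\<in>{\<alpha>..\<beta>}. psign a * \<phi> a\<bar> \<le> ((\<Sum>a\<in>{\<alpha>..\<beta>}. \<bar>\<phi> (a + 1) - \<phi> a\<bar>) + \<bar>\<phi> \<alpha>\<bar> + \<bar>\<phi> (\<beta> + 1)\<bar>) / 2"
proof -
  let ?s = "\<Sum>a\<in>{\<alpha>..\<beta>}. psign a * \<phi> a"
  have "(\<Sum>a\<in>{\<alpha>..\<beta>}. psign a * \<phi> (a + 1)) = - (\<Sum>a\<in>{\<alpha>..\<beta>}. psign (a + 1) * \<phi> (a + 1))"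
    by (simp add: psign_Suc sum_negf)
  also have "(\<Sum>a\<in>{\<alpha>..\<beta>}. psign (a + 1) * \<phi> (a + 1)) = (\<Sum>a\<in>(\<lambda>a. a + 1) ` {\<alpha>..\<beta>}. psign a * \<phi> a)"
    by (subst sum.reindex) auto
  also have "(\<lambda>a. a + 1) ` {\<alpha>..\<beta>} = {\<alpha> + 1..\<beta> + 1}"
    by (auto intro!: image_eqI[of _ _ "_ - 1"])
  also have "(\<Sum>a\<in>{\<alpha> + 1..\<beta> + 1}. psign a * \<phi> a) = ?s - psign \<alpha> * \<phi> \<alpha> + psign (\<beta> + 1) * \<phi> (\<beta> + 1)"
  proof -
    have e1: "{\<alpha>..\<beta> + 1} = insert (\<beta> + 1) {\<alpha>..\<beta>}" "{\<alpha>..\<beta> + 1} = insert \<alpha> {\<alpha> + 1..\<beta> + 1}" using assms by auto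
    have "(\<Sum>a\<in>{\<alpha>..\<beta> + 1}. psign a * \<phi> a) = psign (\<beta> + 1) * \<phi> (\<beta> + 1) + ?s"
      unfolding e1(1) by (subst sum.insert) auto
    moreover have "(\<Sum>a\<in>{\<alpha>..\<beta> + 1}. psign a * \<phi> a) = psign \<alpha> * \<phi> \<alpha> + (\<Sum>a\<in>{\<alpha> + 1..\<beta> + 1}. psign a * \<phi> a)"
      unfolding e1(2) by (subst sum.insert) auto
    ultimately show ?thesis by simp
  qed
  finally have "2 * ?s = (\<Sum>a\<in>{\<alpha>..\<beta>}. psign a * (\<phi> a - \<phi> (a + 1))) + psign \<alpha> * \<phi> \<alpha> - psign (\<beta> + 1) * \<phi> (\<beta> + 1)"
    by (simp add: right_diff_distrib sum_subtractf)
  also have "\<bar>\<dots>\<bar> \<le> \<bar>\<Sum>a\<in>{\<alpha>..\<beta>}. psign a * (\<phi> a - \<phi> (a + 1))\<bar> + \<bar>psign \<alpha> * \<phi> \<alpha>\<bar> + \<bar>psign (\<beta> + 1) * \<phi> (\<beta> + 1)\<bar>" by linarith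
  also have "\<bar>\<Sum>a\<in>{\<alpha>..\<beta>}. psign a * (\<phi> a - \<phi> (a + 1))\<bar> \<le> (\<Sum>a\<in>{\<alpha>..\<beta>}. \<bar>\<phi> (a + 1) - \<phi> a\<bar>)"
    by (rule order_trans[OF sum_abs]) (simp add: abs_mult abs_psign abs_minus_commute)
  finally show ?thesis by (simp add: abs_mult abs_psign)
qed

lemma maj_le_sqrt: "0 \<le> s \<Longrightarrow> maj s a \<le> sqrt s"
  unfolding maj_def by (intro mult_left_le) auto

lemma gauss_dgauss_le_maj:
  assumes "0 < s"
  shows "\<bar>gauss s a\<bar> \<le> maj s a" "\<bar>dgauss s a\<bar> \<le> 3 * maj s a"
proof -
  have "exp (- s * (real_of_int a)\<^sup>2 / 4) * maj s a \<le> 1 * maj s a"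
    using assms by (intro mult_right_mono maj_nonneg) auto
  thus "\<bar>gauss s a\<bar> \<le> maj s a" "\<bar>dgauss s a\<bar> \<le> 3 * maj s a"
    using dgauss_le[of s a] gauss_le[of s a] gauss_nonneg[of s a] assms by auto
qed

lemma sum_gauss_dgauss_le:
  assumes s: "0 < s" "s \<le> 1" and A: "finite A"
  shows "\<bar>\<Sum>a\<in>A. gauss s a\<bar> \<le> 36" "\<bar>\<Sum>a\<in>A. dgauss s a\<bar> \<le> 36"
proof -
  have "\<bar>\<Sum>a\<in>A. gauss s a\<bar> \<le> (\<Sum>a\<in>A. maj s a)"
    by (rule order_trans[OF sum_abs sum_mono]) (rule gauss_dgauss_le_maj[OF s(1)])
  thus "\<bar>\<Sum>a\<in>A. gauss s a\<bar> \<le> 36" using sum_maj_le[OF s A] by linarith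
  have "\<bar>\<Sum>a\<in>A. dgauss s a\<bar> \<le> (\<Sum>a\<in>A. 3 * maj s a)"
    by (rule order_trans[OF sum_abs sum_mono]) (rule gauss_dgauss_le_maj[OF s(1)])
  thus "\<bar>\<Sum>a\<in>A. dgauss s a\<bar> \<le> 36" using sum_maj_le[OF s A] by (simp add: sum_distrib_left[symmetric])
qed

text \<open>The gain of \<open>sqrt s\<close> over the sum without signs is what makes the far part
  integrable in \<open>s\<close> after the division by \<open>s\<close>.\<close>
lemma sum_alt_gauss_dgauss_le:
  assumes s: "0 < s" "s \<le> 1" and ab: "\<alpha> \<le> \<beta>"
  shows "\<bar>\<Sum>a\<in>{\<alpha>..\<beta>}. psign a * gauss s a\<bar> \<le> 250 * sqrt s" "\<bar>\<Sum>a\<in>{\<alpha>..\<beta>}. psign a * dgauss s a\<bar> \<le> 250 * sqrt s"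
proof -
  have s0: "sqrt s \<ge> 0" using s by simp
  have m: "sqrt s * (\<Sum>a\<in>{\<alpha>..\<beta>}. maj s a) \<le> sqrt s * 12" by (intro mult_left_mono sum_maj_le s) (use s in auto)
  have "(\<Sum>a\<in>{\<alpha>..\<beta>}. \<bar>gauss s (a + 1) - gauss s a\<bar>) \<le> (\<Sum>a\<in>{\<alpha>..\<beta>}. 4 * (sqrt s * maj s a))" by (intro sum_mono gauss_shift s)
  also have "\<dots> = 4 * (sqrt s * (\<Sum>a\<in>{\<alpha>..\<beta>}. maj s a))" by (simp add: sum_distrib_left)
  finally have 1: "(\<Sum>a\<in>{\<alpha>..\<beta>}. \<bar>gauss s (a + 1) - gauss s a\<bar>) \<le> 48 * sqrt s" using m by linarith
  have "(\<Sum>a\<in>{\<alpha>..\<beta>}. \<bar>dgauss s (a + 1) - dgauss s a\<bar>) \<le> (\<Sum>a\<in>{\<alpha>..\<beta>}. 40 * (sqrt s * maj s a))" by (intro sum_mono dgauss_shift s)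
  also have "\<dots> = 40 * (sqrt s * (\<Sum>a\<in>{\<alpha>..\<beta>}. maj s a))" by (simp add: sum_distrib_left)
  finally have 2: "(\<Sum>a\<in>{\<alpha>..\<beta>}. \<bar>dgauss s (a + 1) - dgauss s a\<bar>) \<le> 480 * sqrt s" using m by linarith
  have g: "\<bar>gauss s a\<bar> \<le> sqrt s" "\<bar>dgauss s a\<bar> \<le> 3 * sqrt s" for a
    using gauss_dgauss_le_maj[OF s(1), of a] maj_le_sqrt[of s a] s by auto
  have ab': "\<alpha> \<le> \<beta> + 1" using ab by simp
  show "\<bar>\<Sum>a\<in>{\<alpha>..\<beta>}. psign a * gauss s a\<bar> \<le> 250 * sqrt s"
    using alternating_sum_le[OF ab', of "gauss s"] 1 g(1)[of \<alpha>] g(1)[of "\<beta> + 1"] s0 by simp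
  show "\<bar>\<Sum>a\<in>{\<alpha>..\<beta>}. psign a * dgauss s a\<bar> \<le> 250 * sqrt s"
    using alternating_sum_le[OF ab', of "dgauss s"] 2 g(2)[of \<alpha>] g(2)[of "\<beta> + 1"] s0 by simp
qed

abbreviation cube :: "nat \<Rightarrow> nat \<Rightarrow> (nat \<Rightarrow> int) set" where
  "cube d L \<equiv> Zbox d (\<lambda>_. {- int L..int L})"

lemma finite_cube: "finite (cube d L)" by (rule finite_Zbox) auto

lemma cube_Zd: "cube d L \<subseteq> Zd d" by (auto simp: Zbox_def)

lemma card_cube: "card (cube d L) = (2 * L + 1) ^ d"
proof -
  have "card {- int L..int L} = 2 * L + 1" by simp
  thus ?thesis by (subst card_Zbox) (auto simp del: card_atLeastAtMost_int)
qed

lemma double_sum_prod_cube: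
  fixes \<psi> :: "nat \<Rightarrow> int \<Rightarrow> real"
  shows "(\<Sum>n\<in>cube d L. \<Sum>x\<in>cube d L. \<Prod>i\<in>{1..d}. \<psi> i ((n - x) i))
    = (\<Prod>i\<in>{1..d}. \<Sum>u\<in>{- int L..int L}. \<Sum>v\<in>{- int L..int L}. \<psi> i (u - v))"
proof -
  have "(\<Sum>n\<in>cube d L. \<Sum>x\<in>cube d L. \<Prod>i\<in>{1..d}. \<psi> i ((n - x) i))
     = (\<Sum>n\<in>cube d L. \<Prod>i\<in>{1..d}. \<Sum>v\<in>{- int L..int L}. \<psi> i (n i - v))"
  proof (intro sum.cong refl)
    fix n
    show "(\<Sum>x\<in>cube d L. \<Prod>i\<in>{1..d}. \<psi> i ((n - x) i)) = (\<Prod>i\<in>{1..d}. \<Sum>v\<in>{- int L..int L}. \<psi> i (n i - v))"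
      using sum_prod_Zbox[where \<phi> = "\<lambda>i a. \<psi> i (n i - a)" and A = "\<lambda>_. {- int L..int L}" and d = d] by simp
  qed
  also have "\<dots> = (\<Prod>i\<in>{1..d}. \<Sum>u\<in>{- int L..int L}. \<Sum>v\<in>{- int L..int L}. \<psi> i (u - v))"
    by (rule sum_prod_Zbox[where \<phi> = "\<lambda>i a. \<Sum>v\<in>{- int L..int L}. \<psi> i (a - v)"]) simp
  finally show ?thesis .
qed

lemma sum_reflect_interval:
  "(\<Sum>v\<in>{- int L..int L}. \<phi> (u - v)) = (\<Sum>a\<in>{u - int L..u + int L}. \<phi> a)"
  by (rule sum.reindex_bij_witness[of _ "\<lambda>a. u - a" "\<lambda>v. u - v"]) auto

text \<open>One alternating coordinate supplies the factor \<open>sqrt s\<close>, all others only a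
  constant.\<close>
lemma double_sum_prod_le:
  fixes \<psi> :: "nat \<Rightarrow> int \<Rightarrow> real"
  assumes k: "k \<in> {1..d}" and s: "0 < s" "s \<le> 1"
    and o: "\<And>i u. i \<in> {1..d} \<Longrightarrow> i \<noteq> k \<Longrightarrow> \<bar>\<Sum>a\<in>{u - int L..u + int L}. \<psi> i a\<bar> \<le> 36"
    and kk: "\<And>u. \<bar>\<Sum>a\<in>{u - int L..u + int L}. \<psi> k a\<bar> \<le> 250 * sqrt s"
  shows "\<bar>\<Sum>n\<in>cube d L. \<Sum>x\<in>cube d L. \<Prod>i\<in>{1..d}. \<psi> i ((n - x) i)\<bar> \<le> real (card (cube d L)) * (36 ^ d * (250 * sqrt s))"
proof -
  let ?I = "{- int L..int L}"
  have I: "real (card ?I) = 2 * real L + 1" by simp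
  have B: "\<bar>\<Sum>u\<in>?I. \<Sum>v\<in>?I. \<psi> i (u - v)\<bar> \<le> (2 * real L + 1) * b"
    if "\<And>u. \<bar>\<Sum>a\<in>{u - int L..u + int L}. \<psi> i a\<bar> \<le> b" for i b
  proof -
    have "\<bar>\<Sum>u\<in>?I. \<Sum>v\<in>?I. \<psi> i (u - v)\<bar> \<le> (\<Sum>u\<in>?I. b)"
      unfolding sum_reflect_interval by (rule order_trans[OF sum_abs sum_mono]) (rule that)
    thus ?thesis by simp
  qed
  have "\<bar>\<Sum>n\<in>cube d L. \<Sum>x\<in>cube d L. \<Prod>i\<in>{1..d}. \<psi> i ((n - x) i)\<bar> = (\<Prod>i\<in>{1..d}. \<bar>\<Sum>u\<in>?I. \<Sum>v\<in>?I. \<psi> i (u - v)\<bar>)"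
    unfolding double_sum_prod_cube abs_prod ..
  also have "\<dots> \<le> (\<Prod>i\<in>{1..d}. (2 * real L + 1) * (36 * (if i = k then 250 * sqrt s else 1)))"
  proof (rule prod_mono)
    fix i assume i: "i \<in> {1..d}"
    show "0 \<le> \<bar>\<Sum>u\<in>?I. \<Sum>v\<in>?I. \<psi> i (u - v)\<bar> \<and> \<bar>\<Sum>u\<in>?I. \<Sum>v\<in>?I. \<psi> i (u - v)\<bar> \<le> (2 * real L + 1) * (36 * (if i = k then 250 * sqrt s else 1))"
    proof (cases "i = k")
      case True
      have "\<bar>\<Sum>a\<in>{u - int L..u + int L}. \<psi> k a\<bar> \<le> 36 * (250 * sqrt s)" for u
        using kk[of u] s by simp
      thus ?thesis using B[of k "36 * (250 * sqrt s)"] True by simp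
    next
      case False
      thus ?thesis using B[of i 36] o[OF i] by simp
    qed
  qed
  also have "\<dots> = (2 * real L + 1) ^ d * (36 ^ d * (250 * sqrt s))"
    using k by (simp add: prod.distrib prod.delta)
  finally show ?thesis by (simp add: card_cube add.commute)
qed

text \<open>The sign depends on one coordinate only, so the double sum over the cube still
  factorizes for each heat parameter.\<close>
lemma far_alternating:
  assumes jk: "j \<in> {1..d}" "k \<in> {1..d}" "j \<noteq> k"
  shows "\<bar>\<Sum>n\<in>cube d L. \<Sum>x\<in>cube d L. far d j k (n - x) * psign ((n - x) k)\<bar> \<le> real (card (cube d L)) * (1000 * 36 ^ d)"
proof -
  let ?B = "cube d L"
  define N where "N = real (card ?B)"
  have N: "N \<ge> 0" by (simp add: N_def)
  define h where "h s = (\<Sum>n\<in>?B. \<Sum>x\<in>?B. psign ((n - x) k) * dens d j k s (n - x))" for s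
  have cont: "continuous_on A h" for A
    unfolding h_def by (intro continuous_intros continuous_dens)
  have "((\<lambda>s. \<Sum>n\<in>?B. \<Sum>x\<in>?B. psign ((n - x) k) * dens d j k s (n - x)) has_integral (\<Sum>n\<in>?B. \<Sum>x\<in>?B. psign ((n - x) k) * far d j k (n - x))) {0..1}"
    unfolding far_def
    by (intro has_integral_sum finite_cube has_integral_mult_right integrable_integral dens_integrable)
  hence hi: "(h has_integral (\<Sum>n\<in>?B. \<Sum>x\<in>?B. far d j k (n - x) * psign ((n - x) k))) {0..1}"
    by (simp add: h_def[abs_def] mult.commute)
  have bd: "\<bar>h s\<bar> \<le> (N * (500 * 36 ^ d)) * (1 / sqrt s)" if s01: "s \<in> {0..1}" for s
  proof (cases "s = 0")
    case True
    have "d \<noteq> 0" using jk by auto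
    thus ?thesis using True by (simp add: h_def dens_zero_time)
  next
    case False
    hence s: "0 < s" "s \<le> 1" using s01 by auto
    define \<psi> where "\<psi> l i a = (if i = k then psign a else 1) * (if i = l then dgauss s a else gauss s a)" for l i a
    have L1: "psign (m k) * lprod d l s m = (\<Prod>i\<in>{1..d}. \<psi> l i (m i))" for l m
    proof -
      have "(\<Prod>i\<in>{1..d}. \<psi> l i (m i)) = (\<Prod>i\<in>{1..d}. if i = k then psign (m i) else 1) * lprod d l s m"
        by (simp add: \<psi>_def lprod_def prod.distrib)
      also have "(\<Prod>i\<in>{1..d}. if i = k then psign (m i) else 1) = psign (m k)" using jk by (simp add: prod.delta)
      finally show ?thesis by simp
    qed
    have P: "\<bar>\<Sum>n\<in>?B. \<Sum>x\<in>?B. psign ((n - x) k) * lprod d l s (n - x)\<bar> \<le> N * (36 ^ d * (250 * sqrt s))" for l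
      unfolding L1 N_def
    proof (rule double_sum_prod_le[OF jk(2) s])
      show "\<bar>\<Sum>a\<in>{u - int L..u + int L}. \<psi> l i a\<bar> \<le> 36" if "i \<noteq> k" for i u
        using that sum_gauss_dgauss_le[OF s, of "{u - int L..u + int L}"] by (cases "i = l") (simp_all add: \<psi>_def)
      show "\<bar>\<Sum>a\<in>{u - int L..u + int L}. \<psi> l k a\<bar> \<le> 250 * sqrt s" for u
        using sum_alt_gauss_dgauss_le[OF s, of "u - int L" "u + int L"] by (cases "k = l") (simp_all add: \<psi>_def)
    qed
    have "s * h s = (\<Sum>n\<in>?B. \<Sum>x\<in>?B. psign ((n - x) k) * (s * dens d j k s (n - x)))"
      unfolding h_def sum_distrib_left by (intro sum.cong refl) simp
    also have "\<dots> = (\<Sum>n\<in>?B. \<Sum>x\<in>?B. psign ((n - x) k) * lprod d j s (n - x)) - (\<Sum>n\<in>?B. \<Sum>x\<in>?B. psign ((n - x) k) * lprod d k s (n - x))"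
      unfolding dens_eq[OF jk(1,2)] by (simp add: right_diff_distrib sum_subtractf)
    finally have "\<bar>s * h s\<bar> \<le> 2 * (N * (36 ^ d * (250 * sqrt s)))" using P[of j] P[of k] by linarith
    hence "s * \<bar>h s\<bar> \<le> N * (500 * 36 ^ d) * sqrt s" using s by (simp add: abs_mult mult_ac)
    hence "\<bar>h s\<bar> \<le> N * (500 * 36 ^ d) * sqrt s / s" using s by (simp add: pos_le_divide_eq mult.commute)
    also have "\<dots> = (N * (500 * 36 ^ d)) * (1 / sqrt s)" using s by (simp add: real_div_sqrt field_simps)
    finally show ?thesis .
  qed
  have Bi: "((\<lambda>s. (N * (500 * 36 ^ d)) * (1 / sqrt s)) has_integral (N * (500 * 36 ^ d)) * (2 * sqrt 1)) {0..1}"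
    by (rule has_integral_mult_right[OF has_integral_inverse_sqrt]) simp
  have "(\<Sum>n\<in>?B. \<Sum>x\<in>?B. far d j k (n - x) * psign ((n - x) k)) \<le> (N * (500 * 36 ^ d)) * (2 * sqrt 1)"
    by (rule has_integral_le[OF hi Bi]) (rule abs_le_D1[OF bd])
  moreover have "- ((N * (500 * 36 ^ d)) * (2 * sqrt 1)) \<le> (\<Sum>n\<in>?B. \<Sum>x\<in>?B. far d j k (n - x) * psign ((n - x) k))"
    by (rule has_integral_le[OF has_integral_neg[OF Bi] hi]) (subst minus_le_iff, rule abs_le_D2[OF bd])
  ultimately show ?thesis by (simp add: abs_le_iff N_def mult_ac)
qed

lemma near_swap:
  assumes jk: "j \<in> {1..d}" "k \<in> {1..d}"
  shows "near d j k (m \<circ> Transposition.transpose j k) = - near d j k m"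
proof -
  let ?\<pi> = "Transposition.transpose j k"
  have pi: "?\<pi> permutes {1..d}" using jk by (rule permutes_swap_id)
  have "dens d j k s (m \<circ> ?\<pi>) = - dens d j k s m" for s
    using prod.permute[OF pi, of "\<lambda>i. gauss s (m i)"] by (simp add: dens_def o_def algebra_simps)
  hence "far d j k (m \<circ> ?\<pi>) = - far d j k m" by (simp add: far_def)
  moreover have "kern d j k (m \<circ> ?\<pi>) = - kern d j k m"
    by (simp add: kern_def sum_permute_sq[OF pi] algebra_simps diff_divide_distrib)
  ultimately show ?thesis by (simp add: near_def)
qed

text \<open>The antisymmetrization of the near part times the sign in coordinate \<open>k\<close>,
  under the exchange of coordinates \<open>j\<close> and \<open>k\<close>.\<close>
definition sym_near :: "nat \<Rightarrow> nat \<Rightarrow> nat \<Rightarrow> (nat \<Rightarrow> int) \<Rightarrow> real" where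
  "sym_near d j k m = near d j k m * ((psign (m k) - psign (m j)) / 2)"

lemma near_antisym:
  assumes jk: "j \<in> {1..d}" "k \<in> {1..d}"
  shows "(\<Sum>n\<in>cube d L. \<Sum>x\<in>cube d L. near d j k (n - x) * psign ((n - x) k)) = (\<Sum>n\<in>cube d L. \<Sum>x\<in>cube d L. sym_near d j k (n - x))"
proof -
  let ?\<pi> = "Transposition.transpose j k"
  let ?B = "cube d L"
  have pi: "?\<pi> permutes {1..d}" using jk by (rule permutes_swap_id)
  have bij: "bij_betw (\<lambda>x. x \<circ> ?\<pi>) ?B ?B"
  proof (rule bij_betw_byWitness[of _ "\<lambda>x. x \<circ> ?\<pi>"])
    show "\<forall>x\<in>?B. (x \<circ> ?\<pi>) \<circ> ?\<pi> = x" "\<forall>x\<in>?B. (x \<circ> ?\<pi>) \<circ> ?\<pi> = x" by (simp_all add: comp_assoc)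
    have "(x \<circ> ?\<pi>) \<in> ?B" if x: "x \<in> ?B" for x
    proof -
      have "?\<pi> i \<in> {1..d} \<longleftrightarrow> i \<in> {1..d}" for i using permutes_in_image[OF pi] .
      thus ?thesis using x by (auto simp: Zbox_def Zd_def)
    qed
    thus "(\<lambda>x. x \<circ> ?\<pi>) ` ?B \<subseteq> ?B" "(\<lambda>x. x \<circ> ?\<pi>) ` ?B \<subseteq> ?B" by auto
  qed
  define A where "A = (\<Sum>n\<in>?B. \<Sum>x\<in>?B. near d j k (n - x) * psign ((n - x) k))"
  have "A = (\<Sum>n\<in>?B. \<Sum>x\<in>?B. near d j k ((n \<circ> ?\<pi>) - x) * psign (((n \<circ> ?\<pi>) - x) k))"
    unfolding A_def by (rule sum.reindex_bij_betw[OF bij, symmetric])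
  also have "\<dots> = (\<Sum>n\<in>?B. \<Sum>x\<in>?B. near d j k ((n \<circ> ?\<pi>) - (x \<circ> ?\<pi>)) * psign (((n \<circ> ?\<pi>) - (x \<circ> ?\<pi>)) k))"
    by (intro sum.cong refl sum.reindex_bij_betw[OF bij, symmetric, where g = "\<lambda>x. near d j k ((_ \<circ> ?\<pi>) - x) * psign (((_ \<circ> ?\<pi>) - x) k)"])
  also have "\<dots> = (\<Sum>n\<in>?B. \<Sum>x\<in>?B. - (near d j k (n - x) * psign ((n - x) j)))"
  proof (intro sum.cong refl)
    fix n x :: "nat \<Rightarrow> int"
    have e: "(n \<circ> ?\<pi>) - (x \<circ> ?\<pi>) = (n - x) \<circ> ?\<pi>" by (auto simp: fun_eq_iff)
    show "near d j k ((n \<circ> ?\<pi>) - (x \<circ> ?\<pi>)) * psign (((n \<circ> ?\<pi>) - (x \<circ> ?\<pi>)) k) = - (near d j k (n - x) * psign ((n - x) j))"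
      unfolding e near_swap[OF jk] by simp
  qed
  finally have "2 * A = A + (\<Sum>n\<in>?B. \<Sum>x\<in>?B. - (near d j k (n - x) * psign ((n - x) j)))" by simp
  also have "\<dots> = (\<Sum>n\<in>?B. \<Sum>x\<in>?B. 2 * sym_near d j k (n - x))"
    unfolding A_def sum.distrib[symmetric] by (intro sum.cong refl) (simp add: sym_near_def algebra_simps)
  also have "\<dots> = 2 * (\<Sum>n\<in>?B. \<Sum>x\<in>?B. sym_near d j k (n - x))" by (simp add: sum_distrib_left)
  finally show ?thesis by (simp add: A_def)
qed

lemma sym_near_ge: "sym_near d j k m \<ge> - \<bar>near d j k m\<bar>"
  by (cases "even (m j)"; cases "even (m k)") (simp_all add: sym_near_def psign_def)

text \<open>On these shells a nonzero near part requires exactly one of \<open>m\<^sub>j,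
  m\<^sub>k\<close> to be odd, and then both factors of the antisymmetrization have the same
  sign.\<close>
lemma sym_near_shell:
  assumes jk: "j \<in> {1..d}" "k \<in> {1..d}" and m: "m \<in> shell d"
  shows "sym_near d j k m = \<bar>near d j k m\<bar>"
proof -
  have sq: "sqnorm d m > 0" using m by (auto simp: shell_def)
  have r: "m i \<in> {-1, 0, 1}" if "i \<in> {1..d}" for i
    using m shell_subset_Zbox that by (force simp: Zbox_def)
  consider "\<bar>m j\<bar> = \<bar>m k\<bar>" | "\<bar>m j\<bar> = 1" "m k = 0" | "m j = 0" "\<bar>m k\<bar> = 1"
    using r[OF jk(1)] r[OF jk(2)] by auto
  thus ?thesis
  proof cases
    case 1
    hence "near d j k m = 0" using near_mono_sign(1)[OF sq, of k j] near_mono_sign(2)[OF sq, of j k] by simp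
    thus ?thesis by (simp add: sym_near_def)
  next
    case 2
    hence "near d j k m \<ge> 0" using near_mono_sign(1)[OF sq, of k j] by simp
    moreover have "psign (m j) = -1" "psign (m k) = 1" using 2 by (auto simp: psign_def abs_if split: if_splits)
    ultimately show ?thesis by (simp add: sym_near_def)
  next
    case 3
    hence "near d j k m \<le> 0" using near_mono_sign(2)[OF sq, of j k] by simp
    moreover have "psign (m j) = 1" "psign (m k) = -1" using 3 by (auto simp: psign_def abs_if split: if_splits)
    ultimately show ?thesis by (simp add: sym_near_def)
  qed
qed

text \<open>If the parities of \<open>m\<^sub>j\<close> and \<open>m\<^sub>k\<close> differ, the
  even one is \<open>0\<close>: otherwise \<open>m\<^sub>j\<^sup>2 + m\<^sub>k\<^sup>2 \<ge> 4 +
  1\<close>. So the odd coordinate is the larger one, and the signs agree. The bound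
  \<open>5\<close> is optimal, as \<open>(1, 2)\<close> shows.\<close>
lemma sym_near_nonneg:
  assumes jk: "j \<in> {1..d}" "k \<in> {1..d}" "j \<noteq> k" and m: "0 < sqnorm d m" "sqnorm d m < 5"
  shows "sym_near d j k m \<ge> 0"
proof -
  have two: "(real_of_int (m j))\<^sup>2 + (real_of_int (m k))\<^sup>2 \<le> sqnorm d m"
  proof -
    have "(\<Sum>i\<in>{j, k}. (real_of_int (m i))\<^sup>2) \<le> sqnorm d m" unfolding sqnorm_def by (rule sum_mono2) (use jk in auto)
    thus ?thesis using jk by simp
  qed
  have big: "\<not> (\<bar>m a\<bar> \<ge> 2 \<and> \<bar>m b\<bar> \<ge> 1)" if "{a, b} = {j, k}" for a b
  proof
    assume A: "\<bar>m a\<bar> \<ge> 2 \<and> \<bar>m b\<bar> \<ge> 1"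
    have "2 \<le> \<bar>real_of_int (m a)\<bar>" "1 \<le> \<bar>real_of_int (m b)\<bar>" using A by linarith+
    hence "2\<^sup>2 \<le> \<bar>real_of_int (m a)\<bar>\<^sup>2" "1\<^sup>2 \<le> \<bar>real_of_int (m b)\<bar>\<^sup>2" by (intro power_mono; simp)+
    hence "4 \<le> (real_of_int (m a))\<^sup>2" "1 \<le> (real_of_int (m b))\<^sup>2" unfolding power2_abs by simp_all
    thus False using two m(2) that by (auto simp: doubleton_eq_iff)
  qed
  consider "psign (m j) = psign (m k)" | "odd (m j)" "even (m k)" | "even (m j)" "odd (m k)"
    by (cases "even (m j)"; cases "even (m k)") (auto simp: psign_def)
  thus ?thesis
  proof cases
    case 1 thus ?thesis by (simp add: sym_near_def)
  next
    case 2
    hence "m j \<noteq> 0" by auto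
    hence "\<bar>m j\<bar> \<ge> 1" by linarith
    hence "\<bar>m k\<bar> < 2" using big[of k j] by (simp add: insert_commute not_le)
    hence "m k = 0" using 2(2) by (auto elim!: evenE)
    hence "near d j k m \<ge> 0" using near_mono_sign(1)[OF m(1), of k j] by simp
    thus ?thesis using 2 by (simp add: sym_near_def psign_def)
  next
    case 3
    hence "m k \<noteq> 0" by auto
    hence "\<bar>m k\<bar> \<ge> 1" by linarith
    hence "\<bar>m j\<bar> < 2" using big[of j k] by (simp add: not_le)
    hence "m j = 0" using 3(1) by (auto elim!: evenE)
    hence "near d j k m \<le> 0" using near_mono_sign(2)[OF m(1), of j k] by simp
    thus ?thesis using 3 by (simp add: sym_near_def psign_def)
  qed
qed

text \<open>A point of the smaller cube sees the whole shell within the larger cube. Elsewhere, the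
  terms with \<open>|m|\<^sup>2 < 5\<close> can be dropped and the others are small in absolute
  value.\<close>
lemma near_alternating:
  assumes jk: "j \<in> {1..d}" "k \<in> {1..d}" "j \<noteq> k"
  shows "(\<Sum>n\<in>cube d (Suc L). \<Sum>x\<in>cube d (Suc L). near d j k (n - x) * psign ((n - x) k))
    \<ge> real (card (cube d L)) * (\<Sum>m\<in>shell d. \<bar>near d j k m\<bar>) - real (card (cube d (Suc L))) * (near_const * riesz_const d * ((19/20) / 2) ^ d)"
proof -
  define B5 where "B5 = near_const * riesz_const d * ((19/20) / 2) ^ d"
  define A where "A = (\<Sum>m\<in>shell d. \<bar>near d j k m\<bar>)"
  let ?B = "cube d (Suc L)"
  have A0: "A \<ge> 0" unfolding A_def by (rule sum_nonneg) simp
  have in1: "(\<Sum>x\<in>?B. sym_near d j k (n - x)) \<ge> (if n \<in> cube d L then A else 0) - B5" if n: "n \<in> ?B" for n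
  proof -
    define D where "D = (\<lambda>x. n - x) ` ?B"
    have D: "finite D" "D \<subseteq> Zd d" using finite_cube[of d "Suc L"] cube_Zd[of d "Suc L"] n by (auto simp: D_def intro!: Zd_diff)
    have eq: "(\<Sum>x\<in>?B. sym_near d j k (n - x)) = (\<Sum>m\<in>D. sym_near d j k m)"
      unfolding D_def by (subst sum.reindex) (auto simp: inj_on_def)
    define D5 where "D5 = {m \<in> D. sqnorm d m \<ge> 5}"
    have D5: "(\<Sum>m\<in>D5. sym_near d j k m) \<ge> - B5"
    proof -
      have "(\<Sum>m\<in>D5. \<bar>near d j k m\<bar>) \<le> B5" unfolding B5_def
        by (rule sum_near_le_3_5(2)[OF jk(1,2)]) (use D in \<open>auto simp: D5_def\<close>)
      moreover have "(\<Sum>m\<in>D5. sym_near d j k m) \<ge> (\<Sum>m\<in>D5. - \<bar>near d j k m\<bar>)" by (intro sum_mono sym_near_ge)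
      ultimately show ?thesis by (simp add: sum_negf)
    qed
    have D4: "(\<Sum>m\<in>D - D5. sym_near d j k m) \<ge> (if n \<in> cube d L then A else 0)"
    proof -
      have nn: "sym_near d j k m \<ge> 0" if "m \<in> D - D5" for m
      proof (cases "m = (\<lambda>_. 0)")
        case True thus ?thesis by (simp add: sym_near_def near_0)
      next
        case False
        have "m \<in> Zd d" using that D by auto
        hence "sqnorm d m > 0" using sqnorm_eq_0[of m d] False sqnorm_nonneg[of d m] by auto
        thus ?thesis using that by (intro sym_near_nonneg[OF jk]) (auto simp: D5_def)
      qed
      show ?thesis
      proof (cases "n \<in> cube d L")
        case True
        have "shell d \<subseteq> D - D5"
        proof
          fix m assume m: "m \<in> shell d"
          have mi: "m i \<in> {-1..1}" if "i \<in> {1..d}" for i using m shell_subset_Zbox that by (force simp: Zbox_def)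
          have "n - m \<in> ?B"
          proof -
            have "(n - m) i \<in> {- int (Suc L)..int (Suc L)}" if "i \<in> {1..d}" for i
            proof -
              have "n i \<in> {- int L..int L}" using True that by (auto simp: Zbox_def)
              thus ?thesis using mi[OF that] by auto
            qed
            moreover have "n - m \<in> Zd d" using True m by (auto simp: Zbox_def shell_def intro!: Zd_diff)
            ultimately show ?thesis by (auto simp: Zbox_def)
          qed
          hence "m \<in> D" unfolding D_def by (intro image_eqI[of _ _ "n - m"]) auto
          thus "m \<in> D - D5" using m by (auto simp: D5_def shell_def)
        qed
        hence "(\<Sum>m\<in>shell d. sym_near d j k m) \<le> (\<Sum>m\<in>D - D5. sym_near d j k m)"
          by (intro sum_mono2) (use D nn in auto)
        moreover have "(\<Sum>m\<in>shell d. sym_near d j k m) = A"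
          unfolding A_def by (intro sum.cong refl sym_near_shell jk)
        ultimately show ?thesis using True by simp
      next
        case False thus ?thesis using sum_nonneg[of "D - D5" "sym_near d j k"] nn by simp
      qed
    qed
    have "(\<Sum>m\<in>D. sym_near d j k m) = (\<Sum>m\<in>D - D5. sym_near d j k m) + (\<Sum>m\<in>D5. sym_near d j k m)"
      by (rule sum.subset_diff) (use D in \<open>auto simp: D5_def\<close>)
    thus ?thesis using D4 D5 eq by linarith
  qed
  have sub: "cube d L \<subseteq> ?B" by (force simp: Zbox_def)
  have "real (card (cube d L)) * A - real (card ?B) * B5 = (\<Sum>n\<in>?B. (if n \<in> cube d L then A else 0) - B5)"
  proof -
    have "(\<Sum>n\<in>?B. if n \<in> cube d L then A else 0) = (\<Sum>n\<in>cube d L. A)"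
      using sub finite_cube[of d "Suc L"] by (simp add: sum.If_cases Int_absorb1)
    thus ?thesis by (simp add: sum_subtractf)
  qed
  also have "\<dots> \<le> (\<Sum>n\<in>?B. \<Sum>x\<in>?B. sym_near d j k (n - x))" by (rule sum_mono) (rule in1)
  finally show ?thesis unfolding near_antisym[OF jk(1,2)] A_def B5_def .
qed

text \<open>Hoelder's inequality against the constant function.\<close>
lemma power_mean_le:
  fixes a :: "'i \<Rightarrow> real"
  assumes p: "p > 1" and S: "finite S" "S \<noteq> {}" and a: "\<And>x. x \<in> S \<Longrightarrow> a x \<ge> 0"
  shows "(\<Sum>x\<in>S. a x) \<le> real (card S) powr (1 - 1/p) * (\<Sum>x\<in>S. a x powr p) powr (1/p)"
proof (cases "(\<Sum>x\<in>S. a x powr p) = 0")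
  case True
  hence "\<forall>x\<in>S. a x powr p = 0" using S by (subst (asm) sum_nonneg_eq_0_iff) auto
  thus ?thesis by (simp add: True)
next
  case False
  define R where "R = (\<Sum>x\<in>S. a x powr p) powr (1/p)"
  have pos: "(\<Sum>x\<in>S. a x powr p) > 0" using False sum_nonneg[of S "\<lambda>x. a x powr p"] by auto
  hence R: "R > 0" by (simp add: R_def)
  have Rp: "R powr p = (\<Sum>x\<in>S. a x powr p)" using pos p by (simp add: R_def powr_powr)
  define q where "q = p/(p - 1)"
  have q0: "q > 1" using p by (simp add: q_def field_simps)
  have iq: "1/q = 1 - 1/p" using p by (simp add: q_def field_simps)
  define N where "N = real (card S)"
  have N: "N > 0" using S by (simp add: N_def card_gt_0_iff)
  define w where "w = N powr (- 1/q)"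
  have w: "w > 0" using N by (simp add: w_def)
  have wq: "w powr q = 1/N" unfolding w_def powr_powr using N q0 by (simp add: powr_minus_divide)
  have "(\<Sum>x\<in>S. (a x / R) * w) \<le> (\<Sum>x\<in>S. a x powr p / (R powr p * p) + 1 / (N * q))"
  proof (rule sum_mono)
    fix x assume x: "x \<in> S"
    have "(a x / R) * w \<le> \<bar>a x / R\<bar> powr p / p + \<bar>w\<bar> powr q / q" by (rule young_abs[OF p q_def])
    also have "\<bar>a x / R\<bar> powr p = a x powr p / R powr p" using a[OF x] R by (simp add: powr_divide)
    also have "\<bar>w\<bar> powr q = 1/N" using w wq by simp
    finally show "(a x / R) * w \<le> a x powr p / (R powr p * p) + 1 / (N * q)" by simp
  qed
  also have "\<dots> = (\<Sum>x\<in>S. a x powr p) / (R powr p * p) + N * (1 / (N * q))"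
    by (simp add: sum.distrib sum_divide_distrib N_def)
  also have "\<dots> = 1/p + 1/q" using Rp pos N by simp
  also have "\<dots> = 1" unfolding iq by simp
  also have "(\<Sum>x\<in>S. (a x / R) * w) = (\<Sum>x\<in>S. a x) * (w / R)" unfolding sum_distrib_right by (intro sum.cong) auto
  finally have "(\<Sum>x\<in>S. a x) * (w / R) \<le> 1" .
  hence "(\<Sum>x\<in>S. a x) \<le> R * (1 / w)" using R w by (simp add: field_simps)
  also have "1 / w = N powr (1 - 1/p)" unfolding iq[symmetric] using N by (simp add: w_def powr_minus_divide)
  finally show ?thesis by (simp add: R_def N_def mult.commute)
qed

text \<open>The normalized sign function on the cube, paired with the same sign function by
  Hoelder's inequality.\<close>
lemma lp_opnorm_test:
  assumes jk: "j \<in> {1..d}" "k \<in> {1..d}" and p: "p > 1"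
  shows "ereal ((\<Sum>n\<in>cube d L. \<Sum>x\<in>cube d L. kern d j k (n - x) * psign ((n - x) k)) / real (card (cube d L))) \<le> lp_opnorm d p (R_dis_diff d j k)"
proof -
  let ?B = "cube d L"
  define N where "N = real (card ?B)"
  have N: "N > 0" by (simp add: N_def card_cube)
  have ne: "?B \<noteq> {}" using N unfolding N_def by (metis card.empty less_irrefl of_nat_0)
  define f :: "(nat \<Rightarrow> int) \<Rightarrow> complex" where
    "f x = (if x \<in> ?B then of_real (N powr (- 1/p) * psign (x k)) else 0)" for x
  have f0: "\<And>x. x \<in> Zd d \<Longrightarrow> x \<notin> ?B \<Longrightarrow> f x = 0" by (simp add: f_def)
  have nf: "norm (f x) powr p = 1/N" if "x \<in> ?B" for x
  proof -
    have "norm (f x) = \<bar>N powr (- 1/p) * psign (x k)\<bar>" using that by (simp only: f_def if_True norm_of_real)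
    hence "norm (f x) = N powr (- 1/p)" by (simp add: abs_mult abs_psign)
    hence "norm (f x) powr p = N powr (- 1/p * p)" by (simp only: powr_powr)
    thus ?thesis using N p by (simp add: powr_minus_divide)
  qed
  have "(\<Sum>x\<in>?B. norm (f x) powr p) = 1" using N by (simp add: nf N_def)
  hence lf: "lp_norm d p f \<le> 1"
    unfolding lp_norm_def using lp_norm_finite_support[OF finite_cube cube_Zd f0, where p = p] by simp
  let ?T = "R_dis_diff d j k f"
  have T: "?T n = of_real (N powr (- 1/p) * (\<Sum>x\<in>?B. kern d j k (n - x) * psign (x k)))" if "n \<in> ?B" for n
  proof -
    have "?T n = (\<Sum>x\<in>?B. of_real (kern d j k (n - x)) * f x)"
      by (rule conv_finite_support[OF jk finite_cube cube_Zd f0]) (use that cube_Zd in auto)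
    also have "\<dots> = (\<Sum>x\<in>?B. of_real (N powr (- 1/p) * (kern d j k (n - x) * psign (x k))))"
      by (intro sum.cong refl) (simp add: f_def)
    finally show ?thesis by (simp only: of_real_sum[symmetric] sum_distrib_left)
  qed
  define X where "X = (\<Sum>n\<in>?B. \<Sum>x\<in>?B. kern d j k (n - x) * psign ((n - x) k))"
  have "N powr (- 1/p) * X = (\<Sum>n\<in>?B. psign (n k) * (N powr (- 1/p) * (\<Sum>x\<in>?B. kern d j k (n - x) * psign (x k))))"
    unfolding X_def sum_distrib_left by (intro sum.cong refl) (simp add: psign_diff mult_ac)
  also have "\<dots> \<le> (\<Sum>n\<in>?B. norm (?T n))"
  proof (rule sum_mono)
    fix n assume n: "n \<in> ?B"
    show "psign (n k) * (N powr (- 1/p) * (\<Sum>x\<in>?B. kern d j k (n - x) * psign (x k))) \<le> norm (?T n)"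
      unfolding T[OF n] norm_of_real using abs_ge_self[of "psign (n k) * (N powr (- 1/p) * (\<Sum>x\<in>?B. kern d j k (n - x) * psign (x k)))"]
      by (simp add: abs_mult abs_psign)
  qed
  also have "\<dots> \<le> N powr (1 - 1/p) * (\<Sum>n\<in>?B. norm (?T n) powr p) powr (1/p)"
    unfolding N_def by (rule power_mean_le[OF p finite_cube ne]) simp
  finally have X1: "N powr (- 1/p) * X \<le> N powr (1 - 1/p) * (\<Sum>n\<in>?B. norm (?T n) powr p) powr (1/p)" .
  have "N powr (1 - 1/p) = N * N powr (- 1/p)" using N powr_add[of N 1 "- 1/p"] by simp
  hence "N powr (- 1/p) * X \<le> N powr (- 1/p) * (N * (\<Sum>n\<in>?B. norm (?T n) powr p) powr (1/p))" using X1 by (simp add: mult_ac)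
  hence "X \<le> N * (\<Sum>n\<in>?B. norm (?T n) powr p) powr (1/p)" using N by (simp add: mult_le_cancel_left)
  hence X2: "X / N \<le> (\<Sum>n\<in>?B. norm (?T n) powr p) powr (1/p)" using N by (simp add: pos_divide_le_eq mult.commute)
  have "ereal (X / N) \<le> lp_norm d p ?T"
  proof (cases "(\<lambda>n. norm (?T n) powr p) summable_on Zd d")
    case True
    have "(\<Sum>n\<in>?B. norm (?T n) powr p) \<le> (\<Sum>\<^sub>\<infinity>n\<in>Zd d. norm (?T n) powr p)"
      by (rule finite_sum_le_infsum[OF True finite_cube cube_Zd]) simp
    hence "(\<Sum>n\<in>?B. norm (?T n) powr p) powr (1/p) \<le> (\<Sum>\<^sub>\<infinity>n\<in>Zd d. norm (?T n) powr p) powr (1/p)"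
      by (intro powr_mono2) (use p in \<open>auto intro: sum_nonneg\<close>)
    thus ?thesis using X2 True by (simp add: lp_norm_def)
  qed (simp add: lp_norm_def)
  also have "\<dots> \<le> lp_opnorm d p (R_dis_diff d j k)" unfolding lp_opnorm_def by (rule SUP_upper) (use lf in auto)
  finally show ?thesis by (simp add: X_def N_def)
qed

text \<open>As the cube grows, its boundary layer becomes negligible.\<close>
lemma lp_opnorm_lower:
  assumes jk: "j \<in> {1..d}" "k \<in> {1..d}" "j \<noteq> k" and p: "p > 1"
  shows "ereal (4 * riesz_const d * (1 + (real d - 2) / 2 powr (real d / 2)) - 2 * 3 ^ d
      - near_const * riesz_const d * ((19/20) / 2) ^ d - 1000 * 36 ^ d) \<le> lp_opnorm d p (R_dis_diff d j k)"
proof -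
  define A where "A = (\<Sum>m\<in>shell d. \<bar>near d j k m\<bar>)"
  define B5 where "B5 = near_const * riesz_const d * ((19/20) / 2) ^ d"
  have main: "ereal ((((2 * real L + 1) / (2 * real L + 3)) ^ d) * A - B5 - 1000 * 36 ^ d) \<le> lp_opnorm d p (R_dis_diff d j k)" for L
  proof -
    let ?B = "cube d (Suc L)"
    define N where "N = real (card ?B)"
    have N: "N = (2 * real L + 3) ^ d" unfolding N_def card_cube by (simp add: algebra_simps)
    have N0: "N > 0" by (simp add: N zero_less_power add_nonneg_pos)
    have N1: "real (card (cube d L)) = (2 * real L + 1) ^ d" unfolding card_cube by (simp add: algebra_simps)
    have "(\<Sum>n\<in>?B. \<Sum>x\<in>?B. kern d j k (n - x) * psign ((n - x) k))
      = (\<Sum>n\<in>?B. \<Sum>x\<in>?B. near d j k (n - x) * psign ((n - x) k)) + (\<Sum>n\<in>?B. \<Sum>x\<in>?B. far d j k (n - x) * psign ((n - x) k))"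
      unfolding sum.distrib[symmetric] by (intro sum.cong refl) (simp add: near_def algebra_simps)
    also have "\<dots> \<ge> (real (card (cube d L)) * A - N * B5) - N * (1000 * 36 ^ d)"
      using near_alternating[OF jk, of L] far_alternating[OF jk, of "Suc L"] unfolding A_def[symmetric] B5_def[symmetric] N_def[symmetric] by linarith
    finally have "(real (card (cube d L)) * A - N * B5 - N * (1000 * 36 ^ d)) / N \<le> (\<Sum>n\<in>?B. \<Sum>x\<in>?B. kern d j k (n - x) * psign ((n - x) k)) / N"
      by (rule divide_right_mono) (use N0 in simp)
    moreover have "(real (card (cube d L)) * A - N * B5 - N * (1000 * 36 ^ d)) / N = (((2 * real L + 1) / (2 * real L + 3)) ^ d) * A - B5 - 1000 * 36 ^ d"
      using N0 by (simp add: N1 diff_divide_distrib power_divide N[symmetric])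
    ultimately have "ereal ((((2 * real L + 1) / (2 * real L + 3)) ^ d) * A - B5 - 1000 * 36 ^ d) \<le> ereal ((\<Sum>n\<in>?B. \<Sum>x\<in>?B. kern d j k (n - x) * psign ((n - x) k)) / N)" by simp
    also have "\<dots> \<le> lp_opnorm d p (R_dis_diff d j k)" unfolding N_def by (rule lp_opnorm_test[OF jk(1,2) p])
    finally show ?thesis .
  qed
  have lim: "(\<lambda>L. ereal ((((2 * real L + 1) / (2 * real L + 3)) ^ d) * A - B5 - 1000 * 36 ^ d)) \<longlonglongrightarrow> ereal (1 ^ d * A - B5 - 1000 * 36 ^ d)"
  proof -
    have "(\<lambda>L. (2 * real L + 1) / (2 * real L + 3)) \<longlonglongrightarrow> 1" by real_asymp
    thus ?thesis by (intro tendsto_intros)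
  qed
  have "4 * riesz_const d * (1 + (real d - 2) / 2 powr (real d / 2)) - 2 * 3 ^ d \<le> A"
    using shell_near_kern(2)[OF jk(1,2)] unfolding A_def shell_kern_sum[OF jk] .
  hence "ereal (4 * riesz_const d * (1 + (real d - 2) / 2 powr (real d / 2)) - 2 * 3 ^ d - B5 - 1000 * 36 ^ d)
      \<le> ereal (1 ^ d * A - B5 - 1000 * 36 ^ d)" by simp
  also have "\<dots> \<le> lp_opnorm d p (R_dis_diff d j k)"
    by (rule LIMSEQ_le_const2[OF lim]) (use main in auto)
  finally show ?thesis unfolding B5_def .
qed

section \<open>Asymptotics in the dimension\<close>

lemma half_powr_dim: "2 powr (real d / 2) = sqrt 2 ^ d" "4 powr (real d / 2) = 2 ^ d"
proof -
  show "2 powr (real d / 2) = sqrt 2 ^ d"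
    by (simp add: powr_half_sqrt[symmetric] powr_powr flip: powr_realpow)
  have "4 powr (real d / 2) = (4 powr (1/2)) powr real d" by (simp add: powr_powr)
  thus "4 powr (real d / 2) = 2 ^ d" by (simp add: powr_half_sqrt powr_realpow)
qed

text \<open>The relative size of the error terms in the upper bounds; the factor
  \<open>19/20\<close> is the gain over \<open>2^(-d/2)\<close> outside the two innermost
  shells.\<close>
definition rate :: "nat \<Rightarrow> real" where "rate d = ((19/20) / sqrt 2) ^ d"

lemma rate_bounds:
  assumes d: "d \<ge> 2"
  shows "0 < rate d" "rate d \<le> 1"
    and "rate d \<le> (19/20) ^ d * (real d / sqrt 2 ^ d)" "rate d \<le> real d / sqrt 2 ^ d" "real d / sqrt 2 ^ d \<le> 5/2"
proof -
  have S: "sqrt 2 ^ d > 0" by simp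
  show "0 < rate d" by (simp add: rate_def)
  have "1 \<le> sqrt (2::real)" by simp
  hence "19/20 \<le> sqrt (2::real)" by linarith
  hence "(19/20) / sqrt 2 \<le> (1::real)" by (simp add: pos_divide_le_eq)
  thus "rate d \<le> 1" unfolding rate_def by (intro power_le_one) auto
  have "rate d = (19/20) ^ d * (1 / sqrt 2 ^ d)" by (simp add: rate_def power_divide)
  also have "\<dots> \<le> (19/20) ^ d * (real d / sqrt 2 ^ d)"
    by (intro mult_left_mono divide_right_mono) (use d in auto)
  finally show 1: "rate d \<le> (19/20) ^ d * (real d / sqrt 2 ^ d)" .
  also have "\<dots> \<le> 1 * (real d / sqrt 2 ^ d)" by (intro mult_right_mono power_le_one) auto
  finally show "rate d \<le> real d / sqrt 2 ^ d" by simp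
  have s14: "(7/5)\<^sup>2 \<le> (2::real)" by (simp add: power2_eq_square)
  hence s: "7/5 \<le> sqrt 2" by (rule real_le_rsqrt)
  have "1 + real d * (2/5) \<le> (1 + 2/5) ^ d" by (rule Bernoulli_inequality) simp
  also have "\<dots> \<le> sqrt 2 ^ d" by (rule power_mono) (use s in auto)
  finally show "real d / sqrt 2 ^ d \<le> 5/2" by (simp add: pos_divide_le_eq)
qed

text \<open>All exponentials in \<open>d\<close> are absorbed by a single comparison with
  \<open>c\<^sub>d\<close>. The base \<open>10\<^sup>3\<^sup>0\<close> is large enough to leave room
  for the factors \<open>rate d\<close>, its square, and \<open>2\<^sup>-\<^sup>d\<close>.\<close>
lemma norm_bounds_rate:
  obtains M :: real where "M > 0"
    and "\<And>d. d \<ge> 2 \<Longrightarrow> 1 \<le> M * riesz_const d * rate d"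
    and "\<And>d j k. d \<ge> 2 \<Longrightarrow> j \<in> {1..d} \<Longrightarrow> k \<in> {1..d} \<Longrightarrow> j \<noteq> k \<Longrightarrow>
      weak_opnorm d (R_dis_diff d j k) \<le> ereal (4 * riesz_const d * (1 + real d / 2 powr (real d / 2)) + M * riesz_const d * rate d)"
    and "\<And>d j k p. d \<ge> 2 \<Longrightarrow> j \<in> {1..d} \<Longrightarrow> k \<in> {1..d} \<Longrightarrow> j \<noteq> k \<Longrightarrow> 1 < p \<Longrightarrow>
      lp_opnorm d p (R_dis_diff d j k) \<le> ereal ((max p (p/(p - 1)) - 1)
        + 4 * riesz_const d * (1 + real d / 2 powr (real d / 2)) + M * riesz_const d * rate d)"
    and "\<And>d j k p. d \<ge> 2 \<Longrightarrow> j \<in> {1..d} \<Longrightarrow> k \<in> {1..d} \<Longrightarrow> j \<noteq> k \<Longrightarrow> 1 < p \<Longrightarrow>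
      ereal (4 * riesz_const d * (1 + (real d - 2) / 2 powr (real d / 2)) - M * riesz_const d / 4 powr (real d / 2))
        \<le> lp_opnorm d p (R_dis_diff d j k)"
proof -
  obtain M0 where M0: "M0 > 0" "\<And>d. (10 ^ 30) ^ d \<le> M0 * riesz_const d"
    using power_le_riesz_const[of "10 ^ 30"] by auto
  define M where "M = 14 + 2 * near_const + 1002 * M0"
  have C: "near_const > 0" by (simp add: near_const_def add_pos_pos)
  have M: "M > 0" using C M0 by (simp add: M_def)
  have absorb: "X ^ d \<le> M0 * riesz_const d * r ^ d" if "0 \<le> X" "0 \<le> r" "X \<le> 10 ^ 30 * r" for X r d
  proof -
    have "X ^ d \<le> (10 ^ 30 * r) ^ d" by (rule power_mono) (use that in auto)
    also have "\<dots> = (10 ^ 30) ^ d * r ^ d" by (rule power_mult_distrib)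
    also have "\<dots> \<le> M0 * riesz_const d * r ^ d" by (rule mult_right_mono[OF M0(2)]) (use that in simp)
    finally show ?thesis .
  qed
  have r1: "1/2 \<le> (19/20) / sqrt 2"
  proof -
    have "sqrt 2 \<le> 19/10" by (rule real_le_lsqrt) (auto simp: power2_eq_square)
    thus ?thesis by (simp add: pos_le_divide_eq)
  qed
  have r2: "((19/20) / sqrt 2)\<^sup>2 = 361/800" by (simp add: power_divide power2_eq_square)
  have one: "1 \<le> M0 * riesz_const d * rate d" for d
    using absorb[of 1 "(19/20) / sqrt 2" d] r1 by (simp add: rate_def)
  have tail: "(10 ^ 9) ^ d \<le> M0 * riesz_const d * rate d" for d
    using absorb[of "10 ^ 9" "(19/20) / sqrt 2" d] r1 by (simp add: rate_def)
  have tail2: "(10 ^ 20) ^ d \<le> M0 * riesz_const d * (rate d)\<^sup>2" for d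
  proof -
    have "(rate d)\<^sup>2 = (((19/20) / sqrt 2)\<^sup>2) ^ d" unfolding rate_def power_mult[symmetric] by (simp only: mult.commute)
    thus ?thesis using absorb[of "10 ^ 20" "361/800" d] unfolding r2 by simp
  qed
  have low: "2 * 3 ^ d + 1000 * 36 ^ d \<le> 1002 * M0 * riesz_const d * (1/2) ^ d" for d
    using absorb[of 3 "1/2" d] absorb[of 36 "1/2" d] by simp
  show thesis
  proof (rule that[OF M])
    fix d :: nat assume d: "d \<ge> 2"
    define c where "c = riesz_const d"
    define u where "u = rate d"
    define w where "w = real d / sqrt 2 ^ d"
    have c: "c > 0" by (simp add: c_def riesz_const_pos)
    have u: "0 < u" "u \<le> 1" using rate_bounds[OF d] by (auto simp: u_def)
    have w: "w \<le> 5/2" using rate_bounds[OF d] by (auto simp: w_def)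
    have cu: "0 < c * u" using c u by simp
    have Mcu: "Y * c * u \<le> M * c * u" if "Y \<le> M" for Y
      using that c u by (intro mult_right_mono) auto
    have "M0 * c * u \<le> M * c * u" by (rule Mcu) (use C M0 in \<open>simp add: M_def\<close>)
    thus "1 \<le> M * riesz_const d * rate d" using one[of d] unfolding c_def u_def by linarith
    fix j k assume jk: "j \<in> {1..d}" "k \<in> {1..d}" "j \<noteq> k"
    define v where "v = (real d - 2) / sqrt 2 ^ d"
    have vw: "v \<le> w" unfolding v_def w_def by (rule divide_right_mono) auto
    have cvw: "4 * c * (1 + v) \<le> 4 * c * (1 + w)" using vw c by simp
    define E where "E = 4 * c * (1 + v) + near_const * c * u"
    have Eb: "(\<Sum>m\<in>F. \<bar>near d j k m\<bar>) \<le> E" if "finite F" "F \<subseteq> Zd d" for F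
      using sum_near_total[OF jk that] by (simp add: E_def c_def v_def u_def rate_def half_powr_dim)
    have E0: "0 \<le> E" using Eb[of "{}"] by simp
    have E1: "E \<le> 4 * c * (1 + w) + near_const * c * u" using cvw by (simp add: E_def)
    have E2: "E \<le> (14 + near_const) * c"
    proof -
      have "4 * c * (1 + w) \<le> 4 * c * (1 + 5/2)" using w c by (intro mult_left_mono) auto
      moreover have "near_const * c * u \<le> near_const * c * 1" using u c C by (intro mult_left_mono) auto
      ultimately show ?thesis using E1 by (simp add: algebra_simps)
    qed
    show "weak_opnorm d (R_dis_diff d j k) \<le> ereal (4 * riesz_const d * (1 + real d / 2 powr (real d / 2)) + M * riesz_const d * rate d)"
    proof -
      \<comment> \<open>the level is split with \<open>\<eta> = u/2\<close>, so the factor \<open>1/(1-\<eta>)\<close> adds a term of size \<open>c u\<close>, and \<open>1/\<eta>\<close> is paid by one of the two factors \<open>u\<close> in \<open>tail2\<close>\<close>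
      have "E / (1 - u/2) \<le> E + (14 + near_const) * c * u"
      proof -
        have "E * 1 \<le> E * ((1 + u) * (1 - u/2))"
        proof (rule mult_left_mono[OF _ E0])
          have "u * u \<le> u * 1" by (rule mult_left_mono) (use u in auto)
          thus "1 \<le> (1 + u) * (1 - u/2)" by (simp add: algebra_simps)
        qed
        hence "E / (1 - u/2) \<le> E * (1 + u)" using u by (simp add: pos_divide_le_eq mult.assoc)
        also have "\<dots> = E + E * u" by (simp add: algebra_simps)
        also have "E * u \<le> (14 + near_const) * c * u" by (rule mult_right_mono[OF E2]) (use u in simp)
        finally show ?thesis by simp
      qed
      moreover have "(10 ^ 20) ^ d / (u/2) \<le> 2 * M0 * c * u"
      proof -
        have "2 * (10 ^ 20) ^ d \<le> 2 * M0 * c * u * u" using tail2[of d] unfolding c_def u_def power2_eq_square by simp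
        thus ?thesis using u by (simp add: pos_divide_le_eq mult.commute)
      qed
      moreover have "(14 + near_const) * c * u + near_const * c * u + 2 * M0 * c * u \<le> M * c * u"
      proof -
        have "(14 + 2 * near_const + 2 * M0) * c * u \<le> M * c * u" by (rule Mcu) (use M0 in \<open>simp add: M_def\<close>)
        thus ?thesis by (simp add: algebra_simps)
      qed
      ultimately have "E / (1 - u/2) + (10 ^ 20) ^ d / (u/2) \<le> 4 * c * (1 + w) + M * c * u" using E1 by linarith
      moreover have "weak_opnorm d (R_dis_diff d j k) \<le> ereal (E / (1 - u/2) + (10 ^ 20) ^ d / (u/2))"
        by (rule weak_opnorm_upper[OF jk _ _ Eb]) (use u in auto)
      ultimately show ?thesis unfolding half_powr_dim c_def u_def w_def by (meson ereal_less_eq(3) order_trans)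
    qed
    fix p :: real assume p: "1 < p"
    show "lp_opnorm d p (R_dis_diff d j k) \<le> ereal ((max p (p/(p - 1)) - 1)
        + 4 * riesz_const d * (1 + real d / 2 powr (real d / 2)) + M * riesz_const d * rate d)"
    proof -
      have "M0 * c * u + near_const * c * u \<le> M * c * u"
        using Mcu[of "M0 + near_const"] C M0 by (simp add: M_def algebra_simps)
      hence "(10 ^ 9) ^ d + E \<le> 4 * c * (1 + w) + M * c * u" using tail[of d] E1 unfolding c_def[symmetric] u_def[symmetric] by linarith
      hence "max p (p/(p - 1)) - 1 + 1000000000 ^ d + E \<le> max p (p/(p - 1)) - 1 + 4 * c * (1 + w) + M * c * u" by simp
      moreover have "lp_opnorm d p (R_dis_diff d j k) \<le> ereal (max p (p/(p - 1)) - 1 + 1000000000 ^ d + E)"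
        using lp_opnorm_upper[OF jk p] by (simp add: E_def c_def v_def u_def rate_def half_powr_dim)
      ultimately show ?thesis unfolding half_powr_dim c_def u_def w_def by (meson ereal_less_eq(3) order_trans)
    qed
    show "ereal (4 * riesz_const d * (1 + (real d - 2) / 2 powr (real d / 2)) - M * riesz_const d / 4 powr (real d / 2))
        \<le> lp_opnorm d p (R_dis_diff d j k)"
    proof -
      have "near_const * c * ((19/20) / 2) ^ d \<le> near_const * c * (1/2) ^ d"
        by (intro mult_left_mono power_mono) (use C c in auto)
      moreover have "near_const * c * (1/2) ^ d + 1002 * M0 * c * (1/2) ^ d \<le> M * c * (1/2) ^ d"
      proof -
        have "(near_const + 1002 * M0) * (c * (1/2) ^ d) \<le> M * (c * (1/2) ^ d)"
          by (intro mult_right_mono) (use C c in \<open>auto simp: M_def\<close>)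
        thus ?thesis by (simp add: algebra_simps)
      qed
      moreover have "M * c / 2 ^ d = M * c * (1/2) ^ d" by (simp add: power_divide)
      ultimately have "4 * c * (1 + v) - M * c / 2 ^ d \<le> 4 * c * (1 + v) - 2 * 3 ^ d - near_const * c * ((19/20) / 2) ^ d - 1000 * 36 ^ d"
        using low[of d] unfolding c_def[symmetric] by linarith
      moreover have "ereal (4 * c * (1 + v) - 2 * 3 ^ d - near_const * c * ((19/20) / 2) ^ d - 1000 * 36 ^ d) \<le> lp_opnorm d p (R_dis_diff d j k)"
        using lp_opnorm_lower[OF jk p] by (simp add: c_def v_def half_powr_dim)
      ultimately show ?thesis unfolding half_powr_dim c_def v_def by (meson ereal_less_eq(3) order_trans)
    qed
  qed
qed

theorem theorem1p5:
  "(\<exists>\<rho> \<gamma> lam :: real. \<rho> > 0 \<and> \<gamma> > 0 \<and> lam > 0 \<and>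
      (\<forall>d \<ge> 2. \<forall>j\<in>{1..d}. \<forall>k\<in>{1..d}. j \<noteq> k \<longrightarrow>
         ereal (4 * riesz_const d) \<le> weak_opnorm d (R_dis_diff d j k) \<and>
         weak_opnorm d (R_dis_diff d j k)
           \<le> ereal (4 * riesz_const d * (1 + lam * real d / 2 powr (real d / 2))) \<and>
         (\<forall>p::real. 1 < p \<longrightarrow>
            ereal (4 * riesz_const d *
                (1 + (real d - 2) / 2 powr (real d / 2) - \<rho> / 4 powr (real d / 2)))
              \<le> lp_opnorm d p (R_dis_diff d j k) \<and>
            lp_opnorm d p (R_dis_diff d j k)
              \<le> ereal ((max p (p / (p - 1)) - 1) +
                  4 * riesz_const d * (1 + \<gamma> * real d / 2 powr (real d / 2)))))) \<and>
   (\<exists>\<epsilon> :: nat \<Rightarrow> real. \<epsilon> \<longlonglongrightarrow> 0 \<and>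
      (\<forall>d \<ge> 2. \<forall>j\<in>{1..d}. \<forall>k\<in>{1..d}. j \<noteq> k \<longrightarrow>
         ereal (4 * riesz_const d) \<le> weak_opnorm d (R_dis_diff d j k) \<and>
         weak_opnorm d (R_dis_diff d j k)
           \<le> ereal (4 * riesz_const d * (1 + (1 + \<epsilon> d) * (real d / 2 powr (real d / 2)))))) \<and>
   (\<forall>p::real. 1 < p \<longrightarrow>
      (\<exists>\<epsilon> :: nat \<Rightarrow> real. \<epsilon> \<longlonglongrightarrow> 0 \<and>
         (\<forall>d \<ge> 2. \<forall>j\<in>{1..d}. \<forall>k\<in>{1..d}. j \<noteq> k \<longrightarrow>
            lp_opnorm d p (R_dis_diff d j k)
              = ereal (4 * riesz_const d * (1 + (1 + \<epsilon> d) * (real d / 2 powr (real d / 2)))))))"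
proof -
  obtain M :: real where M: "M > 0"
    and one: "\<And>d. d \<ge> 2 \<Longrightarrow> 1 \<le> M * riesz_const d * rate d"
    and weak: "\<And>d j k. d \<ge> 2 \<Longrightarrow> j \<in> {1..d} \<Longrightarrow> k \<in> {1..d} \<Longrightarrow> j \<noteq> k \<Longrightarrow>
      weak_opnorm d (R_dis_diff d j k) \<le> ereal (4 * riesz_const d * (1 + real d / 2 powr (real d / 2)) + M * riesz_const d * rate d)"
    and upper: "\<And>d j k p. d \<ge> 2 \<Longrightarrow> j \<in> {1..d} \<Longrightarrow> k \<in> {1..d} \<Longrightarrow> j \<noteq> k \<Longrightarrow> 1 < p \<Longrightarrow>
      lp_opnorm d p (R_dis_diff d j k) \<le> ereal ((max p (p/(p - 1)) - 1)
        + 4 * riesz_const d * (1 + real d / 2 powr (real d / 2)) + M * riesz_const d * rate d)"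
    and lower: "\<And>d j k p. d \<ge> 2 \<Longrightarrow> j \<in> {1..d} \<Longrightarrow> k \<in> {1..d} \<Longrightarrow> j \<noteq> k \<Longrightarrow> 1 < p \<Longrightarrow>
      ereal (4 * riesz_const d * (1 + (real d - 2) / 2 powr (real d / 2)) - M * riesz_const d / 4 powr (real d / 2))
        \<le> lp_opnorm d p (R_dis_diff d j k)"
    by (rule norm_bounds_rate) blast
  have c: "riesz_const d > 0" for d by (rule riesz_const_pos)
  have ratew: "4 * riesz_const d * (1 + real d / 2 powr (real d / 2)) + M * riesz_const d * rate d
      \<le> 4 * riesz_const d * (1 + (1 + M/4 * b) * (real d / 2 powr (real d / 2)))"
    if "rate d \<le> b * (real d / sqrt 2 ^ d)" for d b
  proof -
    have "M * riesz_const d * rate d \<le> M * riesz_const d * (b * (real d / sqrt 2 ^ d))"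
      by (rule mult_left_mono[OF that]) (use M c[of d] in auto)
    thus ?thesis unfolding half_powr_dim by (simp add: algebra_simps)
  qed
  have rate1: "4 * riesz_const d * (1 + real d / 2 powr (real d / 2)) + M * riesz_const d * rate d
      \<le> 4 * riesz_const d * (1 + (1 + M/4) * real d / 2 powr (real d / 2))" if "d \<ge> 2" for d
    using ratew[of d 1] rate_bounds(4)[OF that] by simp
  have rate2: "4 * riesz_const d * (1 + real d / 2 powr (real d / 2)) + M * riesz_const d * rate d
      \<le> 4 * riesz_const d * (1 + (1 + M/4 * (19/20) ^ d) * (real d / 2 powr (real d / 2)))" if "d \<ge> 2" for d
    by (rule ratew[OF rate_bounds(3)[OF that]])
  show ?thesis
  proof (intro conjI allI impI)
    show "\<exists>\<rho> \<gamma> lam :: real. \<rho> > 0 \<and> \<gamma> > 0 \<and> lam > 0 \<and>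
      (\<forall>d \<ge> 2. \<forall>j\<in>{1..d}. \<forall>k\<in>{1..d}. j \<noteq> k \<longrightarrow>
         ereal (4 * riesz_const d) \<le> weak_opnorm d (R_dis_diff d j k) \<and>
         weak_opnorm d (R_dis_diff d j k)
           \<le> ereal (4 * riesz_const d * (1 + lam * real d / 2 powr (real d / 2))) \<and>
         (\<forall>p::real. 1 < p \<longrightarrow>
            ereal (4 * riesz_const d *
                (1 + (real d - 2) / 2 powr (real d / 2) - \<rho> / 4 powr (real d / 2)))
              \<le> lp_opnorm d p (R_dis_diff d j k) \<and>
            lp_opnorm d p (R_dis_diff d j k)
              \<le> ereal ((max p (p / (p - 1)) - 1) +
                  4 * riesz_const d * (1 + \<gamma> * real d / 2 powr (real d / 2)))))"
    proof (rule exI[of _ "M/4"], rule exI[of _ "1 + M/4"], rule exI[of _ "1 + M/4"], intro conjI allI impI ballI)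
      fix d j k :: nat and p :: real
      assume d: "d \<ge> 2" and jk: "j \<in> {1..d}" "k \<in> {1..d}" "j \<noteq> k"
      show "ereal (4 * riesz_const d) \<le> weak_opnorm d (R_dis_diff d j k)" by (rule weak_opnorm_lower[OF jk])
      show "weak_opnorm d (R_dis_diff d j k) \<le> ereal (4 * riesz_const d * (1 + (1 + M/4) * real d / 2 powr (real d / 2)))"
        using weak[OF d jk] rate1[OF d] by (meson ereal_less_eq(3) order_trans)
      assume p: "1 < p"
      have "4 * riesz_const d * (1 + (real d - 2) / 2 powr (real d / 2) - M / 4 / 4 powr (real d / 2))
        = 4 * riesz_const d * (1 + (real d - 2) / 2 powr (real d / 2)) - M * riesz_const d / 4 powr (real d / 2)"
        by (simp add: algebra_simps)
      thus "ereal (4 * riesz_const d * (1 + (real d - 2) / 2 powr (real d / 2) - M / 4 / 4 powr (real d / 2)))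
        \<le> lp_opnorm d p (R_dis_diff d j k)" using lower[OF d jk p] by simp
      have "(max p (p/(p - 1)) - 1) + 4 * riesz_const d * (1 + real d / 2 powr (real d / 2)) + M * riesz_const d * rate d
        \<le> (max p (p / (p - 1)) - 1) + 4 * riesz_const d * (1 + (1 + M/4) * real d / 2 powr (real d / 2))"
        using rate1[OF d] by linarith
      thus "lp_opnorm d p (R_dis_diff d j k)
        \<le> ereal ((max p (p / (p - 1)) - 1) + 4 * riesz_const d * (1 + (1 + M/4) * real d / 2 powr (real d / 2)))"
        using upper[OF d jk p] by (meson ereal_less_eq(3) order_trans)
    qed (use M in auto)
  next
    show "\<exists>\<epsilon> :: nat \<Rightarrow> real. \<epsilon> \<longlonglongrightarrow> 0 \<and>
      (\<forall>d \<ge> 2. \<forall>j\<in>{1..d}. \<forall>k\<in>{1..d}. j \<noteq> k \<longrightarrow>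
         ereal (4 * riesz_const d) \<le> weak_opnorm d (R_dis_diff d j k) \<and>
         weak_opnorm d (R_dis_diff d j k)
           \<le> ereal (4 * riesz_const d * (1 + (1 + \<epsilon> d) * (real d / 2 powr (real d / 2)))))"
    proof (rule exI[of _ "\<lambda>d. M/4 * (19/20) ^ d"], intro conjI allI impI ballI)
      show "(\<lambda>d. M/4 * (19/20) ^ d) \<longlonglongrightarrow> 0" by real_asymp
      fix d j k :: nat
      assume d: "d \<ge> 2" and jk: "j \<in> {1..d}" "k \<in> {1..d}" "j \<noteq> k"
      show "ereal (4 * riesz_const d) \<le> weak_opnorm d (R_dis_diff d j k)" by (rule weak_opnorm_lower[OF jk])
      show "weak_opnorm d (R_dis_diff d j k) \<le> ereal (4 * riesz_const d * (1 + (1 + M/4 * (19/20) ^ d) * (real d / 2 powr (real d / 2))))"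
        using weak[OF d jk] rate2[OF d] by (meson ereal_less_eq(3) order_trans)
    qed
  next
    fix p :: real assume p: "1 < p"
    define Q where "Q = max p (p / (p - 1)) - 1"
    have Q: "Q > 0" using p by (simp add: Q_def)
    define nrm where "nrm d = real_of_ereal (lp_opnorm d p (R_dis_diff d 1 2))" for d
    \<comment> \<open>the equation is solved for the error term; the bounds on the norm then force it to \<open>0\<close>\<close>
    define \<epsilon> where "\<epsilon> d = (if d \<ge> 2 then (nrm d / (4 * riesz_const d) - 1) / (real d / sqrt 2 ^ d) - 1 else 0)" for d
    have nrm: "lp_opnorm d p (R_dis_diff d 1 2) = ereal (nrm d)"
      "4 * riesz_const d * (1 + (real d - 2) / sqrt 2 ^ d) - M * riesz_const d / 2 ^ d \<le> nrm d"
      "nrm d \<le> Q + 4 * riesz_const d * (1 + real d / sqrt 2 ^ d) + M * riesz_const d * rate d"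
      if d: "d \<ge> 2" for d
    proof -
      have 12: "1 \<in> {1..d}" "2 \<in> {1..d}" "1 \<noteq> (2::nat)" using d by auto
      note b = lower[OF d 12 p] upper[OF d 12 p, folded Q_def]
      show 1: "lp_opnorm d p (R_dis_diff d 1 2) = ereal (nrm d)"
        using b unfolding nrm_def by (cases "lp_opnorm d p (R_dis_diff d 1 2)") auto
      show "4 * riesz_const d * (1 + (real d - 2) / sqrt 2 ^ d) - M * riesz_const d / 2 ^ d \<le> nrm d"
        "nrm d \<le> Q + 4 * riesz_const d * (1 + real d / sqrt 2 ^ d) + M * riesz_const d * rate d"
        using b unfolding 1 half_powr_dim by simp_all
    qed
    define K where "K = (Q * M + M) / 4"
    have bounds: "- (2 + M/4) * (1 / real d) \<le> \<epsilon> d \<and> \<epsilon> d \<le> K * (19/20) ^ d" if d: "d \<ge> 2" for d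
    proof
      define w where "w = real d / sqrt 2 ^ d"
      define y where "y = nrm d / (4 * riesz_const d) - 1"
      have w: "w > 0" using d by (simp add: w_def)
      have eps: "\<epsilon> d = y / w - 1" using d by (simp add: \<epsilon>_def w_def y_def)
      have "(4 * riesz_const d * (1 + (real d - 2) / sqrt 2 ^ d) - M * riesz_const d / 2 ^ d) / (4 * riesz_const d) \<le> nrm d / (4 * riesz_const d)"
        by (rule divide_right_mono[OF nrm(2)[OF d]]) (use c[of d] in auto)
      moreover have "(4 * riesz_const d * (1 + (real d - 2) / sqrt 2 ^ d) - M * riesz_const d / 2 ^ d) / (4 * riesz_const d)
        = 1 + (real d - 2) / sqrt 2 ^ d - M / 4 / 2 ^ d" using c[of d] by (simp add: field_simps)
      ultimately have y1: "(real d - 2) / sqrt 2 ^ d - M / 4 / 2 ^ d \<le> y" by (simp add: y_def)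
      have "(1::real) \<le> sqrt 2 ^ d" by (rule one_le_power) simp
      hence S: "1 / sqrt 2 ^ d \<le> 1" by simp
      have ww: "2 ^ d = sqrt 2 ^ d * sqrt 2 ^ d" by (simp add: power_mult_distrib[symmetric])
      have "- (2 + M/4) * (1 / real d) * w = - 2 / sqrt 2 ^ d - (M/4) * (1 / sqrt 2 ^ d) * 1"
        using d by (simp add: w_def field_simps)
      also have "\<dots> \<le> - 2 / sqrt 2 ^ d - (M/4) * (1 / sqrt 2 ^ d) * (1 / sqrt 2 ^ d)"
        by (intro diff_left_mono mult_left_mono S) (use M in auto)
      also have "\<dots> = (real d - 2) / sqrt 2 ^ d - M / 4 / 2 ^ d - w"
        by (simp add: ww w_def diff_divide_distrib)
      finally have "- (2 + M/4) * (1 / real d) * w \<le> y - w" using y1 by linarith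
      hence "- (2 + M/4) * (1 / real d) \<le> (y - w) / w" using w by (simp add: pos_le_divide_eq)
      thus "- (2 + M/4) * (1 / real d) \<le> \<epsilon> d" using w by (simp add: eps diff_divide_distrib)
      \<comment> \<open>for fixed \<open>p\<close> the term \<open>p* - 1\<close> is itself negligible\<close>
      have "Q * 1 \<le> Q * (M * riesz_const d * rate d)" by (rule mult_left_mono[OF one[OF d]]) (use Q in simp)
      hence "nrm d \<le> 4 * riesz_const d * (1 + w + K * rate d)"
      proof -
        have "4 * riesz_const d * (1 + w + K * rate d) = 4 * riesz_const d * (1 + w) + Q * (M * riesz_const d * rate d) + M * riesz_const d * rate d"
          by (simp add: K_def field_simps)
        thus ?thesis using nrm(3)[OF d] \<open>Q * 1 \<le> Q * (M * riesz_const d * rate d)\<close> unfolding w_def by linarith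
      qed
      hence "nrm d / (4 * riesz_const d) \<le> 1 + w + K * rate d" using c[of d] by (simp add: pos_divide_le_eq mult.commute)
      hence "y - w \<le> K * rate d" by (simp add: y_def)
      also have "\<dots> \<le> K * ((19/20) ^ d * w)"
        by (rule mult_left_mono) (use rate_bounds(3)[OF d] Q M in \<open>auto simp: w_def K_def\<close>)
      finally have "(y - w) / w \<le> K * (19/20) ^ d" using w by (simp add: pos_divide_le_eq mult.assoc)
      thus "\<epsilon> d \<le> K * (19/20) ^ d" using w by (simp add: eps diff_divide_distrib)
    qed
    have "\<epsilon> \<longlonglongrightarrow> 0"
    proof (rule tendsto_sandwich)
      show "eventually (\<lambda>d. - (2 + M/4) * (1 / real d) \<le> \<epsilon> d) sequentially"
        "eventually (\<lambda>d. \<epsilon> d \<le> K * (19/20) ^ d) sequentially"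
        using bounds by (auto simp: eventually_sequentially)
      show "(\<lambda>d. - (2 + M/4) * (1 / real d)) \<longlonglongrightarrow> 0" "(\<lambda>d. K * (19/20) ^ d) \<longlonglongrightarrow> 0" by real_asymp+
    qed
    moreover have "lp_opnorm d p (R_dis_diff d j k) = ereal (4 * riesz_const d * (1 + (1 + \<epsilon> d) * (real d / 2 powr (real d / 2))))"
      if d: "d \<ge> 2" and jk: "j \<in> {1..d}" "k \<in> {1..d}" "j \<noteq> k" for d j k
    proof -
      have "real d / sqrt 2 ^ d \<noteq> 0" using d by simp
      hence "nrm d = 4 * riesz_const d * (1 + (1 + \<epsilon> d) * (real d / 2 powr (real d / 2)))"
        using d c[of d] unfolding half_powr_dim \<epsilon>_def by simp
      thus ?thesis unfolding lp_opnorm_indep[OF jk] nrm(1)[OF d] by simp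
    qed
    ultimately show "\<exists>\<epsilon> :: nat \<Rightarrow> real. \<epsilon> \<longlonglongrightarrow> 0 \<and>
         (\<forall>d \<ge> 2. \<forall>j\<in>{1..d}. \<forall>k\<in>{1..d}. j \<noteq> k \<longrightarrow>
            lp_opnorm d p (R_dis_diff d j k)
              = ereal (4 * riesz_const d * (1 + (1 + \<epsilon> d) * (real d / 2 powr (real d / 2)))))" by blast
  qed
qed

end
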